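(* Let $\mathbb{M},\mu,L,\Gamma,\Gamma^Z,P_t$ be as in the context. Assume: (a) there is an increasing sequence $h_k\in C_0^\infty(\mathbb{M})$ with $h_k\nearrow1$ on $\mathbb{M}$ and $\|\Gamma(h_k)\|_\infty+\|\Gamma^Z(h_k)\|_\infty\to0$ as $k\to\infty$; (b) $\Gamma(f,\Gamma^Z(f))=\Gamma^Z(f,\Gamma(f))$ for every $f\in C^\infty(\mathbb{M})$; (c) $P_t1=1$ for every $t\ge0$, and for every $f\in C_0^\infty(\mathbb{M})$ and $T\ge0$, $\sup_{t\in[0,T]}(\|\Gamma(P_tf)\|_\infty+\|\Gamma^Z(P_tf)\|_\infty)<\infty$; (d) for some $\rho_1\ge0$, $\rho_2>0$, $\kappa\ge0$, $0<d<\infty$, the inequality $\Gamma_2(f)+\nu\Gamma_2^Z(f)\ge\frac1d(Lf)^2+(\rho_1-\frac\kappa\nu)\Gamma(f)+\rho_2\Gamma^Z(f)$ holds for every $f\in C^\infty(\mathbb{M})$ and every $\nu>0$. Put $D=d\big(1+\frac{3\kappa}{2\rho_2}\big)$. Then for all $(x,s),(y,t)\in\mathbb{M}\times(0,\infty)$ with $s<t$ and every $f\in C^\infty(\mathbb{M})\cap L^\infty(\mathbb{M})$ with $f\ge0$, $$P_sf(x)\le P_tf(y)\Big(\frac ts\Big)^{\frac D2}\exp\Big(\frac Dd\,\frac{d(x,y)^2}{4(t-s)}\Big).$$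
   Context: $\mathbb{M}$ is a smooth connected manifold with a smooth measure $\mu$; $L$ is a smooth second-order diffusion operator with real coefficients, $L1=0$, symmetric and non-positive: $\int fLg\,d\mu=\int gLf\,d\mu$, $\int fLf\,d\mu\le0$ for $f,g\in C_0^\infty(\mathbb{M})$ (smooth compactly supported). $L$ is locally subelliptic (Fefferman-Phong): locally, estimates $\|f\|^2_{H^\epsilon}\le C(-\int fLf\,d\mu+\int f^2d\mu)$ hold for test functions, for some $\epsilon>0$. $\Gamma(f,g)=\frac12(L(fg)-fLg-gLf)$, $\Gamma(f)=\Gamma(f,f)\ge 0$. Locally $L=-\sum_iX_i^*X_i$ with Lipschitz vector fields $X_i$; $v\in T_x\mathbb{M}$ is subunit if $v=\sum a_iX_i(x)$ with $\sum a_i^2\le1$; a Lipschitz path is subunit if its velocity is subunit a.e. Any two points are assumed to be joined by a subunit path, and $d(x,y)=\sup\{|f(x)-f(y)|:f\in C^\infty(\mathbb{M}),\|\Gamma(f)\|_\infty\le1\}$, which equals the infimum of $T$ over subunit paths $[0,T]\to\mathbb{M}$ from $x$ to $y$; $(\mathbb{M},d)$ is assumed complete (the distance $d(\cdot,\cdot)$ is not to be confused with the constant $d$). $\Gamma^Z$ is a smooth symmetric first-order differential bilinear form on $C^\infty(\mathbb{M})$, $\Gamma^Z(fg,h)=f\Gamma^Z(g,h)+g\Gamma^Z(f,h)$, with $\Gamma^Z(f)=\Gamma^Z(f,f)\ge0$. $\Gamma_2(f)=\frac12[L\Gamma(f)-2\Gamma(f,Lf)]$, $\Gamma_2^Z(f)=\frac12[L\Gamma^Z(f)-2\Gamma^Z(f,Lf)]$.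 $L$ is essentially self-adjoint on $C_0^\infty(\mathbb{M})$; $P_t=e^{tL}$ is the heat semigroup, with smooth positive symmetric heat kernel $p(x,y,t)$, $P_tf(x)=\int p(x,y,t)f(y)d\mu(y)$. *)

theory Defs
  imports "HOL-Analysis.Analysis"
begin

section \<open>Smooth functions on open subsets of a Euclidean space\<close>

definition pd :: "'e \<Rightarrow> ('e::euclidean_space \<Rightarrow> 'b::real_normed_vector) \<Rightarrow> 'e \<Rightarrow> 'b" where
  "pd v f u = frechet_derivative f (at u) v"

text \<open>Only used for open sets, where differentiability within the set is differentiability.\<close>

primrec Ck_on :: "nat \<Rightarrow> 'e::euclidean_space set \<Rightarrow> ('e \<Rightarrow> 'b::real_normed_vector) \<Rightarrow> bool" where
  "Ck_on 0 S f \<longleftrightarrow> continuous_on S f"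
| "Ck_on (Suc k) S f \<longleftrightarrow> f differentiable_on S \<and> (\<forall>i\<in>Basis. Ck_on k S (pd i f))"

definition smooth_on :: "'e::euclidean_space set \<Rightarrow> ('e \<Rightarrow> 'b::real_normed_vector) \<Rightarrow> bool" where
  "smooth_on S f \<longleftrightarrow> (\<forall>k. Ck_on k S f)"


section \<open>Smooth manifolds\<close>

text \<open>
  The manifold is the whole type \<open>'a\<close> with its topology; a chart \<open>(U, \<phi>)\<close> is a total function
  of which only the restriction to \<open>U\<close> matters.
\<close>

type_synonym ('a, 'e) chart = "'a set \<times> ('a \<Rightarrow> 'e)"
type_synonym ('a, 'e) atlas = "('a, 'e) chart set"

definition smooth_manifold ::
  "('a::{t2_space, second_countable_topology}, 'e::euclidean_space) atlas \<Rightarrow> bool" where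
  "smooth_manifold A \<longleftrightarrow>
     (\<forall>(U, \<phi>)\<in>A. open U \<and> open (\<phi> ` U) \<and> homeomorphism U (\<phi> ` U) \<phi> (inv_into U \<phi>)) \<and>
     (\<Union>(U, \<phi>)\<in>A. U) = UNIV \<and>
     (\<forall>(U, \<phi>)\<in>A. \<forall>(V, \<psi>)\<in>A. smooth_on (\<phi> ` (U \<inter> V)) (\<psi> \<circ> inv_into U \<phi>))"

definition smooth_fun ::
  "('a, 'e::euclidean_space) atlas \<Rightarrow> ('a \<Rightarrow> real) \<Rightarrow> bool" where
  "smooth_fun A f \<longleftrightarrow> (\<forall>(U, \<phi>)\<in>A. smooth_on (\<phi> ` U) (f \<circ> inv_into U \<phi>))"

definition tsupp :: "('a::topological_space \<Rightarrow> real) \<Rightarrow> 'a set" where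
  "tsupp f = closure {x. f x \<noteq> 0}"

definition test_fun ::
  "('a::topological_space, 'e::euclidean_space) atlas \<Rightarrow> ('a \<Rightarrow> real) \<Rightarrow> bool" where
  "test_fun A f \<longleftrightarrow> smooth_fun A f \<and> compact (tsupp f)"

definition smooth_measure ::
  "('a::topological_space, 'e::euclidean_space) atlas \<Rightarrow> 'a measure \<Rightarrow> bool" where
  "smooth_measure A M \<longleftrightarrow> sets M = sets borel \<and>
     (\<forall>(U, \<phi>)\<in>A. \<exists>r. smooth_on (\<phi> ` U) r \<and> (\<forall>u\<in>\<phi> ` U. r u > 0) \<and>
        (\<forall>B\<in>sets borel. B \<subseteq> U \<longrightarrow>
           emeasure M B = (\<integral>\<^sup>+u\<in>\<phi> ` B. ennreal (r u) \<partial>lborel)))"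

text \<open>
  The supremum norm.  It is only applied to continuous functions, for which it agrees with the
  essential supremum with respect to a smooth measure.
\<close>

definition sup_norm :: "('a \<Rightarrow> real) \<Rightarrow> ennreal" where
  "sup_norm f = (SUP x. ennreal \<bar>f x\<bar>)"


section \<open>Diffusion operators\<close>

text \<open>
  Operators on smooth functions are modelled as total functions; their values outside
  \<open>C\<^sup>\<infinity>\<close> are unconstrained and irrelevant.  A zero-order term is allowed here;
  it is removed by the separate hypothesis \<open>L 1 = 0\<close>.
\<close>

definition smooth_diffusion_operator ::
  "('a, 'e::euclidean_space) atlas \<Rightarrow> (('a \<Rightarrow> real) \<Rightarrow> 'a \<Rightarrow> real) \<Rightarrow> bool" where
  "smooth_diffusion_operator A L \<longleftrightarrow>
     (\<forall>(U, \<phi>)\<in>A. \<exists>(\<sigma> :: 'e \<Rightarrow> 'e \<Rightarrow> 'e \<Rightarrow> real) (b :: 'e \<Rightarrow> 'e \<Rightarrow> real) (c :: 'e \<Rightarrow> real).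
        (\<forall>i\<in>Basis. \<forall>j\<in>Basis. smooth_on (\<phi> ` U) (\<sigma> i j)) \<and>
        (\<forall>i\<in>Basis. smooth_on (\<phi> ` U) (b i)) \<and> smooth_on (\<phi> ` U) c \<and>
        (\<forall>u\<in>\<phi> ` U. \<forall>i\<in>Basis. \<forall>j\<in>Basis. \<sigma> i j u = \<sigma> j i u) \<and>
        (\<forall>u\<in>\<phi> ` U. \<forall>v. (\<Sum>i\<in>Basis. \<Sum>j\<in>Basis. \<sigma> i j u * (v \<bullet> i) * (v \<bullet> j)) \<ge> 0) \<and>
        (\<forall>f. smooth_fun A f \<longrightarrow> (\<forall>x\<in>U. let F = f \<circ> inv_into U \<phi>; u = \<phi> x in
           L f x = (\<Sum>i\<in>Basis. \<Sum>j\<in>Basis. \<sigma> i j u * pd i (pd j F) u)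
                   + (\<Sum>i\<in>Basis. b i u * pd i F u) + c u * F u)))"

definition symmetric_on_tests ::
  "('a::topological_space, 'e::euclidean_space) atlas \<Rightarrow> 'a measure \<Rightarrow>
     (('a \<Rightarrow> real) \<Rightarrow> 'a \<Rightarrow> real) \<Rightarrow> bool" where
  "symmetric_on_tests A M L \<longleftrightarrow> (\<forall>f g. test_fun A f \<and> test_fun A g \<longrightarrow>
     (\<integral>x. f x * L g x \<partial>M) = (\<integral>x. g x * L f x \<partial>M))"

definition nonpositive_on_tests ::
  "('a::topological_space, 'e::euclidean_space) atlas \<Rightarrow> 'a measure \<Rightarrow>
     (('a \<Rightarrow> real) \<Rightarrow> 'a \<Rightarrow> real) \<Rightarrow> bool" where
  "nonpositive_on_tests A M L \<longleftrightarrow> (\<forall>f. test_fun A f \<longrightarrow> (\<integral>x. f x * L f x \<partial>M) \<le> 0)"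


subsection \<open>Local subellipticity\<close>

definition fourier :: "('e::euclidean_space \<Rightarrow> real) \<Rightarrow> 'e \<Rightarrow> complex" where
  "fourier F \<xi> = complex_of_real ((2 * pi) powr (- real DIM('e) / 2)) *
     (\<integral>u. cis (- (u \<bullet> \<xi>)) * complex_of_real (F u) \<partial>lborel)"

definition sobolev_norm_sq :: "real \<Rightarrow> ('e::euclidean_space \<Rightarrow> real) \<Rightarrow> ennreal" where
  "sobolev_norm_sq \<epsilon> F =
     (\<integral>\<^sup>+\<xi>. ennreal ((1 + (norm \<xi>)\<^sup>2) powr \<epsilon> * (cmod (fourier F \<xi>))\<^sup>2) \<partial>lborel)"

definition locally_subelliptic ::
  "('a::topological_space, 'e::euclidean_space) atlas \<Rightarrow> 'a measure \<Rightarrow>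
     (('a \<Rightarrow> real) \<Rightarrow> 'a \<Rightarrow> real) \<Rightarrow> bool" where
  "locally_subelliptic A M L \<longleftrightarrow>
     (\<forall>x. \<exists>(U, \<phi>)\<in>A. \<exists>V. open V \<and> x \<in> V \<and> V \<subseteq> U \<and>
        (\<exists>\<epsilon> C. \<epsilon> > 0 \<and> (\<forall>f. test_fun A f \<and> tsupp f \<subseteq> V \<longrightarrow>
           sobolev_norm_sq \<epsilon> (\<lambda>u. if u \<in> \<phi> ` U then f (inv_into U \<phi> u) else 0)
             \<le> ennreal (C * (- (\<integral>y. f y * L f y \<partial>M) + (\<integral>y. (f y)\<^sup>2 \<partial>M))))))"


subsection \<open>Carre du champ and its iterations\<close>

definition carre :: "(('a \<Rightarrow> real) \<Rightarrow> 'a \<Rightarrow> real) \<Rightarrow> ('a \<Rightarrow> real) \<Rightarrow> ('a \<Rightarrow> real) \<Rightarrow> 'a \<Rightarrow> real" where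
  "carre L f g = (\<lambda>x. (L (\<lambda>y. f y * g y) x - f x * L g x - g x * L f x) / 2)"

text \<open>With \<open>G\<close> the carre du champ this is \<open>\<Gamma>\<^sub>2\<close>, with \<open>G = \<Gamma>\<^sup>Z\<close> it is \<open>\<Gamma>\<^sub>2\<^sup>Z\<close>.\<close>

definition iterated ::
  "(('a \<Rightarrow> real) \<Rightarrow> 'a \<Rightarrow> real) \<Rightarrow> (('a \<Rightarrow> real) \<Rightarrow> ('a \<Rightarrow> real) \<Rightarrow> 'a \<Rightarrow> real) \<Rightarrow>
     ('a \<Rightarrow> real) \<Rightarrow> 'a \<Rightarrow> real" where
  "iterated L G f = (\<lambda>x. (L (G f f) x - 2 * G f (L f) x) / 2)"

definition smooth_symmetric_form ::
  "('a, 'e::euclidean_space) atlas \<Rightarrow>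
     (('a \<Rightarrow> real) \<Rightarrow> ('a \<Rightarrow> real) \<Rightarrow> 'a \<Rightarrow> real) \<Rightarrow> bool" where
  "smooth_symmetric_form A G \<longleftrightarrow>
     (\<forall>(U, \<phi>)\<in>A. \<exists>\<tau> :: 'e \<Rightarrow> 'e \<Rightarrow> 'e \<Rightarrow> real.
        (\<forall>i\<in>Basis. \<forall>j\<in>Basis. smooth_on (\<phi> ` U) (\<tau> i j)) \<and>
        (\<forall>f g. smooth_fun A f \<and> smooth_fun A g \<longrightarrow> (\<forall>x\<in>U.
           G f g x = (\<Sum>i\<in>Basis. \<Sum>j\<in>Basis. \<tau> i j (\<phi> x) *
             pd i (f \<circ> inv_into U \<phi>) (\<phi> x) * pd j (g \<circ> inv_into U \<phi>) (\<phi> x))))) \<and>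
     (\<forall>f g. smooth_fun A f \<and> smooth_fun A g \<longrightarrow> G f g = G g f) \<and>
     (\<forall>f g h. smooth_fun A f \<and> smooth_fun A g \<and> smooth_fun A h \<longrightarrow>
        G (\<lambda>x. f x * g x) h = (\<lambda>x. f x * G g h x + g x * G f h x))"


section \<open>Subunit paths and the distance\<close>

text \<open>
  \<open>L = - (\<Sum>i<m. X\<^sub>i\<^sup>* X\<^sub>i)\<close> on the open set \<open>V\<close> inside the chart domain \<open>U\<close>, tested against
  smooth functions supported in \<open>V\<close> (the adjoints are those of \<open>L\<^sup>2(\<mu>)\<close>).  The vector
  fields are given by their components in the chart, as functions of the coordinates.
\<close>

definition local_squares ::
  "('a::topological_space, 'e::euclidean_space) atlas \<Rightarrow> 'a measure \<Rightarrow>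
     (('a \<Rightarrow> real) \<Rightarrow> 'a \<Rightarrow> real) \<Rightarrow> ('a, 'e) chart \<Rightarrow> 'a set \<Rightarrow> nat \<Rightarrow> (nat \<Rightarrow> 'e \<Rightarrow> 'e) \<Rightarrow> bool" where
  "local_squares A M L = (\<lambda>(U, \<phi>) V m X. open V \<and> V \<subseteq> U \<and>
     (\<forall>i<m. \<exists>K. K-lipschitz_on (\<phi> ` V) (X i)) \<and>
     (\<forall>f g. test_fun A f \<and> test_fun A g \<and> tsupp f \<subseteq> V \<and> tsupp g \<subseteq> V \<longrightarrow>
        (\<integral>x. g x * L f x \<partial>M) =
          - (\<Sum>i<m. LINT x:V|M. pd (X i (\<phi> x)) (f \<circ> inv_into U \<phi>) (\<phi> x) *
                                pd (X i (\<phi> x)) (g \<circ> inv_into U \<phi>) (\<phi> x))))"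

definition locally_sum_of_squares ::
  "('a::topological_space, 'e::euclidean_space) atlas \<Rightarrow> 'a measure \<Rightarrow>
     (('a \<Rightarrow> real) \<Rightarrow> 'a \<Rightarrow> real) \<Rightarrow> bool" where
  "locally_sum_of_squares A M L \<longleftrightarrow>
     (\<forall>x. \<forall>(U, \<phi>)\<in>A. x \<in> U \<longrightarrow> (\<exists>V m X. x \<in> V \<and> local_squares A M L (U, \<phi>) V m X))"

text \<open>
  The tangent vector at \<open>x\<close> with components \<open>v\<close> in the chart \<open>(U, \<phi>)\<close> is subunit.  This does not
  depend on the local representation, so that an existential quantifier is harmless.
\<close>

definition subunit_vec ::
  "('a::topological_space, 'e::euclidean_space) atlas \<Rightarrow> 'a measure \<Rightarrow>
     (('a \<Rightarrow> real) \<Rightarrow> 'a \<Rightarrow> real) \<Rightarrow> ('a, 'e) chart \<Rightarrow> 'a \<Rightarrow> 'e \<Rightarrow> bool" where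
  "subunit_vec A M L c x v \<longleftrightarrow>
     (\<exists>V m X. x \<in> V \<and> local_squares A M L c V m X \<and>
        (\<exists>a :: nat \<Rightarrow> real. (\<Sum>i<m. (a i)\<^sup>2) \<le> 1 \<and> v = (\<Sum>i<m. a i *\<^sub>R X i (snd c x))))"

definition lipschitz_path ::
  "('a::topological_space, 'e::euclidean_space) atlas \<Rightarrow> real \<Rightarrow> (real \<Rightarrow> 'a) \<Rightarrow> bool" where
  "lipschitz_path A T \<gamma> \<longleftrightarrow> continuous_on {0..T} \<gamma> \<and>
     (\<forall>(U, \<phi>)\<in>A. \<forall>a b. 0 \<le> a \<and> b \<le> T \<and> \<gamma> ` {a..b} \<subseteq> U \<longrightarrow>
        (\<exists>K. K-lipschitz_on {a..b} (\<phi> \<circ> \<gamma>)))"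

definition subunit_path ::
  "('a::topological_space, 'e::euclidean_space) atlas \<Rightarrow> 'a measure \<Rightarrow>
     (('a \<Rightarrow> real) \<Rightarrow> 'a \<Rightarrow> real) \<Rightarrow> real \<Rightarrow> (real \<Rightarrow> 'a) \<Rightarrow> bool" where
  "subunit_path A M L T \<gamma> \<longleftrightarrow> T \<ge> 0 \<and> lipschitz_path A T \<gamma> \<and>
     (AE t in lborel. t \<in> {0<..<T} \<longrightarrow> (\<forall>(U, \<phi>)\<in>A. \<gamma> t \<in> U \<longrightarrow>
        (\<exists>v. ((\<phi> \<circ> \<gamma>) has_vector_derivative v) (at t) \<and> subunit_vec A M L (U, \<phi>) (\<gamma> t) v)))"

text \<open>The supremum is finite as soon as any two points are joined by a subunit path.\<close>

definition cc_dist ::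
  "('a, 'e::euclidean_space) atlas \<Rightarrow> (('a \<Rightarrow> real) \<Rightarrow> 'a \<Rightarrow> real) \<Rightarrow> 'a \<Rightarrow> 'a \<Rightarrow> real" where
  "cc_dist A L x y = Sup {\<bar>f x - f y\<bar> | f. smooth_fun A f \<and> sup_norm (carre L f f) \<le> 1}"


section \<open>The heat semigroup\<close>

text \<open>
  Unbounded operators on the real Hilbert space \<open>L\<^sup>2(M)\<close> are represented by their graphs, whose
  elements are pairs of functions.  Closures, adjoints and generators contain all
  representatives of the almost-everywhere classes.
\<close>

type_synonym 'a op_graph = "(('a \<Rightarrow> real) \<times> ('a \<Rightarrow> real)) set"

definition l2 :: "'a measure \<Rightarrow> ('a \<Rightarrow> real) set" where
  "l2 M = {f \<in> borel_measurable M. integrable M (\<lambda>x. (f x)\<^sup>2)}"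

definition l2_inner :: "'a measure \<Rightarrow> ('a \<Rightarrow> real) \<Rightarrow> ('a \<Rightarrow> real) \<Rightarrow> real" where
  "l2_inner M f g = (\<integral>x. f x * g x \<partial>M)"

definition l2_norm :: "'a measure \<Rightarrow> ('a \<Rightarrow> real) \<Rightarrow> real" where
  "l2_norm M f = sqrt (l2_inner M f f)"

definition graph_closure :: "'a measure \<Rightarrow> 'a op_graph \<Rightarrow> 'a op_graph" where
  "graph_closure M G = {(f, g). f \<in> l2 M \<and> g \<in> l2 M \<and>
     (\<exists>F. range F \<subseteq> G \<and>
        (\<lambda>n. l2_norm M (\<lambda>x. fst (F n) x - f x)) \<longlonglongrightarrow> 0 \<and>
        (\<lambda>n. l2_norm M (\<lambda>x. snd (F n) x - g x)) \<longlonglongrightarrow> 0)}"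

definition graph_adjoint :: "'a measure \<Rightarrow> 'a op_graph \<Rightarrow> 'a op_graph" where
  "graph_adjoint M G = {(f, g). f \<in> l2 M \<and> g \<in> l2 M \<and>
     (\<forall>(u, w)\<in>G. l2_inner M w f = l2_inner M u g)}"

definition test_graph ::
  "('a::topological_space, 'e::euclidean_space) atlas \<Rightarrow>
     (('a \<Rightarrow> real) \<Rightarrow> 'a \<Rightarrow> real) \<Rightarrow> 'a op_graph" where
  "test_graph A L = {(f, L f) | f. test_fun A f}"

definition essentially_self_adjoint :: "'a measure \<Rightarrow> 'a op_graph \<Rightarrow> bool" where
  "essentially_self_adjoint M G \<longleftrightarrow> graph_adjoint M (graph_closure M G) = graph_closure M G"

definition l2_semigroup :: "'a measure \<Rightarrow> (real \<Rightarrow> ('a \<Rightarrow> real) \<Rightarrow> 'a \<Rightarrow> real) \<Rightarrow> bool" where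
  "l2_semigroup M P \<longleftrightarrow>
     (\<forall>t\<ge>0. \<forall>f\<in>l2 M. P t f \<in> l2 M) \<and>
     (\<forall>t\<ge>0. \<forall>f\<in>l2 M. \<forall>g\<in>l2 M. \<forall>a b. AE x in M.
        P t (\<lambda>y. a * f y + b * g y) x = a * P t f x + b * P t g x) \<and>
     (\<forall>t\<ge>0. \<exists>C. \<forall>f\<in>l2 M. l2_norm M (P t f) \<le> C * l2_norm M f) \<and>
     (\<forall>f\<in>l2 M. AE x in M. P 0 f x = f x) \<and>
     (\<forall>s\<ge>0. \<forall>t\<ge>0. \<forall>f\<in>l2 M. AE x in M. P (s + t) f x = P s (P t f) x) \<and>
     (\<forall>f\<in>l2 M. ((\<lambda>t. l2_norm M (\<lambda>x. P t f x - f x)) \<longlongrightarrow> 0) (at_right 0))"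

definition generator :: "'a measure \<Rightarrow> (real \<Rightarrow> ('a \<Rightarrow> real) \<Rightarrow> 'a \<Rightarrow> real) \<Rightarrow> 'a op_graph" where
  "generator M P = {(f, g). f \<in> l2 M \<and> g \<in> l2 M \<and>
     ((\<lambda>t. l2_norm M (\<lambda>x. (P t f x - f x) / t - g x)) \<longlongrightarrow> 0) (at_right 0)}"

definition heat :: "'a measure \<Rightarrow> ('a \<Rightarrow> 'a \<Rightarrow> real \<Rightarrow> real) \<Rightarrow> real \<Rightarrow> ('a \<Rightarrow> real) \<Rightarrow> 'a \<Rightarrow> real" where
  "heat M p t f = (if t = 0 then f else (\<lambda>x. \<integral>y. p x y t * f y \<partial>M))"

text \<open>
  \<open>p\<close> is the smooth, positive, symmetric kernel of \<open>e\<^sup>t\<^sup>L\<close>, the strongly continuous semigroup on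
  \<open>L\<^sup>2\<close> generated by the closure of \<open>L\<close> on test functions.
\<close>

definition heat_kernel ::
  "('a::topological_space, 'e::euclidean_space) atlas \<Rightarrow> 'a measure \<Rightarrow>
     (('a \<Rightarrow> real) \<Rightarrow> 'a \<Rightarrow> real) \<Rightarrow> ('a \<Rightarrow> 'a \<Rightarrow> real \<Rightarrow> real) \<Rightarrow> bool" where
  "heat_kernel A M L p \<longleftrightarrow>
     (\<forall>(U, \<phi>)\<in>A. \<forall>(V, \<psi>)\<in>A. smooth_on (\<phi> ` U \<times> \<psi> ` V \<times> {0<..})
        (\<lambda>(u, v, t). p (inv_into U \<phi> u) (inv_into V \<psi> v) t)) \<and>
     (\<forall>x y. \<forall>t>0. p x y t > 0 \<and> p x y t = p y x t) \<and>
     (\<forall>f\<in>l2 M. \<forall>x. \<forall>t>0. integrable M (\<lambda>y. p x y t * f y)) \<and>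
     l2_semigroup M (heat M p) \<and>
     generator M (heat M p) = graph_closure M (test_graph A L)"

end

(*
  Write U = P_t f + eps for a test function f >= 0, and u = ln U.  By hypothesis (b) the terms
  U Gamma(u) and U Gamma^Z(u) evolve through Gamma_2(u) and Gamma_2^Z(u), and (d), applied with
  nu = (2 rho_2 / 3) t and completed to a square, shows that
    t^2 U Gamma(u) + (2 rho_2 / 3) t^3 U Gamma^Z(u) - (D^2 / 2d) t U - (D / d) t^2 L U
  is a subsolution of the heat equation.  It is bounded by (c) and vanishes at t = 0.  Bounded
  subsolutions obey the maximum principle: compared with constants minus P_t h_k they lead to an
  energy estimate in which only Gamma(h_k) -> 0 enters, and P_t h_k -> 1.  The resulting Li-Yau
  inequality says that w = ln U + (D/2) ln t satisfies w_t >= c Gamma(w) with c = d / D.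

  This is not integrated along subunit paths, which would require that the distance, defined as a
  supremum over functions, is the infimum of the lengths.  Instead, Perron's argument shows that
  delta = d(x, .) is a viscosity supersolution of the eikonal equation Gamma(delta) >= 1, because
  a smooth maximum of functions with Gamma <= 1 has Gamma <= 1.  At a minimum of
  w(y, s + tau) + delta(y)^2 / (4 c (tau + eta)) + beta tau, made to exist by a penalty C (1 - h_k),
  this contradicts w_t >= c Gamma(w) unless the value there is at least w(x, s) up to a small error.
  Subunit paths are only needed for the finiteness of the distance.
*)

theory Submission
  imports Defs
begin

section \<open>Smooth functions\<close>

text \<open>The weights come from matching coefficients. Take a U Gamma(u) + b U Gamma^Z(u) with a =
  t^2. After division by U its evolution contributes b' Gamma^Z(u), and (d) with nu = b / a removes
  2 a rho2 Gamma^Z(u); the equation b' = 2 a rho2 fixes b, hence nu. The Gamma(u) terms then add up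
  to a' + 2 a kappa / nu = 2 D t / d, the time derivative of the weight (D / d) t^2 of L U; since L
  U = U (L u + Gamma(u)), they cancel. This is the origin of D.

  Two obstacles shape the rest. The semigroup is given through its L^2 generator and
  almost-everywhere identities, so the pointwise heat equation must be recovered: smoothness comes
  from the kernel, and identities tested against bump functions become pointwise by continuity. The
  distance enters only as a supremum of smooth functions, hence as a lower semicontinuous function
  without known continuity or compact balls. Its minimum problem is therefore posed on the compact
  support of some h_k, and calculus reaches the distance only through smooth functions lying below
  it.\<close>

lemma pd_eq: "(f has_derivative f') (at u) \<Longrightarrow> pd v f u = f' v"
  unfolding pd_def by (metis frechet_derivative_at)

text \<open>\<open>frechet_derivative\<close> is a choice from the predicate of being a derivative.
  The two predicates coincide at u, so the choices agree even where neither function is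
  differentiable.\<close>

lemma pd_cong_open:
  assumes "open S" "u \<in> S" "\<And>x. x \<in> S \<Longrightarrow> f x = g x"
  shows "pd v f u = pd v g u"
proof -
  have "(f has_derivative D) (at u) \<longleftrightarrow> (g has_derivative D) (at u)" for D
    using has_derivative_transform_within_open[OF _ assms(1,2), of f D UNIV g]
      has_derivative_transform_within_open[OF _ assms(1,2), of g D UNIV f] assms(3) by auto
  then show ?thesis unfolding pd_def frechet_derivative_def by simp
qed

lemma differentiable_onD_open:
  "f differentiable_on S \<Longrightarrow> open S \<Longrightarrow> u \<in> S \<Longrightarrow> (f has_derivative (\<lambda>v. pd v f u)) (at u)"
  unfolding pd_def
  by (metis differentiable_on_eq_differentiable_at frechet_derivative_works)

lemma has_derivative_imp_differentiable_on:
  "(\<And>u. u \<in> S \<Longrightarrow> (f has_derivative f' u) (at u)) \<Longrightarrow> f differentiable_on S"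
  by (meson differentiable_def differentiable_at_imp_differentiable_on)

lemma Ck_on_cong_open:
  assumes "open S" "Ck_on k S f" "\<And>x. x \<in> S \<Longrightarrow> f x = g x"
  shows "Ck_on k S g"
  using assms(2,3)
proof (induction k arbitrary: f g)
  case 0
  then show ?case by (auto cong: continuous_on_cong)
next
  case (Suc k)
  have 1: "g differentiable_on S"
    using Suc.prems unfolding Ck_on.simps
    by (metis differentiable_on_def differentiable_transform_within zero_less_one)
  have "Ck_on k S (pd i g)" if "i \<in> Basis" for i
  proof (rule Suc.IH)
    show "Ck_on k S (pd i f)" using Suc.prems that by simp
    show "pd i f x = pd i g x" if "x \<in> S" for x
      by (rule pd_cong_open[OF assms(1) that Suc.prems(2)])
  qed
  with 1 show ?case by simp
qed

lemma Ck_on_SucD: "open S \<Longrightarrow> Ck_on (Suc k) S f \<Longrightarrow> Ck_on k S f"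
proof (induction k arbitrary: f)
  case 0
  then show ?case by (simp add: differentiable_imp_continuous_on)
next
  case (Suc k)
  then show ?case by (metis Ck_on.simps(2))
qed

lemma Ck_on_subset: "Ck_on k S f \<Longrightarrow> T \<subseteq> S \<Longrightarrow> Ck_on k T f"
  by (induction k arbitrary: f) (auto intro: continuous_on_subset differentiable_on_subset)

lemma smooth_on_subset: "smooth_on S f \<Longrightarrow> T \<subseteq> S \<Longrightarrow> smooth_on T f"
  unfolding smooth_on_def using Ck_on_subset by blast

lemma smooth_on_cong_open:
  "open S \<Longrightarrow> smooth_on S f \<Longrightarrow> (\<And>x. x \<in> S \<Longrightarrow> f x = g x) \<Longrightarrow> smooth_on S g"
  unfolding smooth_on_def using Ck_on_cong_open by blast

lemma smooth_on_continuous: "smooth_on S f \<Longrightarrow> continuous_on S f"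
  unfolding smooth_on_def using Ck_on.simps(1) by blast

lemma smooth_on_differentiable: "smooth_on S f \<Longrightarrow> f differentiable_on S"
  unfolding smooth_on_def using Ck_on.simps(2) by blast

lemma smooth_on_has_derivative:
  "smooth_on S f \<Longrightarrow> open S \<Longrightarrow> u \<in> S \<Longrightarrow> (f has_derivative (\<lambda>v. pd v f u)) (at u)"
  by (rule differentiable_onD_open[OF smooth_on_differentiable])

lemma smooth_on_pd: "smooth_on S f \<Longrightarrow> i \<in> Basis \<Longrightarrow> smooth_on S (pd i f)"
  unfolding smooth_on_def using Ck_on.simps(2) by blast

lemma Ck_on_local:
  assumes "\<And>u. u \<in> S \<Longrightarrow> \<exists>T. open T \<and> u \<in> T \<and> Ck_on k T f"
  shows "Ck_on k S f"
  using assms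
proof (induction k arbitrary: f)
  case 0
  show ?case unfolding Ck_on.simps
    by (rule continuous_at_imp_continuous_on)
      (use 0 in \<open>metis Ck_on.simps(1) continuous_on_eq_continuous_at\<close>)
next
  case (Suc k)
  have "f differentiable_on S"
    by (rule differentiable_at_imp_differentiable_on)
      (use Suc.prems in \<open>metis Ck_on.simps(2) differentiable_on_eq_differentiable_at\<close>)
  moreover have "Ck_on k S (pd i f)" if "i \<in> Basis" for i
    by (rule Suc.IH) (use Suc.prems that in \<open>metis Ck_on.simps(2)\<close>)
  ultimately show ?case by simp
qed

lemma smooth_on_local:
  assumes "\<And>u. u \<in> S \<Longrightarrow> \<exists>T. open T \<and> u \<in> T \<and> smooth_on T f"
  shows "smooth_on S f"
  using assms unfolding smooth_on_def by (meson Ck_on_local)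

lemma Ck_on_const: "Ck_on k S (\<lambda>_. c)"
proof (induction k arbitrary: c)
  case (Suc k)
  have "pd i (\<lambda>_. c) = (\<lambda>_. 0)" for i :: 'a
    by (rule ext) (rule pd_eq, rule has_derivative_const)
  with Suc show ?case by simp
qed simp

lemma Ck_on_add:
  assumes "open S" "Ck_on k S f" "Ck_on k S g"
  shows "Ck_on k S (\<lambda>u. f u + g u)"
  using assms(2,3)
proof (induction k arbitrary: f g)
  case 0
  then show ?case by (auto intro: continuous_intros)
next
  case (Suc k)
  have "Ck_on k S (pd i (\<lambda>u. f u + g u))" if "i \<in> Basis" for i
  proof (rule Ck_on_cong_open[OF assms(1)])
    show "Ck_on k S (\<lambda>u. pd i f u + pd i g u)" using Suc that by simp
    show "pd i f u + pd i g u = pd i (\<lambda>u. f u + g u) u" if "u \<in> S" for u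
      using Suc.prems that assms(1)
      by (intro pd_eq[symmetric] has_derivative_add differentiable_onD_open) auto
  qed
  with Suc.prems show ?case by (auto intro: differentiable_on_add)
qed

lemma Ck_on_mult:
  fixes f g :: "'e::euclidean_space \<Rightarrow> real"
  assumes "open S" "Ck_on k S f" "Ck_on k S g"
  shows "Ck_on k S (\<lambda>u. f u * g u)"
  using assms(2,3)
proof (induction k arbitrary: f g)
  case 0
  then show ?case by (auto intro: continuous_intros)
next
  case (Suc k)
  have "Ck_on k S (pd i (\<lambda>u. f u * g u))" if "i \<in> Basis" for i
  proof (rule Ck_on_cong_open[OF assms(1)])
    show "Ck_on k S (\<lambda>u. f u * pd i g u + pd i f u * g u)" 
      using Suc that Ck_on_SucD[OF assms(1)] by (intro Ck_on_add[OF assms(1)] Suc.IH) auto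
    show "f u * pd i g u + pd i f u * g u = pd i (\<lambda>u. f u * g u) u" if "u \<in> S" for u
      using Suc.prems that assms(1)
      by (intro pd_eq[symmetric] has_derivative_mult differentiable_onD_open) auto
  qed
  with Suc.prems show ?case by (auto intro: differentiable_on_mult)
qed

lemma smooth_on_const [intro, simp]: "smooth_on S (\<lambda>_. c)"
  by (simp add: smooth_on_def Ck_on_const)

lemma smooth_on_add [intro]:
  "open S \<Longrightarrow> smooth_on S f \<Longrightarrow> smooth_on S g \<Longrightarrow> smooth_on S (\<lambda>u. f u + g u)"
  by (simp add: smooth_on_def Ck_on_add)

lemma smooth_on_mult [intro]:
  fixes f g :: "'e::euclidean_space \<Rightarrow> real"
  shows "open S \<Longrightarrow> smooth_on S f \<Longrightarrow> smooth_on S g \<Longrightarrow> smooth_on S (\<lambda>u. f u * g u)"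
  by (simp add: smooth_on_def Ck_on_mult)

lemma Ck_on_sum:
  assumes "open S" "\<And>i. i \<in> I \<Longrightarrow> Ck_on k S (f i)"
  shows "Ck_on k S (\<lambda>u. \<Sum>i\<in>I. f i u)"
  using assms(2)
  by (induction I rule: infinite_finite_induct) (auto intro: Ck_on_const Ck_on_add[OF assms(1)])

lemma smooth_on_sum [intro]:
  "open S \<Longrightarrow> (\<And>i. i \<in> I \<Longrightarrow> smooth_on S (f i)) \<Longrightarrow> smooth_on S (\<lambda>u. \<Sum>i\<in>I. f i u)"
  by (simp add: smooth_on_def Ck_on_sum)

lemma smooth_on_bounded_linear:
  assumes "bounded_linear f" shows "smooth_on S f"
proof -
  have 1: "pd i f = (\<lambda>_. f i)" for i
    by (rule ext) (rule pd_eq, rule bounded_linear_imp_has_derivative[OF assms])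
  have 2: "f differentiable_on S"
    by (rule has_derivative_imp_differentiable_on)
      (rule bounded_linear_imp_has_derivative[OF assms])
  have "Ck_on k S f" for k
    using 1 2 by (cases k) (simp_all add: Ck_on_const differentiable_imp_continuous_on)
  then show ?thesis by (simp add: smooth_on_def)
qed

lemma has_derivative_componentwise_pd:
  fixes f :: "'e::euclidean_space \<Rightarrow> 'f::euclidean_space"
  assumes "open S" "u \<in> S" "\<And>j. j \<in> Basis \<Longrightarrow> (\<lambda>u. f u \<bullet> j) differentiable_on S"
  shows "(f has_derivative (\<lambda>v. \<Sum>j\<in>Basis. pd v (\<lambda>u. f u \<bullet> j) u *\<^sub>R j)) (at u)"
proof -
  have "((\<lambda>u. \<Sum>j\<in>Basis. (f u \<bullet> j) *\<^sub>R j) has_derivative (\<lambda>v. \<Sum>j\<in>Basis. pd v (\<lambda>u. f u \<bullet> j) u *\<^sub>R j)) (at u)"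
    using assms by (intro has_derivative_sum has_derivative_scaleR_left differentiable_onD_open) auto
  then show ?thesis by (simp add: euclidean_representation)
qed

lemma pd_compose:
  fixes f :: "'e::euclidean_space \<Rightarrow> 'f::euclidean_space" and g :: "'f \<Rightarrow> real"
  assumes "open S" "open T" "f ` S \<subseteq> T" "u \<in> S"
    and "\<And>j. j \<in> Basis \<Longrightarrow> (\<lambda>u. f u \<bullet> j) differentiable_on S" "g differentiable_on T"
  shows "((\<lambda>u. g (f u)) has_derivative (\<lambda>v. \<Sum>j\<in>Basis. pd v (\<lambda>u. f u \<bullet> j) u * pd j g (f u))) (at u)"
proof -
  have g: "(g has_derivative (\<lambda>v. pd v g (f u))) (at (f u))"
    using assms by (intro differentiable_onD_open) auto
  have "((\<lambda>u. g (f u)) has_derivative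
      (\<lambda>v. pd (\<Sum>j\<in>Basis. pd v (\<lambda>u. f u \<bullet> j) u *\<^sub>R j) g (f u))) (at u)"
    using has_derivative_compose[OF has_derivative_componentwise_pd[OF assms(1,4,5)] g] by simp
  moreover have "pd (\<Sum>j\<in>Basis. c j *\<^sub>R j) g (f u) = (\<Sum>j\<in>Basis. c j * pd j g (f u))" for c :: "'f \<Rightarrow> real"
    using linear_sum[OF has_derivative_linear[OF g], of "\<lambda>j. c j *\<^sub>R j" Basis]
      linear_scale[OF has_derivative_linear[OF g]] by simp
  ultimately show ?thesis by simp
qed

text \<open>The induction closes with the inner map fixed and \<open>g\<close> arbitrary: by the
  chain rule a partial derivative of the composition is a sum of products of component derivatives
  of \<open>f\<close> with \<open>pd j g (f u)\<close>, and the induction hypothesis applies to each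
  \<open>pd j g\<close>.\<close>

lemma Ck_on_compose:
  fixes f :: "'e::euclidean_space \<Rightarrow> 'f::euclidean_space" and g :: "'f \<Rightarrow> real"
  assumes "open S" "open T" "f ` S \<subseteq> T" "\<And>j. j \<in> Basis \<Longrightarrow> Ck_on k S (\<lambda>u. f u \<bullet> j)" "Ck_on k T g"
  shows "Ck_on k S (\<lambda>u. g (f u))"
  using assms(4,5)
proof (induction k arbitrary: g)
  case 0
  have "continuous_on S f"
    using 0 by (subst continuous_on_componentwise) auto
  then show ?case using 0 assms(3) continuous_on_compose2 by (auto intro: continuous_on_compose2)
next
  case (Suc k)
  have D: "((\<lambda>u. g (f u)) has_derivative (\<lambda>v. \<Sum>j\<in>Basis. pd v (\<lambda>u. f u \<bullet> j) u * pd j g (f u))) (at u)"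
    if "u \<in> S" for u
    using Suc.prems that by (intro pd_compose[OF assms(1-3)]) auto
  have "Ck_on k S (pd i (\<lambda>u. g (f u)))" if "i \<in> Basis" for i
  proof (rule Ck_on_cong_open[OF assms(1)])
    show "Ck_on k S (\<lambda>u. \<Sum>j\<in>Basis. pd i (\<lambda>u. f u \<bullet> j) u * pd j g (f u))"
    proof (intro Ck_on_sum Ck_on_mult assms(1))
      fix j :: 'f assume j: "j \<in> Basis"
      show "Ck_on k S (pd i (\<lambda>u. f u \<bullet> j))" using Suc.prems(1)[OF j] that by simp
      show "Ck_on k S (\<lambda>u. pd j g (f u))"
        by (rule Suc.IH[OF Ck_on_SucD[OF assms(1) Suc.prems(1)]]) (use Suc.prems(2) j in simp_all)
    qed
  qed (simp add: pd_eq[OF D])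
  moreover have "(\<lambda>u. g (f u)) differentiable_on S"
    using D by (rule has_derivative_imp_differentiable_on)
  ultimately show ?case by simp
qed

lemma smooth_on_compose_components:
  fixes f :: "'e::euclidean_space \<Rightarrow> 'f::euclidean_space" and g :: "'f \<Rightarrow> real"
  assumes "open S" "open T" "f ` S \<subseteq> T" "\<And>j. j \<in> Basis \<Longrightarrow> smooth_on S (\<lambda>u. f u \<bullet> j)" "smooth_on T g"
  shows "smooth_on S (\<lambda>u. g (f u))"
  unfolding smooth_on_def
proof
  fix k
  show "Ck_on k S (\<lambda>u. g (f u))"
    by (rule Ck_on_compose[OF assms(1-3)]) (use assms(4,5) in \<open>simp_all add: smooth_on_def\<close>)
qed

lemma Ck_on_inner:
  fixes f :: "'e::euclidean_space \<Rightarrow> 'f::euclidean_space"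
  assumes "open S" "Ck_on k S f"
  shows "Ck_on k S (\<lambda>u. f u \<bullet> j)"
  using assms(2)
proof (induction k arbitrary: f)
  case 0
  then show ?case by (auto intro: continuous_intros)
next
  case (Suc k)
  have D: "((\<lambda>u. f u \<bullet> j) has_derivative (\<lambda>v. pd v f u \<bullet> j)) (at u)" if "u \<in> S" for u
    using Suc.prems assms(1) that by (intro has_derivative_inner_left differentiable_onD_open) auto
  have "Ck_on k S (pd i (\<lambda>u. f u \<bullet> j))" if "i \<in> Basis" for i
    by (rule Ck_on_cong_open[OF assms(1) Suc.IH[of "pd i f"]]) (use Suc.prems that pd_eq[OF D] in auto)
  then show ?case using has_derivative_imp_differentiable_on[OF D] by simp
qed

lemma smooth_on_compose:
  fixes f :: "'e::euclidean_space \<Rightarrow> 'f::euclidean_space" and g :: "'f \<Rightarrow> real"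
  assumes "open S" "open T" "f ` S \<subseteq> T" "smooth_on S f" "smooth_on T g"
  shows "smooth_on S (\<lambda>u. g (f u))"
proof (rule smooth_on_compose_components[OF assms(1-3) _ assms(5)])
  show "smooth_on S (\<lambda>u. f u \<bullet> j)" for j
    using assms(4) by (simp add: smooth_on_def Ck_on_inner[OF assms(1)])
qed

lemma smooth_on_compose_real:
  fixes f :: "'e::euclidean_space \<Rightarrow> real" and g :: "real \<Rightarrow> real"
  shows "smooth_on T g \<Longrightarrow> open S \<Longrightarrow> open T \<Longrightarrow> smooth_on S f \<Longrightarrow> f ` S \<subseteq> T \<Longrightarrow> smooth_on S (\<lambda>u. g (f u))"
  by (rule smooth_on_compose)

text \<open>Coinduction: the members of a family that is closed under differentiation are smooth,
  and no formula for the derivative of order k has to be written down.\<close>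

lemma smooth_on_real_coinduct:
  fixes g :: "real \<Rightarrow> real"
  assumes "Q g" "open T"
    and step: "\<And>g. Q g \<Longrightarrow> \<exists>g'. Q g' \<and> (\<forall>x\<in>T. (g has_real_derivative g' x) (at x))"
  shows "smooth_on T g"
proof -
  have "Ck_on k T g" if "Q g" for k g
    using that
  proof (induction k arbitrary: g)
    case 0
    from step[OF 0] show ?case
      by (auto intro!: continuous_at_imp_continuous_on intro: DERIV_isCont)
  next
    case (Suc k)
    from step[OF Suc.prems] obtain g' where g': "Q g'" "\<And>x. x \<in> T \<Longrightarrow> (g has_real_derivative g' x) (at x)"
      by blast
    have "g differentiable_on T"
      by (rule differentiable_at_imp_differentiable_on)
        (use g'(2) real_differentiable_def in blast)
    moreover have "g' x = pd 1 g x" if "x \<in> T" for x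
      using pd_eq[OF g'(2)[OF that, unfolded has_field_derivative_def]] by simp
    ultimately show ?case using Ck_on_cong_open[OF assms(2) Suc.IH[OF g'(1)]] by simp
  qed
  with assms(1) show ?thesis by (simp add: smooth_on_def)
qed

lemma smooth_on_inverse_power:
  "smooth_on {0<..} (\<lambda>x::real. c * inverse x ^ n)"
\<comment> \<open>The factor \<open>c\<close> belongs to the family because differentiation brings
  down the factor -n.\<close>
proof (rule smooth_on_real_coinduct[where Q = "\<lambda>g. \<exists>c n. g = (\<lambda>x::real. c * inverse x ^ n)"])
  fix g :: "real \<Rightarrow> real" assume "\<exists>c n. g = (\<lambda>x. c * inverse x ^ n)"
  then obtain c n where g: "g = (\<lambda>x. c * inverse x ^ n)" by blast
  have "(g has_real_derivative (- c * real n) * inverse x ^ Suc n) (at x)" if "x > 0" for x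
  proof (cases n)
    case (Suc m)
    have "(inverse has_real_derivative - (inverse x * inverse x)) (at x)"
      using DERIV_inverse[of x] that by (simp add: power2_eq_square)
    from DERIV_cmult[OF DERIV_power_Suc[OF this, of m], of c] show ?thesis
      unfolding g Suc by (simp add: algebra_simps)
  qed (simp add: g)
  then show "\<exists>g'. (\<exists>c n. g' = (\<lambda>x. c * inverse x ^ n)) \<and>
      (\<forall>x\<in>{0<..}. (g has_real_derivative g' x) (at x))"
    by (intro exI[of _ "\<lambda>x. (- c * real n) * inverse x ^ Suc n"] conjI exI[of _ "- c * real n"] exI[of _ "Suc n"]) auto
qed auto

lemma smooth_on_real_derivative:
  fixes g g' :: "real \<Rightarrow> real"
  assumes "open T" "smooth_on T g'" "\<And>x. x \<in> T \<Longrightarrow> (g has_real_derivative g' x) (at x)"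
  shows "smooth_on T g"
proof -
  have "g' x = pd 1 g x" if "x \<in> T" for x
    using pd_eq[OF assms(3)[OF that, unfolded has_field_derivative_def]] by simp
  then have "Ck_on k T (pd 1 g)" for k
    using assms(2) Ck_on_cong_open[OF assms(1)] unfolding smooth_on_def by blast
  moreover have "g differentiable_on T"
    by (rule differentiable_at_imp_differentiable_on)
      (use assms(3) real_differentiable_def in blast)
  ultimately have "Ck_on (Suc k) T g" for k by simp
  then show ?thesis unfolding smooth_on_def using Ck_on_SucD[OF assms(1)] by blast
qed

lemma smooth_on_inverse: "smooth_on {0<..} (inverse :: real \<Rightarrow> real)"
  using smooth_on_inverse_power[of 1 1] by (simp del: inverse_eq_divide)

lemma smooth_on_ln: "smooth_on {0<..} (ln :: real \<Rightarrow> real)"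
  by (rule smooth_on_real_derivative[OF _ smooth_on_inverse]) (auto intro!: DERIV_ln)

subsection \<open>Flat functions\<close>

text \<open>r^-n exp(-1/r), extended by zero. The derivative of a member is a linear combination of
  two further members, also at the origin, so one induction for all \<open>n\<close> at once gives
  smoothness across 0.\<close>

definition flatn :: "nat \<Rightarrow> real \<Rightarrow> real" where
  "flatn n r = (if r > 0 then inverse r ^ n * exp (- inverse r) else 0)"

lemma flatn_nonneg: "flatn n r \<ge> 0"
  by (simp add: flatn_def)

lemma flatn_eq_0: "r \<le> 0 \<Longrightarrow> flatn n r = 0"
  by (simp add: flatn_def)

lemma flatn_pos: "r > 0 \<Longrightarrow> flatn n r > 0"
  by (simp add: flatn_def)

lemma flatn_mult: "r * flatn (Suc n) r = flatn n r"
  by (simp add: flatn_def)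

lemma flatn_tendsto_0: "((flatn n) \<longlongrightarrow> 0) (at_right 0)"
proof -
  have "((\<lambda>x::real. inverse x ^ n / exp (inverse x)) \<longlongrightarrow> 0) (at_right 0)"
    using tendsto_power_div_exp_0[of n] filterlim_inverse_at_top_right
    by (rule filterlim_compose)
  moreover have "\<forall>\<^sub>F x in at_right 0. inverse x ^ n / exp (inverse x) = flatn n x"
    by (rule eventually_at_rightI[of 0 1]) (auto simp: flatn_def exp_minus divide_inverse)
  ultimately show ?thesis by (simp cong: filterlim_cong add: tendsto_cong)
qed

lemma DERIV_flatn:
  "(flatn n has_real_derivative (- real n * flatn (n + 1) x + flatn (n + 2) x)) (at x)"
proof -
  consider "x > 0" | "x < 0" | "x = 0" by linarith
  then show ?thesis
  proof cases
    case 1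
    have "((\<lambda>r. inverse r ^ n * exp (- inverse r)) has_real_derivative
        (- real n * flatn (n + 1) x + flatn (n + 2) x)) (at x)"
    proof (cases n)
      case 0
      then show ?thesis using 1
        by (auto intro!: derivative_eq_intros simp: flatn_def power2_eq_square)
    next
      case (Suc m)
      have "(inverse has_real_derivative - (inverse x * inverse x)) (at x)"
        using DERIV_inverse[of x] 1 by (simp add: power2_eq_square)
      from DERIV_power_Suc[OF this, of m]
      have a: "((\<lambda>r. inverse r ^ Suc m) has_real_derivative
          (1 + real m) * (- (inverse x * inverse x) * inverse x ^ m)) (at x)" by simp
      have b: "((\<lambda>r. exp (- inverse r)) has_real_derivative
          exp (- inverse x) * (inverse x * inverse x)) (at x)"
        using 1 by (auto intro!: derivative_eq_intros simp: power2_eq_square)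
      show ?thesis using 1 DERIV_mult[OF a b] unfolding Suc
        by (simp add: flatn_def algebra_simps)
    qed
    then show ?thesis
      by (rule has_field_derivative_transform_within_open[of _ _ _ "{0<..}"]) (use 1 in \<open>auto simp: flatn_def\<close>)
  next
    case 2
    have "((\<lambda>r. 0) has_real_derivative 0) (at x)" by simp
    then have "(flatn n has_real_derivative 0) (at x)"
      by (rule has_field_derivative_transform_within_open[of _ _ _ "{..<0}"])
        (use 2 in \<open>auto simp: flatn_def\<close>)
    then show ?thesis using 2 by (simp add: flatn_eq_0)
  next
    case 3
    \<comment> \<open>From the right the difference quotient at 0 is itself the next function of the
      family, whose limit is already known.\<close>
    have r: "((\<lambda>y. (flatn n y - flatn n 0) / (y - 0)) \<longlongrightarrow> 0) (at_right 0)"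
    proof (rule Lim_transform_eventually[OF flatn_tendsto_0[of "Suc n"]])
      show "\<forall>\<^sub>F y in at_right 0. flatn (Suc n) y = (flatn n y - flatn n 0) / (y - 0)"
        by (rule eventually_at_rightI[of 0 1]) (auto simp: flatn_def field_simps)
    qed
    have l: "((\<lambda>y. (flatn n y - flatn n 0) / (y - 0)) \<longlongrightarrow> 0) (at_left 0)"
    proof (rule Lim_transform_eventually[OF tendsto_const])
      show "\<forall>\<^sub>F y in at_left 0. 0 = (flatn n y - flatn n 0) / (y - 0)"
        by (rule eventually_at_leftI[of "-1" 0]) (auto simp: flatn_def)
    qed
    have "((\<lambda>y. (flatn n y - flatn n 0) / (y - 0)) \<longlongrightarrow> 0) (at 0)"
      using l r by (simp add: filterlim_split_at)
    then show ?thesis using 3 by (simp add: has_field_derivative_iff flatn_eq_0)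
  qed
qed

lemma smooth_on_flatn: "smooth_on UNIV (flatn n)"
proof -
  have "Ck_on k UNIV (flatn n)" for k n
  proof (induction k arbitrary: n)
    case 0
    show ?case
      by (auto intro!: continuous_at_imp_continuous_on DERIV_isCont DERIV_flatn)
  next
    case (Suc k)
    have "pd 1 (flatn n) = (\<lambda>x. - real n * flatn (n + 1) x + flatn (n + 2) x)"
      using pd_eq[OF DERIV_flatn[unfolded has_field_derivative_def]] by auto
    moreover have "Ck_on k UNIV (\<lambda>x. - real n * flatn (n + 1) x + flatn (n + 2) x)"
      by (intro Ck_on_add Ck_on_mult Ck_on_const Suc open_UNIV)
    moreover have "flatn n differentiable_on UNIV"
      by (rule differentiable_at_imp_differentiable_on)
        (use DERIV_flatn real_differentiable_def in blast)
    ultimately show ?case by simp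
  qed
  then show ?thesis by (simp add: smooth_on_def)
qed

lemma flatn_0_le_1: "flatn 0 r \<le> 1"
  by (simp add: flatn_def)

lemma flatn_0_le: "r \<ge> 0 \<Longrightarrow> flatn 0 r \<le> r"
proof -
  assume "r \<ge> 0"
  moreover have "exp (- inverse r) \<le> r" if "r > 0"
  proof -
    have "inverse r \<le> exp (inverse r)" using exp_ge_add_one_self[of "inverse r"] by linarith
    then show ?thesis using that by (simp add: exp_minus inverse_le_imp_le)
  qed
  ultimately show ?thesis by (auto simp: flatn_def)
qed

subsection \<open>A smooth step and a smooth positive part\<close>

text \<open>The two flat functions never vanish together, so the quotient is smooth everywhere; it
  climbs from 0 for r <= 0 to 1 for r >= 1.\<close>

definition sstep :: "real \<Rightarrow> real" where
  "sstep r = flatn 0 r * inverse (flatn 0 r + flatn 0 (1 - r))"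

lemma flatn_sum_pos: "flatn 0 r + flatn 0 (1 - r) > 0"
  using flatn_pos[of r 0] flatn_pos[of "1 - r" 0] flatn_nonneg[of 0 r] flatn_nonneg[of 0 "1 - r"]
  by (smt (verit))

lemma smooth_on_sstep: "smooth_on UNIV sstep"
proof -
  have 1: "smooth_on UNIV (\<lambda>r::real. 1 + (-1) * r)"
    by (intro smooth_on_add smooth_on_mult smooth_on_const open_UNIV
        smooth_on_bounded_linear bounded_linear_ident)
  have 2: "smooth_on UNIV (\<lambda>r. flatn 0 (1 + (-1) * r))"
    by (rule smooth_on_compose_real[OF smooth_on_flatn _ _ 1]) auto
  have "smooth_on UNIV (\<lambda>r. inverse (flatn 0 r + flatn 0 (1 + (-1) * r)))"
    by (rule smooth_on_compose_real[OF smooth_on_inverse])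
      (use flatn_sum_pos in \<open>auto intro!: smooth_on_add smooth_on_flatn 2[simplified]\<close>)
  then have "smooth_on UNIV (\<lambda>r. flatn 0 r * inverse (flatn 0 r + flatn 0 (1 + (-1) * r)))"
    by (intro smooth_on_mult smooth_on_flatn open_UNIV)
  then show ?thesis by (simp add: sstep_def[abs_def])
qed

lemma sstep_0: "r \<le> 0 \<Longrightarrow> sstep r = 0"
  by (simp add: sstep_def flatn_eq_0)

lemma sstep_1: "r \<ge> 1 \<Longrightarrow> sstep r = 1"
  using flatn_sum_pos[of r] by (simp add: sstep_def flatn_eq_0)

text \<open>A smooth convex substitute for the positive part: the first derivative lies in [0, 1]
  and the second is \<open>flatn 3\<close>. It serves twice, as the integrand of the energy in the
  maximum principle and as the building block of a smooth maximum that keeps the gradient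
  bound.\<close>

definition spos :: "real \<Rightarrow> real" where
  "spos r = r * flatn 0 r"

definition spos' :: "real \<Rightarrow> real" where
  "spos' r = flatn 0 r + flatn 1 r"

lemma smooth_on_spos: "smooth_on UNIV spos"
  unfolding spos_def
  by (intro smooth_on_mult smooth_on_flatn smooth_on_bounded_linear bounded_linear_ident open_UNIV)

lemma smooth_on_spos': "smooth_on UNIV spos'"
  unfolding spos'_def by (intro smooth_on_add smooth_on_flatn open_UNIV)

lemma DERIV_spos: "(spos has_real_derivative spos' r) (at r)"
proof -
  have "r * flatn 2 r = flatn 1 r" using flatn_mult[of r 1] by (simp add: numeral_2_eq_2)
  then show ?thesis unfolding spos_def spos'_def
    by (auto intro!: derivative_eq_intros DERIV_flatn simp: numeral_2_eq_2 mult.commute)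
qed

lemma DERIV_spos': "(spos' has_real_derivative flatn 3 r) (at r)"
  unfolding spos'_def
  by (rule derivative_eq_intros DERIV_flatn)+ (simp add: numeral_2_eq_2 numeral_3_eq_3)

lemma spos_eq_0: "r \<le> 0 \<Longrightarrow> spos r = 0"
  by (simp add: spos_def flatn_eq_0)

lemma spos_nonneg: "spos r \<ge> 0"
  by (cases "r > 0") (simp_all add: spos_def flatn_nonneg flatn_eq_0)

lemma spos_pos: "r > 0 \<Longrightarrow> spos r > 0"
  by (simp add: spos_def flatn_pos)

lemma spos'_nonneg: "spos' r \<ge> 0"
  by (simp add: spos'_def flatn_nonneg)

lemma spos'_eq_0: "r \<le> 0 \<Longrightarrow> spos' r = 0"
  by (simp add: spos'_def flatn_eq_0)

lemma spos'_le_1: "spos' r \<le> 1"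
proof (cases "r > 0")
  case True
  then have "spos' r = (1 + inverse r) * inverse (exp (inverse r))"
    by (simp add: spos'_def flatn_def algebra_simps exp_minus)
  also have "\<dots> \<le> exp (inverse r) * inverse (exp (inverse r))"
    by (intro mult_right_mono exp_ge_add_one_self) auto
  finally show ?thesis by simp
qed (simp add: spos'_eq_0)

lemma spos_ge: "spos r \<ge> r - 1"
proof (cases "r > 0")
  case True
  have "1 - inverse r \<le> flatn 0 r"
    using exp_ge_add_one_self[of "- inverse r"] True by (simp add: flatn_def)
  then have "r * (1 - inverse r) \<le> spos r"
    unfolding spos_def using True by (intro mult_left_mono) auto
  then show ?thesis using True by (simp add: algebra_simps)
next
  case False
  then show ?thesis using spos_nonneg[of r] by linarith
qed

lemma spos_le: "r \<ge> 0 \<Longrightarrow> spos r \<le> r"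
  unfolding spos_def by (rule mult_left_le) (auto simp: flatn_0_le_1)

text \<open>The left-hand side is the bound that completing the square produces in the energy
  estimate of the maximum principle.\<close>

lemma spos'_sq_le:
  assumes "0 < r" "r \<le> M"
  shows "(spos' r)\<^sup>2 / flatn 3 r \<le> (1 + M)\<^sup>2 * r\<^sup>2"
proof -
  have e: "spos' r = (1 + r) * flatn 1 r" "flatn 1 r = r\<^sup>2 * flatn 3 r"
    using assms by (simp_all add: spos'_def flatn_def field_simps power2_eq_square power3_eq_cube)
  \<comment> \<open>The quotient of two flat functions is not flat: it equals (1 + r)^2 r exp(-1/r).
    The exponential, bounded by r, supplies the second factor r, so that the bound becomes quadratic
    and square integrability suffices later.\<close>
  have "(spos' r)\<^sup>2 / flatn 3 r = (1 + r)\<^sup>2 * (r * flatn 0 r)"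
    using assms flatn_pos[of r 3] unfolding e(1) power_mult_distrib
    by (simp add: flatn_def field_simps power2_eq_square power3_eq_cube)
  also have "\<dots> \<le> (1 + M)\<^sup>2 * (r * r)"
    using assms flatn_0_le[of r] flatn_nonneg[of 0 r]
    by (intro mult_mono power_mono) auto
  finally show ?thesis by (simp add: power2_eq_square)
qed

section \<open>Calculus on a manifold\<close>

lemma pd_mult:
  fixes F G :: "'e::euclidean_space \<Rightarrow> real"
  assumes "open S" "u \<in> S" "smooth_on S F" "smooth_on S G"
  shows "pd i (\<lambda>u. F u * G u) u = F u * pd i G u + pd i F u * G u"
  using has_derivative_mult[OF smooth_on_has_derivative[OF assms(3,1,2)]
      smooth_on_has_derivative[OF assms(4,1,2)]]
  by (rule pd_eq)

lemma pd_add: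
  fixes F G :: "'e::euclidean_space \<Rightarrow> real"
  assumes "open S" "u \<in> S" "smooth_on S F" "smooth_on S G"
  shows "pd i (\<lambda>u. F u + G u) u = pd i F u + pd i G u"
  using has_derivative_add[OF smooth_on_has_derivative[OF assms(3,1,2)]
      smooth_on_has_derivative[OF assms(4,1,2)]]
  by (rule pd_eq)

lemma pd_const [simp]: "pd i (\<lambda>_. c) u = 0"
  by (rule pd_eq[OF has_derivative_const])

lemma pd_real_compose:
  fixes F :: "'e::euclidean_space \<Rightarrow> real"
  assumes "open S" "u \<in> S" "smooth_on S F" "(g has_real_derivative g') (at (F u))"
  shows "pd i (\<lambda>u. g (F u)) u = g' * pd i F u"
  using has_derivative_compose[OF smooth_on_has_derivative[OF assms(3,1,2)]
      assms(4)[unfolded has_field_derivative_def]]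
  by (rule pd_eq)

lemma pd_pd_mult:
  fixes F G :: "'e::euclidean_space \<Rightarrow> real"
  assumes "open S" "u \<in> S" "smooth_on S F" "smooth_on S G" "i \<in> Basis" "j \<in> Basis"
  shows "pd i (pd j (\<lambda>u. F u * G u)) u =
    F u * pd i (pd j G) u + pd i F u * pd j G u + pd j F u * pd i G u + pd i (pd j F) u * G u"
proof -
  have "pd i (pd j (\<lambda>u. F u * G u)) u = pd i (\<lambda>u. F u * pd j G u + pd j F u * G u) u"
    by (rule pd_cong_open[OF assms(1,2)]) (rule pd_mult[OF assms(1) _ assms(3,4)])
  also have "\<dots> = pd i (\<lambda>u. F u * pd j G u) u + pd i (\<lambda>u. pd j F u * G u) u"
    by (rule pd_add[OF assms(1,2)]) (use assms in \<open>auto intro!: smooth_on_mult smooth_on_pd\<close>)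
  finally show ?thesis
    using assms by (simp add: pd_mult[OF assms(1,2)] smooth_on_pd)
qed

lemma pd_pd_compose:
  fixes F :: "'e::euclidean_space \<Rightarrow> real"
  assumes "open S" "u \<in> S" "smooth_on S F" "i \<in> Basis" "j \<in> Basis" "F ` S \<subseteq> T" "open T"
    and "smooth_on T g'"
    and "\<And>r. r \<in> T \<Longrightarrow> (g has_real_derivative g' r) (at r)"
    and "\<And>r. r \<in> T \<Longrightarrow> (g' has_real_derivative g'' r) (at r)"
  shows "pd i (pd j (\<lambda>u. g (F u))) u =
    g' (F u) * pd i (pd j F) u + g'' (F u) * (pd i F u * pd j F u)"
proof -
  have T: "F u \<in> T" if "u \<in> S" for u using assms(6) that by blast
  have "pd i (pd j (\<lambda>u. g (F u))) u = pd i (\<lambda>u. g' (F u) * pd j F u) u"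
    by (rule pd_cong_open[OF assms(1,2)])
      (rule pd_real_compose[OF assms(1) _ assms(3)], simp_all add: assms(9) T)
  also have "\<dots> = g' (F u) * pd i (pd j F) u + pd i (\<lambda>u. g' (F u)) u * pd j F u"
    by (rule pd_mult[OF assms(1,2)])
      (use assms in \<open>auto intro!: smooth_on_compose_real[OF assms(8)] smooth_on_pd\<close>)
  also have "pd i (\<lambda>u. g' (F u)) u = g'' (F u) * pd i F u"
    by (rule pd_real_compose[OF assms(1-3) assms(10)[OF T[OF assms(2)]]])
  finally show ?thesis by simp
qed

lemma real_bilinear_discriminant:
  fixes a b c :: real
  assumes "\<And>r. a + 2 * r * b + r\<^sup>2 * c \<ge> 0"
  shows "b\<^sup>2 \<le> a * c"
proof (cases "c = 0")
  case True
  have "b = 0"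
  proof (rule ccontr)
    assume b: "b \<noteq> 0"
    \<comment> \<open>This value of r would make the affine expression equal to -1.\<close>
    have "a + 2 * (- (a + 1) / (2 * b)) * b \<ge> 0" using assms[of "- (a + 1) / (2 * b)"] True by simp
    then show False using b by (simp add: field_simps)
  qed
  then show ?thesis using True by simp
next
  case False
  have "c \<ge> 0"
  proof (rule ccontr)
    assume c: "\<not> c \<ge> 0"
    \<comment> \<open>So large that a negative quadratic term outweighs the constant and the linear
      term together.\<close>
    define r where "r = (\<bar>a\<bar> + 2 * \<bar>b\<bar> + 1) / (- c) + 1"
    have r: "r \<ge> 1" "r * (- c) \<ge> \<bar>a\<bar> + 2 * \<bar>b\<bar> + 1"
      using c unfolding r_def by (simp_all add: field_simps)
    have "r * (r * (- c)) \<ge> r * (\<bar>a\<bar> + 2 * \<bar>b\<bar> + 1)" using r by (intro mult_left_mono) auto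
    moreover have "r * (\<bar>a\<bar> + 2 * \<bar>b\<bar> + 1) \<ge> \<bar>a\<bar> + 1 + 2 * r * b"
    proof -
      have "1 * (\<bar>a\<bar> + 1) \<le> r * (\<bar>a\<bar> + 1)" using r by (intro mult_right_mono) auto
      moreover have "r * b \<le> r * \<bar>b\<bar>" using r by (intro mult_left_mono) auto
      ultimately show ?thesis by (simp add: algebra_simps)
    qed
    ultimately show False using assms[of r] by (simp add: power2_eq_square algebra_simps)
  qed
  then have c: "c > 0" using False by simp
  have "c * (a + 2 * (- b / c) * b + (- b / c)\<^sup>2 * c) \<ge> 0"
    using assms[of "- b / c"] c by simp
  moreover have "c * (a + 2 * (- b / c) * b + (- b / c)\<^sup>2 * c) = a * c - b\<^sup>2"
    using c by (simp add: field_simps power2_eq_square)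
  ultimately show ?thesis by simp
qed

section \<open>Charts, smooth functions and bump functions on the manifold\<close>

locale smooth_mfd =
  fixes A :: "('a::{t2_space, second_countable_topology}, 'e::euclidean_space) atlas"
  assumes mfd: "smooth_manifold A"
begin

lemma chart:
  assumes "(U, \<phi>) \<in> A"
  shows "open U" "open (\<phi> ` U)" "homeomorphism U (\<phi> ` U) \<phi> (inv_into U \<phi>)"
  using mfd assms unfolding smooth_manifold_def by auto

lemma chart_inv: "(U, \<phi>) \<in> A \<Longrightarrow> x \<in> U \<Longrightarrow> inv_into U \<phi> (\<phi> x) = x"
  using chart(3) by (meson homeomorphism_apply1)

lemma chart_inv_in: "(U, \<phi>) \<in> A \<Longrightarrow> u \<in> \<phi> ` U \<Longrightarrow> inv_into U \<phi> u \<in> U"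
  by (rule inv_into_into)

lemma chart_apply_inv: "u \<in> \<phi> ` U \<Longrightarrow> \<phi> (inv_into U \<phi> u) = u"
  by (rule f_inv_into_f)

lemma chart_continuous: "(U, \<phi>) \<in> A \<Longrightarrow> continuous_on U \<phi>"
  using chart(3) homeomorphism_cont1 by blast

lemma chart_inv_continuous: "(U, \<phi>) \<in> A \<Longrightarrow> continuous_on (\<phi> ` U) (inv_into U \<phi>)"
  using chart(3) homeomorphism_cont2 by blast

lemma chart_at: obtains U \<phi> where "(U, \<phi>) \<in> A" "x \<in> U"
  using mfd unfolding smooth_manifold_def by blast

lemma chart_image_eq:
  "(U, \<phi>) \<in> A \<Longrightarrow> W \<subseteq> U \<Longrightarrow> \<phi> ` W = {u \<in> \<phi> ` U. inv_into U \<phi> u \<in> W}"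
  using chart_inv by force

lemma chart_image_open:
  assumes "(U, \<phi>) \<in> A" "open W" "W \<subseteq> U"
  shows "open (\<phi> ` W)"
proof -
  have "\<phi> ` W = \<phi> ` U \<inter> inv_into U \<phi> -` W"
    using chart_image_eq[OF assms(1,3)] by auto
  then show ?thesis
    using continuous_open_preimage[OF chart_inv_continuous chart(2)] assms by metis
qed

lemma chart_transition:
  "(U, \<phi>) \<in> A \<Longrightarrow> (V, \<psi>) \<in> A \<Longrightarrow> smooth_on (\<phi> ` (U \<inter> V)) (\<psi> \<circ> inv_into U \<phi>)"
  using mfd unfolding smooth_manifold_def by fast

lemma smooth_fun_chart:
  "smooth_fun A f \<Longrightarrow> (U, \<phi>) \<in> A \<Longrightarrow> smooth_on (\<phi> ` U) (f \<circ> inv_into U \<phi>)"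
  unfolding smooth_fun_def by blast

lemma smooth_fun_const [simp, intro]: "smooth_fun A (\<lambda>_. c)"
  unfolding smooth_fun_def by (auto simp: o_def)

lemma smooth_fun_add [intro]:
  "smooth_fun A f \<Longrightarrow> smooth_fun A g \<Longrightarrow> smooth_fun A (\<lambda>x. f x + g x)"
  unfolding smooth_fun_def using smooth_on_add chart(2) by (fastforce simp: o_def)

lemma smooth_fun_mult [intro]:
  "smooth_fun A f \<Longrightarrow> smooth_fun A g \<Longrightarrow> smooth_fun A (\<lambda>x. f x * g x)"
  unfolding smooth_fun_def using smooth_on_mult chart(2) by (fastforce simp: o_def)

lemma smooth_fun_minus [intro]: "smooth_fun A f \<Longrightarrow> smooth_fun A (\<lambda>x. - f x)"
  using smooth_fun_mult[of "\<lambda>_. -1" f] by simp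

lemma smooth_fun_diff [intro]:
  "smooth_fun A f \<Longrightarrow> smooth_fun A g \<Longrightarrow> smooth_fun A (\<lambda>x. f x - g x)"
  using smooth_fun_add[of f "\<lambda>x. - g x"] by auto

lemma smooth_fun_compose:
  assumes "smooth_on T g" "open T" "smooth_fun A f" "\<And>x. f x \<in> T"
  shows "smooth_fun A (\<lambda>x. g (f x))"
  unfolding smooth_fun_def
proof clarify
  fix U \<phi> assume c: "(U, \<phi>) \<in> A"
  have "smooth_on (\<phi> ` U) (\<lambda>u. g ((f \<circ> inv_into U \<phi>) u))"
    by (rule smooth_on_compose_real[OF assms(1) chart(2)[OF c] assms(2) smooth_fun_chart[OF assms(3) c]])
      (use assms(4) in auto)
  then show "smooth_on (\<phi> ` U) ((\<lambda>x. g (f x)) \<circ> inv_into U \<phi>)" by (simp add: o_def)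
qed

lemma smooth_fun_continuous:
  assumes "smooth_fun A f" shows "continuous_on S f"
proof -
  have "isCont f x" for x
  proof -
    obtain U \<phi> where c: "(U, \<phi>) \<in> A" "x \<in> U" by (rule chart_at)
    have "continuous_on U (\<lambda>x. (f \<circ> inv_into U \<phi>) (\<phi> x))"
      using smooth_on_continuous[OF smooth_fun_chart[OF assms c(1)]] chart_continuous[OF c(1)]
      by (rule continuous_on_compose2) auto
    then have "continuous_on U f"
      by (rule continuous_on_eq) (use c chart_inv in auto)
    then show ?thesis using c chart(1) continuous_on_eq_continuous_at by blast
  qed
  then show ?thesis by (simp add: continuous_at_imp_continuous_on)
qed

text \<open>A single chart around each point is enough, because the transition maps carry smoothness
  to every other chart of the atlas.\<close>

lemma smooth_funI_chart:
  assumes "\<And>x. \<exists>U \<phi> W. (U, \<phi>) \<in> A \<and> open W \<and> x \<in> W \<and> W \<subseteq> U \<and>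
    smooth_on (\<phi> ` W) (f \<circ> inv_into U \<phi>)"
  shows "smooth_fun A f"
  unfolding smooth_fun_def
proof clarify
  fix V \<psi> assume V: "(V, \<psi>) \<in> A"
  show "smooth_on (\<psi> ` V) (f \<circ> inv_into V \<psi>)"
  proof (rule smooth_on_local)
    fix v assume "v \<in> \<psi> ` V"
    then obtain z where z: "z \<in> V" "v = \<psi> z" by blast
    from assms[of z] obtain U \<phi> W where W: "(U, \<phi>) \<in> A" "open W" "z \<in> W" "W \<subseteq> U"
      "smooth_on (\<phi> ` W) (f \<circ> inv_into U \<phi>)" by blast
    have o: "open (\<psi> ` (V \<inter> W))" "open (\<phi> ` W)"
      using V W chart(1) by (auto intro!: chart_image_open)
    have "smooth_on (\<psi> ` (V \<inter> W)) (\<lambda>v. (f \<circ> inv_into U \<phi>) ((\<phi> \<circ> inv_into V \<psi>) v))"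
    proof (rule smooth_on_compose[OF o _ _ W(5)])
      show "smooth_on (\<psi> ` (V \<inter> W)) (\<phi> \<circ> inv_into V \<psi>)"
        by (rule smooth_on_subset[OF chart_transition[OF V W(1)]]) (use W in auto)
      show "(\<phi> \<circ> inv_into V \<psi>) ` \<psi> ` (V \<inter> W) \<subseteq> \<phi> ` W"
        using chart_inv[OF V] by auto
    qed
    then have "smooth_on (\<psi> ` (V \<inter> W)) (f \<circ> inv_into V \<psi>)"
      by (rule smooth_on_cong_open[OF o(1)]) (use chart_inv[OF V] chart_inv[OF W(1)] W(4) in auto)
    then show "\<exists>T. open T \<and> v \<in> T \<and> smooth_on T (f \<circ> inv_into V \<psi>)"
      using o(1) z W(3) by blast
  qed
qed

text \<open>This is the form in which functions glued from several pieces, each smooth on the whole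
  manifold, are recognised as smooth.\<close>

lemma smooth_fun_local:
  assumes "\<And>x. \<exists>W g. open W \<and> x \<in> W \<and> smooth_fun A g \<and> (\<forall>y\<in>W. f y = g y)"
  shows "smooth_fun A f"
proof (rule smooth_funI_chart)
  fix x
  obtain U \<phi> where c: "(U, \<phi>) \<in> A" "x \<in> U" by (rule chart_at)
  from assms[of x] obtain W g where W: "open W" "x \<in> W" "smooth_fun A g" "\<And>y. y \<in> W \<Longrightarrow> f y = g y"
    by blast
  have o: "open (\<phi> ` (U \<inter> W))" using c W chart(1) by (auto intro!: chart_image_open)
  have "smooth_on (\<phi> ` (U \<inter> W)) (g \<circ> inv_into U \<phi>)"
    by (rule smooth_on_subset[OF smooth_fun_chart[OF W(3) c(1)]]) auto
  then have "smooth_on (\<phi> ` (U \<inter> W)) (f \<circ> inv_into U \<phi>)"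
    by (rule smooth_on_cong_open[OF o]) (use W(4) chart_inv[OF c(1)] in auto)
  then show "\<exists>U \<phi> W. (U, \<phi>) \<in> A \<and> open W \<and> x \<in> W \<and> W \<subseteq> U \<and> smooth_on (\<phi> ` W) (f \<circ> inv_into U \<phi>)"
    using c W(1,2) chart(1)[OF c(1)]
    by (intro exI[of _ U] exI[of _ \<phi>] exI[of _ "U \<inter> W"]) auto
qed

lemma tsupp_closed: "closed (tsupp f)" by (simp add: tsupp_def)

lemma tsupp_outside: "x \<notin> tsupp f \<Longrightarrow> f x = 0"
  unfolding tsupp_def using closure_subset[of "{x. f x \<noteq> 0}"] by auto

lemma tsupp_subsetI: "closed K \<Longrightarrow> (\<And>x. x \<notin> K \<Longrightarrow> f x = 0) \<Longrightarrow> tsupp f \<subseteq> K"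
  unfolding tsupp_def by (rule closure_minimal) auto

lemma test_funI:
  assumes "smooth_fun A f" "compact K" "\<And>x. x \<notin> K \<Longrightarrow> f x = 0"
  shows "test_fun A f"
proof -
  have "tsupp f \<subseteq> K" using assms(2,3) by (intro tsupp_subsetI compact_imp_closed)
  then have "compact (tsupp f)"
    using compact_Int_closed[OF assms(2) tsupp_closed[of f]] by (simp add: Int_absorb1)
  with assms(1) show ?thesis by (simp add: test_fun_def)
qed

lemma test_fun_smooth: "test_fun A f \<Longrightarrow> smooth_fun A f" by (simp add: test_fun_def)

lemma test_fun_compact: "test_fun A f \<Longrightarrow> compact (tsupp f)" by (simp add: test_fun_def)

lemma test_fun_mult:
  assumes "test_fun A f" "smooth_fun A g"
  shows "test_fun A (\<lambda>x. f x * g x)" "test_fun A (\<lambda>x. g x * f x)"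
  by (rule test_funI[OF _ test_fun_compact[OF assms(1)]],
      use test_fun_smooth[OF assms(1)] assms(2) tsupp_outside[of _ f] in auto)+

lemma test_fun_add:
  assumes "test_fun A f" "test_fun A g"
  shows "test_fun A (\<lambda>x. f x + g x)"
  by (rule test_funI[OF _ compact_Un[OF assms[THEN test_fun_compact]]])
    (use assms[THEN test_fun_smooth] tsupp_outside[of _ f] tsupp_outside[of _ g] in auto)

lemma test_fun_bounded:
  assumes "test_fun A f" obtains B where "B > 0" "\<And>x. \<bar>f x\<bar> \<le> B"
proof -
  have "compact (f ` tsupp f)"
    using assms smooth_fun_continuous by (auto simp: test_fun_def intro: compact_continuous_image)
  then obtain B where B: "\<forall>y\<in>f ` tsupp f. norm y \<le> B"
    using compact_imp_bounded bounded_iff by metis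
  show thesis
  proof (rule that[of "\<bar>B\<bar> + 1"])
    show "\<bar>f x\<bar> \<le> \<bar>B\<bar> + 1" for x
      using B tsupp_outside[of x f] by (cases "x \<in> tsupp f") fastforce+
  qed auto
qed

text \<open>The flat function of r^2 - |v - phi(x)|^2 is pulled back by a chart and extended by
  zero. The delicate points lie outside the chart domain: the preimage \<open>K\<close> of the
  closed ball is compact, hence closed in the Hausdorff manifold, so the extension vanishes on an
  open set around each of them.\<close>

lemma bump_exists:
  assumes "open O'" "x \<in> O'"
  obtains \<zeta> where "test_fun A \<zeta>" "\<And>y. \<zeta> y \<ge> 0" "\<zeta> x > 0" "tsupp \<zeta> \<subseteq> O'"
proof -
  obtain U \<phi> where c: "(U, \<phi>) \<in> A" "x \<in> U" by (rule chart_at)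
  have o: "open (\<phi> ` (U \<inter> O'))" using c assms chart(1) by (auto intro!: chart_image_open)
  obtain r where r: "r > 0" "cball (\<phi> x) r \<subseteq> \<phi> ` (U \<inter> O')"
  proof -
    have "\<phi> x \<in> \<phi> ` (U \<inter> O')" using assms c by blast
    with o show thesis using that open_contains_cball by blast
  qed
  define \<eta> where "\<eta> = (\<lambda>v::'e. flatn 0 (r\<^sup>2 + (-1) * ((v - \<phi> x) \<bullet> (v - \<phi> x))))"
  define \<zeta> where "\<zeta> = (\<lambda>y. if y \<in> U then \<eta> (\<phi> y) else 0)"
  define K where "K = inv_into U \<phi> ` cball (\<phi> x) r"
  have \<eta>_smooth: "smooth_on UNIV \<eta>"
  proof -
    have 1: "smooth_on UNIV (\<lambda>v. (v - \<phi> x) \<bullet> i)" for i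
    proof -
      have "smooth_on UNIV (\<lambda>v. v \<bullet> i + (- (\<phi> x \<bullet> i)))"
        by (intro smooth_on_add smooth_on_const open_UNIV smooth_on_bounded_linear
            bounded_linear_inner_left)
      then show ?thesis by (simp add: inner_diff_left)
    qed
    have "smooth_on UNIV (\<lambda>v. r\<^sup>2 + (-1) * (\<Sum>i\<in>Basis. ((v - \<phi> x) \<bullet> i) * ((v - \<phi> x) \<bullet> i)))"
      by (intro smooth_on_add smooth_on_mult smooth_on_sum smooth_on_const open_UNIV 1)
    then have 2: "smooth_on UNIV (\<lambda>v. r\<^sup>2 + (-1) * ((v - \<phi> x) \<bullet> (v - \<phi> x)))"
      by (simp add: euclidean_inner[symmetric])
    show ?thesis unfolding \<eta>_def
      by (rule smooth_on_compose_real[OF smooth_on_flatn _ _ 2]) auto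
  qed
  have \<eta>_0: "\<eta> v = 0" if "v \<notin> cball (\<phi> x) r" for v
  proof -
    have "r\<^sup>2 \<le> (dist (\<phi> x) v)\<^sup>2" using that r(1) by (intro power_mono) auto
    then have "r\<^sup>2 \<le> (v - \<phi> x) \<bullet> (v - \<phi> x)"
      by (simp add: dist_norm norm_minus_commute power2_norm_eq_inner)
    then show ?thesis by (simp add: \<eta>_def flatn_eq_0)
  qed
  have K: "compact K" "K \<subseteq> U \<inter> O'"
  proof -
    show "compact K" unfolding K_def
      by (rule compact_continuous_image[OF continuous_on_subset[OF chart_inv_continuous[OF c(1)]]])
        (use r in auto)
    show "K \<subseteq> U \<inter> O'" unfolding K_def using r(2) chart_inv[OF c(1)] by force
  qed
  have \<zeta>_0: "\<zeta> y = 0" if "y \<notin> K" for y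
  proof (cases "y \<in> U")
    case True
    then have "\<phi> y \<notin> cball (\<phi> x) r" using that chart_inv[OF c(1) True] unfolding K_def by force
    then show ?thesis by (simp add: \<zeta>_def \<eta>_0)
  qed (simp add: \<zeta>_def)
  have "smooth_fun A \<zeta>"
  proof (rule smooth_funI_chart)
    fix y
    show "\<exists>V \<psi> W. (V, \<psi>) \<in> A \<and> open W \<and> y \<in> W \<and> W \<subseteq> V \<and> smooth_on (\<psi> ` W) (\<zeta> \<circ> inv_into V \<psi>)"
    proof (cases "y \<in> U")
      case True
      have "smooth_on (\<phi> ` U) (\<zeta> \<circ> inv_into U \<phi>)"
        by (rule smooth_on_cong_open[OF chart(2)[OF c(1)] smooth_on_subset[OF \<eta>_smooth]])
          (use chart_inv[OF c(1)] in \<open>auto simp: \<zeta>_def\<close>)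
      then show ?thesis using True c(1) chart(1) by blast
    next
      case False
      obtain V \<psi> where V: "(V, \<psi>) \<in> A" "y \<in> V" by (rule chart_at)
      have o: "open (V - K)" using V K(1) chart(1) by (simp add: open_Diff compact_imp_closed)
      have "smooth_on (\<psi> ` (V - K)) (\<zeta> \<circ> inv_into V \<psi>)"
        by (rule smooth_on_cong_open[OF chart_image_open[OF V(1) o] smooth_on_const[of _ 0]])
          (use chart_inv[OF V(1)] \<zeta>_0 in auto)
      moreover have "y \<in> V - K" using False K(2) V(2) by blast
      ultimately show ?thesis using V(1) o by blast
    qed
  qed
  then have "test_fun A \<zeta>" using K(1) \<zeta>_0 by (rule test_funI)
  moreover have "tsupp \<zeta> \<subseteq> O'"
    using tsupp_subsetI[OF compact_imp_closed[OF K(1)], of \<zeta>] \<zeta>_0 K(2) by blast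
  moreover have "\<zeta> y \<ge> 0" for y by (simp add: \<zeta>_def \<eta>_def flatn_nonneg)
  moreover have "\<zeta> x > 0" using c r(1) by (simp add: \<zeta>_def \<eta>_def flatn_pos)
  ultimately show thesis using that by blast
qed

lemma pd_chart_cong:
  assumes "(U, \<phi>) \<in> A" "x \<in> U" "open W" "x \<in> W" "\<And>y. y \<in> W \<Longrightarrow> f y = g y"
  shows "pd i (f \<circ> inv_into U \<phi>) (\<phi> x) = pd i (g \<circ> inv_into U \<phi>) (\<phi> x)"
proof (rule pd_cong_open[of "\<phi> ` (U \<inter> W)"])
  show "open (\<phi> ` (U \<inter> W))" using assms chart(1) by (auto intro!: chart_image_open)
qed (use assms chart_inv[OF assms(1)] in auto)

end

section \<open>Calculus of symmetric first-order forms, common to \<open>carre L\<close> and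
  \<open>GZ\<close>\<close>

locale sym_form = smooth_mfd A
  for A :: "('a::{t2_space, second_countable_topology}, 'e::euclidean_space) atlas" +
  fixes G :: "('a \<Rightarrow> real) \<Rightarrow> ('a \<Rightarrow> real) \<Rightarrow> 'a \<Rightarrow> real"
  assumes form: "smooth_symmetric_form A G"
begin

definition form_rep :: "'a set \<Rightarrow> ('a \<Rightarrow> 'e) \<Rightarrow> ('e \<Rightarrow> 'e \<Rightarrow> 'e \<Rightarrow> real) \<Rightarrow> bool" where
  "form_rep U \<phi> \<tau> \<longleftrightarrow> (\<forall>f g. smooth_fun A f \<and> smooth_fun A g \<longrightarrow> (\<forall>x\<in>U.
           G f g x = (\<Sum>i\<in>Basis. \<Sum>j\<in>Basis. \<tau> i j (\<phi> x) *
             pd i (f \<circ> inv_into U \<phi>) (\<phi> x) * pd j (g \<circ> inv_into U \<phi>) (\<phi> x))))"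

lemma form_coord:
  assumes "(U, \<phi>) \<in> A"
  obtains \<tau> where "\<And>i j. i \<in> Basis \<Longrightarrow> j \<in> Basis \<Longrightarrow> smooth_on (\<phi> ` U) (\<tau> i j)" "form_rep U \<phi> \<tau>"
proof -
  note ex = bspec[OF conjunct1[OF form[unfolded smooth_symmetric_form_def]] assms, unfolded prod.case]
  then obtain \<tau> where \<tau>: "\<forall>i\<in>Basis. \<forall>j\<in>Basis. smooth_on (\<phi> ` U) (\<tau> i j)" "form_rep U \<phi> \<tau>"
    unfolding form_rep_def[symmetric] by (elim exE conjE) (rule that)
  show thesis by (rule that[OF _ \<tau>(2)]) (use \<tau>(1) in blast)
qed

lemma form_repD:
  "form_rep U \<phi> \<tau> \<Longrightarrow> smooth_fun A f \<Longrightarrow> smooth_fun A g \<Longrightarrow> x \<in> U \<Longrightarrow>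
    G f g x = (\<Sum>i\<in>Basis. \<Sum>j\<in>Basis. \<tau> i j (\<phi> x) *
             pd i (f \<circ> inv_into U \<phi>) (\<phi> x) * pd j (g \<circ> inv_into U \<phi>) (\<phi> x))"
  unfolding form_rep_def by blast

lemma form_commute: "smooth_fun A f \<Longrightarrow> smooth_fun A g \<Longrightarrow> G f g = G g f"
  using form unfolding smooth_symmetric_form_def by (elim conjE) metis

lemma form_local:
  assumes "smooth_fun A f" "smooth_fun A f'" "smooth_fun A g" "open W" "x \<in> W"
    and "\<And>y. y \<in> W \<Longrightarrow> f y = f' y"
  shows "G f g x = G f' g x" "G g f x = G g f' x"
proof -
  obtain U \<phi> where c: "(U, \<phi>) \<in> A" "x \<in> U" by (rule chart_at)
  obtain \<tau> where "form_rep U \<phi> \<tau>" by (rule form_coord[OF c(1)])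
  note \<tau> = form_repD[OF this]
  show "G f g x = G f' g x"
    using assms c pd_chart_cong[OF c assms(4,5,6)] by (simp add: \<tau>)
  then show "G g f x = G g f' x" using form_commute assms by metis
qed

lemma form_compose:
  assumes "smooth_fun A f" "smooth_fun A h" "smooth_on T g" "open T" "\<And>y. f y \<in> T"
    and "(g has_real_derivative g') (at (f x))"
  shows "G (\<lambda>y. g (f y)) h x = g' * G f h x" "G h (\<lambda>y. g (f y)) x = g' * G h f x"
proof -
  obtain U \<phi> where c: "(U, \<phi>) \<in> A" "x \<in> U" by (rule chart_at)
  obtain \<tau> where "form_rep U \<phi> \<tau>" by (rule form_coord[OF c(1)])
  note \<tau> = form_repD[OF this]
  have s: "smooth_fun A (\<lambda>y. g (f y))" by (rule smooth_fun_compose[OF assms(3,4,1,5)])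
  have "pd i ((\<lambda>y. g (f y)) \<circ> inv_into U \<phi>) (\<phi> x) = g' * pd i (f \<circ> inv_into U \<phi>) (\<phi> x)" for i
    using pd_real_compose[OF chart(2)[OF c(1)] _ smooth_fun_chart[OF assms(1) c(1)], of "\<phi> x" g g' i]
      c assms(6) chart_inv[OF c] by (simp add: o_def)
  then show "G (\<lambda>y. g (f y)) h x = g' * G f h x"
    using assms c s by (simp add: \<tau> sum_distrib_left mult_ac)
  then show "G h (\<lambda>y. g (f y)) x = g' * G h f x" using form_commute[OF s assms(2)] form_commute[OF assms(1,2)] by simp
qed

lemma form_add:
  assumes "smooth_fun A f" "smooth_fun A g" "smooth_fun A h"
  shows "G (\<lambda>y. f y + g y) h x = G f h x + G g h x" "G h (\<lambda>y. f y + g y) x = G h f x + G h g x"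
proof -
  obtain U \<phi> where c: "(U, \<phi>) \<in> A" "x \<in> U" by (rule chart_at)
  obtain \<tau> where "form_rep U \<phi> \<tau>" by (rule form_coord[OF c(1)])
  note \<tau> = form_repD[OF this]
  have s: "smooth_fun A (\<lambda>y. f y + g y)" using assms by auto
  have "pd i ((\<lambda>y. f y + g y) \<circ> inv_into U \<phi>) (\<phi> x) =
      pd i (f \<circ> inv_into U \<phi>) (\<phi> x) + pd i (g \<circ> inv_into U \<phi>) (\<phi> x)" for i
    using pd_add[OF chart(2)[OF c(1)] _ smooth_fun_chart[OF assms(1) c(1)] smooth_fun_chart[OF assms(2) c(1)]]
      c by (simp add: o_def)
  then show "G (\<lambda>y. f y + g y) h x = G f h x + G g h x"
    using assms c s by (simp add: \<tau> sum.distrib algebra_simps)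
  then show "G h (\<lambda>y. f y + g y) x = G h f x + G h g x"
    using form_commute[OF s assms(3)] form_commute[OF assms(1,3)] form_commute[OF assms(2,3)] by simp
qed

lemma form_mult:
  assumes "smooth_fun A f" "smooth_fun A g" "smooth_fun A h"
  shows "G (\<lambda>y. f y * g y) h x = f x * G g h x + g x * G f h x"
    "G h (\<lambda>y. f y * g y) x = f x * G h g x + g x * G h f x"
proof -
  show 1: "G (\<lambda>y. f y * g y) h x = f x * G g h x + g x * G f h x"
    using form assms unfolding smooth_symmetric_form_def by (elim conjE) (simp only: simp_thms)
  have s: "smooth_fun A (\<lambda>y. f y * g y)" using assms by auto
  show "G h (\<lambda>y. f y * g y) x = f x * G h g x + g x * G h f x"
    using 1 form_commute[OF s assms(3)] form_commute[OF assms(1,3)] form_commute[OF assms(2,3)] by simp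
qed

lemma form_const:
  assumes "smooth_fun A h" shows "G (\<lambda>_. c) h x = 0" "G h (\<lambda>_. c) x = 0"
  using form_compose[OF smooth_fun_const[of 0] assms smooth_on_const[of UNIV c] open_UNIV, of 0 x] by auto

lemma form_cmult:
  assumes "smooth_fun A f" "smooth_fun A h"
  shows "G (\<lambda>y. c * f y) h x = c * G f h x" "G h (\<lambda>y. c * f y) x = c * G h f x"
  using form_mult[OF smooth_fun_const[of c] assms] form_const[OF assms(2)] by auto

lemma smooth_fun_form [intro]:
  assumes "smooth_fun A f" "smooth_fun A g" shows "smooth_fun A (G f g)"
  unfolding smooth_fun_def
proof clarify
  fix U \<phi> assume c: "(U, \<phi>) \<in> A"
  obtain \<tau> where \<tau>: "\<And>i j. i \<in> Basis \<Longrightarrow> j \<in> Basis \<Longrightarrow> smooth_on (\<phi> ` U) (\<tau> i j)" "form_rep U \<phi> \<tau>"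
    by (rule form_coord[OF c]) blast
  have "smooth_on (\<phi> ` U) (\<lambda>u. \<Sum>i\<in>Basis. \<Sum>j\<in>Basis. \<tau> i j u *
             pd i (f \<circ> inv_into U \<phi>) u * pd j (g \<circ> inv_into U \<phi>) u)"
    by (intro smooth_on_sum smooth_on_mult smooth_on_pd chart(2)[OF c] \<tau>(1)
        smooth_fun_chart[OF assms(1) c] smooth_fun_chart[OF assms(2) c])
  then show "smooth_on (\<phi> ` U) (G f g \<circ> inv_into U \<phi>)"
    by (rule smooth_on_cong_open[OF chart(2)[OF c]])
      (use form_repD[OF \<tau>(2) assms chart_inv_in[OF c]] chart_apply_inv[of _ \<phi> U] in auto)
qed

lemma form_cauchy_schwarz:
  assumes "\<And>f. smooth_fun A f \<Longrightarrow> G f f x \<ge> 0" "smooth_fun A f" "smooth_fun A g"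
  shows "(G f g x)\<^sup>2 \<le> G f f x * G g g x"
proof (rule real_bilinear_discriminant)
  fix r :: real
  have s: "smooth_fun A (\<lambda>y. r * g y)" "smooth_fun A (\<lambda>y. f y + r * g y)"
    using assms(2,3) smooth_fun_mult[OF smooth_fun_const] smooth_fun_add by simp_all
  have "0 \<le> G (\<lambda>y. f y + r * g y) (\<lambda>y. f y + r * g y) x" using s by (intro assms(1))
  also have "\<dots> = G f f x + 2 * r * G f g x + r\<^sup>2 * G g g x"
    using assms s form_commute[OF assms(2,3)]
    by (simp add: form_add form_cmult power2_eq_square algebra_simps)
  finally show "0 \<le> G f f x + 2 * r * G f g x + r\<^sup>2 * G g g x" .
qed

end

section \<open>The diffusion operator in charts and its carre du champ\<close>

locale diffusion = smooth_mfd A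
  for A :: "('a::{t2_space, second_countable_topology}, 'e::euclidean_space) atlas" +
  fixes L :: "('a \<Rightarrow> real) \<Rightarrow> 'a \<Rightarrow> real"
  assumes op: "smooth_diffusion_operator A L" and L_one: "L (\<lambda>_. 1) = (\<lambda>_. 0)"
begin

definition op_rep ::
  "'a set \<Rightarrow> ('a \<Rightarrow> 'e) \<Rightarrow> ('e \<Rightarrow> 'e \<Rightarrow> 'e \<Rightarrow> real) \<Rightarrow> ('e \<Rightarrow> 'e \<Rightarrow> real) \<Rightarrow> bool" where
  "op_rep U \<phi> \<sigma> b \<longleftrightarrow>
     (\<forall>i\<in>Basis. \<forall>j\<in>Basis. smooth_on (\<phi> ` U) (\<sigma> i j)) \<and> (\<forall>i\<in>Basis. smooth_on (\<phi> ` U) (b i)) \<and>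
     (\<forall>u\<in>\<phi> ` U. \<forall>i\<in>Basis. \<forall>j\<in>Basis. \<sigma> i j u = \<sigma> j i u) \<and>
     (\<forall>u\<in>\<phi> ` U. \<forall>v. (\<Sum>i\<in>Basis. \<Sum>j\<in>Basis. \<sigma> i j u * (v \<bullet> i) * (v \<bullet> j)) \<ge> 0) \<and>
     (\<forall>f. smooth_fun A f \<longrightarrow> (\<forall>x\<in>U. L f x =
       (\<Sum>i\<in>Basis. \<Sum>j\<in>Basis. \<sigma> i j (\<phi> x) * pd i (pd j (f \<circ> inv_into U \<phi>)) (\<phi> x))
       + (\<Sum>i\<in>Basis. b i (\<phi> x) * pd i (f \<circ> inv_into U \<phi>) (\<phi> x))))"

lemma op_repD:
  assumes "op_rep U \<phi> \<sigma> b"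
  shows "\<And>i j. i \<in> Basis \<Longrightarrow> j \<in> Basis \<Longrightarrow> smooth_on (\<phi> ` U) (\<sigma> i j)"
    "\<And>i. i \<in> Basis \<Longrightarrow> smooth_on (\<phi> ` U) (b i)"
    "\<And>i j u. i \<in> Basis \<Longrightarrow> j \<in> Basis \<Longrightarrow> u \<in> \<phi> ` U \<Longrightarrow> \<sigma> i j u = \<sigma> j i u"
    "\<And>u v. u \<in> \<phi> ` U \<Longrightarrow> (\<Sum>i\<in>Basis. \<Sum>j\<in>Basis. \<sigma> i j u * (v \<bullet> i) * (v \<bullet> j)) \<ge> 0"
    "\<And>f x. smooth_fun A f \<Longrightarrow> x \<in> U \<Longrightarrow> L f x =
       (\<Sum>i\<in>Basis. \<Sum>j\<in>Basis. \<sigma> i j (\<phi> x) * pd i (pd j (f \<circ> inv_into U \<phi>)) (\<phi> x))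
       + (\<Sum>i\<in>Basis. b i (\<phi> x) * pd i (f \<circ> inv_into U \<phi>) (\<phi> x))"
  using assms[unfolded op_rep_def] by blast+

text \<open>Evaluated on the constant 1, all derivative terms of the chart expression vanish, so
  \<open>L_one\<close> forces the zero-order coefficient to be zero throughout the chart.\<close>

lemma op_coord:
  assumes "(U, \<phi>) \<in> A"
  obtains \<sigma> b where "op_rep U \<phi> \<sigma> b"
proof -
  note ex = bspec[OF op[unfolded smooth_diffusion_operator_def] assms, unfolded prod.case Let_def]
  then obtain \<sigma> b c where H:
    "\<forall>i\<in>Basis. \<forall>j\<in>Basis. smooth_on (\<phi> ` U) (\<sigma> i j)"
    "\<forall>i\<in>Basis. smooth_on (\<phi> ` U) (b i)"
    "\<forall>u\<in>\<phi> ` U. \<forall>i\<in>Basis. \<forall>j\<in>Basis. \<sigma> i j u = \<sigma> j i u"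
    "\<forall>u\<in>\<phi> ` U. \<forall>v. (\<Sum>i\<in>Basis. \<Sum>j\<in>Basis. \<sigma> i j u * (v \<bullet> i) * (v \<bullet> j)) \<ge> 0"
    "\<forall>f. smooth_fun A f \<longrightarrow> (\<forall>x\<in>U. L f x =
       (\<Sum>i\<in>Basis. \<Sum>j\<in>Basis. \<sigma> i j (\<phi> x) * pd i (pd j (f \<circ> inv_into U \<phi>)) (\<phi> x))
       + (\<Sum>i\<in>Basis. b i (\<phi> x) * pd i (f \<circ> inv_into U \<phi>) (\<phi> x))
       + c (\<phi> x) * (f \<circ> inv_into U \<phi>) (\<phi> x))"
    by (elim exE conjE) (rule that; assumption)
  have pp: "pd i (pd j (\<lambda>_::'e. 1::real)) u = 0" for i j u
  proof -
    have "pd j (\<lambda>_::'e. 1::real) = (\<lambda>_. 0)" by (rule ext) simp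
    then show ?thesis by simp
  qed
  have c0: "c (\<phi> x) = 0" if "x \<in> U" for x
  proof -
    have "(\<lambda>_. 1::real) \<circ> inv_into U \<phi> = (\<lambda>_. 1)" by (simp add: o_def)
    then show ?thesis using H(5)[rule_format, OF smooth_fun_const[of 1] that] fun_cong[OF L_one, of x]
      by (simp add: pp)
  qed
  show thesis by (rule that[of \<sigma> b]) (use H c0 in \<open>simp add: op_rep_def\<close>)
qed

lemma carre_coord:
  assumes c: "(U, \<phi>) \<in> A" and R: "op_rep U \<phi> \<sigma> b"
    and "smooth_fun A f" "smooth_fun A g" "x \<in> U"
  shows "carre L f g x = (\<Sum>i\<in>Basis. \<Sum>j\<in>Basis. \<sigma> i j (\<phi> x) *
             pd i (f \<circ> inv_into U \<phi>) (\<phi> x) * pd j (g \<circ> inv_into U \<phi>) (\<phi> x))"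
proof -
  note sym = op_repD(3)[OF R] and Lc = op_repD(5)[OF R]
  define F where "F = f \<circ> inv_into U \<phi>"
  define H where "H = g \<circ> inv_into U \<phi>"
  define u where "u = \<phi> x"
  have S: "smooth_on (\<phi> ` U) F" "smooth_on (\<phi> ` U) H" "open (\<phi> ` U)" "u \<in> \<phi> ` U"
    using assms smooth_fun_chart chart(2) by (auto simp: F_def H_def u_def)
  have FH: "(\<lambda>y. f y * g y) \<circ> inv_into U \<phi> = (\<lambda>u. F u * H u)" by (auto simp: F_def H_def)
  have Fu: "F u = f x" "H u = g x" using chart_inv[OF c \<open>x \<in> U\<close>] by (simp_all add: F_def H_def u_def)
  \<comment> \<open>The product rule yields two mixed sums; the symmetry of \<open>\<sigma>\<close>
    identifies them, which is where the factor 2 in front of the carre du champ goes.\<close>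
  have sw: "(\<Sum>i\<in>Basis. \<Sum>j\<in>Basis. \<sigma> i j u * (pd j F u * pd i H u)) =
      (\<Sum>i\<in>Basis. \<Sum>j\<in>Basis. \<sigma> i j u * (pd i F u * pd j H u))"
    by (subst sum.swap) (intro sum.cong refl, simp add: sym S(4))
  have "L (\<lambda>y. f y * g y) x = (\<Sum>i\<in>Basis. \<Sum>j\<in>Basis. \<sigma> i j u * pd i (pd j (\<lambda>u. F u * H u)) u)
       + (\<Sum>i\<in>Basis. b i u * pd i (\<lambda>u. F u * H u) u)"
    using Lc[OF smooth_fun_mult[OF assms(3,4)] \<open>x \<in> U\<close>] by (simp add: FH u_def)
  also have "(\<Sum>i\<in>Basis. b i u * pd i (\<lambda>u. F u * H u) u) =
      F u * (\<Sum>i\<in>Basis. b i u * pd i H u) + H u * (\<Sum>i\<in>Basis. b i u * pd i F u)"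
    by (simp add: pd_mult[OF S(3,4,1,2)] sum_distrib_left sum.distrib[symmetric] algebra_simps)
  also have "(\<Sum>i\<in>Basis. \<Sum>j\<in>Basis. \<sigma> i j u * pd i (pd j (\<lambda>u. F u * H u)) u) =
     (\<Sum>i\<in>Basis. \<Sum>j\<in>Basis. F u * (\<sigma> i j u * pd i (pd j H) u) + \<sigma> i j u * (pd i F u * pd j H u)
        + \<sigma> i j u * (pd j F u * pd i H u) + H u * (\<sigma> i j u * pd i (pd j F) u))"
    by (intro sum.cong refl) (simp add: pd_pd_mult[OF S(3,4,1,2)] algebra_simps)
  also have "\<dots> = F u * (\<Sum>i\<in>Basis. \<Sum>j\<in>Basis. \<sigma> i j u * pd i (pd j H) u)
     + 2 * (\<Sum>i\<in>Basis. \<Sum>j\<in>Basis. \<sigma> i j u * (pd i F u * pd j H u))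
     + H u * (\<Sum>i\<in>Basis. \<Sum>j\<in>Basis. \<sigma> i j u * pd i (pd j F) u)"
    by (simp only: sum.distrib sw sum_distrib_left[symmetric])
  finally show ?thesis
    using Lc[OF assms(3) \<open>x \<in> U\<close>] Lc[OF assms(4) \<open>x \<in> U\<close>]
    unfolding carre_def Fu F_def[symmetric] H_def[symmetric] u_def[symmetric]
    by (simp add: algebra_simps)
qed

lemma carre_symmetric_form: "smooth_symmetric_form A (carre L)"
  unfolding smooth_symmetric_form_def
proof (intro conjI allI impI ballI)
  fix c assume "c \<in> A"
  then obtain U \<phi> where c: "c = (U, \<phi>)" "(U, \<phi>) \<in> A" by (metis surj_pair)
  obtain \<sigma> b where R: "op_rep U \<phi> \<sigma> b" by (rule op_coord[OF c(2)])
  note H = op_repD(1,3,5)[OF R]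
  show "case c of (U, \<phi>) \<Rightarrow> \<exists>\<tau> :: 'e \<Rightarrow> 'e \<Rightarrow> 'e \<Rightarrow> real.
        (\<forall>i\<in>Basis. \<forall>j\<in>Basis. smooth_on (\<phi> ` U) (\<tau> i j)) \<and>
        (\<forall>f g. smooth_fun A f \<and> smooth_fun A g \<longrightarrow> (\<forall>x\<in>U.
           carre L f g x = (\<Sum>i\<in>Basis. \<Sum>j\<in>Basis. \<tau> i j (\<phi> x) *
             pd i (f \<circ> inv_into U \<phi>) (\<phi> x) * pd j (g \<circ> inv_into U \<phi>) (\<phi> x))))"
    unfolding c(1) prod.case
    by (rule exI[of _ \<sigma>]) (intro conjI allI impI ballI H(1) carre_coord[OF c(2) R]; simp)
next
  fix f g
  show "carre L f g = carre L g f" by (auto simp: carre_def mult.commute)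
next
  fix f g h assume s: "smooth_fun A f \<and> smooth_fun A g \<and> smooth_fun A h"
  show "carre L (\<lambda>x. f x * g x) h = (\<lambda>x. f x * carre L g h x + g x * carre L f h x)"
  proof
    fix x
    obtain U \<phi> where c: "(U, \<phi>) \<in> A" "x \<in> U" by (rule chart_at)
    obtain \<sigma> b where R: "op_rep U \<phi> \<sigma> b" by (rule op_coord[OF c(1)])
    note H = op_repD(3,5)[OF R]
    have fg: "smooth_fun A (\<lambda>x. f x * g x)" using s by auto
    have "pd i ((\<lambda>x. f x * g x) \<circ> inv_into U \<phi>) (\<phi> x) =
      f x * pd i (g \<circ> inv_into U \<phi>) (\<phi> x) + pd i (f \<circ> inv_into U \<phi>) (\<phi> x) * g x" for i
      using pd_mult[OF chart(2)[OF c(1)] _ smooth_fun_chart[OF _ c(1), of f] smooth_fun_chart[OF _ c(1), of g], of "\<phi> x" i]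
        c(2) s chart_inv[OF c] by (simp add: o_def)
    then show "carre L (\<lambda>x. f x * g x) h x = f x * carre L g h x + g x * carre L f h x"
      using s fg c by (simp add: carre_coord[OF c(1) R] sum_distrib_left sum.distrib[symmetric] algebra_simps)
  qed
qed

end

sublocale diffusion \<subseteq> carre: sym_form A "carre L"
  by unfold_locales (rule carre_symmetric_form)

context diffusion
begin

lemma carre_nonneg:
  assumes "smooth_fun A f" shows "carre L f f x \<ge> 0"
proof -
  obtain U \<phi> where c: "(U, \<phi>) \<in> A" "x \<in> U" by (rule chart_at)
  obtain \<sigma> b where R: "op_rep U \<phi> \<sigma> b" by (rule op_coord[OF c(1)])
  note H = op_repD(3,4,5)[OF R]
  \<comment> \<open>The positivity of the principal symbol is applied to the coordinate gradient of
    \<open>f\<close>.\<close>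
  have "0 \<le> (\<Sum>i\<in>Basis. \<Sum>j\<in>Basis. \<sigma> i j (\<phi> x) *
      ((\<Sum>k\<in>Basis. pd k (f \<circ> inv_into U \<phi>) (\<phi> x) *\<^sub>R k) \<bullet> i) *
      ((\<Sum>k\<in>Basis. pd k (f \<circ> inv_into U \<phi>) (\<phi> x) *\<^sub>R k) \<bullet> j))"
    by (rule H(2)) (use c in simp)
  also have "\<dots> = carre L f f x"
    by (subst carre_coord[OF c(1) R assms assms c(2)]) (auto intro!: sum.cong)
  finally show ?thesis .
qed

lemma carre_commute: "carre L f g x = carre L g f x"
  by (simp add: carre_def mult.commute)

lemma L_mult: "L (\<lambda>y. f y * g y) x = f x * L g x + g x * L f x + 2 * carre L f g x"
  by (simp add: carre_def field_simps)

lemma L_compose: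
  assumes "smooth_fun A f" "smooth_on T g" "smooth_on T g'" "open T" "\<And>y. f y \<in> T"
    and "\<And>r. r \<in> T \<Longrightarrow> (g has_real_derivative g' r) (at r)"
    and "\<And>r. r \<in> T \<Longrightarrow> (g' has_real_derivative g'' r) (at r)"
  shows "L (\<lambda>y. g (f y)) x = g' (f x) * L f x + g'' (f x) * carre L f f x"
proof -
  obtain U \<phi> where c: "(U, \<phi>) \<in> A" "x \<in> U" by (rule chart_at)
  obtain \<sigma> b where R: "op_rep U \<phi> \<sigma> b" by (rule op_coord[OF c(1)])
  note H = op_repD(3,5)[OF R]
  define F where "F = f \<circ> inv_into U \<phi>"
  define u where "u = \<phi> x"
  have S: "open (\<phi> ` U)" "u \<in> \<phi> ` U" "smooth_on (\<phi> ` U) F" "F ` \<phi> ` U \<subseteq> T"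
    using assms c smooth_fun_chart chart(2) by (auto simp: F_def u_def)
  have Fu: "F u = f x" using chart_inv[OF c] by (simp add: F_def u_def)
  have s: "smooth_fun A (\<lambda>y. g (f y))" by (rule smooth_fun_compose[OF assms(2,4,1,5)])
  have gF: "(\<lambda>y. g (f y)) \<circ> inv_into U \<phi> = (\<lambda>u. g (F u))" by (auto simp: F_def)
  have "L (\<lambda>y. g (f y)) x = (\<Sum>i\<in>Basis. \<Sum>j\<in>Basis. \<sigma> i j u * pd i (pd j (\<lambda>u. g (F u))) u)
       + (\<Sum>i\<in>Basis. b i u * pd i (\<lambda>u. g (F u)) u)"
    using H(2)[OF s c(2)] by (simp add: gF u_def)
  also have "(\<Sum>i\<in>Basis. b i u * pd i (\<lambda>u. g (F u)) u) = g' (F u) * (\<Sum>i\<in>Basis. b i u * pd i F u)"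
    unfolding sum_distrib_left
    by (intro sum.cong refl, subst pd_real_compose[OF S(1-3) assms(6)])
      (use S in \<open>auto simp: algebra_simps\<close>)
  also have "(\<Sum>i\<in>Basis. \<Sum>j\<in>Basis. \<sigma> i j u * pd i (pd j (\<lambda>u. g (F u))) u) =
     (\<Sum>i\<in>Basis. \<Sum>j\<in>Basis. g' (F u) * (\<sigma> i j u * pd i (pd j F) u) + g'' (F u) * (\<sigma> i j u * pd i F u * pd j F u))"
    by (intro sum.cong refl, subst pd_pd_compose[OF S(1-3) _ _ S(4) assms(4,3,6,7)])
      (auto simp: algebra_simps)
  also have "\<dots> = g' (F u) * (\<Sum>i\<in>Basis. \<Sum>j\<in>Basis. \<sigma> i j u * pd i (pd j F) u)
     + g'' (F u) * (\<Sum>i\<in>Basis. \<Sum>j\<in>Basis. \<sigma> i j u * pd i F u * pd j F u)"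
    by (simp only: sum.distrib sum_distrib_left)
  finally have 1: "L (\<lambda>y. g (f y)) x =
      g' (F u) * (\<Sum>i\<in>Basis. \<Sum>j\<in>Basis. \<sigma> i j u * pd i (pd j F) u)
     + g'' (F u) * (\<Sum>i\<in>Basis. \<Sum>j\<in>Basis. \<sigma> i j u * pd i F u * pd j F u)
     + g' (F u) * (\<Sum>i\<in>Basis. b i u * pd i F u)" .
  have 2: "carre L f f x = (\<Sum>i\<in>Basis. \<Sum>j\<in>Basis. \<sigma> i j u * pd i F u * pd j F u)"
    unfolding F_def u_def
    by (rule carre_coord[OF c(1) R assms(1) assms(1) c(2)])
  show ?thesis
    unfolding 1 2 H(2)[OF assms(1) c(2)] Fu F_def[symmetric] u_def[symmetric]
    by (simp only: distrib_left add_ac)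
qed

lemma L_local:
  assumes "smooth_fun A f" "smooth_fun A g" "open W" "x \<in> W" "\<And>y. y \<in> W \<Longrightarrow> f y = g y"
  shows "L f x = L g x"
proof -
  obtain U \<phi> where c: "(U, \<phi>) \<in> A" "x \<in> U" by (rule chart_at)
  obtain \<sigma> b where R: "op_rep U \<phi> \<sigma> b" by (rule op_coord[OF c(1)])
  note H = op_repD(5)[OF R]
  have 1: "pd i (f \<circ> inv_into U \<phi>) (\<phi> y) = pd i (g \<circ> inv_into U \<phi>) (\<phi> y)" if "y \<in> U \<inter> W" for i y
    by (rule pd_chart_cong[OF c(1) _ assms(3)]) (use assms(5) that in auto)
  have "pd i (pd j (f \<circ> inv_into U \<phi>)) (\<phi> x) = pd i (pd j (g \<circ> inv_into U \<phi>)) (\<phi> x)" for i j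
  proof (rule pd_cong_open[of "\<phi> ` (U \<inter> W)"])
    show "open (\<phi> ` (U \<inter> W))" using c assms chart(1) by (auto intro!: chart_image_open)
  qed (use c assms(4) 1 in auto)
  then show ?thesis using H assms(1,2) c(2) 1 assms(4) by simp
qed

lemma L_add:
  assumes "smooth_fun A f" "smooth_fun A g"
  shows "L (\<lambda>y. f y + g y) x = L f x + L g x"
proof -
  obtain U \<phi> where c: "(U, \<phi>) \<in> A" "x \<in> U" by (rule chart_at)
  obtain \<sigma> b where R: "op_rep U \<phi> \<sigma> b" by (rule op_coord[OF c(1)])
  note H = op_repD(5)[OF R]
  define F where "F = f \<circ> inv_into U \<phi>"
  define K where "K = g \<circ> inv_into U \<phi>"
  define u where "u = \<phi> x"
  have S: "open (\<phi> ` U)" "u \<in> \<phi> ` U" "smooth_on (\<phi> ` U) F" "smooth_on (\<phi> ` U) K"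
    using assms c smooth_fun_chart chart(2) by (auto simp: F_def K_def u_def)
  have FK: "(\<lambda>y. f y + g y) \<circ> inv_into U \<phi> = (\<lambda>u. F u + K u)" by (auto simp: F_def K_def)
  have 2: "pd i (pd j (\<lambda>u. F u + K u)) u = pd i (pd j F) u + pd i (pd j K) u"
    if "j \<in> Basis" for i j
  proof -
    have "pd i (pd j (\<lambda>u. F u + K u)) u = pd i (\<lambda>u. pd j F u + pd j K u) u"
      by (rule pd_cong_open[OF S(1,2)]) (rule pd_add[OF S(1) _ S(3,4)])
    then show ?thesis using pd_add[OF S(1,2) smooth_on_pd[OF S(3) that] smooth_on_pd[OF S(4) that]] by simp
  qed
  have "L (\<lambda>y. f y + g y) x = (\<Sum>i\<in>Basis. \<Sum>j\<in>Basis. \<sigma> i j u * pd i (pd j (\<lambda>u. F u + K u)) u)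
       + (\<Sum>i\<in>Basis. b i u * pd i (\<lambda>u. F u + K u) u)"
    using H[OF smooth_fun_add[OF assms] c(2)] by (simp add: FK u_def)
  then show ?thesis
    unfolding H[OF assms(1) c(2)] H[OF assms(2) c(2)] F_def[symmetric] u_def[symmetric] K_def[symmetric]
    by (simp add: 2 pd_add[OF S] sum.distrib distrib_left)
qed

lemma L_const: "L (\<lambda>_. c) x = 0"
proof -
  \<comment> \<open>The chain rule for the linear map r -> c r, applied to the constant 1, since
    homogeneity of \<open>L\<close> is only derived from this lemma.\<close>
  have "L (\<lambda>y. c * 1) x = c * L (\<lambda>_. 1) x + 0 * carre L (\<lambda>_. 1) (\<lambda>_. 1) x"
    by (rule L_compose[where T = UNIV and g' = "\<lambda>_. c" and g'' = "\<lambda>_. 0"])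
      (auto intro!: derivative_eq_intros smooth_on_bounded_linear[OF bounded_linear_mult_right])
  then show ?thesis using L_one by simp
qed

lemma L_cmult: "smooth_fun A f \<Longrightarrow> L (\<lambda>y. c * f y) x = c * L f x"
  using L_mult[of "\<lambda>_. c" f x] carre.form_const[of f c x] L_const[of c x] by simp

lemma L_diff: "smooth_fun A f \<Longrightarrow> smooth_fun A g \<Longrightarrow> L (\<lambda>y. f y - g y) x = L f x - L g x"
  using L_add[of f "\<lambda>y. -1 * g y" x] L_cmult[of g "-1" x] by auto

lemma smooth_fun_L [intro]:
  assumes "smooth_fun A f" shows "smooth_fun A (L f)"
  unfolding smooth_fun_def
proof clarify
  fix U \<phi> assume c: "(U, \<phi>) \<in> A"
  obtain \<sigma> b where R: "op_rep U \<phi> \<sigma> b" by (rule op_coord[OF c])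
  note H = op_repD(1,2,5)[OF R]
  have "smooth_on (\<phi> ` U) (\<lambda>u. (\<Sum>i\<in>Basis. \<Sum>j\<in>Basis. \<sigma> i j u * pd i (pd j (f \<circ> inv_into U \<phi>)) u)
       + (\<Sum>i\<in>Basis. b i u * pd i (f \<circ> inv_into U \<phi>) u))"
    by (intro smooth_on_add smooth_on_sum smooth_on_mult smooth_on_pd chart(2)[OF c] H(1,2)
        smooth_fun_chart[OF assms(1) c])
  then show "smooth_on (\<phi> ` U) (L f \<circ> inv_into U \<phi>)"
    by (rule smooth_on_cong_open[OF chart(2)[OF c]])
      (use H(3)[OF assms chart_inv_in[OF c]] chart_apply_inv[of _ \<phi> U] in auto)
qed

lemma test_fun_L:
  assumes "test_fun A f" shows "test_fun A (L f)"
proof (rule test_funI[OF smooth_fun_L[OF test_fun_smooth[OF assms]] test_fun_compact[OF assms]])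
  fix x assume "x \<notin> tsupp f"
  then have "L f x = L (\<lambda>_. 0) x"
    by (intro L_local[where W = "- tsupp f"])
      (use test_fun_smooth[OF assms] tsupp_closed tsupp_outside[of _ f] in auto)
  then show "L f x = 0" by (simp add: L_const)
qed

end

section \<open>Integration\<close>

lemma bounded_on_compact_product:
  fixes g :: "'z::topological_space \<Rightarrow> 'a::topological_space \<Rightarrow> real"
  assumes "continuous_on (S \<times> K) (\<lambda>(z, y). g z y)" "C \<subseteq> S" "compact C" "compact K"
  obtains B where "B > 0" "\<And>z y. z \<in> C \<Longrightarrow> y \<in> K \<Longrightarrow> \<bar>g z y\<bar> \<le> B"
proof -
  have "compact ((\<lambda>(z, y). g z y) ` (C \<times> K))"
    by (rule compact_continuous_image[OF continuous_on_subset[OF assms(1)]])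
      (use assms in \<open>auto intro: compact_Times\<close>)
  then obtain B where B: "\<forall>v\<in>(\<lambda>(z, y). g z y) ` (C \<times> K). norm v \<le> B"
    using compact_imp_bounded bounded_iff by metis
  show thesis
  proof (rule that[of "\<bar>B\<bar> + 1"])
    show "\<bar>g z y\<bar> \<le> \<bar>B\<bar> + 1" if "z \<in> C" "y \<in> K" for z y
    proof -
      have "g z y \<in> (\<lambda>(z, y). g z y) ` (C \<times> K)" using that by force
      then have "norm (g z y) \<le> B" using B by blast
      then show ?thesis by simp
    qed
  qed simp
qed

lemma continuous_on_integral_compact:
  fixes D :: "'z::euclidean_space \<Rightarrow> 'a::t2_space \<Rightarrow> real"
  assumes K: "compact K" "K \<in> sets M" "emeasure M K < \<infinity>" and "open S"
    and int: "\<And>z. z \<in> S \<Longrightarrow> integrable M (D z)"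
    and off: "\<And>z y. y \<notin> K \<Longrightarrow> D z y = 0"
    and cont: "continuous_on (S \<times> K) (\<lambda>(z, y). D z y)"
  shows "continuous_on S (\<lambda>z. \<integral>y. D z y \<partial>M)"
proof (rule continuous_at_imp_continuous_on, clarify)
  fix z assume z: "z \<in> S"
  obtain r where r: "r > 0" "cball z r \<subseteq> S" using \<open>open S\<close> z open_contains_cball by blast
  obtain B where B: "B > 0" "\<And>z' y. z' \<in> cball z r \<Longrightarrow> y \<in> K \<Longrightarrow> \<bar>D z' y\<bar> \<le> B"
    by (rule bounded_on_compact_product[OF cont r(2) compact_cball K(1)]) blast
  show "isCont (\<lambda>z. \<integral>y. D z y \<partial>M) z"
    unfolding continuous_at_sequentially o_def
  proof (intro allI impI)
    fix X assume X: "X \<longlonglongrightarrow> z"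
    have "\<forall>\<^sub>F n in sequentially. X n \<in> cball z r"
      using tendstoD[OF X r(1)] by eventually_elim (simp add: dist_commute)
    then obtain N where N: "\<And>n. n \<ge> N \<Longrightarrow> X n \<in> cball z r"
      unfolding eventually_sequentially by blast
    have "(\<lambda>n. \<integral>y. D (X (n + N)) y \<partial>M) \<longlonglongrightarrow> (\<integral>y. D z y \<partial>M)"
    proof (rule integral_dominated_convergence[where w = "\<lambda>y. B * indicator K y"])
      show "integrable M (\<lambda>y. B * indicator K y)"
        using K by (intro integrable_mult_right integrable_real_indicator) auto
      show "D (X (n + N)) \<in> borel_measurable M" for n using int N[of "n + N"] r(2) by auto
      show "D z \<in> borel_measurable M" using int z by auto
      show "AE y in M. norm (D (X (n + N)) y) \<le> B * indicator K y" for n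
        using N[of "n + N"] B off by (auto simp: indicator_def)
      show "AE y in M. (\<lambda>n. D (X (n + N)) y) \<longlonglongrightarrow> D z y"
      proof (intro AE_I2)
        fix y
        show "(\<lambda>n. D (X (n + N)) y) \<longlonglongrightarrow> D z y"
        proof (cases "y \<in> K")
          case True
          have "continuous_on S (\<lambda>z. D z y)"
            by (rule continuous_on_compose2[OF cont, of _ "\<lambda>z. (z, y)", simplified])
              (use True in \<open>auto intro!: continuous_intros\<close>)
          then have "isCont (\<lambda>z. D z y) z" using \<open>open S\<close> z continuous_on_eq_continuous_at by blast
          then show ?thesis
            using isCont_tendsto_compose[OF _ LIMSEQ_ignore_initial_segment[OF X]] by blast
        qed (simp add: off)
      qed
    qed
    then show "(\<lambda>n. \<integral>y. D (X n) y \<partial>M) \<longlonglongrightarrow> (\<integral>y. D z y \<partial>M)"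
      by (rule LIMSEQ_offset)
  qed
qed

text \<open>Dominated convergence for the normalised remainder. On a closed ball around
  \<open>z\<close> the partial derivatives are bounded by some B on K; the mean value inequality
  bounds the increment by B |h|, the linear part has the same bound, and 2 B times the indicator of
  K is the integrable majorant.\<close>

lemma has_derivative_integral_compact:
  fixes F :: "'z::euclidean_space \<Rightarrow> 'a::t2_space \<Rightarrow> real" and D :: "'z \<Rightarrow> 'z \<Rightarrow> 'a \<Rightarrow> real"
  assumes K: "compact K" "K \<in> sets M" "emeasure M K < \<infinity>" and "open S" "z \<in> S"
    and F: "\<And>z. z \<in> S \<Longrightarrow> integrable M (F z)" "\<And>z y. y \<notin> K \<Longrightarrow> F z y = 0"
    and D: "\<And>z i. z \<in> S \<Longrightarrow> i \<in> Basis \<Longrightarrow> integrable M (D i z)"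
      "\<And>z i y. y \<notin> K \<Longrightarrow> D i z y = 0"
      "\<And>i. i \<in> Basis \<Longrightarrow> continuous_on (S \<times> K) (\<lambda>(z, y). D i z y)"
    and deriv: "\<And>z y. z \<in> S \<Longrightarrow> y \<in> K \<Longrightarrow>
      ((\<lambda>z. F z y) has_derivative (\<lambda>v. \<Sum>i\<in>Basis. (v \<bullet> i) * D i z y)) (at z)"
  shows "((\<lambda>z. \<integral>y. F z y \<partial>M) has_derivative (\<lambda>v. \<Sum>i\<in>Basis. (v \<bullet> i) * (\<integral>y. D i z y \<partial>M))) (at z)"
proof -
  obtain r where r: "r > 0" "cball z r \<subseteq> S" using assms(4,5) open_contains_cball by blast
  have "continuous_on (S \<times> K) (\<lambda>(z, y). \<Sum>i\<in>Basis. \<bar>D i z y\<bar>)"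
    using D(3) by (auto intro!: continuous_intros simp: case_prod_beta)
  then obtain B where B: "B > 0"
    "\<And>z' y. z' \<in> cball z r \<Longrightarrow> y \<in> K \<Longrightarrow> \<bar>\<Sum>i\<in>Basis. \<bar>D i z' y\<bar>\<bar> \<le> B"
    using bounded_on_compact_product[OF _ r(2) compact_cball K(1)] by blast
  define F' where "F' = (\<lambda>z v y. \<Sum>i\<in>Basis. (v \<bullet> i) * D i z y)"
  have F'_bound: "\<bar>F' z' v y\<bar> \<le> B * norm v" if "z' \<in> cball z r" "y \<in> K" for z' v y
  proof -
    have "\<bar>F' z' v y\<bar> \<le> (\<Sum>i\<in>Basis. \<bar>v \<bullet> i\<bar> * \<bar>D i z' y\<bar>)"
      unfolding F'_def by (rule order_trans[OF sum_abs]) (simp add: abs_mult)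
    also have "\<dots> \<le> (\<Sum>i\<in>Basis. norm v * \<bar>D i z' y\<bar>)"
      by (intro sum_mono mult_right_mono Basis_le_norm) auto
    also have "\<dots> = norm v * (\<Sum>i\<in>Basis. \<bar>D i z' y\<bar>)" by (simp add: sum_distrib_left)
    also have "\<dots> \<le> norm v * B" using B(2)[OF that] by (intro mult_left_mono) auto
    finally show ?thesis by (simp add: mult.commute)
  qed
  have F_bound: "\<bar>F (z + h) y - F z y\<bar> \<le> B * norm h" if "norm h \<le> r" "y \<in> K" for h y
  proof -
    have "norm (F (z + h) y - F z y) \<le> B * norm ((z + h) - z)"
    proof (rule differentiable_bound[where S = "cball z r" and f' = "\<lambda>z' v. F' z' v y"])
      fix z' assume z': "z' \<in> cball z r"
      show "((\<lambda>z. F z y) has_derivative (\<lambda>v. F' z' v y)) (at z' within cball z r)"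
        unfolding F'_def
        by (rule has_derivative_at_withinI, rule deriv[OF _ that(2)]) (use z' r(2) in blast)
      show "onorm (\<lambda>v. F' z' v y) \<le> B"
        by (rule onorm_le) (simp add: F'_bound[OF z' that(2)])
    next
      show "z + h \<in> cball z r" using that by (simp add: dist_norm)
      show "z \<in> cball z r" using r(1) by simp
    qed simp
    then show ?thesis by simp
  qed
  have int': "integrable M (\<lambda>y. F' z v y)" for v
    unfolding F'_def using D(1) \<open>z \<in> S\<close> by (intro Bochner_Integration.integrable_sum integrable_mult_right) auto
  have F'_int: "(\<integral>y. F' z v y \<partial>M) = (\<Sum>i\<in>Basis. (v \<bullet> i) * (\<integral>y. D i z y \<partial>M))" for v
    unfolding F'_def using D(1) \<open>z \<in> S\<close> by (subst Bochner_Integration.integral_sum) auto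
  \<comment> \<open>The remainder of the linear approximation divided by |h|. Its integral dominates
    the remainder of the integrated function, so one limit proves the claim.\<close>
  define q where "q = (\<lambda>h y. \<bar>F (z + h) y - F z y - F' z h y\<bar> / norm h)"
  have lim: "((\<lambda>h. \<integral>y. q h y \<partial>M) \<longlongrightarrow> 0) (at 0)"
    unfolding tendsto_at_iff_sequentially o_def
  proof (intro allI impI)
    fix X :: "nat \<Rightarrow> 'z" assume X: "\<forall>i. X i \<in> UNIV - {0}" "X \<longlonglongrightarrow> 0"
    have "\<forall>\<^sub>F n in sequentially. norm (X n) < r"
      using tendstoD[OF X(2) r(1)] by (simp add: dist_norm)
    then obtain N where N: "\<And>n. n \<ge> N \<Longrightarrow> norm (X n) < r"
      unfolding eventually_sequentially by blast
    have zX: "z + X (n + N) \<in> S" for n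
      using N[of "n + N"] r(2) by (auto simp: subset_iff dist_norm)
    have "(\<lambda>n. \<integral>y. q (X (n + N)) y \<partial>M) \<longlonglongrightarrow> (\<integral>y. 0 \<partial>M)"
    proof (rule integral_dominated_convergence[where w = "\<lambda>y. (2 * B) * indicator K y"])
      show "integrable M (\<lambda>y. 2 * B * indicator K y)"
        using K by (intro integrable_mult_right integrable_real_indicator) auto
      show "q (X (n + N)) \<in> borel_measurable M" for n
        unfolding q_def
        using borel_measurable_integrable[OF F(1)[OF zX[of n]]] borel_measurable_integrable[OF F(1)[OF \<open>z \<in> S\<close>]]
          borel_measurable_integrable[OF int'] by measurable
      show "AE y in M. norm (q (X (n + N)) y) \<le> 2 * B * indicator K y" for n
      proof (intro AE_I2)
        fix y
        show "norm (q (X (n + N)) y) \<le> 2 * B * indicator K y"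
        proof (cases "y \<in> K")
          case True
          have x: "norm (X (n + N)) > 0" using X(1) by simp
          have "\<bar>F (z + X (n + N)) y - F z y - F' z (X (n + N)) y\<bar> \<le> 2 * B * norm (X (n + N))"
            using F_bound[OF less_imp_le[OF N[of "n + N"]] True] F'_bound[OF _ True, of z "X (n + N)"] r(1) by simp
          then show ?thesis using True x by (simp add: q_def divide_le_eq)
        next
          case False
          then show ?thesis by (simp add: q_def F(2) F'_def D(2))
        qed
      qed
      show "AE y in M. (\<lambda>n. q (X (n + N)) y) \<longlonglongrightarrow> 0"
      proof (intro AE_I2)
        fix y
        show "(\<lambda>n. q (X (n + N)) y) \<longlonglongrightarrow> 0"
        proof (cases "y \<in> K")
          case True
          have "((\<lambda>h. norm (F (z + h) y - F z y - F' z h y) / norm h) \<longlongrightarrow> 0) (at 0)"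
            using deriv[OF \<open>z \<in> S\<close> True] unfolding has_derivative_at F'_def by blast
          then have "((\<lambda>h. q h y) \<longlongrightarrow> 0) (at 0)" by (simp add: q_def)
          from this[unfolded tendsto_at_iff_sequentially, rule_format, of "\<lambda>n. X (n + N)"]
          show ?thesis using X(1) LIMSEQ_ignore_initial_segment[OF X(2), of N] by (simp add: o_def)
        qed (simp add: q_def F(2) F'_def D(2))
      qed
    qed simp_all
    then show "(\<lambda>n. \<integral>y. q (X n) y \<partial>M) \<longlonglongrightarrow> 0" using LIMSEQ_offset by simp
  qed
  have "((\<lambda>h. norm ((\<integral>y. F (z + h) y \<partial>M) - (\<integral>y. F z y \<partial>M) - (\<Sum>i\<in>Basis. (h \<bullet> i) * (\<integral>y. D i z y \<partial>M)))
      / norm h) \<longlongrightarrow> 0) (at 0)"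
  proof (rule tendsto_sandwich[OF _ _ tendsto_const lim])
    show "\<forall>\<^sub>F h in at 0. 0 \<le> norm ((\<integral>y. F (z + h) y \<partial>M) - (\<integral>y. F z y \<partial>M)
        - (\<Sum>i\<in>Basis. (h \<bullet> i) * (\<integral>y. D i z y \<partial>M))) / norm h" by simp
    show "\<forall>\<^sub>F h in at 0. norm ((\<integral>y. F (z + h) y \<partial>M) - (\<integral>y. F z y \<partial>M)
        - (\<Sum>i\<in>Basis. (h \<bullet> i) * (\<integral>y. D i z y \<partial>M))) / norm h \<le> (\<integral>y. q h y \<partial>M)"
      unfolding eventually_at
    proof (intro exI[of _ r] conjI ballI impI r(1))
      fix h :: 'z assume h: "h \<noteq> 0 \<and> dist h 0 < r"
      then have zh: "z + h \<in> S" using r(2) by (auto simp: subset_iff dist_norm)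
      have "(\<integral>y. F (z + h) y \<partial>M) - (\<integral>y. F z y \<partial>M) - (\<integral>y. F' z h y \<partial>M) =
          (\<integral>y. F (z + h) y - F z y - F' z h y \<partial>M)"
        using F(1)[OF zh] F(1)[OF \<open>z \<in> S\<close>] int' by simp
      also have "norm \<dots> \<le> (\<integral>y. \<bar>F (z + h) y - F z y - F' z h y\<bar> \<partial>M)"
        using integral_norm_bound by simp
      also have "\<dots> = norm h * (\<integral>y. q h y \<partial>M)" using h by (simp add: q_def)
      finally show "norm ((\<integral>y. F (z + h) y \<partial>M) - (\<integral>y. F z y \<partial>M)
        - (\<Sum>i\<in>Basis. (h \<bullet> i) * (\<integral>y. D i z y \<partial>M))) / norm h \<le> (\<integral>y. q h y \<partial>M)"
        using h by (simp add: F'_int divide_le_eq mult.commute)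
    qed
  qed
  moreover have "bounded_linear (\<lambda>v. \<Sum>i\<in>Basis. (v \<bullet> i) * (\<integral>y. D i z y \<partial>M))"
    by (intro bounded_linear_sum bounded_linear_mult_const bounded_linear_inner_left)
  ultimately show ?thesis unfolding has_derivative_at by blast
qed

lemma continuous_on_extend_zero:
  fixes f :: "'a::t2_space \<Rightarrow> real"
  assumes "open O'" "continuous_on O' f" "compact K" "K \<subseteq> O'" "\<And>x. x \<notin> K \<Longrightarrow> f x = 0"
  shows "continuous_on UNIV f"
proof -
  have "continuous_on (- K) f"
    by (rule continuous_on_eq[OF continuous_on_const[of _ 0]]) (use assms(5) in auto)
  then have "continuous_on (O' \<union> - K) f"
    using assms by (intro continuous_on_open_Un) (auto intro: compact_imp_closed)
  moreover have "O' \<union> - K = UNIV" using assms(4) by blast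
  ultimately show ?thesis by simp
qed

section \<open>Smooth measures: finiteness on compact sets, full support, testing\<close>

locale measured_mfd = smooth_mfd A
  for A :: "('a::{t2_space, second_countable_topology}, 'e::euclidean_space) atlas" +
  fixes \<mu> :: "'a measure"
  assumes meas: "smooth_measure A \<mu>"
begin

lemma sets_\<mu> [measurable_cong]: "sets \<mu> = sets borel"
  using meas by (simp add: smooth_measure_def)

lemma space_\<mu> [simp]: "space \<mu> = UNIV"
  using sets_eq_imp_space_eq[OF sets_\<mu>] by simp

lemma meas_chart:
  assumes "(U, \<phi>) \<in> A"
  obtains r where "smooth_on (\<phi> ` U) r" "\<And>u. u \<in> \<phi> ` U \<Longrightarrow> r u > 0"
    "\<And>B. B \<in> sets borel \<Longrightarrow> B \<subseteq> U \<Longrightarrow> emeasure \<mu> B = (\<integral>\<^sup>+u\<in>\<phi> ` B. ennreal (r u) \<partial>lborel)"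
proof -
  note ex = bspec[OF conjunct2[OF meas[unfolded smooth_measure_def]] assms, unfolded prod.case]
  then obtain r where r: "smooth_on (\<phi> ` U) r" "\<forall>u\<in>\<phi> ` U. r u > 0"
    "\<forall>B\<in>sets borel. B \<subseteq> U \<longrightarrow> emeasure \<mu> B = (\<integral>\<^sup>+u\<in>\<phi> ` B. ennreal (r u) \<partial>lborel)"
    by (elim exE conjE) (rule that)
  show thesis by (rule that[OF r(1) r(2)[rule_format] r(3)[rule_format]])
qed

lemma locally_finite: "\<exists>W. open W \<and> x \<in> W \<and> emeasure \<mu> W < \<infinity>"
proof -
  obtain U \<phi> where c: "(U, \<phi>) \<in> A" "x \<in> U" by (rule chart_at)
  obtain r where r: "smooth_on (\<phi> ` U) r" "\<And>u. u \<in> \<phi> ` U \<Longrightarrow> r u > 0"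
    "\<And>B. B \<in> sets borel \<Longrightarrow> B \<subseteq> U \<Longrightarrow> emeasure \<mu> B = (\<integral>\<^sup>+u\<in>\<phi> ` B. ennreal (r u) \<partial>lborel)"
    by (rule meas_chart[OF c(1)]) blast
  obtain e where e: "e > 0" "cball (\<phi> x) e \<subseteq> \<phi> ` U"
    using chart(2)[OF c(1)] c(2) open_contains_cball by blast
  have "compact (r ` cball (\<phi> x) e)"
    by (rule compact_continuous_image[OF continuous_on_subset[OF smooth_on_continuous[OF r(1)] e(2)]]) simp
  then obtain B where B: "\<forall>v\<in>r ` cball (\<phi> x) e. norm v \<le> B"
    using compact_imp_bounded bounded_iff by metis
  define W where "W = {y \<in> U. \<phi> y \<in> ball (\<phi> x) e}"
  have W: "open W"
    unfolding W_def using continuous_open_preimage[OF chart_continuous[OF c(1)] chart(1)[OF c(1)] open_ball]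
    by (simp add: vimage_def Int_def)
  have "emeasure \<mu> W = (\<integral>\<^sup>+u\<in>\<phi> ` W. ennreal (r u) \<partial>lborel)"
    using W by (intro r(3)) (auto simp: W_def)
  also have "\<dots> \<le> (\<integral>\<^sup>+u. ennreal B * indicator (cball (\<phi> x) e) u \<partial>lborel)"
  proof (rule nn_integral_mono)
    fix u
    show "ennreal (r u) * indicator (\<phi> ` W) u \<le> ennreal B * indicator (cball (\<phi> x) e) u"
    proof (cases "u \<in> \<phi> ` W")
      case True
      then have "u \<in> cball (\<phi> x) e" unfolding W_def by auto
      moreover from this have "norm (r u) \<le> B" using B by blast
      then have "r u \<le> B" by simp
      ultimately show ?thesis using True by (simp add: ennreal_leI)
    qed simp
  qed
  also have "\<dots> = ennreal B * emeasure lborel (cball (\<phi> x) e)"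
    by (rule nn_integral_cmult_indicator) simp
  also have "\<dots> < \<infinity>"
    using emeasure_lborel_cball_finite[of "\<phi> x" e] by (simp add: ennreal_mult_less_top)
  finally have "emeasure \<mu> W < \<infinity>" .
  moreover have "x \<in> W" using c(2) e(1) by (simp add: W_def)
  ultimately show ?thesis using W by blast
qed

lemma compact_sets: "compact K \<Longrightarrow> K \<in> sets \<mu>"
  by (simp add: sets_\<mu> borel_closed compact_imp_closed)

lemma compact_finite_measure:
  assumes "compact K" shows "emeasure \<mu> K < \<infinity>"
proof -
  define C where "C = {W. open W \<and> emeasure \<mu> W < \<infinity>}"
  have "K \<subseteq> \<Union>C" using locally_finite unfolding C_def by blast
  then obtain D where D: "D \<subseteq> C" "finite D" "K \<subseteq> \<Union>D"
    using compactE[OF assms, of C] unfolding C_def by blast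
  have "emeasure \<mu> K \<le> emeasure \<mu> (\<Union>D)"
    using D by (intro emeasure_mono) (auto simp: C_def sets_\<mu> intro!: borel_open)
  also have "\<dots> \<le> (\<Sum>W\<in>D. emeasure \<mu> W)"
    using emeasure_subadditive_finite[OF D(2), of "\<lambda>W. W" \<mu>] D(1)
    by (auto simp: C_def sets_\<mu> subset_iff intro: borel_open)
  also have "\<dots> < \<infinity>" using D by (auto simp: C_def)
  finally show ?thesis .
qed

text \<open>By Lindelof countably many of the open sets of finite measure already cover the
  manifold. The heat kernel is later integrated in both variables by Tonelli's theorem, which asks
  for this.\<close>

lemma sigma_finite: "sigma_finite_measure \<mu>"
proof -
  obtain F' where F': "F' \<subseteq> {W. open W \<and> emeasure \<mu> W < \<infinity>}" "countable F'"
    "\<Union>F' = \<Union>{W. open W \<and> emeasure \<mu> W < \<infinity>}"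
    using Lindelof[of "{W. open W \<and> emeasure \<mu> W < \<infinity>}"] by blast
  have "\<Union>{W. open W \<and> emeasure \<mu> W < \<infinity>} = UNIV" using locally_finite by blast
  with F'(3) have u: "\<Union>F' = UNIV" by simp
  have fs: "F' \<subseteq> sets \<mu>" "\<forall>a\<in>F'. emeasure \<mu> a \<noteq> \<infinity>" using F'(1) by (auto simp: sets_\<mu>)
  show ?thesis
    by (rule sigma_finite_measure.intro, rule exI[of _ F']) (use F'(2) fs u in simp)
qed

text \<open>Positivity of the density in charts. It turns almost-everywhere statements about
  continuous functions into pointwise ones.\<close>

lemma open_positive_measure:
  assumes "open W" "x \<in> W" shows "emeasure \<mu> W > 0"
proof -
  obtain U \<phi> where c: "(U, \<phi>) \<in> A" "x \<in> U" by (rule chart_at)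
  obtain r where r: "smooth_on (\<phi> ` U) r" "\<And>u. u \<in> \<phi> ` U \<Longrightarrow> r u > 0"
    "\<And>B. B \<in> sets borel \<Longrightarrow> B \<subseteq> U \<Longrightarrow> emeasure \<mu> B = (\<integral>\<^sup>+u\<in>\<phi> ` B. ennreal (r u) \<partial>lborel)"
    by (rule meas_chart[OF c(1)]) blast
  define V where "V = U \<inter> W"
  have V: "open V" "V \<subseteq> U" "x \<in> V" using assms c chart(1) by (auto simp: V_def)
  have oV: "open (\<phi> ` V)" using chart_image_open[OF c(1) V(1,2)] .
  have eq: "emeasure \<mu> V = (\<integral>\<^sup>+u\<in>\<phi> ` V. ennreal (r u) \<partial>lborel)"
    using V by (intro r(3)) auto
  have "emeasure \<mu> V \<noteq> 0"
  proof
    assume 0: "emeasure \<mu> V = 0"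
    have m: "(\<lambda>u. ennreal (r u) * indicator (\<phi> ` V) u) \<in> borel_measurable lborel"
    proof -
      have "continuous_on (\<phi> ` V) r"
        using continuous_on_subset[OF smooth_on_continuous[OF r(1)]] V(2) by blast
      then have "(\<lambda>u. indicator (\<phi> ` V) u *\<^sub>R r u) \<in> borel_measurable borel"
        using borel_measurable_continuous_on_indicator[OF borel_open[OF oV]] by blast
      then have "(\<lambda>u. ennreal (indicator (\<phi> ` V) u *\<^sub>R r u)) \<in> borel_measurable lborel" by simp
      then show ?thesis by (rule measurable_cong[THEN iffD1, rotated]) (auto simp: indicator_def)
    qed
    have "AE u in lborel. ennreal (r u) * indicator (\<phi> ` V) u = 0"
      using 0 eq nn_integral_0_iff_AE[OF m] by simp
    then have "AE u in lborel. u \<notin> \<phi> ` V"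
    proof eventually_elim
      case (elim u)
      show ?case
      proof
        assume u: "u \<in> \<phi> ` V"
        then have "r u > 0" using r(2) V(2) by blast
        with elim u show False by (simp add: ennreal_eq_0_iff)
      qed
    qed
    then have "emeasure lborel (\<phi> ` V) = 0"
      using oV by (subst emeasure_eq_0_AE[of "\<lambda>u. u \<in> \<phi> ` V", symmetric]) auto
    moreover obtain e where e: "e > 0" "ball (\<phi> x) e \<subseteq> \<phi> ` V"
      using oV V(3) open_contains_ball by blast
    ultimately have "emeasure lborel (ball (\<phi> x) e) = 0"
      using emeasure_mono[OF e(2), of lborel] oV by (auto simp: borel_open)
    then show False using content_ball_pos[OF e(1), of "\<phi> x"] by (simp add: measure_def)
  qed
  then have "emeasure \<mu> V > 0" by (simp add: zero_less_iff_neq_zero)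
  also have "emeasure \<mu> V \<le> emeasure \<mu> W"
    using assms by (intro emeasure_mono) (auto simp: V_def sets_\<mu>)
  finally show ?thesis .
qed

lemma continuous_measurable: "continuous_on UNIV f \<Longrightarrow> f \<in> borel_measurable \<mu>"
  by (simp add: borel_measurable_continuous_onI measurable_cong_sets[OF sets_\<mu>])

lemma integrable_compact_support:
  fixes f :: "'a \<Rightarrow> real"
  assumes "compact K" "continuous_on UNIV f" "\<And>x. x \<notin> K \<Longrightarrow> f x = 0"
  shows "integrable \<mu> f"
proof -
  have "compact (f ` K)"
    using assms by (auto intro: compact_continuous_image continuous_on_subset)
  then obtain B where B: "\<forall>v\<in>f ` K. norm v \<le> B"
    using compact_imp_bounded bounded_iff by metis
  show ?thesis
    by (rule integrableI_bounded_set[where A = K and B = B])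
      (use assms B compact_sets compact_finite_measure continuous_measurable in \<open>auto simp: less_top\<close>)
qed

lemma integrable_test_mult:
  assumes "test_fun A \<zeta>" "continuous_on UNIV f"
  shows "integrable \<mu> (\<lambda>x. \<zeta> x * f x)"
  by (rule integrable_compact_support[OF test_fun_compact[OF assms(1)]])
    (use assms tsupp_outside[of _ \<zeta>] smooth_fun_continuous[OF test_fun_smooth[OF assms(1)]]
      in \<open>auto intro!: continuous_intros\<close>)

lemma integrable_test: "test_fun A \<zeta> \<Longrightarrow> integrable \<mu> \<zeta>"
  using integrable_test_mult[of \<zeta> "\<lambda>_. 1"] by simp

lemma continuous_nonneg_integral_0:
  fixes f :: "'a \<Rightarrow> real"
  assumes "continuous_on UNIV f" "integrable \<mu> f" "\<And>x. f x \<ge> 0" "(\<integral>x. f x \<partial>\<mu>) = 0"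
  shows "f x = 0"
proof (rule ccontr)
  assume x: "f x \<noteq> 0"
  have "AE x in \<mu>. f x = 0"
    using integral_nonneg_eq_0_iff_AE[OF assms(2)] assms(3,4) by auto
  moreover have o: "open {x. f x \<noteq> 0}"
    using assms(1) by (intro open_Collect_neq continuous_on_const)
  ultimately have "emeasure \<mu> {x. f x \<noteq> 0} = 0"
    by (subst emeasure_eq_0_AE[of "\<lambda>x. f x \<noteq> 0", symmetric]) (auto simp: sets_\<mu>)
  then show False using open_positive_measure[OF o, of x] x by simp
qed

text \<open>Where \<open>g\<close> keeps its sign, a bump against it would have a nonzero integral.
  Every weak identity of the development, for the generator, for the time derivative and for the sum
  of squares, becomes pointwise through this lemma; the last of them lives only on a chart domain,
  hence the open set \<open>O'\<close>.\<close>

lemma fundamental_lemma: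
  fixes g :: "'a \<Rightarrow> real"
  assumes "open O'" "continuous_on O' g" "x \<in> O'"
    and "\<And>\<zeta>. test_fun A \<zeta> \<Longrightarrow> tsupp \<zeta> \<subseteq> O' \<Longrightarrow> (\<integral>x. \<zeta> x * g x \<partial>\<mu>) = 0"
  shows "g x = 0"
proof (rule ccontr)
  assume gx: "g x \<noteq> 0"
  define s where "s = sgn (g x)"
  define W where "W = {y \<in> O'. s * g y > 0}"
  have "continuous_on O' (\<lambda>y. s * g y)" by (intro continuous_intros assms(2))
  from continuous_open_preimage[OF this assms(1) open_greaterThan[of 0]]
  have W: "open W" by (simp add: W_def vimage_def Int_def)
  have "x \<in> W" using assms(3) gx by (simp add: W_def s_def sgn_real_def)
  then obtain \<zeta> where z: "test_fun A \<zeta>" "\<And>y. \<zeta> y \<ge> 0" "\<zeta> x > 0" "tsupp \<zeta> \<subseteq> W"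
    using bump_exists[OF W] by metis
  define f where "f = (\<lambda>y. \<zeta> y * (s * g y))"
  have f0: "f y = 0" if "y \<notin> tsupp \<zeta>" for y using tsupp_outside[OF that] by (simp add: f_def)
  have "continuous_on W f"
    unfolding f_def
    by (intro continuous_intros smooth_fun_continuous[OF test_fun_smooth[OF z(1)]]
        continuous_on_subset[OF assms(2)]) (auto simp: W_def)
  then have fc: "continuous_on UNIV f"
    by (rule continuous_on_extend_zero[OF W _ test_fun_compact[OF z(1)] z(4)]) (rule f0)
  have fi: "integrable \<mu> f" by (rule integrable_compact_support[OF test_fun_compact[OF z(1)] fc f0])
  have fn: "f y \<ge> 0" for y
  proof (cases "y \<in> tsupp \<zeta>")
    case True
    then have "s * g y > 0" using z(4) by (auto simp: W_def)
    then show ?thesis using z(2)[of y] by (simp add: f_def)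
  qed (simp add: f0)
  have "(\<integral>y. f y \<partial>\<mu>) = s * (\<integral>y. \<zeta> y * g y \<partial>\<mu>)"
    unfolding f_def by (subst Bochner_Integration.integral_mult_right_zero[symmetric]) (simp add: mult_ac)
  also have "\<dots> = 0" using assms(4)[OF z(1)] z(4) by (auto simp: W_def)
  finally have "f x = 0" by (rule continuous_nonneg_integral_0[OF fc fi fn])
  then show False using z(3) \<open>x \<in> W\<close> by (auto simp: f_def W_def)
qed

end

context smooth_mfd
begin

lemma test_fun_sum:
  "finite I \<Longrightarrow> I \<noteq> {} \<Longrightarrow> (\<And>i. i \<in> I \<Longrightarrow> test_fun A (f i)) \<Longrightarrow> test_fun A (\<lambda>x. \<Sum>i\<in>I. f i x)"
  by (induction I rule: finite_ne_induct) (auto intro: test_fun_add)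

lemma cutoff_exists:
  assumes "compact K" "open O'" "K \<subseteq> O'"
  obtains \<theta> W where "test_fun A \<theta>" "tsupp \<theta> \<subseteq> O'" "open W" "K \<subseteq> W" "\<And>x. x \<in> W \<Longrightarrow> \<theta> x = 1"
proof (cases "K = {}")
  case True
  have "test_fun A (\<lambda>_. 0)" by (rule test_funI[where K = "{}"]) auto
  with True that[of "\<lambda>_. 0" "{}"] show thesis by (simp add: tsupp_def)
next
  case False
  \<comment> \<open>Points outside \<open>O'\<close> receive a bump around some other point, so that
    bumps can be chosen for all points at once.\<close>
  have "\<exists>\<zeta>. test_fun A \<zeta> \<and> (\<forall>y. \<zeta> y \<ge> 0) \<and> (x \<in> O' \<longrightarrow> \<zeta> x > 0) \<and> tsupp \<zeta> \<subseteq> O'" for x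
  proof (cases "x \<in> O'")
    case True
    then show ?thesis using bump_exists[OF assms(2), of x] by metis
  next
    case False
    moreover obtain z where "z \<in> O'" using \<open>K \<noteq> {}\<close> assms(3) by blast
    ultimately show ?thesis using bump_exists[OF assms(2), of z] by metis
  qed
  then obtain Z where Z: "\<And>x. test_fun A (Z x)" "\<And>x y. Z x y \<ge> 0"
    "\<And>x. x \<in> O' \<Longrightarrow> Z x x > 0" "\<And>x. tsupp (Z x) \<subseteq> O'" by metis
  have o: "open {y. Z x y > 0}" for x
    using smooth_fun_continuous[OF test_fun_smooth[OF Z(1)]] by (intro open_Collect_less) auto
  obtain I where I: "I \<subseteq> K" "finite I" "K \<subseteq> (\<Union>x\<in>I. {y. Z x y > 0})"
  proof (rule compactE_image[OF assms(1), of K "\<lambda>x. {y. Z x y > 0}"])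
    show "K \<subseteq> (\<Union>x\<in>K. {y. Z x y > 0})" using Z(3) assms(3) by blast
  qed (use o in auto)
  have I': "I \<noteq> {}" using False I(3) by auto
  define s where "s = (\<lambda>y. \<Sum>x\<in>I. Z x y)"
  have s: "test_fun A s" unfolding s_def by (rule test_fun_sum[OF I(2) I' Z(1)])
  have spos: "s y > 0" if y: "y \<in> K" for y
  proof -
    obtain x where "x \<in> I" "Z x y > 0" using I(3) y by blast
    then show ?thesis unfolding s_def by (intro sum_pos2[OF I(2), of x]) (auto simp: Z(2))
  qed
  obtain y0 where y0: "y0 \<in> K" "\<And>y. y \<in> K \<Longrightarrow> s y0 \<le> s y"
    using continuous_attains_inf[OF assms(1) False smooth_fun_continuous[OF test_fun_smooth[OF s]]] by blast
  \<comment> \<open>On K the argument of \<open>sstep\<close> is at least 2, and on the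
    neighbourhood where s exceeds half its minimum over K it is still above 1; hence the value 1 on
    an open set and not only on K.\<close>
  define \<theta> where "\<theta> = (\<lambda>y. sstep (2 / s y0 * s y))"
  define W where "W = {y. s y0 / 2 < s y}"
  have "smooth_fun A \<theta>" unfolding \<theta>_def
    by (rule smooth_fun_compose[OF smooth_on_sstep open_UNIV smooth_fun_mult[OF smooth_fun_const test_fun_smooth[OF s]]]) simp
  then have "test_fun A \<theta>"
    by (rule test_funI[OF _ test_fun_compact[OF s]]) (simp add: \<theta>_def tsupp_outside sstep_0)
  moreover have "open W" unfolding W_def
    using smooth_fun_continuous[OF test_fun_smooth[OF s]] by (intro open_Collect_less) auto
  moreover have "K \<subseteq> W" using y0 spos[OF y0(1)] unfolding W_def by fastforce
  moreover have "\<theta> x = 1" if "x \<in> W" for x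
    using that spos[OF y0(1)] by (auto simp: \<theta>_def W_def field_simps intro!: sstep_1)
  moreover have "tsupp \<theta> \<subseteq> O'"
  proof -
    have "tsupp \<theta> \<subseteq> (\<Union>x\<in>I. tsupp (Z x))"
    proof (rule tsupp_subsetI)
      show "closed (\<Union>x\<in>I. tsupp (Z x))" using I(2) tsupp_closed by (intro closed_UN) auto
      fix y assume "y \<notin> (\<Union>x\<in>I. tsupp (Z x))"
      then have "s y = 0" unfolding s_def using tsupp_outside by (intro sum.neutral) blast
      then show "\<theta> y = 0" by (simp add: \<theta>_def sstep_0)
    qed
    also have "\<dots> \<subseteq> O'" using Z(4) by blast
    finally show ?thesis .
  qed
  ultimately show thesis using that by blast
qed

end

locale measured_diffusion = diffusion A L + measured_mfd A \<mu>
  for A :: "('a::{t2_space, second_countable_topology}, 'e::euclidean_space) atlas" and L and \<mu> +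
  assumes sym: "symmetric_on_tests A \<mu> L"
begin

text \<open>Symmetry is assumed for two test functions. A cutoff equal to 1 near the support of
  \<open>\<zeta>\<close> replaces \<open>w\<close> by a test function without changing either
  integrand, since \<open>L\<close> is local.\<close>

lemma L_symmetric:
  assumes "test_fun A \<zeta>" "smooth_fun A w"
  shows "(\<integral>x. \<zeta> x * L w x \<partial>\<mu>) = (\<integral>x. w x * L \<zeta> x \<partial>\<mu>)"
proof -
  obtain \<theta> W where \<theta>: "test_fun A \<theta>" "open W" "tsupp \<zeta> \<subseteq> W" "\<And>x. x \<in> W \<Longrightarrow> \<theta> x = 1"
    by (rule cutoff_exists[OF test_fun_compact[OF assms(1)] open_UNIV subset_UNIV]) blast
  have t: "test_fun A (\<lambda>x. \<theta> x * w x)" by (rule test_fun_mult(1)[OF \<theta>(1) assms(2)])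
  have 1: "\<zeta> x * L w x = \<zeta> x * L (\<lambda>x. \<theta> x * w x) x" for x
  proof (cases "x \<in> tsupp \<zeta>")
    case True
    have "L w x = L (\<lambda>x. \<theta> x * w x) x"
      by (rule L_local[OF assms(2) test_fun_smooth[OF t] \<theta>(2)]) (use \<theta> True in auto)
    then show ?thesis by simp
  qed (simp add: tsupp_outside)
  have 2: "(\<theta> x * w x) * L \<zeta> x = w x * L \<zeta> x" for x
  proof (cases "x \<in> tsupp \<zeta>")
    case False
    have "L \<zeta> x = L (\<lambda>_. 0) x"
      by (rule L_local[OF test_fun_smooth[OF assms(1)] smooth_fun_const open_Compl[OF tsupp_closed[of \<zeta>]]])
        (use False tsupp_outside[of _ \<zeta>] in auto)
    then show ?thesis by (simp add: L_const)
  qed (use \<theta> in auto)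
  have "(\<integral>x. \<zeta> x * L (\<lambda>x. \<theta> x * w x) x \<partial>\<mu>) = (\<integral>x. (\<theta> x * w x) * L \<zeta> x \<partial>\<mu>)"
    using sym assms(1) t unfolding symmetric_on_tests_def by blast
  then show ?thesis by (simp only: 1 2)
qed

text \<open>Symmetry against the constant 1 shows that L(zeta w) has integral zero. Expanding it
  into the two products and the carre du champ, and using symmetry once more, gives the
  formula.\<close>

lemma integral_by_parts:
  assumes "test_fun A \<zeta>" "smooth_fun A w"
  shows "(\<integral>x. \<zeta> x * L w x \<partial>\<mu>) = - (\<integral>x. carre L \<zeta> w x \<partial>\<mu>)"
proof -
  have z: "smooth_fun A \<zeta>" by (rule test_fun_smooth[OF assms(1)])
  have t: "test_fun A (\<lambda>x. \<zeta> x * w x)" by (rule test_fun_mult(1)[OF assms])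
  have i1: "integrable \<mu> (\<lambda>x. \<zeta> x * L w x)"
    using assms by (intro integrable_test_mult smooth_fun_continuous) auto
  have i2: "integrable \<mu> (\<lambda>x. w x * L \<zeta> x)"
    using integrable_test_mult[OF test_fun_L[OF assms(1)] smooth_fun_continuous[OF assms(2)]]
    by (simp add: mult.commute)
  have i3: "integrable \<mu> (L (\<lambda>x. \<zeta> x * w x))" by (rule integrable_test[OF test_fun_L[OF t]])
  have i4: "integrable \<mu> (carre L \<zeta> w)" unfolding carre_def using i1 i2 i3 by auto
  have "(\<integral>x. L (\<lambda>x. \<zeta> x * w x) x \<partial>\<mu>) = (\<integral>x. (\<zeta> x * w x) * L (\<lambda>_. 1) x \<partial>\<mu>)"
    using L_symmetric[OF t smooth_fun_const[of 1]] by simp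
  also have "\<dots> = 0" by (simp add: L_const)
  finally have "0 = (\<integral>x. \<zeta> x * L w x + w x * L \<zeta> x + 2 * carre L \<zeta> w x \<partial>\<mu>)"
    unfolding L_mult[abs_def] by simp
  also have "\<dots> = (\<integral>x. \<zeta> x * L w x \<partial>\<mu>) + (\<integral>x. w x * L \<zeta> x \<partial>\<mu>) + 2 * (\<integral>x. carre L \<zeta> w x \<partial>\<mu>)"
    using i1 i2 i4 by simp
  finally show ?thesis using L_symmetric[OF assms] by simp
qed

end

section \<open>The parabolic maximum principle\<close>

lemma (in sym_form) form_quadratic:
  assumes "smooth_fun A f" "smooth_fun A g" "\<And>f. smooth_fun A f \<Longrightarrow> G f f x \<ge> 0"
  shows "a\<^sup>2 * G f f x + 2 * a * b * G f g x + b\<^sup>2 * G g g x \<ge> 0"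
proof -
  have s: "smooth_fun A (\<lambda>y. a * f y)" "smooth_fun A (\<lambda>y. b * g y)" using assms by auto
  note s2 = smooth_fun_add[OF s]
  have "0 \<le> G (\<lambda>y. a * f y + b * g y) (\<lambda>y. a * f y + b * g y) x" by (rule assms(3)[OF s2])
  also have "\<dots> = a\<^sup>2 * G f f x + 2 * a * b * G f g x + b\<^sup>2 * G g g x"
    using assms(1,2) s s2 form_commute[OF assms(1,2)]
    by (simp add: form_add form_cmult power2_eq_square algebra_simps)
  finally show ?thesis .
qed

lemma (in measured_diffusion) integrable_carre:
  assumes "test_fun A \<zeta>" "smooth_fun A w"
  shows "integrable \<mu> (carre L \<zeta> w)"
proof -
  have i1: "integrable \<mu> (\<lambda>x. \<zeta> x * L w x)"
    using assms by (intro integrable_test_mult smooth_fun_continuous) auto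
  have i2: "integrable \<mu> (\<lambda>x. w x * L \<zeta> x)"
    using integrable_test_mult[OF test_fun_L[OF assms(1)] smooth_fun_continuous[OF assms(2)]]
    by (simp add: mult.commute)
  have i3: "integrable \<mu> (L (\<lambda>x. \<zeta> x * w x))"
    by (rule integrable_test[OF test_fun_L[OF test_fun_mult(1)[OF assms]]])
  show ?thesis unfolding carre_def using i1 i2 i3 by auto
qed

locale exhausted_diffusion = measured_diffusion A L \<mu>
  for A :: "('a::{t2_space, second_countable_topology}, 'e::euclidean_space) atlas" and L and \<mu> +
  fixes h :: "nat \<Rightarrow> 'a \<Rightarrow> real"
  assumes h_test: "\<And>k. test_fun A (h k)"
    and h_incseq: "\<And>x. incseq (\<lambda>k. h k x)"
    and h_lim: "\<And>x. (\<lambda>k. h k x) \<longlonglongrightarrow> 1"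
    and h_carre: "\<And>e. e > 0 \<Longrightarrow> \<forall>\<^sub>F k in sequentially. \<forall>x. carre L (h k) (h k) x \<le> e"
begin

lemma h_le_1: "h k x \<le> 1"
  using incseq_le[OF h_incseq h_lim] by blast

lemma h_smooth: "smooth_fun A (h k)"
  by (rule test_fun_smooth[OF h_test])

context
  fixes w w' :: "real \<Rightarrow> 'a \<Rightarrow> real" and \<eta> T M C :: real and q :: "real \<Rightarrow> 'a \<Rightarrow> real"
  assumes \<eta>: "0 < \<eta>"
    and w_smooth: "\<And>t. t > 0 \<Longrightarrow> smooth_fun A (w t)"
    and w_deriv: "\<And>t x. t > 0 \<Longrightarrow> ((\<lambda>s. w s x) has_real_derivative w' t x) (at t)"
    and w_cont: "continuous_on ({0<..} \<times> UNIV) (\<lambda>(t, x). w t x)"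
    and w'_cont: "continuous_on ({0<..} \<times> UNIV) (\<lambda>(t, x). w' t x)"
    and w_sub: "\<And>t x. \<eta> \<le> t \<Longrightarrow> t \<le> T \<Longrightarrow> w' t x \<le> L (w t) x"
    and w_init: "\<And>x. w \<eta> x \<le> 0"
    and w_bound: "\<And>t x. \<eta> \<le> t \<Longrightarrow> t \<le> T \<Longrightarrow> w t x \<le> M" "M \<ge> 0"
    and q_int: "\<And>t. \<eta> \<le> t \<Longrightarrow> t \<le> T \<Longrightarrow> integrable \<mu> (q t)"
    and q_le: "\<And>t. \<eta> \<le> t \<Longrightarrow> t \<le> T \<Longrightarrow> (\<integral>x. q t x \<partial>\<mu>) \<le> C"
    and q_nonneg: "\<And>t x. \<eta> \<le> t \<Longrightarrow> t \<le> T \<Longrightarrow> q t x \<ge> 0"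
    and w_le_q: "\<And>t x. \<eta> \<le> t \<Longrightarrow> t \<le> T \<Longrightarrow> w t x > 0 \<Longrightarrow> (w t x)\<^sup>2 \<le> q t x"
begin

text \<open>The weight is squared because the cutoffs may take negative values, and because the
  square leaves one factor \<open>h j\<close> to be paired with its gradient.\<close>

definition energy :: "nat \<Rightarrow> real \<Rightarrow> real" where
  "energy j t = (\<integral>x. (h j x)\<^sup>2 * spos (w t x) \<partial>\<mu>)"

lemma w'_cont_slice: "t > 0 \<Longrightarrow> continuous_on UNIV (w' t)"
  by (rule continuous_on_compose2[OF w'_cont, of _ "\<lambda>x. (t, x)", simplified])
    (auto intro!: continuous_intros)

lemma h2_test: "test_fun A (\<lambda>x. (h j x)\<^sup>2)"
  unfolding power2_eq_square by (rule test_fun_mult(1)[OF h_test h_smooth])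

lemma spos'_smooth: "t > 0 \<Longrightarrow> smooth_fun A (\<lambda>x. spos' (w t x))"
  by (rule smooth_fun_compose[OF smooth_on_spos' open_UNIV w_smooth]) auto

lemma spos_smooth: "t > 0 \<Longrightarrow> smooth_fun A (\<lambda>x. spos (w t x))"
  by (rule smooth_fun_compose[OF smooth_on_spos open_UNIV w_smooth]) auto

lemma energy_deriv:
  assumes "t > 0"
  shows "(energy j has_real_derivative (\<integral>x. ((h j x)\<^sup>2 * spos' (w t x)) * w' t x \<partial>\<mu>)) (at t)"
proof -
  define K where "K = tsupp (h j)"
  have K: "compact K" "K \<in> sets \<mu>" "emeasure \<mu> K < \<infinity>"
    unfolding K_def using test_fun_compact[OF h_test] compact_sets compact_finite_measure by auto
  have "((\<lambda>t. \<integral>x. (h j x)\<^sup>2 * spos (w t x) \<partial>\<mu>) has_derivative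
      (\<lambda>v. \<Sum>i\<in>Basis. (v \<bullet> i) * (\<integral>x. ((h j x)\<^sup>2 * spos' (w t x)) * w' t x \<partial>\<mu>))) (at t)"
  proof (rule has_derivative_integral_compact[OF K, of "{0<..}"])
    show "t \<in> {0<..}" using assms by simp
    show "integrable \<mu> (\<lambda>x. (h j x)\<^sup>2 * spos (w t x))" if "t \<in> {0<..}" for t
      using that by (intro integrable_test_mult[OF h2_test] smooth_fun_continuous spos_smooth) auto
    show "(h j x)\<^sup>2 * spos (w t x) = 0" if "x \<notin> K" for t x
      using tsupp_outside[of x "h j"] that by (simp add: K_def)
    show "integrable \<mu> (\<lambda>x. ((h j x)\<^sup>2 * spos' (w t x)) * w' t x)" if "t \<in> {0<..}" for t
      using that by (intro integrable_test_mult test_fun_mult(1)[OF h2_test spos'_smooth] w'_cont_slice) auto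
    show "((h j x)\<^sup>2 * spos' (w t x)) * w' t x = 0" if "x \<notin> K" for t x
      using tsupp_outside[of x "h j"] that by (simp add: K_def)
    show "continuous_on ({0<..} \<times> K) (\<lambda>(t, x). ((h j x)\<^sup>2 * spos' (w t x)) * w' t x)"
    proof -
      have 1: "continuous_on ({0<..} \<times> K) (\<lambda>p. w (fst p) (snd p))"
        "continuous_on ({0<..} \<times> K) (\<lambda>p. w' (fst p) (snd p))"
        using continuous_on_subset[OF w_cont, of "{0<..} \<times> K"]
          continuous_on_subset[OF w'_cont, of "{0<..} \<times> K"] by (auto simp: case_prod_beta)
      have 2: "continuous_on ({0<..} \<times> K) (\<lambda>p. spos' (w (fst p) (snd p)))"
        by (rule continuous_on_compose2[OF smooth_on_continuous[OF smooth_on_spos'] 1(1)]) auto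
      have 3: "continuous_on ({0<..} \<times> K) (\<lambda>p. h j (snd p))"
        by (rule continuous_on_compose2[OF smooth_fun_continuous[OF h_smooth, of UNIV] continuous_on_snd[OF continuous_on_id]]) auto
      show ?thesis unfolding case_prod_beta by (intro continuous_intros 1 2 3)
    qed
    show "((\<lambda>t. (h j x)\<^sup>2 * spos (w t x)) has_derivative
      (\<lambda>v. \<Sum>i\<in>Basis. v \<bullet> i * ((h j x)\<^sup>2 * spos' (w t x) * w' t x))) (at t)"
      if "t \<in> {0<..}" for t x
    proof -
      have "((\<lambda>t. (h j x)\<^sup>2 * spos (w t x)) has_real_derivative (h j x)\<^sup>2 * (spos' (w t x) * w' t x)) (at t)"
        using that by (intro DERIV_cmult DERIV_chain2[OF DERIV_spos w_deriv]) auto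
      then show ?thesis unfolding has_field_derivative_def
        by (rule has_derivative_eq_rhs) (auto simp: fun_eq_iff mult_ac)
    qed
  qed auto
  then show ?thesis unfolding has_field_derivative_def energy_def[abs_def]
    by (rule has_derivative_eq_rhs) (auto simp: fun_eq_iff mult.commute)
qed

text \<open>By parts, the integral is at most minus that of Gamma(h^2 spos'(w), w) = h^2 spos''(w)
  Gamma(w) + 2 h spos'(w) Gamma(h, w). Convexity gives the first term the right sign, and completing
  the square leaves at most \<open>(spos')^2 / spos''\<close> times Gamma(h), a multiple of w^2 e by
  the bound for the positive part. The majorant \<open>q\<close> of w^2 where w is positive has
  integral at most \<open>C\<close>, so only the size of the gradient of the cutoff matters.\<close>

lemma energy_dissipation:
  assumes t: "\<eta> \<le> t" "t \<le> T" and e: "\<And>x. carre L (h j) (h j) x \<le> e" "e > 0"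
  shows "(\<integral>x. ((h j x)\<^sup>2 * spos' (w t x)) * w' t x \<partial>\<mu>) \<le> (1 + M)\<^sup>2 * e * C"
proof -
  have t0: "t > 0" using t \<eta> by linarith
  note ws = w_smooth[OF t0]
  define \<zeta> where "\<zeta> = (\<lambda>x. (h j x)\<^sup>2 * spos' (w t x))"
  have z: "test_fun A \<zeta>" unfolding \<zeta>_def by (rule test_fun_mult(1)[OF h2_test spos'_smooth[OF t0]])
  have "(\<integral>x. \<zeta> x * w' t x \<partial>\<mu>) \<le> (\<integral>x. \<zeta> x * L (w t) x \<partial>\<mu>)"
    using w_sub[OF t] by (intro integral_mono integrable_test_mult[OF z] w'_cont_slice[OF t0]
        smooth_fun_continuous smooth_fun_L[OF ws] mult_left_mono) (auto simp: \<zeta>_def spos'_nonneg)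
  also have "\<dots> = (\<integral>x. - carre L \<zeta> (w t) x \<partial>\<mu>)"
    by (subst integral_by_parts[OF z ws]) simp
  also have "\<dots> \<le> (\<integral>x. ((1 + M)\<^sup>2 * e) * q t x \<partial>\<mu>)"
  proof (rule integral_mono)
    show "integrable \<mu> (\<lambda>x. - carre L \<zeta> (w t) x)" using integrable_carre[OF z ws] by auto
    show "integrable \<mu> (\<lambda>x. ((1 + M)\<^sup>2 * e) * q t x)" using q_int[OF t] by auto
    fix x
    have 1: "carre L (\<lambda>x. spos' (w t x)) (w t) x = flatn 3 (w t x) * carre L (w t) (w t) x"
      by (rule carre.form_compose(1)[OF ws ws smooth_on_spos' open_UNIV UNIV_I DERIV_spos'])
    have 2: "carre L (\<lambda>x. (h j x)\<^sup>2) (w t) x = 2 * h j x * carre L (h j) (w t) x"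
      unfolding power2_eq_square by (simp add: carre.form_mult(1)[OF h_smooth h_smooth ws])
    have 3: "carre L \<zeta> (w t) x = (h j x)\<^sup>2 * (flatn 3 (w t x) * carre L (w t) (w t) x)
        + spos' (w t x) * (2 * h j x * carre L (h j) (w t) x)"
      unfolding \<zeta>_def
      by (subst carre.form_mult(1)[OF test_fun_smooth[OF h2_test] spos'_smooth[OF t0] ws]) (simp only: 1 2)
    show "- carre L \<zeta> (w t) x \<le> ((1 + M)\<^sup>2 * e) * q t x"
    proof (cases "w t x > 0")
      case False
      then show ?thesis using q_nonneg[OF t, of x] e(2) unfolding 3
        by (simp add: flatn_eq_0 spos'_eq_0)
    next
      case True
      define f where "f = flatn 3 (w t x)"
      define a where "a = spos' (w t x)"
      have f: "f > 0" using True by (simp add: f_def flatn_pos)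
      \<comment> \<open>The coefficients are chosen so that their squares give \<open>f\<close>
        times h^2 and a^2 / f, while the mixed term becomes exactly 2 h a.\<close>
      have "0 \<le> (sqrt f * h j x)\<^sup>2 * carre L (w t) (w t) x +
          2 * (sqrt f * h j x) * (a / sqrt f) * carre L (w t) (h j) x + (a / sqrt f)\<^sup>2 * carre L (h j) (h j) x"
        by (rule carre.form_quadratic[OF ws h_smooth carre_nonneg])
      also have "(sqrt f * h j x)\<^sup>2 = (h j x)\<^sup>2 * f" using f by (simp add: power_mult_distrib)
      also have "2 * (sqrt f * h j x) * (a / sqrt f) = 2 * h j x * a" using f by simp
      also have "(a / sqrt f)\<^sup>2 = a\<^sup>2 / f" using f by (simp add: power_divide)
      finally have "- carre L \<zeta> (w t) x \<le> a\<^sup>2 / f * carre L (h j) (h j) x"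
        unfolding 3 f_def[symmetric] a_def[symmetric] carre_commute[of "h j" "w t"]
        by (simp add: algebra_simps)
      also have "\<dots> \<le> a\<^sup>2 / f * e" using e(1) f by (intro mult_left_mono) auto
      also have "\<dots> \<le> (1 + M)\<^sup>2 * (w t x)\<^sup>2 * e"
        using spos'_sq_le[OF True w_bound(1)[OF t]] e(2) unfolding f_def a_def
        by (intro mult_right_mono) auto
      also have "\<dots> \<le> (1 + M)\<^sup>2 * q t x * e"
        using w_le_q[OF t True] e(2) by (intro mult_right_mono mult_left_mono) auto
      finally show ?thesis by (simp add: mult_ac)
    qed
  qed
  also have "\<dots> = (1 + M)\<^sup>2 * e * (\<integral>x. q t x \<partial>\<mu>)" by simp
  also have "\<dots> \<le> (1 + M)\<^sup>2 * e * C" using q_le[OF t] e(2) by (intro mult_left_mono) auto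
  finally show ?thesis by (simp add: \<zeta>_def)
qed

lemma energy_le:
  assumes t: "\<eta> \<le> t" "t \<le> T" and e: "\<And>x. carre L (h j) (h j) x \<le> e" "e > 0"
  shows "energy j t \<le> (1 + M)\<^sup>2 * e * C * (t - \<eta>)"
proof -
  let ?c = "(1 + M)\<^sup>2 * e * C"
  have "energy j t - ?c * t \<le> energy j \<eta> - ?c * \<eta>"
  proof (rule DERIV_nonpos_imp_nonincreasing[OF t(1)])
    fix s assume s: "\<eta> \<le> s" "s \<le> t"
    have "((\<lambda>s. energy j s - ?c * s) has_real_derivative
        (\<integral>x. ((h j x)\<^sup>2 * spos' (w s x)) * w' s x \<partial>\<mu>) - ?c) (at s)"
      using \<eta> s by (auto intro!: derivative_eq_intros energy_deriv)
    then show "\<exists>y. ((\<lambda>s. energy j s - ?c * s) has_real_derivative y) (at s) \<and> y \<le> 0"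
      using energy_dissipation[OF s(1) _ e] s t by fastforce
  qed
  moreover have "energy j \<eta> = 0"
    unfolding energy_def using w_init by (simp add: spos_eq_0)
  ultimately show ?thesis by (simp add: algebra_simps)
qed

text \<open>The energy is bounded by a multiple of \<open>e\<close>, which may be taken arbitrarily
  small, while the monotone cutoffs keep a fixed positive weight near \<open>x\<close>. So a
  positive value of \<open>w\<close> at \<open>x\<close> would contradict the vanishing of a
  localised integral.\<close>

lemma max_principle:
  assumes t: "\<eta> \<le> t" "t \<le> T"
  shows "w t x \<le> 0"
proof (rule ccontr)
  assume "\<not> w t x \<le> 0"
  then have wx: "w t x > 0" by simp
  have t0: "t > 0" using t \<eta> by linarith
  have "\<forall>\<^sub>F k in sequentially. h k x > 1 / 2"
    using h_lim[of x] by (rule order_tendstoD) simp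
  then obtain J where J: "h J x > 1 / 2" unfolding eventually_sequentially by blast
  define W where "W = {y. 1 / 2 < h J y}"
  have "open W" unfolding W_def
    by (intro open_Collect_less continuous_on_const smooth_fun_continuous[OF h_smooth])
  moreover have "x \<in> W" using J by (simp add: W_def)
  ultimately obtain \<zeta> where z: "test_fun A \<zeta>" "\<And>y. \<zeta> y \<ge> 0" "\<zeta> x > 0" "tsupp \<zeta> \<subseteq> W"
    by (rule bump_exists) blast
  obtain B where B: "B > 0" "\<And>y. \<bar>\<zeta> y\<bar> \<le> B" by (rule test_fun_bounded[OF z(1)]) blast
  have zs: "continuous_on UNIV (\<lambda>y. spos (w t y))"
    by (rule smooth_fun_continuous[OF spos_smooth[OF t0]])
  have zi: "integrable \<mu> (\<lambda>y. \<zeta> y * spos (w t y))" by (rule integrable_test_mult[OF z(1) zs])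
  have le: "(\<integral>y. \<zeta> y * spos (w t y) \<partial>\<mu>) \<le> 4 * B * ((1 + M)\<^sup>2 * e * C * (t - \<eta>))" if e: "e > 0" for e
  proof -
    have "\<forall>\<^sub>F k in sequentially. (\<forall>x. carre L (h k) (h k) x \<le> e) \<and> k \<ge> J"
      using h_carre[OF e] eventually_ge_at_top[of J] by eventually_elim auto
    then obtain j where j: "\<And>x. carre L (h j) (h j) x \<le> e" "j \<ge> J"
      unfolding eventually_sequentially by blast
    have "(\<integral>y. \<zeta> y * spos (w t y) \<partial>\<mu>) \<le> (\<integral>y. 4 * B * ((h j y)\<^sup>2 * spos (w t y)) \<partial>\<mu>)"
    proof (rule integral_mono[OF zi])
      show "integrable \<mu> (\<lambda>y. 4 * B * ((h j y)\<^sup>2 * spos (w t y)))"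
        by (intro integrable_mult_right integrable_test_mult[OF h2_test zs])
      fix y
      \<comment> \<open>On the support of the bump h_j >= h_J > 1/2, hence 4 h_j^2 > 1, with the
        same J for all later j.\<close>
      have "\<zeta> y \<le> 4 * B * (h j y)\<^sup>2"
      proof (cases "y \<in> tsupp \<zeta>")
        case True
        then have "1 / 2 < h J y" using z(4) by (auto simp: W_def)
        also have "h J y \<le> h j y" using incseqD[OF h_incseq j(2)] .
        finally have "(1 / 2)\<^sup>2 \<le> (h j y)\<^sup>2" by (intro power_mono) auto
        then have "B * 1 \<le> B * (4 * (h j y)\<^sup>2)" using B(1) by (intro mult_left_mono) (auto simp: power2_eq_square)
        then show ?thesis using B(2)[of y] by simp
      next
        case False
        then show ?thesis using B(1) by (simp add: tsupp_outside)
      qed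
      from mult_right_mono[OF this spos_nonneg[of "w t y"]]
      show "\<zeta> y * spos (w t y) \<le> 4 * B * ((h j y)\<^sup>2 * spos (w t y))"
        by (simp add: mult.assoc)
    qed
    also have "\<dots> = 4 * B * energy j t" by (simp add: energy_def)
    also have "\<dots> \<le> 4 * B * ((1 + M)\<^sup>2 * e * C * (t - \<eta>))"
      using energy_le[OF t j(1) e] B(1) by (intro mult_left_mono) auto
    finally show ?thesis .
  qed
  have "(\<integral>y. \<zeta> y * spos (w t y) \<partial>\<mu>) \<le> 0"
  proof (rule tendsto_lowerbound)
    show "((\<lambda>e. 4 * B * ((1 + M)\<^sup>2 * e * C * (t - \<eta>))) \<longlongrightarrow> 0) (at_right 0)"
      by (auto intro!: tendsto_eq_intros)
    show "\<forall>\<^sub>F e in at_right 0. (\<integral>y. \<zeta> y * spos (w t y) \<partial>\<mu>) \<le> 4 * B * ((1 + M)\<^sup>2 * e * C * (t - \<eta>))"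
      using le by (auto simp: eventually_at_filter)
  qed simp
  moreover have "(\<integral>y. \<zeta> y * spos (w t y) \<partial>\<mu>) \<ge> 0"
    using z(2) spos_nonneg by (intro integral_nonneg_AE) auto
  ultimately have "\<zeta> x * spos (w t x) = 0"
    using z(2) spos_nonneg
    by (intro continuous_nonneg_integral_0[OF _ zi]) (auto intro!: continuous_intros zs
        smooth_fun_continuous[OF test_fun_smooth[OF z(1)]])
  then show False using z(3) spos_pos[OF wx] by simp
qed

end

end

section \<open>Smooth functions with parameters\<close>

lemma pd_linear_sum:
  assumes "(f has_derivative (\<lambda>v. pd v f u)) (at u)"
  shows "pd v f u = (\<Sum>i\<in>Basis. (v \<bullet> i) *\<^sub>R pd i f u)"
proof -
  interpret linear "\<lambda>v. pd v f u" by (rule has_derivative_linear[OF assms])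
  have "pd v f u = pd (\<Sum>i\<in>Basis. (v \<bullet> i) *\<^sub>R i) f u" by (simp add: euclidean_representation)
  also have "\<dots> = (\<Sum>i\<in>Basis. (v \<bullet> i) *\<^sub>R pd i f u)" by (simp add: sum scale)
  finally show ?thesis .
qed

text \<open>Regularity in the parameter only: derivatives are taken in \<open>z\<close>, and in the
  variable to be integrated joint continuity is all that is asked. No coordinates are needed on the
  second factor.\<close>

primrec par_Ck :: "nat \<Rightarrow> 'z::euclidean_space set \<Rightarrow> ('z \<Rightarrow> 'a::topological_space \<Rightarrow> real) \<Rightarrow> bool" where
  "par_Ck 0 S k \<longleftrightarrow> continuous_on (S \<times> UNIV) (\<lambda>(z, y). k z y)"
| "par_Ck (Suc n) S k \<longleftrightarrow> continuous_on (S \<times> UNIV) (\<lambda>(z, y). k z y) \<and>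
    (\<forall>y. (\<lambda>z. k z y) differentiable_on S) \<and>
    (\<forall>i\<in>Basis. par_Ck n S (\<lambda>z y. pd i (\<lambda>z. k z y) z))"

lemma par_Ck_continuous: "par_Ck n S k \<Longrightarrow> continuous_on (S \<times> UNIV) (\<lambda>(z, y). k z y)"
  by (cases n) auto

text \<open>Differentiating under the integral produces an integral of the same kind, with
  \<open>k\<close> replaced by its parameter derivative and the same test function. The compact
  support supplies the domination.\<close>

lemma (in measured_mfd) Ck_on_par_integral:
  fixes k :: "'z::euclidean_space \<Rightarrow> 'a \<Rightarrow> real"
  assumes "open S" "test_fun A f" "par_Ck n S k"
  shows "Ck_on n S (\<lambda>z. \<integral>y. k z y * f y \<partial>\<mu>)"
  using assms(3)
proof (induction n arbitrary: k)
  have K: "compact (tsupp f)" "tsupp f \<in> sets \<mu>" "emeasure \<mu> (tsupp f) < \<infinity>"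
    using test_fun_compact[OF assms(2)] compact_sets compact_finite_measure by auto
  have cont: "continuous_on (S \<times> tsupp f) (\<lambda>(z, y). k z y * f y)"
    if "continuous_on (S \<times> UNIV) (\<lambda>(z, y). k z y)" for k :: "'z \<Rightarrow> 'a \<Rightarrow> real"
  proof -
    have "continuous_on (S \<times> tsupp f) (\<lambda>p. k (fst p) (snd p))"
      using continuous_on_subset[OF that, of "S \<times> tsupp f"] by (auto simp: case_prod_beta)
    moreover have "continuous_on (S \<times> tsupp f) (\<lambda>p. f (snd p))"
      by (rule continuous_on_compose2[OF smooth_fun_continuous[OF test_fun_smooth[OF assms(2)], of UNIV]
            continuous_on_snd[OF continuous_on_id]]) auto
    ultimately show ?thesis by (auto simp: case_prod_beta intro!: continuous_intros)
  qed
  have int: "integrable \<mu> (\<lambda>y. k z y * f y)"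
    if "continuous_on (S \<times> UNIV) (\<lambda>(z, y). k z y)" "z \<in> S" for z and k :: "'z \<Rightarrow> 'a \<Rightarrow> real"
  proof -
    have "continuous_on UNIV (k z)"
      by (rule continuous_on_compose2[OF that(1), of _ "\<lambda>y. (z, y)", simplified])
        (use that(2) in \<open>auto intro!: continuous_intros\<close>)
    from integrable_test_mult[OF assms(2) this] show ?thesis by (simp add: mult.commute)
  qed
  have off: "k z y * f y = 0" if "y \<notin> tsupp f" for k :: "'z \<Rightarrow> 'a \<Rightarrow> real" and z y
    using tsupp_outside[OF that] by simp
  {
    case 0
    then show ?case
      by (simp, intro continuous_on_integral_compact[OF K assms(1)] int cont off) auto
  next
    case (Suc n)
    let ?D = "\<lambda>i z y. pd i (\<lambda>z. k z y) z"
    have kc: "continuous_on (S \<times> UNIV) (\<lambda>(z, y). k z y)"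
      and kd: "\<And>y. (\<lambda>z. k z y) differentiable_on S"
      and Dp: "\<And>i. i \<in> Basis \<Longrightarrow> par_Ck n S (?D i)"
      using Suc.prems by auto
    have D: "((\<lambda>z. \<integral>y. k z y * f y \<partial>\<mu>) has_derivative
        (\<lambda>v. \<Sum>i\<in>Basis. (v \<bullet> i) * (\<integral>y. ?D i z y * f y \<partial>\<mu>))) (at z)" if z: "z \<in> S" for z
    proof (rule has_derivative_integral_compact[OF K assms(1) z])
      fix z y assume z: "z \<in> S"
      have d: "((\<lambda>z. k z y) has_derivative (\<lambda>v. pd v (\<lambda>z. k z y) z)) (at z)"
        by (rule differentiable_onD_open[OF kd assms(1) z])
      show "((\<lambda>z. k z y * f y) has_derivative (\<lambda>v. \<Sum>i\<in>Basis. (v \<bullet> i) * (?D i z y * f y))) (at z)"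
        by (rule has_derivative_eq_rhs[OF has_derivative_mult_left[OF d]])
          (subst pd_linear_sum[OF d], simp add: sum_distrib_right mult.assoc)
    qed (use par_Ck_continuous[OF Dp] in \<open>auto intro!: int cont kc simp: tsupp_outside\<close>)
    have pd: "pd i (\<lambda>z. \<integral>y. k z y * f y \<partial>\<mu>) z = (\<integral>y. ?D i z y * f y \<partial>\<mu>)"
      if "z \<in> S" "i \<in> Basis" for z i
      using pd_eq[OF D[OF that(1)], of i] that(2)
      by (simp add: inner_Basis if_distrib[of "\<lambda>c. c * _"] cong: if_cong)
    show ?case unfolding Ck_on.simps
    proof (intro conjI ballI)
      show "(\<lambda>z. \<integral>y. k z y * f y \<partial>\<mu>) differentiable_on S"
        by (rule has_derivative_imp_differentiable_on[OF D])
      fix i :: 'z assume i: "i \<in> Basis"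
      show "Ck_on n S (pd i (\<lambda>z. \<integral>y. k z y * f y \<partial>\<mu>))"
        by (rule Ck_on_cong_open[OF assms(1) Suc.IH[OF Dp[OF i]]]) (simp add: pd[OF _ i])
    qed
  }
qed

lemma slice_has_derivative:
  fixes F :: "'z::euclidean_space \<times> 'w::euclidean_space \<Rightarrow> real"
  assumes "(F has_derivative F') (at (z, w))"
  shows "((\<lambda>z. F (z, w)) has_derivative (\<lambda>v. F' (v, 0))) (at z)"
    "((\<lambda>w. F (z, w)) has_derivative (\<lambda>v. F' (0, v))) (at w)"
proof -
  have "((\<lambda>z. (z, w)) has_derivative (\<lambda>v. (v, 0))) (at z)"
    by (auto intro!: derivative_eq_intros)
  from has_derivative_compose[OF this assms]
  show "((\<lambda>z. F (z, w)) has_derivative (\<lambda>v. F' (v, 0))) (at z)" .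
  have "((\<lambda>w. (z, w)) has_derivative (\<lambda>v. (0, v))) (at w)"
    by (auto intro!: derivative_eq_intros)
  from has_derivative_compose[OF this assms]
  show "((\<lambda>w. F (z, w)) has_derivative (\<lambda>v. F' (0, v))) (at w)" .
qed

text \<open>A derivative in the parameter alone is the joint derivative in the basis direction (i,
  0), so smoothness in product charts passes to the mixed setting one order at a time.\<close>

lemma (in smooth_mfd) par_CkI:
  fixes k :: "'z::euclidean_space \<Rightarrow> 'a \<Rightarrow> real"
  assumes "open S" "\<And>V \<psi>. (V, \<psi>) \<in> A \<Longrightarrow> Ck_on n (S \<times> \<psi> ` V) (\<lambda>(z, v). k z (inv_into V \<psi> v))"
  shows "par_Ck n S k"
  using assms(2)
proof (induction n arbitrary: k)
  have o: "open (S \<times> \<psi> ` V)" if "(V, \<psi>) \<in> A" for V \<psi>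
    using assms(1) chart(2)[OF that] by (rule open_Times)
  have cont: "continuous_on (S \<times> UNIV) (\<lambda>(z, y). k z y)"
    if k: "\<And>V \<psi>. (V, \<psi>) \<in> A \<Longrightarrow> Ck_on 0 (S \<times> \<psi> ` V) (\<lambda>(z, v). k z (inv_into V \<psi> v))"
    for k :: "'z \<Rightarrow> 'a \<Rightarrow> real"
  proof (rule continuous_at_imp_continuous_on, clarify)
    fix z y assume z: "z \<in> S"
    obtain V \<psi> where V: "(V, \<psi>) \<in> A" "y \<in> V" by (rule chart_at)
    have "continuous_on (S \<times> V) (\<lambda>p. (fst p, \<psi> (snd p)))"
      by (intro continuous_intros continuous_on_compose2[OF chart_continuous[OF V(1)]]) auto
    then have "continuous_on (S \<times> V) (\<lambda>p. (\<lambda>(z, v). k z (inv_into V \<psi> v)) (fst p, \<psi> (snd p)))"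
      by (rule continuous_on_compose2[OF k[OF V(1), simplified]]) auto
    then have "continuous_on (S \<times> V) (\<lambda>(z, y). k z y)"
      by (rule continuous_on_eq) (use chart_inv[OF V(1)] in auto)
    then show "isCont (\<lambda>(z, y). k z y) (z, y)"
      using continuous_on_eq_continuous_at[OF open_Times[OF assms(1) chart(1)[OF V(1)]]] z V(2) by blast
  qed
  {
    case 0
    then show ?case using cont by simp
  next
    case (Suc n)
    have D: "((\<lambda>z. k z (inv_into V \<psi> v)) has_derivative
        (\<lambda>u. pd (u, 0) (\<lambda>(z, v). k z (inv_into V \<psi> v)) (z, v))) (at z)"
      if "(V, \<psi>) \<in> A" "z \<in> S" "v \<in> \<psi> ` V" for V \<psi> z v
    proof -
      have "(\<lambda>(z, v). k z (inv_into V \<psi> v)) differentiable_on (S \<times> \<psi> ` V)"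
        using Suc.prems[OF that(1)] by simp
      from slice_has_derivative(1)[OF differentiable_onD_open[OF this o[OF that(1)], of "(z, v)"]] that
      show ?thesis by simp
    qed
    show ?case unfolding par_Ck.simps
    proof (intro conjI allI ballI)
      show "continuous_on (S \<times> UNIV) (\<lambda>(z, y). k z y)"
        by (rule cont) (use Suc.prems in \<open>auto intro: differentiable_imp_continuous_on\<close>)
      fix y
      obtain V \<psi> where V: "(V, \<psi>) \<in> A" "y \<in> V" by (rule chart_at)
      show "(\<lambda>z. k z y) differentiable_on S"
      proof (rule has_derivative_imp_differentiable_on)
        fix z assume "z \<in> S"
        then show "((\<lambda>z. k z y) has_derivative
            (\<lambda>u. pd (u, 0) (\<lambda>(z, v). k z (inv_into V \<psi> v)) (z, \<psi> y))) (at z)"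
          using D[OF V(1), of z "\<psi> y"] V chart_inv[OF V] by simp
      qed
    next
      fix i :: 'z assume i: "i \<in> Basis"
      show "par_Ck n S (\<lambda>z y. pd i (\<lambda>z. k z y) z)"
      proof (rule Suc.IH)
        fix V \<psi> assume V: "(V, \<psi>) \<in> A"
        show "Ck_on n (S \<times> \<psi> ` V) (\<lambda>(z, v). pd i (\<lambda>z. k z (inv_into V \<psi> v)) z)"
        proof (rule Ck_on_cong_open[OF o[OF V]])
          show "Ck_on n (S \<times> \<psi> ` V) (pd (i, 0) (\<lambda>(z, v). k z (inv_into V \<psi> v)))"
            using Suc.prems[OF V] i by (auto simp: Basis_prod_def)
        next
          fix p assume "p \<in> S \<times> \<psi> ` V"
          then obtain z v where p: "p = (z, v)" "z \<in> S" "v \<in> \<psi> ` V" by auto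
          show "pd (i, 0) (\<lambda>(z, v). k z (inv_into V \<psi> v)) p =
              (case p of (z, v) \<Rightarrow> pd i (\<lambda>z. k z (inv_into V \<psi> v)) z)"
            using pd_eq[OF D[OF V p(2,3)], of i] p(1) by simp
        qed
      qed
    qed
  }
qed

lemma smooth_on_slice:
  fixes F :: "'z::euclidean_space \<times> 'w::euclidean_space \<Rightarrow> real"
  assumes "smooth_on (S \<times> T) F" "open S" "open T" "w \<in> T"
  shows "smooth_on S (\<lambda>z. F (z, w))"
proof (rule smooth_on_compose[where f = "\<lambda>z. (z, w)", OF assms(2) open_Times[OF assms(2,3)] _ _ assms(1)])
  have "smooth_on S (\<lambda>z. (z, 0) + (0, w))"
    by (intro smooth_on_add assms(2) smooth_on_const smooth_on_bounded_linear bounded_linear_Pair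
        bounded_linear_ident bounded_linear_zero)
  then show "smooth_on S (\<lambda>z. (z, w))" by simp
qed (use assms(4) in auto)

lemma pd_slice:
  fixes F :: "'z::euclidean_space \<times> 'w::euclidean_space \<Rightarrow> real"
  assumes "smooth_on (S \<times> T) F" "open S" "open T" "z \<in> S" "w \<in> T"
  shows "pd i (\<lambda>z. F (z, w)) z = pd (i, 0) F (z, w)"
  using slice_has_derivative(1)[OF smooth_on_has_derivative[OF assms(1) open_Times[OF assms(2,3)]], of z w]
    assms(4,5) pd_eq by blast

lemma slice_has_real_derivative:
  fixes F :: "'z::euclidean_space \<times> real \<Rightarrow> real"
  assumes "smooth_on (S \<times> T) F" "open S" "open T" "z \<in> S" "t \<in> T"
  shows "((\<lambda>t. F (z, t)) has_real_derivative pd (0, 1) F (z, t)) (at t)"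
proof -
  have d: "(F has_derivative (\<lambda>v. pd v F (z, t))) (at (z, t))"
    by (rule smooth_on_has_derivative[OF assms(1) open_Times[OF assms(2,3)]]) (use assms in auto)
  interpret linear "\<lambda>v. pd v F (z, t)" by (rule has_derivative_linear[OF d])
  have "(\<lambda>v. pd (0, v) F (z, t)) = (*) (pd (0, 1) F (z, t))"
  proof
    show "pd (0, v) F (z, t) = pd (0, 1) F (z, t) * v" for v
      using scale[of v "(0, 1)"] by (simp add: mult.commute)
  qed
  with slice_has_derivative(2)[OF d] show ?thesis by (simp add: has_field_derivative_def)
qed

text \<open>Differentiate \<open>F (z, t) = F (z, s) + \<integral>\<^sub>s\<^sup>t F2 (z, r) dr\<close> under the integral sign.\<close>

lemma mixed_derivative:
  fixes F F2 :: "'z::euclidean_space \<times> real \<Rightarrow> real"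
  assumes F: "smooth_on (S \<times> {0<..}) F" and F2: "smooth_on (S \<times> {0<..}) F2"
    and "open S" "z \<in> S" "t > 0" "i \<in> Basis"
    and deriv: "\<And>z t. z \<in> S \<Longrightarrow> t > 0 \<Longrightarrow> ((\<lambda>t. F (z, t)) has_real_derivative F2 (z, t)) (at t)"
  shows "((\<lambda>t. pd (i, 0) F (z, t)) has_real_derivative pd (i, 0) F2 (z, t)) (at t)"
proof -
  \<comment> \<open>A base point for the time integral strictly between 0 and t, where everything is
    smooth.\<close>
  define s where "s = t / 2"
  have s: "0 < s" "s < t" using \<open>t > 0\<close> by (auto simp: s_def)
  obtain r where r: "r > 0" "ball z r \<subseteq> S" using assms(3,4) open_contains_ball by blast
  have line: "z + a *\<^sub>R i \<in> S" if "\<bar>a\<bar> < r" for a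
    using r(2) that \<open>i \<in> Basis\<close> by (auto simp: subset_iff dist_norm)
  have i0: "(i, 0::real) \<in> Basis" using \<open>i \<in> Basis\<close> by (simp add: Basis_prod_def)
  have dline: "((\<lambda>a. G (z + a *\<^sub>R i, t')) has_real_derivative pd (i, 0) G (z + a *\<^sub>R i, t')) (at a)"
    if "smooth_on (S \<times> {0<..}) G" "\<bar>a\<bar> < r" "t' > 0" for G :: "'z \<times> real \<Rightarrow> real" and a t'
  proof -
    have d: "(G has_derivative (\<lambda>v. pd v G (z + a *\<^sub>R i, t'))) (at (z + a *\<^sub>R i, t'))"
      by (rule smooth_on_has_derivative[OF that(1) open_Times[OF assms(3)]]) (use line that in auto)
    interpret linear "\<lambda>v. pd v G (z + a *\<^sub>R i, t')" by (rule has_derivative_linear[OF d])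
    have "((\<lambda>a. (z + a *\<^sub>R i, t')) has_derivative (\<lambda>v. v *\<^sub>R (i, 0))) (at a)"
      by (auto intro!: derivative_eq_intros)
    from has_derivative_compose[OF this d]
    have 1: "((\<lambda>a. G (z + a *\<^sub>R i, t')) has_derivative (\<lambda>v. pd (v *\<^sub>R (i, 0)) G (z + a *\<^sub>R i, t'))) (at a)" .
    have "(\<lambda>v. pd (v *\<^sub>R (i, 0)) G (z + a *\<^sub>R i, t')) = (*) (pd (i, 0) G (z + a *\<^sub>R i, t'))"
    proof
      show "pd (v *\<^sub>R (i, 0)) G (z + a *\<^sub>R i, t') = pd (i, 0) G (z + a *\<^sub>R i, t') * v" for v
        using scale[of v "(i, 0)"] by (simp add: mult.commute)
    qed
    with 1 show ?thesis by (simp add: has_field_derivative_def)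
  qed
  have int: "((\<lambda>x. F2 (z', x)) has_integral (F (z', t') - F (z', s))) {s..t'}" if "z' \<in> S" "s \<le> t'" for z' t'
  proof (rule fundamental_theorem_of_calculus[where f = "\<lambda>x. F (z', x)", OF that(2)])
    fix x assume "x \<in> {s..t'}"
    then have "((\<lambda>t. F (z', t)) has_real_derivative F2 (z', x)) (at x within {s..t'})"
      using s(1) by (intro has_field_derivative_at_within[OF deriv[OF that(1)]]) simp
    then show "((\<lambda>x. F (z', x)) has_vector_derivative F2 (z', x)) (at x within {s..t'})"
      by (simp only: has_real_derivative_iff_has_vector_derivative)
  qed
  have c: "continuous_on ({- r / 2..r / 2} \<times> {s..t'}) (\<lambda>(a, x). pd (i, 0) F2 (z + a *\<^sub>R i, x))" for t'
  proof -
    have "continuous_on ({- r / 2..r / 2} \<times> {s..t'}) (\<lambda>p. (z + fst p *\<^sub>R i, snd p))"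
      by (intro continuous_intros)
    then have "continuous_on ({- r / 2..r / 2} \<times> {s..t'}) (\<lambda>p. pd (i, 0) F2 (z + fst p *\<^sub>R i, snd p))"
      by (rule continuous_on_compose2[OF smooth_on_continuous[OF smooth_on_pd[OF F2 i0]]])
        (use line s(1) r(1) in auto)
    then show ?thesis by (simp add: case_prod_beta)
  qed
  \<comment> \<open>Both sides are derivatives at a = 0 of F(z + a i, t') - F(z + a i, s): once
    taken directly, once by the Leibniz rule for the integral of \<open>F2\<close>.\<close>
  have eq: "pd (i, 0) F (z, t') - pd (i, 0) F (z, s) = integral {s..t'} (\<lambda>x. pd (i, 0) F2 (z, x))"
    if t': "s \<le> t'" for t'
  proof -
    have "((\<lambda>a. integral (cbox s t') (\<lambda>x. F2 (z + a *\<^sub>R i, x))) has_field_derivative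
        integral (cbox s t') (\<lambda>x. pd (i, 0) F2 (z + 0 *\<^sub>R i, x))) (at 0 within {- r / 2..r / 2})"
    proof (rule leibniz_rule_field_derivative[where f = "\<lambda>a x. F2 (z + a *\<^sub>R i, x)"
          and fx = "\<lambda>a x. pd (i, 0) F2 (z + a *\<^sub>R i, x)"])
      show "((\<lambda>a. F2 (z + a *\<^sub>R i, x)) has_field_derivative pd (i, 0) F2 (z + a *\<^sub>R i, x)) (at a within {- r / 2..r / 2})"
        if "a \<in> {- r / 2..r / 2}" "x \<in> cbox s t'" for a x
        using that s(1) r(1) by (intro has_field_derivative_at_within[OF dline] F2) auto
      show "(\<lambda>x. F2 (z + a *\<^sub>R i, x)) integrable_on cbox s t'" if "a \<in> {- r / 2..r / 2}" for a
      proof -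
        have "z + a *\<^sub>R i \<in> S" using that r(1) by (intro line) auto
        from int[OF this t'] show ?thesis by auto
      qed
      show "continuous_on ({- r / 2..r / 2} \<times> cbox s t') (\<lambda>(a, x). pd (i, 0) F2 (z + a *\<^sub>R i, x))"
        using c by simp
    qed (use r(1) in auto)
    then have 1: "((\<lambda>a. integral {s..t'} (\<lambda>x. F2 (z + a *\<^sub>R i, x))) has_real_derivative
        integral {s..t'} (\<lambda>x. pd (i, 0) F2 (z, x))) (at 0)"
      using r(1) by (subst (asm) at_within_interior) auto
    have "((\<lambda>a. F (z + a *\<^sub>R i, t') - F (z + a *\<^sub>R i, s)) has_real_derivative
        pd (i, 0) F (z + 0 *\<^sub>R i, t') - pd (i, 0) F (z + 0 *\<^sub>R i, s)) (at 0)"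
      by (intro DERIV_diff dline F) (use r(1) s t' in auto)
    then have "((\<lambda>a. integral {s..t'} (\<lambda>x. F2 (z + a *\<^sub>R i, x))) has_real_derivative
        pd (i, 0) F (z + 0 *\<^sub>R i, t') - pd (i, 0) F (z + 0 *\<^sub>R i, s)) (at 0)"
      by (rule has_field_derivative_transform_within_open[of _ _ _ "{- r<..<r}"])
        (use r(1) int[OF line t'] in \<open>auto intro!: integral_unique[symmetric]\<close>)
    from DERIV_unique[OF this 1] show ?thesis by simp
  qed
  \<comment> \<open>The interval runs up to t + 1 so that t is an interior point and the derivative
    within the interval is a full derivative.\<close>
  have cz: "continuous_on {s..t + 1} (\<lambda>x. pd (i, 0) F2 (z, x))"
    by (rule continuous_on_compose2[OF smooth_on_continuous[OF smooth_on_pd[OF F2 i0]]])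
      (use \<open>z \<in> S\<close> s(1) in \<open>auto intro!: continuous_intros\<close>)
  have "((\<lambda>t'. integral {s..t'} (\<lambda>x. pd (i, 0) F2 (z, x))) has_real_derivative pd (i, 0) F2 (z, t)) (at t within {s..t + 1})"
    by (rule integral_has_real_derivative[OF cz]) (use s in auto)
  then have "((\<lambda>t'. integral {s..t'} (\<lambda>x. pd (i, 0) F2 (z, x)) + pd (i, 0) F (z, s)) has_real_derivative pd (i, 0) F2 (z, t)) (at t)"
    using s by (subst (asm) at_within_interior) (auto intro!: derivative_eq_intros)
  then show ?thesis
  proof (rule has_field_derivative_transform_within_open[of _ _ _ "{s<..}"])
    fix t' assume "t' \<in> {s<..}"
    then show "integral {s..t'} (\<lambda>x. pd (i, 0) F2 (z, x)) + pd (i, 0) F (z, s) = pd (i, 0) F (z, t')"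
      using eq[of t'] by simp
  qed (use s in auto)
qed

section \<open>The heat semigroup on test functions\<close>

lemma l2_product_integrable:
  assumes "f \<in> l2 M" "g \<in> l2 M"
  shows "integrable M (\<lambda>x. f x * g x)"
proof (rule Bochner_Integration.integrable_bound)
  show "integrable M (\<lambda>x. (f x)\<^sup>2 + (g x)\<^sup>2)" using assms by (auto simp: l2_def)
  show "(\<lambda>x. f x * g x) \<in> borel_measurable M" using assms by (auto simp: l2_def)
  have "\<bar>f x * g x\<bar> \<le> (f x)\<^sup>2 + (g x)\<^sup>2" for x
    using sum_squares_bound[of "\<bar>f x\<bar>" "\<bar>g x\<bar>"] by (simp add: abs_mult mult.assoc)
      (smt (verit) mult_nonneg_nonneg abs_ge_zero)
  then show "AE x in M. norm (f x * g x) \<le> norm ((f x)\<^sup>2 + (g x)\<^sup>2)" by simp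
qed

lemma l2_linear:
  assumes "f \<in> l2 M" "g \<in> l2 M"
  shows "(\<lambda>x. a * f x + b * g x) \<in> l2 M"
proof -
  have "integrable M (\<lambda>x. a\<^sup>2 * (f x)\<^sup>2 + b\<^sup>2 * (g x)\<^sup>2 + 2 * a * b * (f x * g x))"
    using assms l2_product_integrable[OF assms] by (auto simp: l2_def)
  also have "(\<lambda>x. a\<^sup>2 * (f x)\<^sup>2 + b\<^sup>2 * (g x)\<^sup>2 + 2 * a * b * (f x * g x)) = (\<lambda>x. (a * f x + b * g x)\<^sup>2)"
    by (auto simp: power2_eq_square algebra_simps)
  finally show ?thesis using assms by (auto simp: l2_def)
qed

lemma l2_diff: "f \<in> l2 M \<Longrightarrow> g \<in> l2 M \<Longrightarrow> (\<lambda>x. f x - g x) \<in> l2 M"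
  using l2_linear[of f M g 1 "-1"] by simp

lemma l2_cauchy_schwarz:
  assumes "f \<in> l2 M" "g \<in> l2 M"
  shows "\<bar>\<integral>x. f x * g x \<partial>M\<bar> \<le> l2_norm M f * l2_norm M g"
proof -
  have i: "integrable M (\<lambda>x. (f x)\<^sup>2)" "integrable M (\<lambda>x. (g x)\<^sup>2)" "integrable M (\<lambda>x. f x * g x)"
    using assms l2_product_integrable[OF assms] by (auto simp: l2_def)
  have "(\<integral>x. f x * g x \<partial>M)\<^sup>2 \<le> (\<integral>x. (f x)\<^sup>2 \<partial>M) * (\<integral>x. (g x)\<^sup>2 \<partial>M)"
  proof (rule real_bilinear_discriminant)
    fix r :: real
    have "0 \<le> (\<integral>x. (f x + r * g x)\<^sup>2 \<partial>M)" by (rule integral_nonneg_AE) simp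
    also have "(\<lambda>x. (f x + r * g x)\<^sup>2) = (\<lambda>x. (f x)\<^sup>2 + 2 * r * (f x * g x) + r\<^sup>2 * (g x)\<^sup>2)"
      by (auto simp: power2_eq_square algebra_simps)
    also have "(\<integral>x. (f x)\<^sup>2 + 2 * r * (f x * g x) + r\<^sup>2 * (g x)\<^sup>2 \<partial>M) =
        (\<integral>x. (f x)\<^sup>2 \<partial>M) + 2 * r * (\<integral>x. f x * g x \<partial>M) + r\<^sup>2 * (\<integral>x. (g x)\<^sup>2 \<partial>M)"
      using i by simp
    finally show "0 \<le> (\<integral>x. (f x)\<^sup>2 \<partial>M) + 2 * r * (\<integral>x. f x * g x \<partial>M) + r\<^sup>2 * (\<integral>x. (g x)\<^sup>2 \<partial>M)" .
  qed
  from real_sqrt_le_mono[OF this] show ?thesis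
    by (simp add: l2_norm_def l2_inner_def real_sqrt_mult power2_eq_square real_sqrt_abs2)
qed

lemma l2_norm_nonneg: "l2_norm M f \<ge> 0"
  unfolding l2_norm_def l2_inner_def by (auto intro!: integral_nonneg_AE)

lemma l2_norm_cong_AE:
  assumes "f \<in> borel_measurable M" "g \<in> borel_measurable M" "AE x in M. f x = g x"
  shows "l2_norm M f = l2_norm M g"
proof -
  have "(\<integral>x. f x * f x \<partial>M) = (\<integral>x. g x * g x \<partial>M)"
    by (rule integral_cong_AE) (use assms in auto)
  then show ?thesis by (simp add: l2_norm_def l2_inner_def)
qed

context measured_mfd
begin

lemma test_fun_l2: "test_fun A f \<Longrightarrow> f \<in> l2 \<mu>"
  using integrable_test[OF test_fun_mult(1), of f f]
  by (auto simp: l2_def power2_eq_square intro!: continuous_measurable smooth_fun_continuous test_fun_smooth)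

lemma continuous_on_time_chart:
  fixes W :: "real \<Rightarrow> 'a \<Rightarrow> real"
  assumes "\<And>U \<phi>. (U, \<phi>) \<in> A \<Longrightarrow> continuous_on (\<phi> ` U \<times> {0<..}) (\<lambda>(u, t). W t (inv_into U \<phi> u))"
  shows "continuous_on ({0<..} \<times> UNIV) (\<lambda>(t, x). W t x)"
proof (rule continuous_at_imp_continuous_on, clarify)
  fix t :: real and x assume t: "0 < t"
  obtain U \<phi> where c: "(U, \<phi>) \<in> A" "x \<in> U" by (rule chart_at)
  have "continuous_on ({0<..} \<times> U) (\<lambda>p. (\<phi> (snd p), fst p))"
    by (intro continuous_intros continuous_on_compose2[OF chart_continuous[OF c(1)]]) auto
  then have "continuous_on ({0<..} \<times> U) (\<lambda>p. (\<lambda>(u, t). W t (inv_into U \<phi> u)) (\<phi> (snd p), fst p))"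
    by (rule continuous_on_compose2[OF assms[OF c(1)]]) auto
  then have "continuous_on ({0<..} \<times> U) (\<lambda>(t, x). W t x)"
    by (rule continuous_on_eq) (use chart_inv[OF c(1)] in auto)
  then show "isCont (\<lambda>(t, x). W t x) (t, x)"
    using continuous_on_eq_continuous_at[OF open_Times[OF open_greaterThan chart(1)[OF c(1)]]] t c(2) by blast
qed

end

section \<open>The heat kernel, joint smoothness and the pointwise heat equation\<close>

locale heat_diffusion = exhausted_diffusion A L \<mu> h
  for A :: "('a::{t2_space, second_countable_topology}, 'e::euclidean_space) atlas" and L and \<mu> and h +
  fixes p :: "'a \<Rightarrow> 'a \<Rightarrow> real \<Rightarrow> real"
  assumes kernel: "heat_kernel A \<mu> L p"
    and mass: "\<And>t x. t > 0 \<Longrightarrow> (\<integral>y. p x y t \<partial>\<mu>) = 1"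
begin

abbreviation "P \<equiv> heat \<mu> p"

lemma P_eq: "t > 0 \<Longrightarrow> P t f x = (\<integral>y. p x y t * f y \<partial>\<mu>)"
  by (simp add: heat_def)

lemmas kernel_parts = kernel[unfolded heat_kernel_def]

lemma kernel_smooth:
  assumes "(U, \<phi>) \<in> A" "(V, \<psi>) \<in> A"
  shows "smooth_on (\<phi> ` U \<times> \<psi> ` V \<times> {0<..}) (\<lambda>(u, v, t). p (inv_into U \<phi> u) (inv_into V \<psi> v) t)"
  using bspec[OF bspec[OF conjunct1[OF kernel_parts] assms(1), unfolded prod.case] assms(2), unfolded prod.case] .

lemma p_pos: "t > 0 \<Longrightarrow> p x y t > 0"
  using conjunct1[OF conjunct2[OF kernel_parts]] by blast

lemma p_sym: "t > 0 \<Longrightarrow> p x y t = p y x t"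
  using conjunct1[OF conjunct2[OF kernel_parts]] by blast

lemma p_l2: "f \<in> l2 \<mu> \<Longrightarrow> t > 0 \<Longrightarrow> integrable \<mu> (\<lambda>y. p x y t * f y)"
  using conjunct1[OF conjunct2[OF conjunct2[OF kernel_parts]]] by blast

lemma semigroup: "l2_semigroup \<mu> P"
  using conjunct1[OF conjunct2[OF conjunct2[OF conjunct2[OF kernel_parts]]]] .

lemma generator_eq: "generator \<mu> P = graph_closure \<mu> (test_graph A L)"
  using conjunct2[OF conjunct2[OF conjunct2[OF conjunct2[OF kernel_parts]]]] .

lemma P_l2: "t \<ge> 0 \<Longrightarrow> f \<in> l2 \<mu> \<Longrightarrow> P t f \<in> l2 \<mu>"
  using conjunct1[OF semigroup[unfolded l2_semigroup_def]] by blast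

lemma P_bounded:
  assumes "t \<ge> 0" obtains C where "\<And>f. f \<in> l2 \<mu> \<Longrightarrow> l2_norm \<mu> (P t f) \<le> C * l2_norm \<mu> f"
  using conjunct1[OF conjunct2[OF conjunct2[OF semigroup[unfolded l2_semigroup_def]]]] assms by blast

lemma P_semigroup:
  "s \<ge> 0 \<Longrightarrow> t \<ge> 0 \<Longrightarrow> f \<in> l2 \<mu> \<Longrightarrow> AE x in \<mu>. P (s + t) f x = P s (P t f) x"
  using conjunct1[OF conjunct2[OF conjunct2[OF conjunct2[OF conjunct2[OF semigroup[unfolded l2_semigroup_def]]]]]]
  by blast

text \<open>The semigroup axioms give linearity almost everywhere; the kernel gives it at every
  point.\<close>

lemma P_linear:
  assumes "t > 0" "f \<in> l2 \<mu>" "g \<in> l2 \<mu>"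
  shows "P t (\<lambda>x. a * f x + b * g x) x = a * P t f x + b * P t g x"
proof -
  have "(\<integral>y. p x y t * (a * f y + b * g y) \<partial>\<mu>) = (\<integral>y. a * (p x y t * f y) + b * (p x y t * g y) \<partial>\<mu>)"
    by (rule Bochner_Integration.integral_cong) (auto simp: algebra_simps)
  also have "\<dots> = a * P t f x + b * P t g x"
    using p_l2[OF assms(2,1), of x] p_l2[OF assms(3,1), of x] assms(1) by (simp add: P_eq)
  finally show ?thesis using assms(1) by (simp add: P_eq)
qed

text \<open>The integral of a non-integrable function is 0 by convention, so total mass 1 already
  implies integrability.\<close>

lemma p_integrable: "t > 0 \<Longrightarrow> integrable \<mu> (\<lambda>y. p x y t)"
  using mass[of t x] not_integrable_integral_eq by fastforce

text \<open>The chart point and the time together form the parameter, and \<open>y\<close> is left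
  for integration; this yields smoothness of \<open>P t f\<close> jointly in space and time.\<close>

lemma kernel_par_Ck:
  assumes "(U, \<phi>) \<in> A"
  shows "par_Ck n (\<phi> ` U \<times> {0<..}) (\<lambda>z y. p (inv_into U \<phi> (fst z)) y (snd z))"
proof (rule par_CkI)
  show "open (\<phi> ` U \<times> {0::real<..})" using chart(2)[OF assms] by (intro open_Times) auto
  fix V \<psi> assume V: "(V, \<psi>) \<in> A"
  have "smooth_on ((\<phi> ` U \<times> {0<..}) \<times> \<psi> ` V)
     (\<lambda>q. (\<lambda>(u, v, t). p (inv_into U \<phi> u) (inv_into V \<psi> v) t) (fst (fst q), snd q, snd (fst q)))"
  proof (rule smooth_on_compose[OF _ _ _ _ kernel_smooth[OF assms V]])
    show "open ((\<phi> ` U \<times> {0::real<..}) \<times> \<psi> ` V)" "open (\<phi> ` U \<times> \<psi> ` V \<times> {0::real<..})"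
      using chart(2)[OF assms] chart(2)[OF V] by (auto intro!: open_Times)
    show "smooth_on ((\<phi> ` U \<times> {0::real<..}) \<times> \<psi> ` V) (\<lambda>q. (fst (fst q), snd q, snd (fst q)))"
      by (intro smooth_on_bounded_linear bounded_linear_Pair bounded_linear_fst_comp bounded_linear_snd_comp
          bounded_linear_fst bounded_linear_snd)
  qed auto
  then show "Ck_on n ((\<phi> ` U \<times> {0<..}) \<times> \<psi> ` V)
      (\<lambda>(z, v). p (inv_into U \<phi> (fst z)) (inv_into V \<psi> v) (snd z))"
    by (simp add: smooth_on_def case_prod_beta')
qed

lemma P_joint_smooth:
  assumes "(U, \<phi>) \<in> A" "test_fun A f"
  shows "smooth_on (\<phi> ` U \<times> {0<..}) (\<lambda>(u, t). P t f (inv_into U \<phi> u))"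
proof -
  have o: "open (\<phi> ` U \<times> {0::real<..})" using chart(2)[OF assms(1)] by (intro open_Times) auto
  have "smooth_on (\<phi> ` U \<times> {0<..}) (\<lambda>z. \<integral>y. p (inv_into U \<phi> (fst z)) y (snd z) * f y \<partial>\<mu>)"
    unfolding smooth_on_def using Ck_on_par_integral[OF o assms(2) kernel_par_Ck[OF assms(1)]] by blast
  then show ?thesis
    by (rule smooth_on_cong_open[OF o]) (auto simp: P_eq)
qed

lemma P_smooth:
  assumes "t > 0" "test_fun A f" shows "smooth_fun A (P t f)"
  unfolding smooth_fun_def
proof clarify
  fix U \<phi> assume c: "(U, \<phi>) \<in> A"
  show "smooth_on (\<phi> ` U) (P t f \<circ> inv_into U \<phi>)"
    using smooth_on_slice[OF P_joint_smooth[OF c assms(2)] chart(2)[OF c] open_greaterThan, of t] assms(1)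
    by (simp add: o_def)
qed

lemma P_joint_continuous:
  assumes "test_fun A f" shows "continuous_on ({0<..} \<times> UNIV) (\<lambda>(t, x). P t f x)"
  by (rule continuous_on_time_chart) (rule smooth_on_continuous[OF P_joint_smooth[OF _ assms]])

text \<open>At time 0 the quotient converges because a test function lies in the domain of the
  generator. Applying the bounded operator \<open>P t\<close> carries this to time t, with limit
  \<open>P t (L f)\<close>.\<close>

lemma P_test_limit:
  assumes t: "t > 0" and f: "test_fun A f"
  shows "((\<lambda>r. l2_norm \<mu> (\<lambda>x. (P (t + r) f x - P t f x) / r - P t (L f) x)) \<longlongrightarrow> 0) (at_right 0)"
proof -
  have f2: "f \<in> l2 \<mu>" "L f \<in> l2 \<mu>" using f test_fun_L by (auto intro: test_fun_l2)
  define Q where "Q = (\<lambda>r x. (P r f x - f x) / r - L f x)"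
  have Q_eq: "Q r = (\<lambda>x. 1 / r * (1 * P r f x + (-1) * f x) + (-1) * L f x)" for r
    by (auto simp: Q_def)
  have Q2: "Q r \<in> l2 \<mu>" if "r > 0" for r
    unfolding Q_eq using that f2 by (intro l2_linear P_l2) auto
  \<comment> \<open>The constant sequence witnesses membership in the closure.\<close>
  have "(f, L f) \<in> graph_closure \<mu> (test_graph A L)"
    unfolding graph_closure_def using f f2
    by (auto intro!: exI[of _ "\<lambda>_. (f, L f)"] simp: test_graph_def l2_norm_def l2_inner_def)
  then have lim: "((\<lambda>r. l2_norm \<mu> (Q r)) \<longlongrightarrow> 0) (at_right 0)"
    unfolding generator_eq[symmetric] generator_def Q_def by simp
  obtain C where C: "\<And>f. f \<in> l2 \<mu> \<Longrightarrow> l2_norm \<mu> (P t f) \<le> C * l2_norm \<mu> f"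
    using P_bounded[of t] t by auto
  have eq: "l2_norm \<mu> (\<lambda>x. (P (t + r) f x - P t f x) / r - P t (L f) x) = l2_norm \<mu> (P t (Q r))"
    if r: "r > 0" for r
  proof (rule l2_norm_cong_AE)
    have "(\<lambda>x. 1 / r * (1 * P (t + r) f x + (-1) * P t f x) + (-1) * P t (L f) x) \<in> l2 \<mu>"
      using t r f2 by (intro l2_linear P_l2) auto
    then show "(\<lambda>x. (P (t + r) f x - P t f x) / r - P t (L f) x) \<in> borel_measurable \<mu>"
      by (simp add: l2_def)
    show "P t (Q r) \<in> borel_measurable \<mu>" using P_l2[OF _ Q2[OF r], of t] t by (simp add: l2_def)
    have PQ: "P t (Q r) x = 1 / r * (1 * P t (P r f) x + (-1) * P t f x) + (-1) * P t (L f) x" for x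
      unfolding Q_eq using r t f2
      by (subst P_linear[OF t _ f2(2)], auto intro!: l2_diff P_l2 l2_linear[where a = 1 and b = "-1", simplified])
        (subst P_linear[OF t _ f2(1), where a = 1 and b = "-1", simplified], auto intro: P_l2)
    show "AE x in \<mu>. (P (t + r) f x - P t f x) / r - P t (L f) x = P t (Q r) x"
      using P_semigroup[OF less_imp_le[OF t] less_imp_le[OF r] f2(1)]
      by eventually_elim (simp add: PQ)
  qed
  show ?thesis
  proof (rule tendsto_sandwich[OF _ _ tendsto_const])
    show "\<forall>\<^sub>F r in at_right 0. 0 \<le> l2_norm \<mu> (\<lambda>x. (P (t + r) f x - P t f x) / r - P t (L f) x)"
      by (simp add: l2_norm_nonneg)
    show "\<forall>\<^sub>F r in at_right 0. l2_norm \<mu> (\<lambda>x. (P (t + r) f x - P t f x) / r - P t (L f) x) \<le> C * l2_norm \<mu> (Q r)"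
      by (rule eventually_at_rightI[of 0 1]) (auto simp: eq intro: C Q2)
    show "((\<lambda>r. C * l2_norm \<mu> (Q r)) \<longlongrightarrow> 0) (at_right 0)"
      using tendsto_mult_right_zero[OF lim] .
  qed
qed

lemma l2_limit_pairing:
  assumes "\<zeta> \<in> l2 \<mu>" "\<forall>\<^sub>F r in F. g r \<in> l2 \<mu>" "((\<lambda>r. l2_norm \<mu> (g r)) \<longlongrightarrow> 0) F"
  shows "((\<lambda>r. \<integral>x. \<zeta> x * g r x \<partial>\<mu>) \<longlongrightarrow> 0) F"
proof (rule Lim_null_comparison)
  show "\<forall>\<^sub>F r in F. norm (\<integral>x. \<zeta> x * g r x \<partial>\<mu>) \<le> l2_norm \<mu> \<zeta> * l2_norm \<mu> (g r)"
    using assms(2) by eventually_elim (simp add: l2_cauchy_schwarz assms(1))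
  show "((\<lambda>r. l2_norm \<mu> \<zeta> * l2_norm \<mu> (g r)) \<longlongrightarrow> 0) F"
    using tendsto_mult_right_zero[OF assms(3)] .
qed

text \<open>Writing P_(t+r) f as P_r applied to \<open>P t f\<close> shows that \<open>P t f\<close>
  is in the domain of the generator, with image \<open>P t (L f)\<close>. The generator is the
  closure of \<open>L\<close> on test functions, so approximating test functions F n exist; moving
  \<open>L\<close> onto a fixed test function identifies the image weakly with
  \<open>L (P t f)\<close>, and both sides are continuous.\<close>

lemma L_P:
  assumes t: "t > 0" and f: "test_fun A f"
  shows "L (P t f) x = P t (L f) x"
proof -
  have f2: "f \<in> l2 \<mu>" "L f \<in> l2 \<mu>" using f test_fun_L by (auto intro: test_fun_l2)
  have Pf2: "P t f \<in> l2 \<mu>" "P t (L f) \<in> l2 \<mu>" using t f2 by (auto intro: P_l2)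
  have "((\<lambda>r. l2_norm \<mu> (\<lambda>x. (P r (P t f) x - P t f x) / r - P t (L f) x)) \<longlongrightarrow> 0) (at_right 0)"
  proof (rule Lim_transform_eventually[OF P_test_limit[OF t f]])
    show "\<forall>\<^sub>F r in at_right 0. l2_norm \<mu> (\<lambda>x. (P (t + r) f x - P t f x) / r - P t (L f) x)
        = l2_norm \<mu> (\<lambda>x. (P r (P t f) x - P t f x) / r - P t (L f) x)"
    proof (rule eventually_at_rightI[of 0 1])
      fix r :: real assume "r \<in> {0<..<1}"
      then have r: "r > 0" by simp
      have m: "P (t + r) f \<in> borel_measurable \<mu>" "P r (P t f) \<in> borel_measurable \<mu>"
        "P t f \<in> borel_measurable \<mu>" "P t (L f) \<in> borel_measurable \<mu>"
        using P_l2[of "t + r" f] P_l2[of r "P t f"] Pf2 t r f2 by (auto simp: l2_def)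
      have "AE x in \<mu>. P (r + t) f x = P r (P t f) x" using t r f2 by (intro P_semigroup) auto
      then show "l2_norm \<mu> (\<lambda>x. (P (t + r) f x - P t f x) / r - P t (L f) x)
        = l2_norm \<mu> (\<lambda>x. (P r (P t f) x - P t f x) / r - P t (L f) x)"
        using m by (intro l2_norm_cong_AE) (auto simp: add.commute)
    qed simp
  qed
  then have "(P t f, P t (L f)) \<in> graph_closure \<mu> (test_graph A L)"
    unfolding generator_eq[symmetric] generator_def using Pf2 by simp
  then obtain F where F: "range F \<subseteq> test_graph A L"
    "(\<lambda>n. l2_norm \<mu> (\<lambda>x. fst (F n) x - P t f x)) \<longlonglongrightarrow> 0"
    "(\<lambda>n. l2_norm \<mu> (\<lambda>x. snd (F n) x - P t (L f) x)) \<longlonglongrightarrow> 0"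
    unfolding graph_closure_def by auto
  have Ft: "test_fun A (fst (F n))" "snd (F n) = L (fst (F n))" for n
    using F(1) unfolding test_graph_def by (auto simp: image_subset_iff)
       (metis (mono_tags, lifting) fst_conv snd_conv)+
  have F2: "fst (F n) \<in> l2 \<mu>" "snd (F n) \<in> l2 \<mu>" for n
    using Ft[of n] test_fun_L by (auto intro: test_fun_l2)
  have c: "continuous_on UNIV (\<lambda>x. L (P t f) x - P t (L f) x)"
    using t f by (intro smooth_fun_continuous smooth_fun_diff smooth_fun_L P_smooth test_fun_L)
  have "L (P t f) x - P t (L f) x = 0"
  proof (rule fundamental_lemma[OF open_UNIV c UNIV_I])
    fix \<zeta> assume z: "test_fun A \<zeta>"
    have z2: "\<zeta> \<in> l2 \<mu>" "L \<zeta> \<in> l2 \<mu>" using z test_fun_L by (auto intro: test_fun_l2)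
    have 1: "(\<lambda>n. \<integral>x. \<zeta> x * (snd (F n) x - P t (L f) x) \<partial>\<mu>) \<longlonglongrightarrow> 0"
      by (rule l2_limit_pairing[OF z2(1) always_eventually F(3)]) (auto intro!: l2_diff F2 Pf2)
    have 2: "(\<lambda>n. \<integral>x. L \<zeta> x * (fst (F n) x - P t f x) \<partial>\<mu>) \<longlonglongrightarrow> 0"
      by (rule l2_limit_pairing[OF z2(2) always_eventually F(2)]) (auto intro!: l2_diff F2 Pf2)
    have i: "integrable \<mu> (\<lambda>x. \<zeta> x * g x)" "integrable \<mu> (\<lambda>x. L \<zeta> x * g x)" if "g \<in> l2 \<mu>" for g
      using l2_product_integrable that z2 by auto
    have "(\<integral>x. \<zeta> x * snd (F n) x \<partial>\<mu>) = (\<integral>x. L \<zeta> x * fst (F n) x \<partial>\<mu>)" for n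
      using L_symmetric[OF z test_fun_smooth[OF Ft(1)[of n]]] by (simp add: Ft(2) mult.commute)
    then have eq: "(\<integral>x. \<zeta> x * (snd (F n) x - P t (L f) x) \<partial>\<mu>) - (\<integral>x. L \<zeta> x * (fst (F n) x - P t f x) \<partial>\<mu>)
        = (\<integral>x. L \<zeta> x * P t f x \<partial>\<mu>) - (\<integral>x. \<zeta> x * P t (L f) x \<partial>\<mu>)" for n
      using i(1)[OF F2(2)[of n]] i(2)[OF F2(1)[of n]] i(1)[OF Pf2(2)] i(2)[OF Pf2(1)]
      by (simp add: right_diff_distrib)
    have "(\<integral>x. L \<zeta> x * P t f x \<partial>\<mu>) - (\<integral>x. \<zeta> x * P t (L f) x \<partial>\<mu>) = 0"
      using tendsto_diff[OF 1 2] unfolding eq by (simp add: LIMSEQ_const_iff)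
    moreover have "(\<integral>x. L \<zeta> x * P t f x \<partial>\<mu>) = (\<integral>x. \<zeta> x * L (P t f) x \<partial>\<mu>)"
      using L_symmetric[OF z P_smooth[OF t f]] by (simp add: mult.commute)
    moreover have "(\<integral>x. \<zeta> x * (L (P t f) x - P t (L f) x) \<partial>\<mu>) =
        (\<integral>x. \<zeta> x * L (P t f) x \<partial>\<mu>) - (\<integral>x. \<zeta> x * P t (L f) x \<partial>\<mu>)"
      using integrable_test_mult[OF z smooth_fun_continuous[OF smooth_fun_L[OF P_smooth[OF t f]]]] i(1)[OF Pf2(2)]
      by (simp add: right_diff_distrib)
    ultimately show "(\<integral>x. \<zeta> x * (L (P t f) x - P t (L f) x) \<partial>\<mu>) = 0" by simp
  qed
  then show ?thesis by simp
qed

text \<open>Joint smoothness already provides some time derivative at every point; what remains is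
  its value. Tested against a bump, it is compared with the right-hand quotient, whose L^2 limit is
  known.\<close>

lemma P_has_derivative:
  assumes t: "t > 0" and f: "test_fun A f"
  shows "((\<lambda>s. P s f x) has_real_derivative P t (L f) x) (at t)"
proof -
  \<comment> \<open>Defined by \<open>deriv\<close>, hence independent of charts, although its
    existence and continuity are checked in charts.\<close>
  define V where "V = (\<lambda>t x. deriv (\<lambda>s. P s f x) t)"
  have V: "((\<lambda>s. P s f (inv_into U \<phi> u)) has_real_derivative V t (inv_into U \<phi> u)) (at t)"
      "V t (inv_into U \<phi> u) = pd (0, 1) (\<lambda>(u, t). P t f (inv_into U \<phi> u)) (u, t)"
    if "(U, \<phi>) \<in> A" "u \<in> \<phi> ` U" "t > 0" for U \<phi> u t
  proof -
    have "((\<lambda>s. P s f (inv_into U \<phi> u)) has_real_derivative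
        pd (0, 1) (\<lambda>(u, t). P t f (inv_into U \<phi> u)) (u, t)) (at t)"
      using slice_has_real_derivative[OF P_joint_smooth[OF that(1) f] chart(2)[OF that(1)] open_greaterThan that(2), of t]
        that(3) by simp
    then show "((\<lambda>s. P s f (inv_into U \<phi> u)) has_real_derivative V t (inv_into U \<phi> u)) (at t)"
      "V t (inv_into U \<phi> u) = pd (0, 1) (\<lambda>(u, t). P t f (inv_into U \<phi> u)) (u, t)"
      by (auto simp: V_def DERIV_imp_deriv)
  qed
  have V': "((\<lambda>s. P s f x) has_real_derivative V t x) (at t)" if "t > 0" for t x
  proof -
    obtain U \<phi> where c: "(U, \<phi>) \<in> A" "x \<in> U" by (rule chart_at)
    show ?thesis using V(1)[OF c(1) _ that, of "\<phi> x"] c chart_inv[OF c] by simp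
  qed
  have Vc: "continuous_on ({0<..} \<times> UNIV) (\<lambda>(t, x). V t x)"
  proof (rule continuous_on_time_chart)
    fix U \<phi> assume c: "(U, \<phi>) \<in> A"
    have "continuous_on (\<phi> ` U \<times> {0<..}) (pd (0, 1) (\<lambda>(u, t). P t f (inv_into U \<phi> u)))"
      by (rule smooth_on_continuous[OF smooth_on_pd[OF P_joint_smooth[OF c f]]]) (simp add: Basis_prod_def)
    then show "continuous_on (\<phi> ` U \<times> {0<..}) (\<lambda>(u, t). V t (inv_into U \<phi> u))"
      by (rule continuous_on_eq) (auto simp: V(2)[OF c])
  qed
  have Vs: "continuous_on UNIV (V t)" if "t > 0" for t
    by (rule continuous_on_compose2[OF Vc, of _ "\<lambda>x. (t, x)", simplified])
      (use that in \<open>auto intro!: continuous_intros\<close>)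
  have PLc: "continuous_on UNIV (P t (L f))"
    by (rule smooth_fun_continuous[OF P_smooth[OF t test_fun_L[OF f]]])
  have f2: "f \<in> l2 \<mu>" "L f \<in> l2 \<mu>" using f test_fun_L by (auto intro: test_fun_l2)
  have "V t x - P t (L f) x = 0"
  proof (rule fundamental_lemma[OF open_UNIV _ UNIV_I])
    show "continuous_on UNIV (\<lambda>x. V t x - P t (L f) x)" by (intro continuous_intros Vs[OF t] PLc)
    fix \<zeta> assume z: "test_fun A \<zeta>"
    have K: "compact (tsupp \<zeta>)" "tsupp \<zeta> \<in> sets \<mu>" "emeasure \<mu> (tsupp \<zeta>) < \<infinity>"
      using test_fun_compact[OF z] compact_sets compact_finite_measure by auto
    have "((\<lambda>t. \<integral>x. \<zeta> x * P t f x \<partial>\<mu>) has_derivative (\<lambda>v. \<Sum>i\<in>Basis. (v \<bullet> i) * (\<integral>x. \<zeta> x * V t x \<partial>\<mu>))) (at t)"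
    proof (rule has_derivative_integral_compact[OF K, of "{0<..}"])
      show "continuous_on ({0<..} \<times> tsupp \<zeta>) (\<lambda>(t, x). \<zeta> x * V t x)"
      proof -
        have "continuous_on ({0<..} \<times> tsupp \<zeta>) (\<lambda>q. V (fst q) (snd q))"
          using continuous_on_subset[OF Vc, of "{0<..} \<times> tsupp \<zeta>"] by (auto simp: case_prod_beta)
        moreover have "continuous_on ({0::real<..} \<times> tsupp \<zeta>) (\<lambda>q. \<zeta> (snd q))"
          by (rule continuous_on_compose2[OF smooth_fun_continuous[OF test_fun_smooth[OF z], of UNIV]
                continuous_on_snd[OF continuous_on_id]]) auto
        ultimately show ?thesis by (auto simp: case_prod_beta intro!: continuous_intros)
      qed
      show "((\<lambda>t. \<zeta> x * P t f x) has_derivative (\<lambda>v. \<Sum>i\<in>Basis. v \<bullet> i * (\<zeta> x * V t x))) (at t)"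
        if "t \<in> {0<..}" for t x
      proof -
        have "((\<lambda>t. \<zeta> x * P t f x) has_real_derivative \<zeta> x * V t x) (at t)"
          using that by (intro DERIV_cmult V') simp
        then show ?thesis unfolding has_field_derivative_def
          by (rule has_derivative_eq_rhs) (auto simp: fun_eq_iff mult_ac)
      qed
      show "integrable \<mu> (\<lambda>x. \<zeta> x * P t f x)" if "t \<in> {0<..}" for t
        using that f by (intro integrable_test_mult[OF z] smooth_fun_continuous P_smooth) auto
      show "integrable \<mu> (\<lambda>x. \<zeta> x * V t x)" if "t \<in> {0<..}" for t
        using that by (intro integrable_test_mult[OF z] Vs) auto
    qed (use t in \<open>auto simp: tsupp_outside\<close>)
    then have G: "((\<lambda>t. \<integral>x. \<zeta> x * P t f x \<partial>\<mu>) has_real_derivative (\<integral>x. \<zeta> x * V t x \<partial>\<mu>)) (at t)"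
      unfolding has_field_derivative_def by (rule has_derivative_eq_rhs) (auto simp: fun_eq_iff mult.commute)
    then have G1: "((\<lambda>r. ((\<integral>x. \<zeta> x * P (t + r) f x \<partial>\<mu>) - (\<integral>x. \<zeta> x * P t f x \<partial>\<mu>)) / r) \<longlongrightarrow> (\<integral>x. \<zeta> x * V t x \<partial>\<mu>)) (at_right 0)"
      unfolding DERIV_def by (rule tendsto_within_subset) simp
    have G2: "((\<lambda>r. \<integral>x. \<zeta> x * ((P (t + r) f x - P t f x) / r - P t (L f) x) \<partial>\<mu>) \<longlongrightarrow> 0) (at_right 0)"
    proof (rule l2_limit_pairing[OF test_fun_l2[OF z] _ P_test_limit[OF t f]])
      show "\<forall>\<^sub>F r in at_right 0. (\<lambda>x. (P (t + r) f x - P t f x) / r - P t (L f) x) \<in> l2 \<mu>"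
      proof (rule eventually_at_rightI[of 0 1])
        fix r :: real assume "r \<in> {0<..<1}"
        then have "(\<lambda>x. 1 / r * (1 * P (t + r) f x + (-1) * P t f x) + (-1) * P t (L f) x) \<in> l2 \<mu>"
          using t f2 by (intro l2_linear P_l2) auto
        then show "(\<lambda>x. (P (t + r) f x - P t f x) / r - P t (L f) x) \<in> l2 \<mu>" by simp
      qed simp
    qed
    have zi: "integrable \<mu> (\<lambda>x. \<zeta> x * P s g x)" if "s > 0" "test_fun A g" for s g
      using that by (intro integrable_test_mult[OF z] smooth_fun_continuous P_smooth)
    have "((\<lambda>r. ((\<integral>x. \<zeta> x * P (t + r) f x \<partial>\<mu>) - (\<integral>x. \<zeta> x * P t f x \<partial>\<mu>)) / r - (\<integral>x. \<zeta> x * P t (L f) x \<partial>\<mu>)) \<longlongrightarrow> 0) (at_right 0)"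
    proof (rule Lim_transform_eventually[OF G2])
      show "\<forall>\<^sub>F r in at_right 0. (\<integral>x. \<zeta> x * ((P (t + r) f x - P t f x) / r - P t (L f) x) \<partial>\<mu>) =
         ((\<integral>x. \<zeta> x * P (t + r) f x \<partial>\<mu>) - (\<integral>x. \<zeta> x * P t f x \<partial>\<mu>)) / r - (\<integral>x. \<zeta> x * P t (L f) x \<partial>\<mu>)"
      proof (rule eventually_at_rightI[of 0 1])
        fix r :: real assume "r \<in> {0<..<1}"
        then have r: "t + r > 0" using t by simp
        have "(\<integral>x. \<zeta> x * ((P (t + r) f x - P t f x) / r - P t (L f) x) \<partial>\<mu>) =
          (\<integral>x. 1 / r * (\<zeta> x * P (t + r) f x - \<zeta> x * P t f x) - \<zeta> x * P t (L f) x \<partial>\<mu>)"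
          by (rule Bochner_Integration.integral_cong) (auto simp: algebra_simps diff_divide_distrib)
        then show "(\<integral>x. \<zeta> x * ((P (t + r) f x - P t f x) / r - P t (L f) x) \<partial>\<mu>) =
         ((\<integral>x. \<zeta> x * P (t + r) f x \<partial>\<mu>) - (\<integral>x. \<zeta> x * P t f x \<partial>\<mu>)) / r - (\<integral>x. \<zeta> x * P t (L f) x \<partial>\<mu>)"
          using zi[OF r f] zi[OF t f] zi[OF t test_fun_L[OF f]] by simp
      qed simp
    qed
    moreover have "((\<lambda>r. ((\<integral>x. \<zeta> x * P (t + r) f x \<partial>\<mu>) - (\<integral>x. \<zeta> x * P t f x \<partial>\<mu>)) / r - (\<integral>x. \<zeta> x * P t (L f) x \<partial>\<mu>)) \<longlongrightarrow>
        (\<integral>x. \<zeta> x * V t x \<partial>\<mu>) - (\<integral>x. \<zeta> x * P t (L f) x \<partial>\<mu>)) (at_right 0)"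
      by (intro tendsto_diff G1 tendsto_const)
    ultimately have "(\<integral>x. \<zeta> x * V t x \<partial>\<mu>) - (\<integral>x. \<zeta> x * P t (L f) x \<partial>\<mu>) = 0"
      using tendsto_unique trivial_limit_at_right_real by blast
    then show "(\<integral>x. \<zeta> x * (V t x - P t (L f) x) \<partial>\<mu>) = 0"
      using integrable_test_mult[OF z Vs[OF t]] zi[OF t test_fun_L[OF f]] by (simp add: right_diff_distrib)
  qed
  then have "V t x = P t (L f) x" by simp
  then show ?thesis using V'[OF t, of x] by metis
qed

text \<open>Forms are built from spatial first derivatives, so their time derivative along the
  semigroup needs this interchange of the two differentiations.\<close>

lemma P_pd_has_derivative:
  assumes "t > 0" "test_fun A f" "(U, \<phi>) \<in> A" "u \<in> \<phi> ` U" "i \<in> Basis"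
  shows "((\<lambda>s. pd i (P s f \<circ> inv_into U \<phi>) u) has_real_derivative pd i (P t (L f) \<circ> inv_into U \<phi>) u) (at t)"
proof -
  let ?F = "\<lambda>f (u, t). P t f (inv_into U \<phi> u)"
  have e: "pd i (P s g \<circ> inv_into U \<phi>) u = pd (i, 0) (?F g) (u, s)" if "s > 0" "test_fun A g" for s g
    using pd_slice[OF P_joint_smooth[OF assms(3) that(2)] chart(2)[OF assms(3)] open_greaterThan assms(4), of s i]
      that(1) by (simp add: o_def)
  have "((\<lambda>t. pd (i, 0) (?F f) (u, t)) has_real_derivative pd (i, 0) (?F (L f)) (u, t)) (at t)"
    by (rule mixed_derivative[OF P_joint_smooth[OF assms(3,2)] P_joint_smooth[OF assms(3) test_fun_L[OF assms(2)]]
          chart(2)[OF assms(3)] assms(4,1,5)])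
      (use P_has_derivative assms(2) in auto)
  then have "((\<lambda>s. pd i (P s f \<circ> inv_into U \<phi>) u) has_real_derivative pd (i, 0) (?F (L f)) (u, t)) (at t)"
    by (rule has_field_derivative_transform_within_open[of _ _ _ "{0<..}"])
      (use assms(1) e[OF _ assms(2)] in auto)
  then show ?thesis using e[OF assms(1) test_fun_L[OF assms(2)]] by simp
qed

lemma P_pd_continuous:
  assumes "test_fun A f" "(U, \<phi>) \<in> A" "i \<in> Basis"
  shows "continuous_on (\<phi> ` U \<times> {0<..}) (\<lambda>(u, t). pd i (P t f \<circ> inv_into U \<phi>) u)"
proof -
  have "(i, 0::real) \<in> Basis" using assms(3) by (simp add: Basis_prod_def)
  then have "continuous_on (\<phi> ` U \<times> {0<..}) (pd (i, 0) (\<lambda>(u, t). P t f (inv_into U \<phi> u)))"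
    by (rule smooth_on_continuous[OF smooth_on_pd[OF P_joint_smooth[OF assms(2,1)]]])
  then show ?thesis
    by (rule continuous_on_eq)
      (use pd_slice[OF P_joint_smooth[OF assms(2,1)] chart(2)[OF assms(2)] open_greaterThan] in
        \<open>auto simp: o_def\<close>)
qed

end

section \<open>Positivity, bounds and conservation of mass for the semigroup\<close>

context heat_diffusion
begin

lemma p_mult_bounded_integrable:
  assumes "t > 0" "f \<in> borel_measurable \<mu>" "\<And>y. \<bar>f y\<bar> \<le> B"
  shows "integrable \<mu> (\<lambda>y. p x y t * f y)"
proof (rule Bochner_Integration.integrable_bound)
  show "integrable \<mu> (\<lambda>y. B * p x y t)" using p_integrable[OF assms(1)] by auto
  show "(\<lambda>y. p x y t * f y) \<in> borel_measurable \<mu>"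
    using borel_measurable_integrable[OF p_integrable[OF assms(1)]] assms(2) by measurable
  have "p x y t * \<bar>f y\<bar> \<le> B * p x y t" for y
    using mult_left_mono[OF assms(3)[of y] less_imp_le[OF p_pos[OF assms(1)]]] by (simp add: mult.commute)
  moreover have "0 \<le> B" using assms(3)[of undefined] by linarith
  ultimately show "AE y in \<mu>. norm (p x y t * f y) \<le> norm (B * p x y t)"
    using p_pos[OF assms(1)] by (simp add: abs_mult abs_of_pos)
qed

lemma P_le:
  assumes "t > 0" "f \<in> borel_measurable \<mu>" "\<And>y. \<bar>f y\<bar> \<le> B" "\<And>y. f y \<le> C"
  shows "P t f x \<le> C"
proof -
  have "(\<integral>y. p x y t * f y \<partial>\<mu>) \<le> (\<integral>y. C * p x y t \<partial>\<mu>)"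
  proof (rule integral_mono[OF p_mult_bounded_integrable[OF assms(1-3)]])
    show "integrable \<mu> (\<lambda>y. C * p x y t)" using p_integrable[OF assms(1)] by auto
    show "p x y t * f y \<le> C * p x y t" for y
      using mult_left_mono[OF assms(4)[of y] less_imp_le[OF p_pos[OF assms(1)]]] by (simp add: mult.commute)
  qed
  then show ?thesis using mass[OF assms(1)] assms(1) by (simp add: P_eq)
qed

lemma P_nonneg: "t > 0 \<Longrightarrow> (\<And>y. f y \<ge> 0) \<Longrightarrow> P t f x \<ge> 0"
  using p_pos by (auto simp: P_eq less_imp_le intro!: integral_nonneg_AE)

lemma test_fun_measurable: "test_fun A f \<Longrightarrow> f \<in> borel_measurable \<mu>"
  by (intro continuous_measurable smooth_fun_continuous test_fun_smooth)

lemma P_abs_le: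
  assumes "t > 0" "test_fun A f" "\<And>y. \<bar>f y\<bar> \<le> B"
  shows "\<bar>P t f x\<bar> \<le> B"
proof -
  have m: "f \<in> borel_measurable \<mu>" "(\<lambda>y. - f y) \<in> borel_measurable \<mu>"
    using test_fun_measurable[OF assms(2)] by auto
  have "P t (\<lambda>y. - f y) x = - P t f x" using assms(1) by (simp add: P_eq)
  moreover have "P t (\<lambda>y. - f y) x \<le> B"
    by (rule P_le[OF assms(1) m(2), of B]) (use assms(3) in \<open>auto simp: abs_le_iff\<close>)
  moreover have "P t f x \<le> B"
    by (rule P_le[OF assms(1) m(1), of B]) (use assms(3) in \<open>auto simp: abs_le_iff\<close>)
  ultimately show ?thesis by linarith
qed

text \<open>The cutoffs lie below their limit 1, and since they increase, the first one bounds all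
  of them from below.\<close>

lemma h_bounded: obtains B where "B > 0" "\<And>k y. \<bar>h k y\<bar> \<le> B"
proof -
  obtain B0 where B0: "B0 > 0" "\<And>y. \<bar>h 0 y\<bar> \<le> B0" by (rule test_fun_bounded[OF h_test]) blast
  show thesis
  proof (rule that[of "max B0 1"])
    fix k y
    have "h 0 y \<le> h k y" using incseqD[OF h_incseq[of y]] by simp
    then show "\<bar>h k y\<bar> \<le> max B0 1" using B0(2)[of y] h_le_1[of k y] by (auto simp: abs_le_iff)
  qed simp
qed

lemma P_tendsto:
  assumes "t > 0" "\<And>k. g k \<in> borel_measurable \<mu>" "f \<in> borel_measurable \<mu>"
    and "\<And>k y. \<bar>g k y\<bar> \<le> B" "\<And>y. (\<lambda>k. g k y) \<longlonglongrightarrow> f y"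
  shows "(\<lambda>k. P t (g k) x) \<longlonglongrightarrow> P t f x"
  unfolding P_eq[OF assms(1)]
proof (rule integral_dominated_convergence[where w = "\<lambda>y. B * p x y t"])
  have pm: "(\<lambda>y. p x y t) \<in> borel_measurable \<mu>"
    by (rule borel_measurable_integrable[OF p_integrable[OF assms(1)]])
  show "(\<lambda>y. p x y t * f y) \<in> borel_measurable \<mu>" "(\<lambda>y. p x y t * g k y) \<in> borel_measurable \<mu>" for k
    using pm assms(2,3) by measurable
  show "integrable \<mu> (\<lambda>y. B * p x y t)" using p_integrable[OF assms(1)] by auto
  show "AE y in \<mu>. (\<lambda>k. p x y t * g k y) \<longlonglongrightarrow> p x y t * f y"
    using assms(5) by (auto intro!: tendsto_mult_left)
  show "AE y in \<mu>. norm (p x y t * g k y) \<le> B * p x y t" for k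
  proof (intro AE_I2)
    show "norm (p x y t * g k y) \<le> B * p x y t" for y
      using mult_left_mono[OF assms(4)[of k y] less_imp_le[OF p_pos[OF assms(1), of x y]]] p_pos[OF assms(1), of x y]
      by (simp add: abs_mult mult.commute)
  qed
qed

lemma P_h_tendsto: "t > 0 \<Longrightarrow> (\<lambda>k. P t (h k) x) \<longlonglongrightarrow> 1"
proof -
  assume t: "t > 0"
  obtain B where "\<And>k y. \<bar>h k y\<bar> \<le> B" by (rule h_bounded) blast
  then have "(\<lambda>k. P t (h k) x) \<longlonglongrightarrow> P t (\<lambda>_. 1) x"
    using h_lim test_fun_measurable[OF h_test] by (intro P_tendsto[OF t]) auto
  then show ?thesis using mass[OF t] t by (simp add: P_eq)
qed

lemma p_continuous:
  assumes "t > 0" shows "continuous_on UNIV (\<lambda>(x, y). p x y t)"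
proof (rule continuous_at_imp_continuous_on, clarify)
  fix x y
  obtain U \<phi> where c: "(U, \<phi>) \<in> A" "x \<in> U" by (rule chart_at)
  have "continuous_on (U \<times> UNIV) (\<lambda>q. ((\<phi> (fst q), t), snd q))"
    by (intro continuous_intros continuous_on_compose2[OF chart_continuous[OF c(1)]]) auto
  then have "continuous_on (U \<times> UNIV)
      (\<lambda>q. (\<lambda>(z, y). p (inv_into U \<phi> (fst z)) y (snd z)) ((\<phi> (fst q), t), snd q))"
    by (rule continuous_on_compose2[OF par_Ck_continuous[OF kernel_par_Ck[OF c(1), of 0]]]) (use assms in auto)
  then have "continuous_on (U \<times> UNIV) (\<lambda>(x, y). p x y t)"
    by (rule continuous_on_eq) (use chart_inv[OF c(1)] in auto)
  then show "isCont (\<lambda>(x, y). p x y t) (x, y)"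
    using continuous_on_eq_continuous_at[OF open_Times[OF chart(1)[OF c(1)] open_UNIV]] c(2) by blast
qed

text \<open>Tonelli exchanges the integrals, and the symmetry of the kernel turns the inner one into
  its total mass, which is 1.\<close>

lemma P_integrable:
  assumes t: "t > 0" and f: "f \<in> borel_measurable \<mu>" "integrable \<mu> f" "\<And>y. f y \<ge> 0" "\<And>y. f y \<le> B"
  shows "integrable \<mu> (P t f)" "(\<integral>x. P t f x \<partial>\<mu>) = (\<integral>x. f x \<partial>\<mu>)"
proof -
  note sf = sigma_finite
  interpret sigma_finite_measure \<mu> by (rule sf)
  interpret pair_sigma_finite \<mu> \<mu> ..
  have "(\<lambda>(x, y). p x y t) \<in> borel_measurable (borel \<Otimes>\<^sub>M borel)"
    unfolding borel_prod by (rule borel_measurable_continuous_onI[OF p_continuous[OF t]])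
  then have pm: "(\<lambda>(x, y). p x y t) \<in> borel_measurable (\<mu> \<Otimes>\<^sub>M \<mu>)"
    using measurable_cong_sets[OF sets_pair_measure_cong[OF sets_\<mu> sets_\<mu>] refl] by blast
  have m: "(\<lambda>(x, y). p x y t * f y) \<in> borel_measurable (\<mu> \<Otimes>\<^sub>M \<mu>)"
  proof -
    have "(\<lambda>q. (\<lambda>(x, y). p x y t) q * f (snd q)) \<in> borel_measurable (\<mu> \<Otimes>\<^sub>M \<mu>)"
      using pm f(1) by measurable
    then show ?thesis by (simp add: case_prod_beta')
  qed
  have Pn: "P t f x \<ge> 0" for x by (rule P_nonneg[OF t f(3)])
  have i: "integrable \<mu> (\<lambda>y. p x y t * f y)" for x
    by (rule p_mult_bounded_integrable[OF t f(1), of B]) (use f(3,4) in auto)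
  have Pm: "P t f \<in> borel_measurable \<mu>"
  proof -
    have "(\<lambda>x. \<integral>y. p x y t * f y \<partial>\<mu>) \<in> borel_measurable \<mu>"
      by (rule sigma_finite_measure.borel_measurable_lebesgue_integral[OF sf m])
    then show ?thesis by (simp add: P_eq[OF t] cong: measurable_cong)
  qed
  have "(\<integral>\<^sup>+x. ennreal (P t f x) \<partial>\<mu>) = (\<integral>\<^sup>+x. (\<integral>\<^sup>+y. ennreal (p x y t * f y) \<partial>\<mu>) \<partial>\<mu>)"
    unfolding P_eq[OF t]
    by (intro nn_integral_cong nn_integral_eq_integral[symmetric] i AE_I2 mult_nonneg_nonneg f(3) less_imp_le[OF p_pos[OF t]])
  also have "\<dots> = (\<integral>\<^sup>+y. (\<integral>\<^sup>+x. ennreal (p x y t * f y) \<partial>\<mu>) \<partial>\<mu>)"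
    by (rule Fubini'[symmetric]) (use m in measurable)
  also have "\<dots> = (\<integral>\<^sup>+y. ennreal (f y) \<partial>\<mu>)"
  proof (rule nn_integral_cong)
    fix y
    have "(\<integral>\<^sup>+x. ennreal (p x y t * f y) \<partial>\<mu>) = (\<integral>\<^sup>+x. ennreal (p y x t * f y) \<partial>\<mu>)"
      by (simp add: p_sym[OF t, of _ y])
    also have "\<dots> = ennreal (\<integral>x. p y x t * f y \<partial>\<mu>)"
      by (rule nn_integral_eq_integral) (use p_integrable[OF t, of y] p_pos[OF t] f(3) in \<open>auto simp: less_imp_le\<close>)
    also have "(\<integral>x. p y x t * f y \<partial>\<mu>) = f y" using mass[OF t] by simp
    finally show "(\<integral>\<^sup>+x. ennreal (p x y t * f y) \<partial>\<mu>) = ennreal (f y)" .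
  qed
  also have "\<dots> = ennreal (\<integral>y. f y \<partial>\<mu>)" by (rule nn_integral_eq_integral[OF f(2)]) (use f(3) in auto)
  finally have e: "(\<integral>\<^sup>+x. ennreal (P t f x) \<partial>\<mu>) = ennreal (\<integral>y. f y \<partial>\<mu>)" .
  have n: "0 \<le> (\<integral>y. f y \<partial>\<mu>)" using f(3) by (auto intro: integral_nonneg_AE)
  show "integrable \<mu> (P t f)" using integrableI_nn_integral_finite[OF Pm _ e] Pn by auto
  show "(\<integral>x. P t f x \<partial>\<mu>) = (\<integral>x. f x \<partial>\<mu>)"
    using integral_eq_nn_integral[OF Pm] Pn e n by simp
qed

text \<open>Bounded subsolutions are compared with the semigroup applied to the cutoffs, whose squares
  have bounded integral; stochastic completeness lets \<open>k\<close> tend to infinity.\<close>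

theorem subsolution_nonpos:
  fixes \<Psi> \<Psi>' :: "real \<Rightarrow> 'a \<Rightarrow> real"
  assumes smooth: "\<And>t. t > 0 \<Longrightarrow> smooth_fun A (\<Psi> t)"
    and deriv: "\<And>t x. t > 0 \<Longrightarrow> ((\<lambda>s. \<Psi> s x) has_real_derivative \<Psi>' t x) (at t)"
    and cont: "continuous_on ({0<..} \<times> UNIV) (\<lambda>(t, x). \<Psi> t x)"
      "continuous_on ({0<..} \<times> UNIV) (\<lambda>(t, x). \<Psi>' t x)"
    and sub: "\<And>t x. 0 < t \<Longrightarrow> t \<le> T \<Longrightarrow> \<Psi>' t x \<le> L (\<Psi> t) x"
    and bound: "\<And>t x. 0 < t \<Longrightarrow> t \<le> T \<Longrightarrow> \<bar>\<Psi> t x\<bar> \<le> C * t"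
    and t: "0 < t" "t \<le> T"
  shows "\<Psi> t x \<le> 0"
proof -
  define N where "N = C * T"
  have C: "C \<ge> 0"
  proof -
    have "0 \<le> C * t" using bound[OF t, of x] by linarith
    then show ?thesis using t(1) by (simp add: zero_le_mult_iff)
  qed
  have N: "N \<ge> 0" using C t by (simp add: N_def)
  obtain B where B: "B > 0" "\<And>k y. \<bar>h k y\<bar> \<le> B" by (rule h_bounded) blast
  \<comment> \<open>The comparison function starts at a positive time since nothing is assumed at
    time 0. At that time it is nonpositive, because P h_k <= 1 and the subsolution is at most C eta.
    Later the constant N >= Psi keeps it below N P h_k, so its positive part is square
    integrable.\<close>
  have key: "N * P t (h k) x - (N + C * \<eta>) + \<Psi> t x \<le> 0" if \<eta>: "0 < \<eta>" "\<eta> \<le> t" for k \<eta>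
  proof -
    let ?w = "\<lambda>s y. N * P s (h k) y - (N + C * \<eta>) + \<Psi> s y"
    \<comment> \<open>The square of P h_k is at most B times P |h_k|, whose integral is the same at
      all times; hence a bound uniform in s.\<close>
    let ?q = "\<lambda>s y. N\<^sup>2 * (B * P s (\<lambda>y. \<bar>h k y\<bar>) y)"
    have hm: "(\<lambda>y. \<bar>h k y\<bar>) \<in> borel_measurable \<mu>" using test_fun_measurable[OF h_test] by auto
    have hi: "integrable \<mu> (\<lambda>y. \<bar>h k y\<bar>)" using integrable_test[OF h_test] by auto
    have \<Psi>N: "\<Psi> s y \<le> N" if "0 < s" "s \<le> T" for s y
    proof -
      have "\<Psi> s y \<le> C * s" using bound[OF that, of y] by linarith
      also have "\<dots> \<le> N" unfolding N_def using C that by (intro mult_left_mono) auto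
      finally show ?thesis .
    qed
    have Ph1: "P s (h k) y \<le> 1" if "s > 0" for s y
      by (rule P_le[OF that test_fun_measurable[OF h_test] B(2) h_le_1])
    have wP: "?w s y \<le> N * P s (h k) y" if "0 < s" "s \<le> T" for s y
      using \<Psi>N[OF that, of y] C \<eta>(1) by simp (smt (verit) mult_nonneg_nonneg)
    have P2: "(P s (h k) y)\<^sup>2 \<le> B * P s (\<lambda>y. \<bar>h k y\<bar>) y" if s: "s > 0" for s y
    proof -
      have "\<bar>P s (h k) y\<bar> \<le> P s (\<lambda>y. \<bar>h k y\<bar>) y"
        using integral_norm_bound[of \<mu> "\<lambda>z. p y z s * h k z"] p_pos[OF s] s
        by (simp add: P_eq abs_mult abs_of_pos)
      moreover have "\<bar>P s (h k) y\<bar> \<le> B" by (rule P_abs_le[OF s h_test B(2)])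
      ultimately have "\<bar>P s (h k) y\<bar> * \<bar>P s (h k) y\<bar> \<le> B * P s (\<lambda>y. \<bar>h k y\<bar>) y"
        using B(1) by (intro mult_mono) auto
      then show ?thesis by (simp add: power2_eq_square)
    qed
    show ?thesis
    proof (rule max_principle[where w = ?w and w' = "\<lambda>s y. N * P s (L (h k)) y + \<Psi>' s y" and q = ?q
          and M = N and \<eta> = \<eta> and T = T and C = "N\<^sup>2 * (B * (\<integral>y. \<bar>h k y\<bar> \<partial>\<mu>))"])
      show "smooth_fun A (?w s)" if "s > 0" for s
        using that by (intro smooth_fun_add smooth_fun_diff smooth_fun_mult smooth_fun_const P_smooth h_test smooth)
      show "((\<lambda>s. ?w s y) has_real_derivative N * P s (L (h k)) y + \<Psi>' s y) (at s)" if "s > 0" for s y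
        using that by (auto intro!: derivative_eq_intros P_has_derivative h_test deriv)
      show "continuous_on ({0<..} \<times> UNIV) (\<lambda>(s, y). ?w s y)"
        using P_joint_continuous[OF h_test, of k] cont(1)
        by (auto intro!: continuous_intros simp: case_prod_beta')
      show "continuous_on ({0<..} \<times> UNIV) (\<lambda>(s, y). N * P s (L (h k)) y + \<Psi>' s y)"
        using P_joint_continuous[OF test_fun_L[OF h_test], of k] cont(2)
        by (auto intro!: continuous_intros simp: case_prod_beta')
      show "N * P s (L (h k)) y + \<Psi>' s y \<le> L (?w s) y" if "\<eta> \<le> s" "s \<le> T" for s y
      proof -
        have s: "s > 0" using that \<eta> by simp
        have sm: "smooth_fun A (\<lambda>y. N * P s (h k) y)" "smooth_fun A (\<lambda>y. N * P s (h k) y - (N + C * \<eta>))"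
          using P_smooth[OF s h_test] by (auto intro!: smooth_fun_mult smooth_fun_diff)
        have "L (?w s) y = N * L (P s (h k)) y + L (\<Psi> s) y"
          using L_add[OF sm(2) smooth[OF s]] L_diff[OF sm(1) smooth_fun_const] L_cmult[OF P_smooth[OF s h_test]] L_const
          by simp
        then show ?thesis using L_P[OF s h_test] sub[OF s that(2), of y] by simp
      qed
      show "?w \<eta> y \<le> 0" for y
      proof -
        have "N * P \<eta> (h k) y \<le> N * 1" using Ph1[OF \<eta>(1)] N by (intro mult_left_mono)
        moreover have "\<Psi> \<eta> y \<le> C * \<eta>" using bound[of \<eta> y] \<eta> t by auto
        ultimately show ?thesis by simp
      qed
      show "?w s y \<le> N" if "\<eta> \<le> s" "s \<le> T" for s y
        using wP[of s y] that \<eta> mult_left_mono[OF Ph1[of s y] N] by auto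
      show "integrable \<mu> (?q s)" "(\<integral>y. ?q s y \<partial>\<mu>) \<le> N\<^sup>2 * (B * (\<integral>y. \<bar>h k y\<bar> \<partial>\<mu>))"
        if "\<eta> \<le> s" for s
      proof -
        have s: "s > 0" using that \<eta> by simp
        show "integrable \<mu> (?q s)" "(\<integral>y. ?q s y \<partial>\<mu>) \<le> N\<^sup>2 * (B * (\<integral>y. \<bar>h k y\<bar> \<partial>\<mu>))"
          using P_integrable[OF s hm hi _ B(2)] by auto
      qed
      show "?q s y \<ge> 0" if "\<eta> \<le> s" for s y
        using P_nonneg[of s "\<lambda>y. \<bar>h k y\<bar>" y] that \<eta> B(1) by simp
      show "(?w s y)\<^sup>2 \<le> ?q s y" if "\<eta> \<le> s" "s \<le> T" "?w s y > 0" for s y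
      proof -
        have s: "s > 0" using that \<eta> by simp
        have "(?w s y)\<^sup>2 \<le> (N * P s (h k) y)\<^sup>2"
          using wP[OF s that(2), of y] that(3) by (intro power_mono) auto
        also have "\<dots> = N\<^sup>2 * (P s (h k) y)\<^sup>2" by (simp add: power_mult_distrib)
        also have "\<dots> \<le> ?q s y" by (rule mult_left_mono[OF P2[OF s]]) simp
        finally show ?thesis .
      qed
    qed (use \<eta> t N in auto)
  qed
  \<comment> \<open>In the limit of large k the two constants N cancel, because P_t h_k tends to 1;
    only the initial error C eta is left.\<close>
  have 1: "\<Psi> t x \<le> C * \<eta>" if \<eta>: "0 < \<eta>" "\<eta> \<le> t" for \<eta>
  proof -
    have "(\<lambda>k. N * P t (h k) x - (N + C * \<eta>) + \<Psi> t x) \<longlonglongrightarrow> N * 1 - (N + C * \<eta>) + \<Psi> t x"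
      by (intro tendsto_intros P_h_tendsto t)
    from LIMSEQ_le_const2[OF this, of 0] show ?thesis using key[OF \<eta>] by auto
  qed
  show ?thesis
  proof (rule tendsto_lowerbound)
    show "((\<lambda>\<eta>. C * \<eta>) \<longlongrightarrow> 0) (at_right 0)" by (auto intro!: tendsto_eq_intros)
    show "\<forall>\<^sub>F \<eta> in at_right 0. \<Psi> t x \<le> C * \<eta>"
      by (rule eventually_at_rightI[of 0 t]) (use 1 t in auto)
  qed simp
qed

end

section \<open>The Li-Yau inequality\<close>

context diffusion
begin

text \<open>First-order forms see dU = U du, and the second-order chain rule adds Gamma(u). These
  identities carry every passage between a positive function and its logarithm.\<close>

lemma log_calculus:
  assumes G: "sym_form A G" and U: "smooth_fun A U" "\<And>y. U y > 0"
  defines "u \<equiv> \<lambda>y. ln (U y)"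
  shows "smooth_fun A u"
    "\<And>g x. smooth_fun A g \<Longrightarrow> G U g x = U x * G u g x"
    "\<And>x. L U x = U x * (L u x + carre L u u x)"
proof -
  interpret G: sym_form A G by (rule G)
  show u: "smooth_fun A u"
    unfolding u_def by (rule smooth_fun_compose[OF smooth_on_ln open_greaterThan U(1)]) (use U(2) in auto)
  have ln: "(ln has_real_derivative inverse (U x)) (at (U x))" for x
    using U(2)[of x] by (auto intro!: DERIV_ln)
  show "G U g x = U x * G u g x" if "smooth_fun A g" for g x
  proof -
    have "G u g x = inverse (U x) * G U g x"
      unfolding u_def
      by (rule G.form_compose(1)[OF U(1) that smooth_on_ln open_greaterThan _ ln]) (use U(2) in auto)
    then show ?thesis using U(2)[of x] by simp
  qed
  show "L U x = U x * (L u x + carre L u u x)" for x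
  proof -
    have 1: "L u x = inverse (U x) * L U x + (- (inverse (U x) ^ 2)) * carre L U U x"
      unfolding u_def
      by (rule L_compose[where g = ln, OF U(1) smooth_on_ln smooth_on_inverse open_greaterThan])
        (use U(2) in \<open>auto intro!: DERIV_ln derivative_eq_intros simp: power2_eq_square\<close>)
    have 2: "carre L u g x = inverse (U x) * carre L U g x" if "smooth_fun A g" for g
      unfolding u_def
      by (rule carre.form_compose(1)[OF U(1) that smooth_on_ln open_greaterThan _ ln]) (use U(2) in auto)
    have "carre L u u x = inverse (U x) ^ 2 * carre L U U x"
      using 2[OF u] 2[OF U(1)] carre_commute[of U u x] by (simp add: power2_eq_square)
    then have "L u x + carre L u u x = inverse (U x) * L U x" using 1 by simp
    then show ?thesis using U(2)[of x] by simp
  qed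
qed

text \<open>The commutation hypothesis is what reduces the evolution of \<open>U G (ln U)\<close> to the iterated
  form of \<open>G\<close>.\<close>

lemma evolution_iterated:
  assumes G: "sym_form A G" and U: "smooth_fun A U" "\<And>y. U y > 0"
  defines "u \<equiv> \<lambda>y. ln (U y)"
  assumes comm: "\<And>x. carre L u (G u u) x = G u (carre L u u) x"
  shows "2 * G U (L U) x / U x - G U U x * L U x / (U x)\<^sup>2 - L (\<lambda>y. U y * G u u y) x
    = - 2 * U x * iterated L G u x"
proof -
  interpret G: sym_form A G by (rule G)
  note lc = log_calculus[OF G U, folded u_def]
  note lcc = log_calculus(2)[OF carre.sym_form_axioms U, folded u_def]
  define m where "m = (\<lambda>x. L u x + carre L u u x)"
  have Lu: "smooth_fun A (L u)" and cu: "smooth_fun A (carre L u u)" and Gu: "smooth_fun A (G u u)"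
    using lc(1) by auto
  have m: "smooth_fun A m" unfolding m_def by (rule smooth_fun_add[OF Lu cu])
  have LU: "L U = (\<lambda>x. U x * m x)" using lc(3) by (auto simp: m_def)
  have LUs: "smooth_fun A (L U)" using U(1) by auto
  have 1: "G U (L U) x = U x * (U x * G u m x + m x * (U x * G u u x))"
    unfolding lc(2)[OF LUs] unfolding LU
    by (subst G.form_mult(2)[OF U(1) m lc(1)]) (simp only: G.form_commute[OF lc(1) U(1)] lc(2)[OF lc(1)])
  have 2: "G U U x = U x * (U x * G u u x)"
    by (simp only: lc(2)[OF U(1)] G.form_commute[OF lc(1) U(1)] lc(2)[OF lc(1)])
  have 3: "L (\<lambda>y. U y * G u u y) x = U x * L (G u u) x + G u u x * (U x * m x) + 2 * (U x * carre L u (G u u) x)"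
    by (simp only: L_mult lcc[OF Gu] LU)
  have 4: "G u m x = G u (L u) x + carre L u (G u u) x"
    unfolding m_def by (simp only: G.form_add(2)[OF Lu cu lc(1)] comm)
  show ?thesis
    unfolding 1 2 3 4 iterated_def using U(2)[of x] by (simp add: LU field_simps power2_eq_square)
qed

end

context heat_diffusion
begin

text \<open>In a fixed chart the coefficients do not depend on time, so the product rule acts only
  on the spatial derivatives of \<open>P s f\<close>, and symmetry of the form merges the two
  resulting terms.\<close>

lemma form_P_has_derivative:
  assumes G: "sym_form A G" and t: "t > 0" and f: "test_fun A f"
  shows "((\<lambda>s. G (P s f) (P s f) x) has_real_derivative 2 * G (P t f) (P t (L f)) x) (at t)"
proof -
  interpret G: sym_form A G by (rule G)
  obtain U \<phi> where c: "(U, \<phi>) \<in> A" "x \<in> U" by (rule chart_at)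
  obtain \<tau> where "G.form_rep U \<phi> \<tau>" by (rule G.form_coord[OF c(1)])
  note \<tau> = G.form_repD[OF this]
  let ?d = "\<lambda>i s. pd i (P s f \<circ> inv_into U \<phi>) (\<phi> x)"
  let ?e = "\<lambda>i s. pd i (P s (L f) \<circ> inv_into U \<phi>) (\<phi> x)"
  have D: "((\<lambda>s. ?d i s) has_real_derivative ?e i t) (at t)" if "i \<in> Basis" for i
    by (rule P_pd_has_derivative[OF t f c(1) _ that]) (use c in simp)
  have "((\<lambda>s. \<Sum>i\<in>Basis. \<Sum>j\<in>Basis. \<tau> i j (\<phi> x) * (?d i s * ?d j s)) has_real_derivative
      (\<Sum>i\<in>Basis. \<Sum>j\<in>Basis. \<tau> i j (\<phi> x) * (?e i t * ?d j t + ?e j t * ?d i t))) (at t)"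
    by (intro DERIV_sum DERIV_cmult DERIV_mult D)
  also have "(\<Sum>i\<in>Basis. \<Sum>j\<in>Basis. \<tau> i j (\<phi> x) * (?e i t * ?d j t + ?e j t * ?d i t)) =
      G (P t (L f)) (P t f) x + G (P t f) (P t (L f)) x"
    using \<tau>[OF P_smooth[OF t test_fun_L[OF f]] P_smooth[OF t f] c(2)]
      \<tau>[OF P_smooth[OF t f] P_smooth[OF t test_fun_L[OF f]] c(2)]
    by (simp add: distrib_left sum.distrib mult_ac)
  also have "\<dots> = 2 * G (P t f) (P t (L f)) x"
    using G.form_commute[OF P_smooth[OF t test_fun_L[OF f]] P_smooth[OF t f]] by simp
  finally show ?thesis
    by (rule has_field_derivative_transform_within_open[of _ _ _ "{0<..}"])
      (use t \<tau>[OF P_smooth[OF _ f] P_smooth[OF _ f] c(2)] in \<open>auto simp: mult.assoc o_def\<close>)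
qed

lemma form_P_continuous:
  assumes G: "sym_form A G" and f: "test_fun A f" and g: "test_fun A g"
  shows "continuous_on ({0<..} \<times> UNIV) (\<lambda>(t, x). G (P t f) (P t g) x)"
proof (rule continuous_on_time_chart)
  interpret G: sym_form A G by (rule G)
  fix U \<phi> assume c: "(U, \<phi>) \<in> A"
  obtain \<tau> where \<tau>: "\<And>i j. i \<in> Basis \<Longrightarrow> j \<in> Basis \<Longrightarrow> smooth_on (\<phi> ` U) (\<tau> i j)" "G.form_rep U \<phi> \<tau>"
    by (rule G.form_coord[OF c]) blast
  have t: "continuous_on (\<phi> ` U \<times> {0::real<..}) (\<lambda>q. \<tau> i j (fst q))" if "i \<in> Basis" "j \<in> Basis" for i j
    by (rule continuous_on_compose2[OF smooth_on_continuous[OF \<tau>(1)[OF that]] continuous_on_fst[OF continuous_on_id]]) auto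
  have "continuous_on (\<phi> ` U \<times> {0<..}) (\<lambda>q. \<Sum>i\<in>Basis. \<Sum>j\<in>Basis. \<tau> i j (fst q) *
      pd i (P (snd q) f \<circ> inv_into U \<phi>) (fst q) * pd j (P (snd q) g \<circ> inv_into U \<phi>) (fst q))"
    by (intro continuous_on_sum continuous_on_mult t P_pd_continuous[OF f c, unfolded case_prod_beta']
        P_pd_continuous[OF g c, unfolded case_prod_beta'])
  then show "continuous_on (\<phi> ` U \<times> {0<..}) (\<lambda>(u, t). G (P t f) (P t g) (inv_into U \<phi> u))"
    by (rule continuous_on_eq)
      (use G.form_repD[OF \<tau>(2) P_smooth[OF _ f] P_smooth[OF _ g]] chart_inv[OF c] in auto)
qed

end

section \<open>The Li-Yau functional under the curvature-dimension inequality\<close>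

locale curvature_dimension = heat_diffusion A L \<mu> h p + Z: sym_form A GZ
  for A :: "('a::{t2_space, second_countable_topology}, 'e::euclidean_space) atlas" and L and \<mu> and h and p and GZ +
  fixes \<rho> \<kappa> d :: real
  assumes GZ_nonneg: "\<And>f x. smooth_fun A f \<Longrightarrow> GZ f f x \<ge> 0"
    and commute: "\<And>f x. smooth_fun A f \<Longrightarrow> carre L f (GZ f f) x = GZ f (carre L f f) x"
    and gradient_bound: "\<And>f T. test_fun A f \<Longrightarrow> T > 0 \<Longrightarrow>
      \<exists>B. \<forall>t x. 0 < t \<and> t \<le> T \<longrightarrow> carre L (P t f) (P t f) x \<le> B \<and> GZ (P t f) (P t f) x \<le> B"
    and \<rho>: "\<rho> > 0" and \<kappa>: "\<kappa> \<ge> 0" and d: "d > 0"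
    and CD: "\<And>f \<nu> x. smooth_fun A f \<Longrightarrow> \<nu> > 0 \<Longrightarrow>
      iterated L (carre L) f x + \<nu> * iterated L GZ f x
        \<ge> 1 / d * (L f x)\<^sup>2 - \<kappa> / \<nu> * carre L f f x + \<rho> * GZ f f x"
begin

definition D where "D = d * (1 + 3 * \<kappa> / (2 * \<rho>))"

lemma D_pos: "D > 0"
  using d \<kappa> \<rho> by (simp add: D_def add_pos_nonneg)

text \<open>Completing the square: the choice of \<open>D\<close> makes the terms in \<open>g\<close> cancel.\<close>

lemma li_yau_algebra:
  fixes t g z l G2 GZ2 :: real
  assumes t: "t > 0"
    and cd: "G2 + (2 * \<rho> / 3 * t) * GZ2 \<ge> 1 / d * l\<^sup>2 - \<kappa> / (2 * \<rho> / 3 * t) * g + \<rho> * z"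
  shows "2 * t * g + 2 * \<rho> * t\<^sup>2 * z - 2 * (t\<^sup>2 * G2 + (2 * \<rho> / 3) * t ^ 3 * GZ2)
    - D\<^sup>2 / (2 * d) - 2 * D * t / d * (l + g) \<le> 0"
proof -
  have "2 * (t\<^sup>2 * G2 + (2 * \<rho> / 3) * t ^ 3 * GZ2) = 2 * t\<^sup>2 * (G2 + (2 * \<rho> / 3 * t) * GZ2)"
    by (simp add: algebra_simps power2_eq_square power3_eq_cube)
  also have "\<dots> \<ge> 2 * t\<^sup>2 * (1 / d * l\<^sup>2 - \<kappa> / (2 * \<rho> / 3 * t) * g + \<rho> * z)"
    by (intro mult_left_mono cd) auto
  finally have 1: "2 * (t\<^sup>2 * G2 + (2 * \<rho> / 3) * t ^ 3 * GZ2) \<ge>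
      2 * t\<^sup>2 * (1 / d * l\<^sup>2 - \<kappa> / (2 * \<rho> / 3 * t) * g + \<rho> * z)" .
  have 2: "2 * t\<^sup>2 * (1 / d * l\<^sup>2 - \<kappa> / (2 * \<rho> / 3 * t) * g + \<rho> * z) =
      2 / d * t\<^sup>2 * l\<^sup>2 - 3 * \<kappa> / \<rho> * t * g + 2 * \<rho> * t\<^sup>2 * z"
    using t \<rho> d by (simp add: field_simps power2_eq_square)
  \<comment> \<open>The factor collects 2 t, the derivative of the weight t^2, and the loss 2 t^2
    kappa / nu from the curvature-dimension inequality.\<close>
  have 3: "2 * D * t / d = 2 * t + 3 * \<kappa> / \<rho> * t"
    using \<rho> d by (simp add: D_def field_simps)
  \<comment> \<open>The coefficient of t U in the functional is the constant term of this
    square.\<close>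
  have 4: "2 / d * (t * l + D / 2)\<^sup>2 = 2 / d * t\<^sup>2 * l\<^sup>2 + 2 * D * t / d * l + D\<^sup>2 / (2 * d)"
    using d by (simp add: field_simps power2_eq_square)
  have "2 / d * (t * l + D / 2)\<^sup>2 \<ge> 0" using d by simp
  moreover have "2 * D * t / d * (l + g) = 2 * D * t / d * l + (2 * t + 3 * \<kappa> / \<rho> * t) * g"
    unfolding 3[symmetric] by (simp add: distrib_left)
  ultimately show ?thesis using 1 unfolding 2 4 by (simp add: algebra_simps)
qed

context
  fixes f :: "'a \<Rightarrow> real" and \<epsilon> :: real
  assumes f: "test_fun A f" "\<And>x. f x \<ge> 0" and \<epsilon>: "\<epsilon> > 0"
begin

definition "U t x = P t f x + \<epsilon>"

text \<open>The gradient terms are written as quotients of forms in \<open>P t f\<close>, which is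
  convenient for time derivatives and for bounds; \<open>quotient_eq\<close> rewrites them as U
  times a form in ln U, which is what smoothness and the action of \<open>L\<close> are computed
  from. The last term contains L U, since \<open>P t (L f)\<close> equals it.\<close>

definition "liyau t x = t\<^sup>2 * (carre L (P t f) (P t f) x / U t x)
  + (2 * \<rho> / 3) * t ^ 3 * (GZ (P t f) (P t f) x / U t x)
  - D\<^sup>2 / (2 * d) * t * U t x - D / d * t\<^sup>2 * P t (L f) x"

definition "liyau' t x =
  2 * t * (carre L (P t f) (P t f) x / U t x)
  + t\<^sup>2 * (2 * carre L (P t f) (P t (L f)) x / U t x
     - carre L (P t f) (P t f) x * P t (L f) x / (U t x)\<^sup>2)
  + 2 * \<rho> * t\<^sup>2 * (GZ (P t f) (P t f) x / U t x)
  + (2 * \<rho> / 3) * t ^ 3 * (2 * GZ (P t f) (P t (L f)) x / U t x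
     - GZ (P t f) (P t f) x * P t (L f) x / (U t x)\<^sup>2)
  - D\<^sup>2 / (2 * d) * U t x - D\<^sup>2 / (2 * d) * t * P t (L f) x
  - 2 * D * t / d * P t (L f) x - D / d * t\<^sup>2 * P t (L (L f)) x"

lemma U_ge: "t > 0 \<Longrightarrow> U t x \<ge> \<epsilon>"
  using P_nonneg[OF _ f(2)] by (simp add: U_def)

lemma U_pos: "t > 0 \<Longrightarrow> U t x > 0"
  using U_ge \<epsilon> by (metis less_le_trans)

lemma U_smooth: "t > 0 \<Longrightarrow> smooth_fun A (U t)"
  unfolding U_def by (intro smooth_fun_add smooth_fun_const P_smooth f)

lemma form_U:
  assumes "sym_form A G" "t > 0" "smooth_fun A g"
  shows "G (U t) g x = G (P t f) g x"
proof -
  interpret G: sym_form A G by (rule assms(1))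
  show ?thesis unfolding U_def
    by (simp add: G.form_add(1)[OF P_smooth[OF assms(2) f(1)] smooth_fun_const assms(3)] G.form_const(1)[OF assms(3)])
qed

lemma form_U_U:
  assumes "sym_form A G" "t > 0"
  shows "G (U t) (U t) x = G (P t f) (P t f) x"
proof -
  interpret G: sym_form A G by (rule assms(1))
  note s = U_smooth[OF assms(2)] P_smooth[OF assms(2) f(1)]
  show ?thesis
    using form_U[OF assms s(1)] form_U[OF assms s(2)] G.form_commute[OF s] by simp
qed

lemma L_U: "t > 0 \<Longrightarrow> L (U t) x = P t (L f) x"
  unfolding U_def using L_add[OF P_smooth[OF _ f(1)] smooth_fun_const] L_P[OF _ f(1)] by (simp add: L_const)

lemma U_has_derivative: "t > 0 \<Longrightarrow> ((\<lambda>s. U s x) has_real_derivative P t (L f) x) (at t)"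
  unfolding U_def by (auto intro!: derivative_eq_intros P_has_derivative f)

lemma U_continuous: "continuous_on ({0<..} \<times> UNIV) (\<lambda>q. U (fst q) (snd q))"
  unfolding U_def using P_joint_continuous[OF f(1)] by (auto intro!: continuous_intros simp: case_prod_beta')

lemma quotient_eq:
  assumes G: "sym_form A G" and t: "t > 0"
  shows "G (P t f) (P t f) x / U t x = U t x * G (\<lambda>y. ln (U t y)) (\<lambda>y. ln (U t y)) x"
proof -
  interpret G: sym_form A G by (rule G)
  note lc = log_calculus[OF G U_smooth[OF t] U_pos[OF t]]
  show ?thesis
    using lc(2)[OF U_smooth[OF t], of x] lc(2)[OF lc(1), of x] G.form_commute[OF lc(1) U_smooth[OF t]]
      U_pos[OF t, of x] form_U_U[OF G t, of x] by (simp add: field_simps)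
qed

lemma liyau_smooth: "t > 0 \<Longrightarrow> smooth_fun A (liyau t)"
proof -
  assume t: "t > 0"
  have s: "smooth_fun A (\<lambda>y. ln (U t y))"
    by (rule log_calculus(1)[OF carre.sym_form_axioms U_smooth[OF t] U_pos[OF t]])
  have e: "liyau t = (\<lambda>x. t\<^sup>2 * (U t x * carre L (\<lambda>y. ln (U t y)) (\<lambda>y. ln (U t y)) x)
    + (2 * \<rho> / 3) * t ^ 3 * (U t x * GZ (\<lambda>y. ln (U t y)) (\<lambda>y. ln (U t y)) x)
    - D\<^sup>2 / (2 * d) * t * U t x - D / d * t\<^sup>2 * P t (L f) x)"
    unfolding liyau_def by (simp add: quotient_eq[OF carre.sym_form_axioms t] quotient_eq[OF Z.sym_form_axioms t])
  show ?thesis unfolding e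
    by (intro smooth_fun_add smooth_fun_diff smooth_fun_mult smooth_fun_const U_smooth[OF t]
        carre.smooth_fun_form Z.smooth_fun_form s P_smooth[OF t test_fun_L[OF f(1)]])
qed

lemma liyau_has_derivative:
  assumes t: "t > 0" shows "((\<lambda>s. liyau s x) has_real_derivative liyau' t x) (at t)"
proof -
  have q: "((\<lambda>s. G (P s f) (P s f) x / U s x) has_real_derivative
      2 * G (P t f) (P t (L f)) x / U t x - G (P t f) (P t f) x * P t (L f) x / (U t x)\<^sup>2) (at t)"
    if G: "sym_form A G" for G
    using DERIV_divide[OF form_P_has_derivative[OF G t f(1), of x] U_has_derivative[OF t, of x]] U_pos[OF t, of x]
    by (simp add: diff_divide_distrib power2_eq_square)
  show ?thesis
    unfolding liyau_def
    by (rule derivative_eq_intros q[OF carre.sym_form_axioms] q[OF Z.sym_form_axioms] U_has_derivative[OF t]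
        P_has_derivative[OF t test_fun_L[OF f(1)]] refl)+
      (simp add: liyau'_def algebra_simps power2_eq_square power3_eq_cube)
qed

lemma liyau_continuous:
  "continuous_on ({0<..} \<times> UNIV) (\<lambda>(t, x). liyau t x)"
  "continuous_on ({0<..} \<times> UNIV) (\<lambda>(t, x). liyau' t x)"
proof -
  have P: "continuous_on ({0<..} \<times> UNIV) (\<lambda>q. P (fst q) g (snd q))" if "test_fun A g" for g
    using P_joint_continuous[OF that] by (simp add: case_prod_beta')
  have c: "continuous_on ({0<..} \<times> UNIV) (\<lambda>q. G (P (fst q) f) (P (fst q) g) (snd q))"
    if "sym_form A G" "test_fun A g" for G g
    using form_P_continuous[OF that(1) f(1) that(2)] by (simp add: case_prod_beta')
  have nz: "U (fst q) (snd q) \<noteq> 0" if "q \<in> {0<..} \<times> UNIV" for q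
    using U_pos[of "fst q" "snd q"] that by auto
  have nz2: "(U (fst q) (snd q))\<^sup>2 \<noteq> 0" if "q \<in> {0<..} \<times> UNIV" for q
    using nz[OF that] by simp
  note t1 = test_fun_L[OF f(1)] and t2 = test_fun_L[OF test_fun_L[OF f(1)]]
  note cs = c[OF carre.sym_form_axioms f(1)] c[OF Z.sym_form_axioms f(1)]
    c[OF carre.sym_form_axioms t1] c[OF Z.sym_form_axioms t1] P[OF t1] P[OF t2] U_continuous
    continuous_on_fst[OF continuous_on_id]
  show "continuous_on ({0<..} \<times> UNIV) (\<lambda>(t, x). liyau t x)"
    unfolding case_prod_beta' liyau_def
    by (intro cs continuous_on_add continuous_on_diff continuous_on_mult continuous_on_divide
        continuous_on_const continuous_on_power ballI nz)
  show "continuous_on ({0<..} \<times> UNIV) (\<lambda>(t, x). liyau' t x)"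
    unfolding case_prod_beta' liyau'_def
    by (intro cs continuous_on_add continuous_on_diff continuous_on_mult continuous_on_divide
        continuous_on_const continuous_on_power ballI nz nz2) (use d in auto)
qed

text \<open>U and L U solve the heat equation, so of the last two terms only the time derivatives of
  their weights survive. The gradient terms contribute the iterated forms of u = ln U, and the whole
  difference is U times the expression that \<open>li_yau_algebra\<close> shows to be
  nonpositive.\<close>

lemma liyau_subsolution:
  assumes t: "t > 0" shows "liyau' t x \<le> L (liyau t) x"
proof -
  define u where "u = (\<lambda>y. ln (U t y))"
  note Us = U_smooth[OF t] and Up = U_pos[OF t]
  have u: "smooth_fun A u"
    unfolding u_def by (rule log_calculus(1)[OF carre.sym_form_axioms Us Up])
  let ?X1 = "\<lambda>y. U t y * carre L u u y" and ?X2 = "\<lambda>y. U t y * GZ u u y"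
  have X: "smooth_fun A ?X1" "smooth_fun A ?X2" using u Us by auto
  note Pf = P_smooth[OF t f(1)] and PLf = P_smooth[OF t test_fun_L[OF f(1)]]
  have ev: "2 * G (P t f) (P t (L f)) x / U t x - G (P t f) (P t f) x * P t (L f) x / (U t x)\<^sup>2
      = L (\<lambda>y. U t y * G u u y) x - 2 * U t x * iterated L G u x"
    if G: "sym_form A G" and "carre L u (G u u) = G u (carre L u u)" for G
  proof -
    have LU: "L (U t) = P t (L f)" using L_U[OF t] by auto
    show ?thesis
      using evolution_iterated[OF G Us Up, of x, folded u_def] that(2)
        form_U[OF G t PLf] form_U_U[OF G t] by (simp add: LU)
  qed
  have ev1: "2 * carre L (P t f) (P t (L f)) x / U t x - carre L (P t f) (P t f) x * P t (L f) x / (U t x)\<^sup>2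
      = L ?X1 x - 2 * U t x * iterated L (carre L) u x"
    by (rule ev[OF carre.sym_form_axioms]) simp
  have ev2: "2 * GZ (P t f) (P t (L f)) x / U t x - GZ (P t f) (P t f) x * P t (L f) x / (U t x)\<^sup>2
      = L ?X2 x - 2 * U t x * iterated L GZ u x"
    by (rule ev[OF Z.sym_form_axioms]) (use commute[OF u] in auto)
  have eX: "carre L (P t f) (P t f) y / U t y = ?X1 y" "GZ (P t f) (P t f) y / U t y = ?X2 y" for y
    unfolding u_def by (rule quotient_eq[OF carre.sym_form_axioms t] quotient_eq[OF Z.sym_form_axioms t])+
  have e: "liyau t = (\<lambda>y. ((t\<^sup>2 * ?X1 y + (2 * \<rho> / 3) * t ^ 3 * ?X2 y)
    - D\<^sup>2 / (2 * d) * t * U t y) - D / d * t\<^sup>2 * P t (L f) y)"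
    unfolding liyau_def by (simp only: eX)
  have sm: "smooth_fun A (\<lambda>y. t\<^sup>2 * ?X1 y)" "smooth_fun A (\<lambda>y. (2 * \<rho> / 3) * t ^ 3 * ?X2 y)"
    "smooth_fun A (\<lambda>y. D\<^sup>2 / (2 * d) * t * U t y)" "smooth_fun A (\<lambda>y. D / d * t\<^sup>2 * P t (L f) y)"
    by (rule smooth_fun_mult[OF smooth_fun_const]; rule X Us PLf)+
  have Ll: "L (liyau t) x = t\<^sup>2 * L ?X1 x + (2 * \<rho> / 3) * t ^ 3 * L ?X2 x
      - D\<^sup>2 / (2 * d) * t * P t (L f) x - D / d * t\<^sup>2 * P t (L (L f)) x"
    unfolding e
    by (simp only: L_diff[OF smooth_fun_diff[OF smooth_fun_add[OF sm(1,2)] sm(3)] sm(4)]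
        L_diff[OF smooth_fun_add[OF sm(1,2)] sm(3)] L_add[OF sm(1,2)]
        L_cmult[OF X(1)] L_cmult[OF X(2)] L_cmult[OF Us] L_cmult[OF PLf] L_U[OF t] L_P[OF t test_fun_L[OF f(1)]])
  have PLfe: "P t (L f) x = U t x * (L u x + carre L u u x)"
    using log_calculus(3)[OF carre.sym_form_axioms Us Up, folded u_def] L_U[OF t] by metis
  have "liyau' t x - L (liyau t) x = U t x * (2 * t * carre L u u x + 2 * \<rho> * t\<^sup>2 * GZ u u x
      - 2 * (t\<^sup>2 * iterated L (carre L) u x + (2 * \<rho> / 3) * t ^ 3 * iterated L GZ u x)
      - D\<^sup>2 / (2 * d) - 2 * D * t / d * (L u x + carre L u u x))"
    unfolding Ll liyau'_def ev1 ev2 eX unfolding PLfe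
    by (simp add: algebra_simps add_divide_distrib)
  also have "\<dots> \<le> 0"
  proof (rule mult_nonneg_nonpos[OF less_imp_le[OF Up] li_yau_algebra[OF t]])
    show "iterated L (carre L) u x + (2 * \<rho> / 3 * t) * iterated L GZ u x
        \<ge> 1 / d * (L u x)\<^sup>2 - \<kappa> / (2 * \<rho> / 3 * t) * carre L u u x + \<rho> * GZ u u x"
      by (rule CD[OF u]) (use t \<rho> in simp)
  qed
  finally show ?thesis by simp
qed

text \<open>Each term has a weight with a factor t, and U >= epsilon together with the gradient
  bounds controls the quotients. The factor t replaces an initial condition at time 0.\<close>

lemma liyau_bound:
  assumes "T > 0"
  obtains C where "\<And>t x. 0 < t \<Longrightarrow> t \<le> T \<Longrightarrow> \<bar>liyau t x\<bar> \<le> C * t"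
proof -
  obtain B where B: "\<And>t x. 0 < t \<Longrightarrow> t \<le> T \<Longrightarrow> carre L (P t f) (P t f) x \<le> B"
    "\<And>t x. 0 < t \<Longrightarrow> t \<le> T \<Longrightarrow> GZ (P t f) (P t f) x \<le> B"
    using gradient_bound[OF f(1) assms] by blast
  obtain F where F: "F > 0" "\<And>y. \<bar>f y\<bar> \<le> F" by (rule test_fun_bounded[OF f(1)]) blast
  obtain F' where F': "F' > 0" "\<And>y. \<bar>L f y\<bar> \<le> F'" by (rule test_fun_bounded[OF test_fun_L[OF f(1)]]) blast
  define C where "C = T * (B / \<epsilon>) + (2 * \<rho> / 3) * T\<^sup>2 * (B / \<epsilon>) + D\<^sup>2 / (2 * d) * (F + \<epsilon>) + D / d * T * F'"
  show thesis
  proof (rule that[of C])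
    fix t x assume t: "0 < t" "t \<le> T"
    have q: "0 \<le> G (P t f) (P t f) x / U t x" "G (P t f) (P t f) x / U t x \<le> B / \<epsilon>"
      if "0 \<le> G (P t f) (P t f) x" "G (P t f) (P t f) x \<le> B" for G :: "('a \<Rightarrow> real) \<Rightarrow> ('a \<Rightarrow> real) \<Rightarrow> 'a \<Rightarrow> real"
    proof -
      show "0 \<le> G (P t f) (P t f) x / U t x" using that(1) U_pos[OF t(1), of x] by simp
      show "G (P t f) (P t f) x / U t x \<le> B / \<epsilon>"
        using that \<epsilon> U_ge[OF t(1), of x] by (intro frac_le) auto
    qed
    note q1 = q[of "carre L", OF carre_nonneg[OF P_smooth[OF t(1) f(1)]] B(1)[OF t]]
    note q2 = q[of GZ, OF GZ_nonneg[OF P_smooth[OF t(1) f(1)]] B(2)[OF t]]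
    have U1: "0 \<le> U t x" "U t x \<le> F + \<epsilon>"
      using U_pos[OF t(1), of x] P_abs_le[OF t(1) f(1) F(2), of x] by (auto simp: U_def)
    have PL: "\<bar>P t (L f) x\<bar> \<le> F'" by (rule P_abs_le[OF t(1) test_fun_L[OF f(1)] F'(2)])
    have tt: "t\<^sup>2 \<le> T * t" "t ^ 3 \<le> T\<^sup>2 * t"
      using t by (auto simp: power2_eq_square power3_eq_cube intro!: mult_mono)
    have 1: "0 \<le> t\<^sup>2 * (carre L (P t f) (P t f) x / U t x)"
      "t\<^sup>2 * (carre L (P t f) (P t f) x / U t x) \<le> (T * t) * (B / \<epsilon>)"
      using q1 tt t by (auto intro!: mult_nonneg_nonneg mult_mono simp del: times_divide_eq_right)
    have 2: "0 \<le> (2 * \<rho> / 3) * t ^ 3 * (GZ (P t f) (P t f) x / U t x)"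
      "(2 * \<rho> / 3) * t ^ 3 * (GZ (P t f) (P t f) x / U t x) \<le> (2 * \<rho> / 3) * (T\<^sup>2 * t) * (B / \<epsilon>)"
    proof -
      show "0 \<le> (2 * \<rho> / 3) * t ^ 3 * (GZ (P t f) (P t f) x / U t x)"
        using q2(1) \<rho> t by (intro mult_nonneg_nonneg) auto
      show "(2 * \<rho> / 3) * t ^ 3 * (GZ (P t f) (P t f) x / U t x) \<le> (2 * \<rho> / 3) * (T\<^sup>2 * t) * (B / \<epsilon>)"
        using q2 tt(2) \<rho> t by (intro mult_mono mult_left_mono) auto
    qed
    have 3: "0 \<le> D\<^sup>2 / (2 * d) * t * U t x" "D\<^sup>2 / (2 * d) * t * U t x \<le> D\<^sup>2 / (2 * d) * t * (F + \<epsilon>)"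
      using U1 d t by (auto intro!: mult_nonneg_nonneg mult_left_mono simp del: times_divide_eq_left)
    have 4: "\<bar>D / d * t\<^sup>2 * P t (L f) x\<bar> \<le> D / d * (T * t) * F'"
      unfolding abs_mult using PL tt(1) D_pos d t by (intro mult_mono) auto
    have "\<bar>liyau t x\<bar> \<le> (T * t) * (B / \<epsilon>) + (2 * \<rho> / 3) * (T\<^sup>2 * t) * (B / \<epsilon>)
        + D\<^sup>2 / (2 * d) * t * (F + \<epsilon>) + D / d * (T * t) * F'"
      unfolding liyau_def using 1 2 3 4 by linarith
    also have "\<dots> = C * t" by (simp add: C_def algebra_simps)
    finally show "\<bar>liyau t x\<bar> \<le> C * t" .
  qed
qed

theorem li_yau:
  assumes t: "t > 0"
  shows "d / D * (carre L (P t f) (P t f) x / (U t x)\<^sup>2) \<le> P t (L f) x / U t x + D / (2 * t)"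
proof -
  obtain C where C: "\<And>s x. 0 < s \<Longrightarrow> s \<le> t \<Longrightarrow> \<bar>liyau s x\<bar> \<le> C * s"
    by (rule liyau_bound[OF t]) blast
  have "liyau t x \<le> 0"
    by (rule subsolution_nonpos[OF liyau_smooth liyau_has_derivative liyau_continuous liyau_subsolution C t order_refl])
  \<comment> \<open>The \<open>GZ\<close> term was needed for the evolution to close; its sign
    allows it to be dropped now.\<close>
  moreover have "0 \<le> (2 * \<rho> / 3) * t ^ 3 * (GZ (P t f) (P t f) x / U t x)"
    using GZ_nonneg[OF P_smooth[OF t f(1)], of x] U_pos[OF t, of x] \<rho> t by simp
  ultimately have "t\<^sup>2 * (carre L (P t f) (P t f) x / U t x) \<le> D\<^sup>2 / (2 * d) * t * U t x + D / d * t\<^sup>2 * P t (L f) x"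
    unfolding liyau_def by linarith
  then have "d / (D * t\<^sup>2 * U t x) * (t\<^sup>2 * (carre L (P t f) (P t f) x / U t x))
      \<le> d / (D * t\<^sup>2 * U t x) * (D\<^sup>2 / (2 * d) * t * U t x + D / d * t\<^sup>2 * P t (L f) x)"
    using d D_pos t U_pos[OF t, of x] by (intro mult_left_mono) auto
  also have "\<dots> = P t (L f) x / U t x + D / (2 * t)"
    using d D_pos t U_pos[OF t, of x] by (simp add: field_simps power2_eq_square)
  also have "d / (D * t\<^sup>2 * U t x) * (t\<^sup>2 * (carre L (P t f) (P t f) x / U t x)) =
      d / D * (carre L (P t f) (P t f) x / (U t x)\<^sup>2)"
    using D_pos t U_pos[OF t, of x] by (simp add: field_simps power2_eq_square)
  finally show ?thesis .
qed

end

end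

section \<open>The distance\<close>

context diffusion
begin

definition unit_grad :: "('a \<Rightarrow> real) \<Rightarrow> bool" where
  "unit_grad f \<longleftrightarrow> smooth_fun A f \<and> (\<forall>x. carre L f f x \<le> 1)"

lemma sup_norm_carre_le_1:
  assumes "smooth_fun A f"
  shows "sup_norm (carre L f f) \<le> 1 \<longleftrightarrow> (\<forall>x. carre L f f x \<le> 1)"
  using carre_nonneg[OF assms] by (simp add: sup_norm_def SUP_le_iff)

lemma cc_dist_eq: "cc_dist A L x y = Sup {\<bar>f x - f y\<bar> | f. unit_grad f}"
proof -
  have "{\<bar>f x - f y\<bar> | f. smooth_fun A f \<and> sup_norm (carre L f f) \<le> 1} = {\<bar>f x - f y\<bar> | f. unit_grad f}"
    using sup_norm_carre_le_1 unfolding unit_grad_def by blast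
  then show ?thesis by (simp add: cc_dist_def)
qed

lemma carre_local:
  assumes "smooth_fun A f" "smooth_fun A g" "open W" "x \<in> W" "\<And>y. y \<in> W \<Longrightarrow> f y = g y"
  shows "carre L f f x = carre L g g x"
  using carre.form_local(1)[OF assms(1,2,1,3,4,5)] carre.form_local(2)[OF assms(1,2,2,3,4,5)] by simp

lemma unit_grad_smooth: "unit_grad f \<Longrightarrow> smooth_fun A f"
  by (simp add: unit_grad_def)

lemma unit_grad_const: "unit_grad (\<lambda>_. c)"
  by (simp add: unit_grad_def carre.form_const)

lemma carre_affine:
  assumes "smooth_fun A f"
  shows "carre L (\<lambda>y. a * f y + b) (\<lambda>y. a * f y + b) x = a\<^sup>2 * carre L f f x"
proof -
  have s: "smooth_fun A (\<lambda>y. a * f y)" "smooth_fun A (\<lambda>y. a * f y + b)"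
    by (intro smooth_fun_add smooth_fun_mult smooth_fun_const assms)+
  show ?thesis
    by (simp add: carre.form_add[OF s(1) smooth_fun_const s(2)] carre.form_add[OF s(1) smooth_fun_const s(1)]
        carre.form_cmult[OF assms s(1)] carre.form_cmult[OF assms assms] carre.form_const s power2_eq_square)
qed

lemma unit_grad_affine: "unit_grad f \<Longrightarrow> \<bar>a\<bar> \<le> 1 \<Longrightarrow> unit_grad (\<lambda>y. a * f y + b)"
  unfolding unit_grad_def
  using carre_affine[of f a b] carre_nonneg[of f] abs_square_le_1[of a]
  by (auto intro!: mult_le_one smooth_fun_add smooth_fun_mult)

text \<open>A smooth maximum with error at most \<open>e\<close>. It is deliberately asymmetric: it
  equals \<open>b\<close> exactly wherever a <= b, so it can be glued to \<open>b\<close> there, and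
  it never falls below \<open>b\<close>.\<close>

definition smax :: "real \<Rightarrow> real \<Rightarrow> real \<Rightarrow> real" where
  "smax e a b = b + e * spos (1 / e * (a - b))"

lemma smax_eq: "e > 0 \<Longrightarrow> a \<le> b \<Longrightarrow> smax e a b = b"
  by (simp add: smax_def spos_eq_0 divide_nonpos_pos)

lemma smax_ge: "e > 0 \<Longrightarrow> smax e a b \<ge> b"
  by (simp add: smax_def spos_nonneg)

lemma smax_ge': "e > 0 \<Longrightarrow> smax e a b \<ge> a - e"
proof -
  assume e: "e > 0"
  have "e * (1 / e * (a - b) - 1) \<le> e * spos (1 / e * (a - b))"
    using e by (intro mult_left_mono spos_ge) auto
  moreover have "e * (1 / e * (a - b) - 1) = a - b - e" using e by (simp add: right_diff_distrib)
  ultimately show ?thesis by (simp add: smax_def)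
qed

lemma smax_le: "e > 0 \<Longrightarrow> smax e a b \<le> max a b"
proof (cases "a \<le> b")
  case False
  assume e: "e > 0"
  have "e * spos (1 / e * (a - b)) \<le> e * (1 / e * (a - b))"
    using e False by (intro mult_left_mono spos_le) auto
  then show ?thesis using e False by (simp add: smax_def)
qed (simp add: smax_eq)

lemma smax_smooth:
  assumes "smooth_fun A f" "smooth_fun A g"
  shows "smooth_fun A (\<lambda>y. smax e (f y) (g y))"
proof -
  have "smooth_fun A (\<lambda>y. 1 / e * (f y - g y))"
    by (intro smooth_fun_mult smooth_fun_const smooth_fun_diff assms)
  from smooth_fun_compose[OF smooth_on_spos open_UNIV this]
  have "smooth_fun A (\<lambda>y. spos (1 / e * (f y - g y)))" by simp
  then show ?thesis unfolding smax_def
    by (intro smooth_fun_add smooth_fun_mult smooth_fun_const assms)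
qed

text \<open>The differential of the smooth maximum is a convex combination of the differentials.\<close>

lemma carre_smax_le_1:
  assumes f: "smooth_fun A f" and g: "smooth_fun A g" and e: "e > 0"
    and le: "carre L f f x \<le> 1" "carre L g g x \<le> 1"
  shows "carre L (\<lambda>y. smax e (f y) (g y)) (\<lambda>y. smax e (f y) (g y)) x \<le> 1"
proof -
  define r where "r = (\<lambda>y. 1 / e * (f y - g y))"
  define \<theta> where "\<theta> = spos' (r x)"
  have \<theta>: "0 \<le> \<theta>" "\<theta> \<le> 1" unfolding \<theta>_def by (rule spos'_nonneg spos'_le_1)+
  have d: "smooth_fun A (\<lambda>y. f y - g y)" using f g by auto
  have r: "smooth_fun A r" unfolding r_def by (intro smooth_fun_mult smooth_fun_const d)
  have s: "smooth_fun A (\<lambda>y. spos (r y))"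
    using smooth_fun_compose[OF smooth_on_spos open_UNIV r] by simp
  have es: "smooth_fun A (\<lambda>y. e * spos (r y))" by (intro smooth_fun_mult smooth_fun_const s)
  have m: "(\<lambda>y. smax e (f y) (g y)) = (\<lambda>y. g y + e * spos (r y))" by (simp add: smax_def r_def)
  have D: "carre L (\<lambda>y. g y + e * spos (r y)) k x = (1 - \<theta>) * carre L g k x + \<theta> * carre L f k x"
    if k: "smooth_fun A k" for k
  proof -
    have "carre L (\<lambda>y. spos (r y)) k x = \<theta> * carre L r k x"
      unfolding \<theta>_def by (rule carre.form_compose(1)[OF r k smooth_on_spos open_UNIV UNIV_I DERIV_spos])
    moreover have "carre L r k x = 1 / e * carre L (\<lambda>y. f y - g y) k x"
      unfolding r_def by (rule carre.form_cmult(1)[OF d k])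
    moreover have "carre L (\<lambda>y. f y - g y) k x = carre L f k x - carre L g k x"
      using carre.form_add(1)[OF f smooth_fun_minus[OF g] k] carre.form_cmult(1)[OF g k, of "-1"] by simp
    ultimately have "e * carre L (\<lambda>y. spos (r y)) k x = \<theta> * (carre L f k x - carre L g k x)"
      using e by simp
    then show ?thesis
      by (simp add: carre.form_add(1)[OF g es k] carre.form_cmult(1)[OF s k] left_diff_distrib right_diff_distrib)
  qed
  have ms: "smooth_fun A (\<lambda>y. g y + e * spos (r y))" using g es by auto
  have "carre L (\<lambda>y. g y + e * spos (r y)) (\<lambda>y. g y + e * spos (r y)) x =
      (1 - \<theta>) * ((1 - \<theta>) * carre L g g x + \<theta> * carre L f g x)
      + \<theta> * ((1 - \<theta>) * carre L g f x + \<theta> * carre L f f x)"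
    by (simp only: D[OF ms] carre_commute[of g "\<lambda>y. g y + e * spos (r y)"]
        carre_commute[of f "\<lambda>y. g y + e * spos (r y)"] D[OF g] D[OF f])
  also have "\<dots> = (1 - \<theta>)\<^sup>2 * carre L g g x + \<theta> * (1 - \<theta>) * (2 * carre L f g x) + \<theta>\<^sup>2 * carre L f f x"
    using carre_commute[of f g x] by (simp add: power2_eq_square algebra_simps)
  also have "\<dots> \<le> (1 - \<theta>)\<^sup>2 * carre L g g x + \<theta> * (1 - \<theta>) * (carre L f f x + carre L g g x) + \<theta>\<^sup>2 * carre L f f x"
  proof -
    have "2 * carre L f g x \<le> carre L f f x + carre L g g x"
      using carre.form_quadratic[OF f g carre_nonneg, of 1 x "-1"] by simp
    then show ?thesis using \<theta> by (intro add_mono mult_left_mono) auto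
  qed
  also have "\<dots> = (1 - \<theta>) * carre L g g x + \<theta> * carre L f f x"
    by (simp add: power2_eq_square algebra_simps)
  also have "\<dots> \<le> (1 - \<theta>) * 1 + \<theta> * 1" using \<theta> le by (intro add_mono mult_left_mono) auto
  finally show ?thesis by (simp add: m)
qed

text \<open>The error does not accumulate with the number of functions: the previous maximum enters
  as the second argument of \<open>smax\<close>, which loses nothing, and each function enters only
  once as the first.\<close>

lemma unit_grad_finite_max:
  assumes "finite I" "I \<noteq> {}" "\<And>f. f \<in> I \<Longrightarrow> unit_grad f" "e > 0"
  obtains F where "unit_grad F" "\<And>f y. f \<in> I \<Longrightarrow> F y \<ge> f y - e"
    "\<And>y c. (\<And>f. f \<in> I \<Longrightarrow> f y \<le> c) \<Longrightarrow> F y \<le> c"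
proof -
  have "\<exists>F. unit_grad F \<and> (\<forall>f\<in>I. \<forall>y. F y \<ge> f y - e) \<and> (\<forall>y c. (\<forall>f\<in>I. f y \<le> c) \<longrightarrow> F y \<le> c)"
    using assms(1,2,3)
  proof (induction I rule: finite_ne_induct)
    case (singleton f)
    then show ?case using assms(4) by (intro exI[of _ f]) auto
  next
    case (insert f I)
    then obtain F where F: "unit_grad F" "\<forall>f\<in>I. \<forall>y. F y \<ge> f y - e" "\<forall>y c. (\<forall>f\<in>I. f y \<le> c) \<longrightarrow> F y \<le> c"
      by blast
    have f: "unit_grad f" using insert by blast
    have 1: "unit_grad (\<lambda>y. smax e (f y) (F y))"
      using f F(1) carre_smax_le_1[of f F e] smax_smooth assms(4) by (auto simp: unit_grad_def)
    have ge: "smax e (f y) (F y) \<ge> f y - e" "smax e (f y) (F y) \<ge> F y" "smax e (f y) (F y) \<le> max (f y) (F y)" for y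
      using smax_ge' smax_ge smax_le assms(4) by auto
    show ?case
    proof (intro exI[of _ "\<lambda>y. smax e (f y) (F y)"] conjI ballI allI impI 1)
      fix g y assume "g \<in> insert f I"
      then consider "g = f" | "g \<in> I" by blast
      then show "g y - e \<le> smax e (f y) (F y)"
      proof cases
        case 2
        then have "g y - e \<le> F y" using F(2) by blast
        then show ?thesis using ge(2)[of y] by linarith
      qed (use ge(1) in simp)
    next
      fix y c assume "\<forall>g\<in>insert f I. g y \<le> c"
      then show "smax e (f y) (F y) \<le> c" using ge(3)[of y] F(3) by force
    qed
  qed
  then show thesis using that by blast
qed

end

section \<open>The distance as a supremum: eikonal inequality and minimisation\<close>

locale finite_diffusion = exhausted_diffusion A L \<mu> h
  for A :: "('a::{t2_space, second_countable_topology}, 'e::euclidean_space) atlas" and L and \<mu> and h +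
  assumes finite: "\<And>x y. \<exists>T. \<forall>f. unit_grad f \<longrightarrow> \<bar>f x - f y\<bar> \<le> T"
begin

abbreviation "dst \<equiv> cc_dist A L"

lemma dst_upper: "unit_grad f \<Longrightarrow> \<bar>f x - f y\<bar> \<le> dst x y"
  unfolding cc_dist_eq using finite[of x y] by (intro cSup_upper) (auto simp: bdd_above_def)

lemma dst_le: "(\<And>f. unit_grad f \<Longrightarrow> \<bar>f x - f y\<bar> \<le> c) \<Longrightarrow> dst x y \<le> c"
  unfolding cc_dist_eq using unit_grad_const[of 0] by (intro cSup_least) auto

lemma dst_nonneg: "dst x y \<ge> 0"
  using dst_upper[OF unit_grad_const[of 0], of x y] by simp

lemma dst_refl: "dst x x = 0"
  using dst_le[of x x 0] dst_nonneg[of x x] by fastforce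

lemma dst_approx:
  assumes "c < dst x y" obtains f where "unit_grad f" "f x = 0" "f y > c"
proof -
  have "\<not> (\<forall>f. unit_grad f \<longrightarrow> \<bar>f x - f y\<bar> \<le> c)" using dst_le[of x y c] assms by force
  then obtain f where f: "unit_grad f" "\<bar>f x - f y\<bar> > c" by force
  show thesis
  proof (cases "f y \<ge> f x")
    case True
    then show thesis using that[of "\<lambda>z. 1 * f z + (- f x)"] unit_grad_affine[OF f(1), of 1 "- f x"] f(2) by auto
  next
    case False
    then show thesis using that[of "\<lambda>z. (-1) * f z + f x"] unit_grad_affine[OF f(1), of "-1" "f x"] f(2) by auto
  qed
qed

text \<open>Perron's argument: a function touching the distance from below with gradient smaller than
  one could be glued into a competitor that beats the supremum.\<close>

lemma eikonal_supersolution: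
  assumes q: "smooth_fun A q" "\<And>y. q y \<le> dst x y" "q y0 = dst x y0" "dst x y0 > 0"
  shows "carre L q q y0 \<ge> 1"
proof (rule ccontr)
  assume "\<not> carre L q q y0 \<ge> 1"
  then have q1: "carre L q q y0 < 1" by simp
  have xy0: "y0 \<noteq> x" using q(4) dst_refl by auto
  \<comment> \<open>The point \<open>x\<close> is excluded so that the lifted competitor is left
    untouched there.\<close>
  define O' where "O' = {y. carre L q q y < 1} \<inter> - {x}"
  have "open O'" unfolding O'_def
    using q(1) by (intro open_Int open_Collect_less smooth_fun_continuous carre.smooth_fun_form continuous_on_const) auto
  moreover have "y0 \<in> O'" using q1 xy0 by (simp add: O'_def)
  ultimately obtain \<zeta>1 where z1: "test_fun A \<zeta>1" "\<And>y. \<zeta>1 y \<ge> 0" "\<zeta>1 y0 > 0" "tsupp \<zeta>1 \<subseteq> O'"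
    by (rule bump_exists) blast
  define N where "N = {y. 0 < \<zeta>1 y}"
  define K where "K = tsupp \<zeta>1"
  have N: "open N" unfolding N_def
    by (intro open_Collect_less continuous_on_const smooth_fun_continuous test_fun_smooth z1)
  have K: "compact K" unfolding K_def by (rule test_fun_compact[OF z1(1)])
  have NK: "N \<subseteq> K" unfolding N_def K_def using tsupp_outside[of _ \<zeta>1] by force
  have KO: "K \<subseteq> O'" using z1(4) by (simp add: K_def)
  have y0N: "y0 \<in> N" using z1(3) by (simp add: N_def)
  \<comment> \<open>Two nested bumps: \<open>K\<close> is a compact neighbourhood of y0 with
    Gamma(q) < 1, and the lift of \<open>q\<close> takes place inside its open part
    \<open>N\<close>.\<close>
  obtain \<zeta> where z: "test_fun A \<zeta>" "\<And>y. \<zeta> y \<ge> 0" "\<zeta> y0 > 0" "tsupp \<zeta> \<subseteq> N"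
    by (rule bump_exists[OF N y0N]) blast
  note zs = test_fun_smooth[OF z(1)]
  have Kne: "K \<noteq> {}" using y0N NK by blast
  obtain ym where ym: "ym \<in> K" "\<And>y. y \<in> K \<Longrightarrow> carre L q q y \<le> carre L q q ym"
    using continuous_attains_sup[OF K Kne, of "carre L q q"] q(1) smooth_fun_continuous by blast
  define m where "m = carre L q q ym"
  have m: "m < 1" using ym(1) KO by (auto simp: m_def O'_def)
  have cc: "continuous_on K (\<lambda>y. 2 * \<bar>carre L q \<zeta> y\<bar> + carre L \<zeta> \<zeta> y)"
    using q(1) zs by (intro continuous_intros smooth_fun_continuous carre.smooth_fun_form)
  obtain yb where yb: "\<And>y. y \<in> K \<Longrightarrow> 2 * \<bar>carre L q \<zeta> y\<bar> + carre L \<zeta> \<zeta> y \<le> 2 * \<bar>carre L q \<zeta> yb\<bar> + carre L \<zeta> \<zeta> yb"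
    using continuous_attains_sup[OF K Kne cc] by blast
  define B where "B = 2 * \<bar>carre L q \<zeta> yb\<bar> + carre L \<zeta> \<zeta> yb"
  have B: "B \<ge> 0" using carre_nonneg[OF zs, of yb] by (simp add: B_def)
  \<comment> \<open>The expansion of Gamma(q + s zeta) exceeds Gamma(q) by at most s B on
    \<open>K\<close>, as s <= 1; this s keeps the total below 1.\<close>
  define s where "s = min 1 ((1 - m) / (B + 1))"
  have s: "0 < s" "s \<le> 1" "s * B \<le> 1 - m"
  proof -
    show "0 < s" "s \<le> 1" using m B by (auto simp: s_def)
    have "s * B \<le> (1 - m) / (B + 1) * B" using B by (intro mult_right_mono) (auto simp: s_def)
    also have "\<dots> \<le> 1 - m" using m B by (simp add: field_simps)
    finally show "s * B \<le> 1 - m" .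
  qed
  define \<epsilon> where "\<epsilon> = s * \<zeta> y0 / 2"
  have \<epsilon>: "\<epsilon> > 0" using s(1) z(3) by (simp add: \<epsilon>_def)
  \<comment> \<open>Raised by the bump and lowered by half its height at y0, \<open>Q\<close> lies
    epsilon above the distance at y0 and epsilon below it outside \<open>N\<close>.\<close>
  define Q where "Q = (\<lambda>y. 1 * (q y + s * \<zeta> y) + (- \<epsilon>))"
  have sz: "smooth_fun A (\<lambda>y. s * \<zeta> y)" "smooth_fun A (\<lambda>y. q y + s * \<zeta> y)"
    by (intro smooth_fun_add smooth_fun_mult smooth_fun_const q(1) zs)+
  have Q: "smooth_fun A Q" unfolding Q_def by (intro smooth_fun_add smooth_fun_mult smooth_fun_const sz(2))
  have QK: "carre L Q Q y \<le> 1" if y: "y \<in> K" for y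
  proof -
    have "carre L Q Q y = carre L (\<lambda>y. q y + s * \<zeta> y) (\<lambda>y. q y + s * \<zeta> y) y"
      unfolding Q_def by (subst carre_affine[OF sz(2)]) simp
    also have "\<dots> = carre L q q y + s * (2 * carre L q \<zeta> y) + s * (s * carre L \<zeta> \<zeta> y)"
      using carre_commute[of \<zeta> q y]
      by (simp add: carre.form_add[OF q(1) sz(1) sz(2)] carre.form_add[OF q(1) sz(1) q(1)]
          carre.form_add[OF q(1) sz(1) zs] carre.form_cmult[OF zs sz(2)] carre.form_cmult[OF zs q(1)]
          carre.form_cmult[OF zs zs] algebra_simps)
    also have "\<dots> \<le> m + s * (2 * \<bar>carre L q \<zeta> y\<bar>) + s * (1 * carre L \<zeta> \<zeta> y)"
      using ym(2)[OF y] s carre_nonneg[OF zs, of y]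
      by (intro add_mono mult_left_mono mult_right_mono) (auto simp: m_def)
    also have "\<dots> = m + s * (2 * \<bar>carre L q \<zeta> y\<bar> + carre L \<zeta> \<zeta> y)" by (simp add: algebra_simps)
    also have "\<dots> \<le> m + s * B" using yb[OF y] s(1) by (intro add_mono mult_left_mono) (auto simp: B_def)
    also have "\<dots> \<le> 1" using s(3) by simp
    finally show ?thesis .
  qed
  have Qy0: "Q y0 = dst x y0 + \<epsilon>" using q(3) by (simp add: Q_def \<epsilon>_def)
  have Qout: "Q y \<le> dst x y - \<epsilon>" if "y \<notin> N" for y
  proof -
    have "\<zeta> y = 0" using tsupp_outside[of y \<zeta>] z(4) that by blast
    then show ?thesis using q(2)[of y] by (simp add: Q_def)
  qed
  \<comment> \<open>On this shell around y0 the lifted function must lose against a competitor, and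
    compactness allows finitely many competitors to achieve it.\<close>
  define \<Sigma> where "\<Sigma> = K - N"
  have \<Sigma>: "compact \<Sigma>" unfolding \<Sigma>_def using K N by (rule compact_diff)
  have "\<exists>f. unit_grad f \<and> f x = 0 \<and> f z > dst x z - \<epsilon> / 2" for z
    using dst_approx[of "dst x z - \<epsilon> / 2" x z] \<epsilon> by (metis diff_less_eq half_gt_zero less_add_same_cancel1)
  then obtain f where f: "\<And>z. unit_grad (f z)" "\<And>z. f z x = 0" "\<And>z. f z z > dst x z - \<epsilon> / 2" by metis
  define V where "V = (\<lambda>z. {y. Q y < f z y - \<epsilon> / 2})"
  have Vo: "open (V z)" for z unfolding V_def
    by (intro open_Collect_less smooth_fun_continuous[OF Q] continuous_intros
        smooth_fun_continuous[OF unit_grad_smooth[OF f(1)]])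
  have "\<Sigma> \<subseteq> (\<Union>z\<in>\<Sigma>. V z)"
  proof
    fix z assume z: "z \<in> \<Sigma>"
    then have "Q z < f z z - \<epsilon> / 2" using Qout[of z] f(3)[of z] \<epsilon> by (simp add: \<Sigma>_def)
    then show "z \<in> (\<Union>z\<in>\<Sigma>. V z)" using z by (auto simp: V_def)
  qed
  then obtain I where I: "finite I" "\<Sigma> \<subseteq> (\<Union>z\<in>I. V z)"
    using compactE_image[OF \<Sigma>, of \<Sigma> V] Vo by metis
  \<comment> \<open>The constant 0 keeps the family nonempty when the shell is empty. All members
    vanish at \<open>x\<close>, so \<open>F x\<close> is at most 0.\<close>
  obtain F where F: "unit_grad F" "\<And>g y. g \<in> insert (\<lambda>_. 0) (f ` I) \<Longrightarrow> F y \<ge> g y - \<epsilon> / 2"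
    "\<And>y c. (\<And>g. g \<in> insert (\<lambda>_. 0) (f ` I) \<Longrightarrow> g y \<le> c) \<Longrightarrow> F y \<le> c"
    using unit_grad_finite_max[of "insert (\<lambda>_. 0) (f ` I)" "\<epsilon> / 2"] I(1) f(1) unit_grad_const \<epsilon> by auto
  note Fs = unit_grad_smooth[OF F(1)]
  define W where "W = {y. Q y < F y}"
  have W: "open W" unfolding W_def
    by (intro open_Collect_less smooth_fun_continuous[OF Q] smooth_fun_continuous[OF Fs])
  have \<Sigma>W: "\<Sigma> \<subseteq> W"
  proof
    fix y assume "y \<in> \<Sigma>"
    then obtain z where "z \<in> I" "Q y < f z y - \<epsilon> / 2" using I(2) by (auto simp: V_def)
    moreover from this have "F y \<ge> f z y - \<epsilon> / 2" by (intro F(2)) auto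
    ultimately show "y \<in> W" by (simp add: W_def)
  qed
  \<comment> \<open>On the shell \<open>Q\<close> is below \<open>F\<close>, where the smooth
    maximum is exactly \<open>F\<close>; the two definitions therefore agree near the boundary of
    \<open>N\<close>.\<close>
  define g where "g = (\<lambda>y. if y \<in> N then smax (\<epsilon> / 2) (Q y) (F y) else F y)"
  have e2: "\<epsilon> / 2 > 0" using \<epsilon> by simp
  have gN: "g y = smax (\<epsilon> / 2) (Q y) (F y)" if "y \<in> N" for y using that by (simp add: g_def)
  have gW: "g y = F y" if "y \<in> W \<union> - K" for y
    using that NK smax_eq[OF e2, of "Q y" "F y"] by (auto simp: g_def W_def)
  have cover: "y \<in> N \<or> y \<in> W \<union> - K" for y using \<Sigma>W by (auto simp: \<Sigma>_def)
  have oWK: "open (W \<union> - K)" using W K by (simp add: open_Un compact_imp_closed open_Compl)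
  have ms: "smooth_fun A (\<lambda>y. smax (\<epsilon> / 2) (Q y) (F y))" by (rule smax_smooth[OF Q Fs])
  have gs: "smooth_fun A g"
  proof (rule smooth_fun_local)
    fix y
    show "\<exists>W g'. open W \<and> y \<in> W \<and> smooth_fun A g' \<and> (\<forall>y\<in>W. g y = g' y)"
    proof (cases "y \<in> N")
      case True
      then show ?thesis using N ms gN by blast
    next
      case False
      then have "y \<in> W \<union> - K" using cover by blast
      then show ?thesis using oWK Fs gW by blast
    qed
  qed
  have "carre L g g y \<le> 1" for y
  proof (cases "y \<in> N")
    case True
    then have "carre L g g y = carre L (\<lambda>y. smax (\<epsilon> / 2) (Q y) (F y)) (\<lambda>y. smax (\<epsilon> / 2) (Q y) (F y)) y"
      by (rule carre_local[OF gs ms N]) (rule gN)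
    also have "\<dots> \<le> 1"
      by (rule carre_smax_le_1[OF Q Fs e2]) (use QK True NK F(1) in \<open>auto simp: unit_grad_def\<close>)
    finally show ?thesis .
  next
    case False
    then have "y \<in> W \<union> - K" using cover by blast
    then have "carre L g g y = carre L F F y"
      by (rule carre_local[OF gs Fs oWK]) (rule gW)
    then show ?thesis using F(1) by (simp add: unit_grad_def)
  qed
  then have "unit_grad g" using gs by (simp add: unit_grad_def)
  then have "g y0 - g x \<le> dst x y0" using dst_upper[of g x y0] by linarith
  moreover have "g x \<le> 0"
  proof -
    have "x \<notin> N" using NK KO by (auto simp: O'_def)
    then have "g x = F x" by (simp add: g_def)
    also have "F x \<le> 0" by (rule F(3)) (auto simp: f(2))
    finally show ?thesis .
  qed
  moreover have "g y0 \<ge> Q y0 - \<epsilon> / 2" using gN[OF y0N] smax_ge'[OF e2] by simp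
  ultimately show False using Qy0 \<epsilon> by simp
qed

text \<open>Continuity of the distance is not at hand. As a supremum of the continuous functions |f
  y - f x| it is lower semicontinuous, which is enough for a minimum on a compact set; here this
  appears as a finite intersection argument over sublevel sets, one for each competitor and each
  tolerance.\<close>

lemma dst_minimum:
  fixes T :: real and g :: "'a \<times> real \<Rightarrow> real"
  assumes K: "compact K" "K \<noteq> {}" and T: "T \<ge> 0"
    and g: "continuous_on (UNIV \<times> {0..T}) g"
    and a: "continuous_on {0..T} a" "\<And>t. t \<in> {0..T} \<Longrightarrow> a t > 0"
    and lower: "\<And>y t. t \<in> {0..T} \<Longrightarrow> m0 \<le> g (y, t)"
  obtains y0 t0 where "y0 \<in> K" "t0 \<in> {0..T}"
    "\<And>y t. y \<in> K \<Longrightarrow> t \<in> {0..T} \<Longrightarrow>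
      g (y0, t0) + (dst x y0)\<^sup>2 / a t0 \<le> g (y, t) + (dst x y)\<^sup>2 / a t"
proof -
  define W where "W = (\<lambda>(y, t). g (y, t) + (dst x y)\<^sup>2 / a t)"
  define Wf where "Wf = (\<lambda>f (y, t). g (y, t) + (f y - f x)\<^sup>2 / a t)"
  define S where "S = K \<times> {0..T}"
  define m where "m = Inf (W ` S)"
  have Sne: "S \<noteq> {}"
  proof -
    obtain z where "z \<in> K" using K(2) by blast
    then have "(z, 0) \<in> S" using T by (simp add: S_def)
    then show ?thesis by blast
  qed
  have bdd: "bdd_below (W ` S)"
  proof (rule bdd_belowI2)
    fix p assume "p \<in> S"
    then obtain y t where p: "p = (y, t)" "t \<in> {0..T}" by (auto simp: S_def)
    have "0 \<le> (dst x y)\<^sup>2 / a t" using a(2)[OF p(2)] by simp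
    then show "m0 \<le> W p" using lower[OF p(2), of y] by (simp add: W_def p(1))
  qed
  have mono: "Wf f p \<le> W p" if "unit_grad f" "p \<in> S" for f p
  proof -
    have "\<bar>f (fst p) - f x\<bar> \<le> \<bar>dst x (fst p)\<bar>"
      using dst_upper[OF that(1), of x "fst p"] dst_nonneg[of x "fst p"] by (simp add: abs_minus_commute)
    then have "(f (fst p) - f x)\<^sup>2 \<le> (dst x (fst p))\<^sup>2" by (simp only: abs_le_square_iff)
    moreover have "a (snd p) > 0" using that(2) a(2) by (auto simp: S_def)
    ultimately show ?thesis by (simp add: Wf_def W_def case_prod_beta divide_right_mono)
  qed
  \<comment> \<open>Replacing the distance by a single competitor makes the sublevel set closed; a
    common point of all of them satisfies every competitor's bound with tolerance 0.\<close>
  define Z where "Z = (\<lambda>(f, n::nat). {p \<in> UNIV \<times> {0..T}. Wf f p \<le> m + 1 / real (Suc n)})"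
  have "S \<inter> \<Inter>(Z ` (Collect unit_grad \<times> UNIV)) \<noteq> {}"
  proof (rule compact_imp_fip)
    show "compact S" unfolding S_def by (rule compact_Times[OF K(1) compact_Icc])
    show "closed C" if "C \<in> Z ` (Collect unit_grad \<times> UNIV)" for C
    proof -
      from that obtain f n where f: "unit_grad f" and C: "C = Z (f, n)" by auto
      have "continuous_on (UNIV \<times> {0..T}) (\<lambda>p. f (fst p))"
        by (rule continuous_on_compose2[OF smooth_fun_continuous[OF unit_grad_smooth[OF f], of UNIV]
              continuous_on_fst[OF continuous_on_id]]) auto
      moreover have "continuous_on (UNIV \<times> {0..T}) (\<lambda>p. a (snd p))"
        by (rule continuous_on_compose2[OF a(1) continuous_on_snd[OF continuous_on_id]]) auto
      ultimately have "continuous_on (UNIV \<times> {0..T}) (Wf f)"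
        unfolding Wf_def case_prod_beta using g a(2) by (intro continuous_intros) (auto simp: less_le)
      then show ?thesis unfolding C Z_def prod.case
        by (intro continuous_on_closed_Collect_le continuous_on_const closed_Times) auto
    qed
    show "S \<inter> \<Inter>F' \<noteq> {}" if F': "finite F'" "F' \<subseteq> Z ` (Collect unit_grad \<times> UNIV)" for F'
    proof -
      obtain J where J: "finite J" "J \<subseteq> Collect unit_grad \<times> UNIV" "F' = Z ` J"
        using finite_subset_image[OF F'] by blast
      \<comment> \<open>The smallest tolerance among finitely many sets. A point attaining the
        infimum up to it lies in all of them because \<open>Wf f\<close> is at most
        \<open>W\<close>; the inserted 0 covers the empty family.\<close>
      define n where "n = Max (insert 0 (snd ` J))"
      have n: "k \<le> n" if "(f, k) \<in> J" for f k
        unfolding n_def using J(1) that by (intro Max_ge) force+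
      have "Inf (W ` S) < m + 1 / real (Suc n)" unfolding m_def[symmetric] by simp
      from cInf_lessD[OF _ this] Sne
      obtain p where p: "p \<in> S" "W p < m + 1 / real (Suc n)" by blast
      have "p \<in> Z (f, k)" if j: "(f, k) \<in> J" for f k
      proof -
        have "Wf f p \<le> W p" using mono[of f p] J(2) j p(1) by blast
        also have "\<dots> \<le> m + 1 / real (Suc k)"
        proof -
          have "1 / real (Suc n) \<le> 1 / real (Suc k)" using n[OF j] by (intro divide_left_mono) auto
          then show ?thesis using p(2) by simp
        qed
        finally show ?thesis using p(1) by (auto simp: Z_def S_def)
      qed
      then have "p \<in> S \<inter> \<Inter>F'" using p(1) J(3) by auto
      then show ?thesis by blast
    qed
  qed
  then obtain p where p: "p \<in> S" "\<And>f n. unit_grad f \<Longrightarrow> p \<in> Z (f, n)" by blast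
  obtain y0 t0 where p0: "p = (y0, t0)" by (cases p)
  have at0: "a t0 > 0" using p(1) a(2) by (auto simp: S_def p0)
  have Wfm: "Wf f p \<le> m" if "unit_grad f" for f
  proof (rule LIMSEQ_le_const)
    show "(\<lambda>n. m + 1 / real (Suc n)) \<longlonglongrightarrow> m"
      using tendsto_add[OF tendsto_const[of m] LIMSEQ_Suc[OF lim_1_over_n]] by simp
    show "\<exists>N. \<forall>n\<ge>N. Wf f p \<le> m + 1 / real (Suc n)"
      using p(2)[OF that] by (auto simp: Z_def)
  qed
  \<comment> \<open>Solved for the competitor, the bounds read (f y0 - f x)^2 <= R with the same R
    for all f, so the supremum obeys the bound as well.\<close>
  have "W p \<le> m"
  proof -
    define R where "R = (m - g (y0, t0)) * a t0"
    have fR: "(f y0 - f x)\<^sup>2 \<le> R" if "unit_grad f" for f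
      using Wfm[OF that] at0 by (simp add: Wf_def p0 R_def field_simps)
    have R: "R \<ge> 0" using fR[OF unit_grad_const[of 0]] by simp
    have "dst x y0 \<le> sqrt R"
      by (rule dst_le) (use fR real_le_rsqrt in \<open>fastforce simp: abs_le_iff power2_commute\<close>)
    then have "(dst x y0)\<^sup>2 \<le> R"
      using power_mono[of "dst x y0" "sqrt R" 2] dst_nonneg R by simp
    then show ?thesis using at0 by (simp add: W_def p0 R_def field_simps)
  qed
  moreover have "m \<le> W p'" if "p' \<in> S" for p'
    unfolding m_def using bdd that by (intro cInf_lower) auto
  ultimately have "W p \<le> W p'" if "p' \<in> S" for p' using that order_trans by blast
  then show thesis using that[of y0 t0] p(1) by (auto simp: p0 S_def W_def)
qed

text \<open>The left side is a parabola in Q that touches the square root at Q = v^2 with equal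
  slope 1 / (2 v) and stays below it: with s^2 = Q the difference is s (s - v)^2 (s + 2 v) / (2
  v^3). Unlike the root it is smooth everywhere.\<close>

lemma sqrt_lower_parabola:
  fixes v w Q :: real
  assumes "v > 0" "w \<ge> 0" "Q \<le> w\<^sup>2"
  shows "(3 * v\<^sup>2 * Q - Q\<^sup>2) / (2 * v ^ 3) \<le> w"
proof (cases "Q \<ge> 0")
  case True
  define s where "s = sqrt Q"
  have s: "s \<ge> 0" "Q = s\<^sup>2" "s \<le> w"
    using True assms real_sqrt_le_mono[OF assms(3)] by (auto simp: s_def)
  have "0 \<le> s * ((s - v)\<^sup>2 * (s + 2 * v))" using s assms by (intro mult_nonneg_nonneg) auto
  also have "\<dots> = 2 * v ^ 3 * s - (3 * v\<^sup>2 * Q - Q\<^sup>2)"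
    by (simp add: s(2) power2_eq_square power3_eq_cube algebra_simps)
  finally have "(3 * v\<^sup>2 * Q - Q\<^sup>2) / (2 * v ^ 3) \<le> s"
    using assms(1) by (simp add: divide_le_eq mult.commute)
  then show ?thesis using s(3) by linarith
next
  case False
  have "3 * v\<^sup>2 * Q \<le> 0" using False by (simp add: mult_nonneg_nonpos)
  then have "3 * v\<^sup>2 * Q - Q\<^sup>2 \<le> 0" using zero_le_power2[of Q] by linarith
  then have "(3 * v\<^sup>2 * Q - Q\<^sup>2) / (2 * v ^ 3) \<le> 0" using assms(1) by (simp add: divide_nonpos_pos)
  then show ?thesis using assms(2) by linarith
qed

text \<open>Composing with that parabola turns a function touching the squared distance from below
  into one touching the distance, with gradient scaled by 1 / (2 v). The eikonal inequality then
  gives the factor 4 v^2.\<close>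

lemma dst_sq_touching:
  assumes Q: "smooth_fun A Q" "\<And>y. Q y \<le> (dst x y)\<^sup>2" "Q y0 = (dst x y0)\<^sup>2" "dst x y0 > 0"
  shows "carre L Q Q y0 \<ge> 4 * (dst x y0)\<^sup>2"
proof -
  define v where "v = dst x y0"
  have v: "v > 0" using Q(4) by (simp add: v_def)
  define k where "k = (\<lambda>r. 1 / (2 * v ^ 3) * (3 * v\<^sup>2 * r + (-1) * (r * r)))"
  have k_eq: "k r = (3 * v\<^sup>2 * r - r\<^sup>2) / (2 * v ^ 3)" for r
    by (simp add: k_def power2_eq_square)
  define q where "q = (\<lambda>y. k (Q y))"
  have ks: "smooth_on UNIV k"
  proof -
    have id: "smooth_on UNIV (\<lambda>r::real. r)" by (rule smooth_on_bounded_linear[OF bounded_linear_ident])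
    show ?thesis unfolding k_def
      by (intro smooth_on_mult smooth_on_add smooth_on_const open_UNIV id)
  qed
  have qs: "smooth_fun A q" unfolding q_def by (rule smooth_fun_compose[OF ks open_UNIV Q(1)]) simp
  have kd: "(k has_real_derivative 1 / (2 * v)) (at (Q y0))"
    unfolding k_def Q(3) v_def[symmetric] using v
    by (auto intro!: derivative_eq_intros simp: field_simps power2_eq_square power3_eq_cube)
  have "1 \<le> carre L q q y0"
  proof (rule eikonal_supersolution[OF qs _ _ Q(4)])
    show "q y \<le> dst x y" for y
      unfolding q_def k_eq by (rule sqrt_lower_parabola[OF v dst_nonneg Q(2)])
    show "q y0 = dst x y0"
      unfolding q_def k_eq Q(3) v_def[symmetric] using v by (simp add: field_simps power2_eq_square power3_eq_cube)
  qed
  also have "carre L q q y0 = (1 / (2 * v))\<^sup>2 * carre L Q Q y0"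
    unfolding q_def
    by (simp only: carre.form_compose(1)[OF Q(1) qs[unfolded q_def] ks open_UNIV UNIV_I kd]
        carre.form_compose(2)[OF Q(1) Q(1) ks open_UNIV UNIV_I kd] power2_eq_square mult.assoc)
  finally show ?thesis using v by (simp add: v_def[symmetric] field_simps power2_eq_square)
qed

end

section \<open>From the differential inequality to the Hopf-Lax bound\<close>

context finite_diffusion
begin

context
  fixes w w' :: "real \<Rightarrow> 'a \<Rightarrow> real" and c s T M K :: real
  assumes c: "c > 0" and s: "s > 0" and T: "T > 0" and K: "K > 0"
    and w_smooth: "\<And>t. t > 0 \<Longrightarrow> smooth_fun A (w t)"
    and w_deriv: "\<And>t x. t > 0 \<Longrightarrow> ((\<lambda>r. w r x) has_real_derivative w' t x) (at t)"
    and w_cont: "continuous_on ({0<..} \<times> UNIV) (\<lambda>(t, x). w t x)"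
    and w_super: "\<And>t x. t > 0 \<Longrightarrow> c * carre L (w t) (w t) x \<le> w' t x"
    and w_bound: "\<And>t x. s \<le> t \<Longrightarrow> t \<le> s + T \<Longrightarrow> \<bar>w t x\<bar> \<le> M"
    and w_grad: "\<And>t x. s \<le> t \<Longrightarrow> t \<le> s + T \<Longrightarrow> carre L (w t) (w t) x \<le> K\<^sup>2"
begin

text \<open>Divided by \<open>K\<close>, the function \<open>w s\<close> is a competitor for the
  distance. The estimate excludes minima at the initial time in the argument below.\<close>

lemma w_lipschitz: "w s x - w s y \<le> K * dst x y"
proof -
  have sw: "smooth_fun A (w s)" by (rule w_smooth[OF s])
  have "unit_grad (\<lambda>y. 1 / K * w s y + 0)"
    unfolding unit_grad_def
  proof (intro conjI allI)
    show "smooth_fun A (\<lambda>y. 1 / K * w s y + 0)"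
      by (intro smooth_fun_add smooth_fun_mult smooth_fun_const sw)
    show "carre L (\<lambda>y. 1 / K * w s y + 0) (\<lambda>y. 1 / K * w s y + 0) x \<le> 1" for x
      unfolding carre_affine[OF sw] using w_grad[of s x] T K by (simp add: power_divide divide_le_eq)
  qed
  from dst_upper[OF this, of x y] have "1 / K * (w s x - w s y) \<le> dst x y"
    by (simp add: diff_divide_distrib)
  then show ?thesis using K by (simp add: divide_le_eq mult.commute)
qed

text \<open>At a minimum of the right-hand side, the touching lemma for the squared distance
  contradicts the differential inequality once the gradient of the cutoff is small.\<close>

lemma penalized_bound:
  assumes \<eta>: "\<eta> > 0" and \<beta>: "\<beta> > 0" and C: "C = 2 * M + 1" and e: "e > 0"
    and small: "2 * C * (K * sqrt e) + C\<^sup>2 * e < \<beta> / c"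
    and hk: "\<And>x. carre L (h k) (h k) x \<le> e"
    and \<tau>: "0 \<le> \<tau>" "\<tau> \<le> T"
  shows "w s x - K\<^sup>2 * c * \<eta> \<le>
    w (s + \<tau>) y + (dst x y)\<^sup>2 / (4 * c * (\<tau> + \<eta>)) + C * (1 - h k y) + \<beta> * \<tau>"
proof (rule ccontr)
  assume "\<not> ?thesis"
  then have less: "w (s + \<tau>) y + (dst x y)\<^sup>2 / (4 * c * (\<tau> + \<eta>)) + C * (1 - h k y) + \<beta> * \<tau> < w s x - K\<^sup>2 * c * \<eta>"
    by simp
  have M: "M \<ge> 0" using w_bound[of s x] T by simp
  define \<Lambda> where "\<Lambda> = tsupp (h k)"
  define a where "a = (\<lambda>\<tau>. 4 * c * (\<tau> + \<eta>))"
  define g where "g = (\<lambda>(y, \<tau>). w (s + \<tau>) y + C * (1 - h k y) + \<beta> * \<tau>)"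
  have apos: "a \<tau> > 0" if "\<tau> \<in> {0..T}" for \<tau> using that c \<eta> by (simp add: a_def)
  have pen: "C * (1 - h k y) \<ge> 0" for y using h_le_1[of k y] M by (simp add: C)
  have wb: "\<bar>w (s + \<tau>) y\<bar> \<le> M" if "\<tau> \<in> {0..T}" for \<tau> y using w_bound that by simp
  \<comment> \<open>Off the support of the cutoff the penalty is the full C = 2 M + 1, which exceeds
    the oscillation of \<open>w\<close>; no violation can occur there.\<close>
  have outside: "g (y, \<tau>) + (dst x y)\<^sup>2 / a \<tau> \<ge> w s x" if "y \<notin> \<Lambda>" "\<tau> \<in> {0..T}" for y \<tau>
  proof -
    have "h k y = 0" using tsupp_outside that(1) by (simp add: \<Lambda>_def)
    moreover have "(dst x y)\<^sup>2 / a \<tau> \<ge> 0" using apos[OF that(2)] by simp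
    moreover have "\<beta> * \<tau> \<ge> 0" using \<beta> that(2) by simp
    moreover have "w s x \<le> M" using w_bound[of s x] T by simp
    moreover have "w (s + \<tau>) y \<ge> - M" using wb[OF that(2), of y] by linarith
    ultimately show ?thesis by (simp add: g_def C)
  qed
  have less': "g (y, \<tau>) + (dst x y)\<^sup>2 / a \<tau> < w s x - K\<^sup>2 * c * \<eta>"
    using less by (simp add: g_def a_def)
  have Kc: "K\<^sup>2 * c * \<eta> \<ge> 0" using c \<eta> by simp
  have y\<Lambda>: "y \<in> \<Lambda>" using outside[of y \<tau>] less' \<tau> Kc by force
  have gc: "continuous_on (UNIV \<times> {0..T}) g"
  proof -
    have "continuous_on ((UNIV :: 'a set) \<times> {0..T}) (\<lambda>p. (s + snd p, fst p))"
      by (intro continuous_intros)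
    moreover have "(\<lambda>p. (s + snd p, fst p)) ` ((UNIV :: 'a set) \<times> {0..T}) \<subseteq> {0<..} \<times> UNIV"
      using s by auto
    ultimately have "continuous_on (UNIV \<times> {0..T}) (\<lambda>p. (\<lambda>(t, x). w t x) (s + snd p, fst p))"
      by (rule continuous_on_compose2[OF w_cont])
    then have 1: "continuous_on (UNIV \<times> {0..T}) (\<lambda>p. w (s + snd p) (fst p))" by simp
    have 2: "continuous_on (UNIV \<times> {0..T}) (\<lambda>p. h k (fst p))"
      by (rule continuous_on_compose2[OF smooth_fun_continuous[OF h_smooth, of UNIV] continuous_on_fst[OF continuous_on_id]]) auto
    show ?thesis unfolding g_def case_prod_beta by (intro continuous_intros 1 2)
  qed
  obtain y0 t0 where min: "y0 \<in> \<Lambda>" "t0 \<in> {0..T}"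
    "\<And>y t. y \<in> \<Lambda> \<Longrightarrow> t \<in> {0..T} \<Longrightarrow> g (y0, t0) + (dst x y0)\<^sup>2 / a t0 \<le> g (y, t) + (dst x y)\<^sup>2 / a t"
  proof (rule dst_minimum[of \<Lambda> T g a "- M" x])
    show "compact \<Lambda>" "\<Lambda> \<noteq> {}" using test_fun_compact[OF h_test] y\<Lambda> by (auto simp: \<Lambda>_def)
    show "continuous_on {0..T} a" unfolding a_def by (intro continuous_intros)
    show "- M \<le> g (y, t)" if "t \<in> {0..T}" for y t
    proof -
      have "w (s + t) y \<ge> - M" using wb[OF that, of y] by linarith
      moreover have "\<beta> * t \<ge> 0" using \<beta> that by simp
      ultimately show ?thesis using pen[of y] by (simp add: g_def)
    qed
  qed (use T gc apos in auto)
  define m where "m = g (y0, t0) + (dst x y0)\<^sup>2 / a t0"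
  have m: "m < w s x - K\<^sup>2 * c * \<eta>" using min(3)[OF y\<Lambda>, of \<tau>] \<tau> less' by (simp add: m_def)
  \<comment> \<open>The minimum over the support is global, since outside it the values are at least
    w(x, s), which is above m.\<close>
  have glob: "m \<le> g (y, t) + (dst x y)\<^sup>2 / a t" if "t \<in> {0..T}" for y t
    using min(3)[of y t] outside[of y t] that m Kc by (cases "y \<in> \<Lambda>") (auto simp: m_def)
  define \<delta> where "\<delta> = dst x y0"
  \<comment> \<open>At time 0 the Lipschitz bound and K delta <= delta^2 / (4 c eta) + K^2 c eta
    contradict the assumed violation; the error term K^2 c eta of the statement comes from
    here.\<close>
  have t0: "t0 > 0"
  proof (rule ccontr)
    assume "\<not> t0 > 0"
    then have t0: "t0 = 0" using min(2) by simp
    have "0 \<le> (\<delta> - 2 * c * \<eta> * K)\<^sup>2 / (4 * c * \<eta>)" using c \<eta> by simp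
    also have "\<dots> = \<delta>\<^sup>2 / (4 * c * \<eta>) - K * \<delta> + K\<^sup>2 * c * \<eta>"
      using c \<eta> by (simp add: field_simps power2_eq_square)
    finally have "K * \<delta> - K\<^sup>2 * c * \<eta> \<le> \<delta>\<^sup>2 / (4 * c * \<eta>)" by simp
    moreover have "m = w s y0 + C * (1 - h k y0) + \<delta>\<^sup>2 / (4 * c * \<eta>)"
      by (simp add: m_def t0 g_def a_def \<delta>_def)
    ultimately show False using w_lipschitz[of x y0] pen[of y0] m by (simp add: \<delta>_def)
  qed
  have st0: "s + t0 > 0" using s t0 by simp
  have at0: "a t0 > 0" using apos min(2) by blast
  \<comment> \<open>The minimum may sit at the final time, so only earlier times can be compared: a
    positive derivative would give a smaller value just before t0.\<close>
  have time: "w' (s + t0) y0 - 4 * c * \<delta>\<^sup>2 / (a t0)\<^sup>2 + \<beta> \<le> 0"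
  proof (rule ccontr)
    assume "\<not> ?thesis"
    then have pos: "0 < w' (s + t0) y0 - 4 * c * \<delta>\<^sup>2 / (a t0)\<^sup>2 + \<beta>" by simp
    let ?\<phi> = "\<lambda>t. w (s + t) y0 + C * (1 - h k y0) + \<beta> * t + \<delta>\<^sup>2 / a t"
    have "((\<lambda>t. w (s + t) y0) has_real_derivative w' (s + t0) y0 * 1) (at t0)"
      by (rule DERIV_chain2[where f = "\<lambda>r. w r y0" and g = "\<lambda>t. s + t", OF w_deriv[OF st0]])
        (auto intro!: derivative_eq_intros)
    then have "(?\<phi> has_real_derivative w' (s + t0) y0 - 4 * c * \<delta>\<^sup>2 / (a t0)\<^sup>2 + \<beta>) (at t0)"
      unfolding a_def using at0 c
      by (auto intro!: derivative_eq_intros simp: a_def power2_eq_square)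
    from DERIV_pos_inc_left[OF this pos] obtain r where r: "r > 0" "\<And>h. 0 < h \<Longrightarrow> h < r \<Longrightarrow> ?\<phi> (t0 - h) < ?\<phi> t0"
      by blast
    define h' where "h' = min (r / 2) t0"
    have h': "0 < h'" "h' < r" "t0 - h' \<in> {0..T}" using r(1) t0 min(2) by (auto simp: h'_def)
    have "?\<phi> (t0 - h') < ?\<phi> t0" by (rule r(2)[OF h'(1,2)])
    moreover have "?\<phi> t0 = m" by (simp add: m_def g_def \<delta>_def)
    moreover have "?\<phi> (t0 - h') = g (y0, t0 - h') + (dst x y0)\<^sup>2 / a (t0 - h')" by (simp add: g_def \<delta>_def)
    ultimately show False using glob[OF h'(3), of y0] by simp
  qed
  let ?w = "w (s + t0)"
  have ws: "smooth_fun A ?w" by (rule w_smooth[OF st0])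
  have "c * carre L ?w ?w y0 + \<beta> \<le> 4 * c * \<delta>\<^sup>2 / (a t0)\<^sup>2"
    using time w_super[OF st0, of y0] by linarith
  then have grad: "carre L ?w ?w y0 + \<beta> / c \<le> 4 * \<delta>\<^sup>2 / (a t0)\<^sup>2"
    using c by (simp add: field_simps)
  \<comment> \<open>The strict gain beta keeps the minimum away from \<open>x\<close>, where the
    touching lemma would not apply.\<close>
  have \<delta>: "\<delta> > 0"
  proof -
    have "\<beta> / c > 0" using \<beta> c by simp
    then have "4 * \<delta>\<^sup>2 / (a t0)\<^sup>2 > 0" using grad carre_nonneg[OF ws, of y0] by linarith
    then have "\<delta> \<noteq> 0" by auto
    then show ?thesis using dst_nonneg[of x y0] by (simp add: \<delta>_def)
  qed
  define F where "F = (\<lambda>y. C * h k y + (-1) * ?w y)"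
  \<comment> \<open>Minimality at the fixed time t0, multiplied by a(t0): \<open>Q\<close> is a
    smooth function below the squared distance with equality at y0.\<close>
  define Q where "Q = (\<lambda>y. a t0 * F y + a t0 * (m - C - \<beta> * t0))"
  have Fs: "smooth_fun A F" unfolding F_def
    by (intro smooth_fun_add smooth_fun_mult smooth_fun_const h_smooth ws)
  have Qs: "smooth_fun A Q" unfolding Q_def
    by (intro smooth_fun_add smooth_fun_mult smooth_fun_const Fs)
  have Q_le: "Q y \<le> (dst x y)\<^sup>2" for y
  proof -
    have "m - g (y, t0) \<le> (dst x y)\<^sup>2 / a t0" using glob[OF min(2), of y] by linarith
    then have "a t0 * (m - g (y, t0)) \<le> (dst x y)\<^sup>2" using at0 by (simp add: le_divide_eq mult.commute)
    moreover have "Q y = a t0 * (m - g (y, t0))"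
      by (simp add: Q_def F_def g_def algebra_simps)
    ultimately show ?thesis by simp
  qed
  have Q_eq: "Q y0 = (dst x y0)\<^sup>2"
  proof -
    have "Q y0 = a t0 * (m - g (y0, t0))" by (simp add: Q_def F_def g_def algebra_simps)
    then show ?thesis using at0 by (simp add: m_def)
  qed
  have "4 * \<delta>\<^sup>2 \<le> carre L Q Q y0"
    using dst_sq_touching[OF Qs Q_le Q_eq] \<delta> by (simp add: \<delta>_def)
  also have "\<dots> = (a t0)\<^sup>2 * carre L F F y0" unfolding Q_def by (rule carre_affine[OF Fs])
  finally have "4 * \<delta>\<^sup>2 / (a t0)\<^sup>2 \<le> carre L F F y0" using at0 by (simp add: divide_le_eq mult.commute)
  also have "carre L F F y0 = C\<^sup>2 * carre L (h k) (h k) y0 - 2 * C * carre L (h k) ?w y0 + carre L ?w ?w y0"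
  proof -
    have s1: "smooth_fun A (\<lambda>y. C * h k y)" "smooth_fun A (\<lambda>y. (-1) * ?w y)"
      by (intro smooth_fun_mult smooth_fun_const h_smooth ws)+
    note s2 = smooth_fun_add[OF s1]
    show ?thesis unfolding F_def
      using carre_commute[of ?w "h k" y0]
      by (simp only: carre.form_add[OF s1 s2] carre.form_add[OF s1 s1(1)] carre.form_add[OF s1 s1(2)]
          carre.form_cmult[OF h_smooth s2] carre.form_cmult[OF ws s2] carre.form_cmult[OF h_smooth s1(1)]
          carre.form_cmult[OF h_smooth s1(2)] carre.form_cmult[OF ws s1(1)] carre.form_cmult[OF ws s1(2)]
          carre.form_add[OF s1 h_smooth] carre.form_add[OF s1 ws]
          carre.form_cmult[OF h_smooth h_smooth] carre.form_cmult[OF h_smooth ws] carre.form_cmult[OF ws h_smooth]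
          carre.form_cmult[OF ws ws])
        (simp add: power2_eq_square algebra_simps)
  qed
  also have "\<dots> \<le> C\<^sup>2 * e + 2 * C * (K * sqrt e) + carre L ?w ?w y0"
  proof -
    have C0: "C \<ge> 0" using M by (simp add: C)
    have "(carre L (h k) ?w y0)\<^sup>2 \<le> carre L (h k) (h k) y0 * carre L ?w ?w y0"
      by (rule carre.form_cauchy_schwarz[OF carre_nonneg h_smooth ws])
    also have "\<dots> \<le> e * K\<^sup>2"
      using hk w_grad[of "s + t0" y0] min(2) carre_nonneg[OF ws] e by (intro mult_mono) auto
    also have "\<dots> = (K * sqrt e)\<^sup>2" using e by (simp add: power_mult_distrib mult.commute)
    finally have "\<bar>carre L (h k) ?w y0\<bar> \<le> K * sqrt e"
      using K e by (simp add: abs_le_square_iff[symmetric])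
    then have "- carre L (h k) ?w y0 \<le> K * sqrt e" by linarith
    then have "2 * C * (- carre L (h k) ?w y0) \<le> 2 * C * (K * sqrt e)"
      using C0 by (intro mult_left_mono) auto
    moreover have "C\<^sup>2 * carre L (h k) (h k) y0 \<le> C\<^sup>2 * e" using hk by (intro mult_left_mono) auto
    ultimately show ?thesis by simp
  qed
  finally show False using grad small by simp
qed

theorem hopf_lax: "w s x - (dst x y)\<^sup>2 / (4 * c * T) \<le> w (s + T) y"
proof -
  define C where "C = 2 * M + 1"
  have M: "M \<ge> 0" using w_bound[of s x] T by simp
  \<comment> \<open>For fixed eta and beta the gradient of the cutoff is made small by taking k
    large, and the penalty disappears as h_k tends to 1. The constants eta and beta are sent to 0
    only afterwards, tied together.\<close>
  have 1: "w s x - K\<^sup>2 * c * \<eta> \<le> w (s + T) y + (dst x y)\<^sup>2 / (4 * c * (T + \<eta>)) + \<beta> * T"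
    if \<eta>: "\<eta> > 0" and \<beta>: "\<beta> > 0" for \<eta> \<beta>
  proof -
    have "((\<lambda>e. 2 * C * (K * sqrt e) + C\<^sup>2 * e) \<longlongrightarrow> 2 * C * (K * sqrt 0) + C\<^sup>2 * 0) (at_right 0)"
      by (intro tendsto_intros)
    moreover have "2 * C * (K * sqrt 0) + C\<^sup>2 * 0 < \<beta> / c" using \<beta> c by simp
    ultimately have "\<forall>\<^sub>F e in at_right 0. 2 * C * (K * sqrt e) + C\<^sup>2 * e < \<beta> / c"
      by (rule order_tendstoD(2))
    then have "\<forall>\<^sub>F e in at_right 0. e > 0 \<and> 2 * C * (K * sqrt e) + C\<^sup>2 * e < \<beta> / c"
      using eventually_at_right_less[of 0] by eventually_elim auto
    then obtain e where e: "e > 0" "2 * C * (K * sqrt e) + C\<^sup>2 * e < \<beta> / c"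
      using eventually_happens'[OF trivial_limit_at_right_real] by blast
    have ev: "\<forall>\<^sub>F k in sequentially. w s x - K\<^sup>2 * c * \<eta> \<le>
        w (s + T) y + (dst x y)\<^sup>2 / (4 * c * (T + \<eta>)) + C * (1 - h k y) + \<beta> * T"
      using h_carre[OF e(1)]
      by eventually_elim (rule penalized_bound[OF \<eta> \<beta> C_def e], use T in auto)
    have "(\<lambda>k. w (s + T) y + (dst x y)\<^sup>2 / (4 * c * (T + \<eta>)) + C * (1 - h k y) + \<beta> * T)
        \<longlonglongrightarrow> w (s + T) y + (dst x y)\<^sup>2 / (4 * c * (T + \<eta>)) + C * (1 - 1) + \<beta> * T"
      by (intro tendsto_intros h_lim)
    from tendsto_lowerbound[OF this ev] show ?thesis by simp
  qed
  have 2: "w s x - K\<^sup>2 * c * \<eta> \<le> w (s + T) y + (dst x y)\<^sup>2 / (4 * c * T) + \<eta> * T" if \<eta>: "\<eta> > 0" for \<eta>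
  proof -
    have "(dst x y)\<^sup>2 / (4 * c * (T + \<eta>)) \<le> (dst x y)\<^sup>2 / (4 * c * T)"
      using \<eta> c T by (intro divide_left_mono) auto
    then show ?thesis using 1[OF \<eta> \<eta>] by linarith
  qed
  have "((\<lambda>\<eta>. w (s + T) y + (dst x y)\<^sup>2 / (4 * c * T) + \<eta> * T + K\<^sup>2 * c * \<eta>) \<longlongrightarrow>
      w (s + T) y + (dst x y)\<^sup>2 / (4 * c * T) + 0 * T + K\<^sup>2 * c * 0) (at_right 0)"
    by (intro tendsto_intros)
  moreover have "\<forall>\<^sub>F \<eta> in at_right 0. w s x \<le> w (s + T) y + (dst x y)\<^sup>2 / (4 * c * T) + \<eta> * T + K\<^sup>2 * c * \<eta>"
    using eventually_at_right_less[of 0] by eventually_elim (use 2 in \<open>force simp: algebra_simps\<close>)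
  ultimately have "w s x \<le> w (s + T) y + (dst x y)\<^sup>2 / (4 * c * T) + 0 * T + K\<^sup>2 * c * 0"
    by (rule tendsto_lowerbound) simp
  then show ?thesis by simp
qed

end

end

section \<open>Finiteness of the distance\<close>

text \<open>Exceptional times are handled by avoiding the null set of their values: at the last time
  where such a value \<open>c\<close> is attained, the derivative would be both negative and nonnegative.\<close>

lemma ae_derivative_bound:
  fixes g :: "real \<Rightarrow> real"
  assumes T: "T \<ge> 0" and g: "continuous_on {0..T} g" and N: "negligible N"
    and lip: "\<And>t. 0 < t \<Longrightarrow> t < T \<Longrightarrow> \<exists>e>0. \<exists>B. \<forall>s. \<bar>s - t\<bar> < e \<longrightarrow> \<bar>g s - g t\<bar> \<le> B * \<bar>s - t\<bar>"
    and der: "\<And>t. 0 < t \<Longrightarrow> t < T \<Longrightarrow> t \<notin> N \<Longrightarrow> \<exists>D\<le>1. (g has_real_derivative D) (at t)"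
  shows "g T - g 0 \<le> T"
proof -
  have key: "g T - g 0 \<le> (1 + \<epsilon>) * T" if \<epsilon>: "\<epsilon> > 0" for \<epsilon>
  proof (rule ccontr)
    assume neg: "\<not> g T - g 0 \<le> (1 + \<epsilon>) * T"
    \<comment> \<open>The slack epsilon makes the derivative of \<open>k\<close> strictly negative
      off \<open>N\<close>, so that a genuine decrease follows.\<close>
    define k where "k = (\<lambda>t. g t - (1 + \<epsilon>) * t)"
    have k0T: "k 0 < k T" using neg by (simp add: k_def)
    have kc: "continuous_on {0..T} k" unfolding k_def by (intro continuous_intros g)
    define S where "S = N \<inter> {0<..<T}"
    have "negligible (k ` S)"
    proof (rule negligible_locally_Lipschitz_image)
      show "negligible S" unfolding S_def using N by (rule negligible_subset) blast
      fix t assume "t \<in> S"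
      then have t: "0 < t" "t < T" by (auto simp: S_def)
      from lip[OF t] obtain e B where e: "e > 0" "\<And>s. \<bar>s - t\<bar> < e \<Longrightarrow> \<bar>g s - g t\<bar> \<le> B * \<bar>s - t\<bar>" by blast
      show "\<exists>U C. open U \<and> t \<in> U \<and> (\<forall>s\<in>S \<inter> U. norm (k s - k t) \<le> C * norm (s - t))"
      proof (intro exI[of _ "ball t e"] exI[of _ "B + (1 + \<epsilon>)"] conjI ballI)
        fix s assume "s \<in> S \<inter> ball t e"
        then have "\<bar>s - t\<bar> < e" by (auto simp: dist_real_def)
        from e(2)[OF this] have "\<bar>g s - g t\<bar> + (1 + \<epsilon>) * \<bar>s - t\<bar> \<le> (B + (1 + \<epsilon>)) * \<bar>s - t\<bar>"
          by (simp add: distrib_right)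
        moreover have "\<bar>k s - k t\<bar> \<le> \<bar>g s - g t\<bar> + (1 + \<epsilon>) * \<bar>s - t\<bar>"
        proof -
          have "k s - k t = (g s - g t) - (1 + \<epsilon>) * (s - t)" by (simp add: k_def algebra_simps)
          also have "\<bar>\<dots>\<bar> \<le> \<bar>g s - g t\<bar> + \<bar>(1 + \<epsilon>) * (s - t)\<bar>" by (rule abs_triangle_ineq4)
          finally show ?thesis using \<epsilon> by (simp add: abs_mult)
        qed
        ultimately show "norm (k s - k t) \<le> (B + (1 + \<epsilon>)) * norm (s - t)" by simp
      qed (use e(1) in auto)
    qed simp
    moreover have "\<not> negligible {k 0<..<k T}"
      unfolding box_real(1)[symmetric] negligible_interval using k0T by simp
    ultimately obtain c where c: "k 0 < c" "c < k T" "c \<notin> k ` S"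
      using negligible_subset[of "k ` S" "{k 0<..<k T}"] by fastforce
    define E where "E = {t \<in> {0..T}. k t \<le> c}"
    have "closed E" unfolding E_def
      by (intro continuous_on_closed_Collect_le kc continuous_on_const closed_real_atLeastAtMost)
    moreover have "bounded E" unfolding E_def by (rule bounded_subset[of "{0..T}"]) auto
    ultimately have E: "compact E" by (simp add: compact_eq_bounded_closed)
    have "0 \<in> E" using T c(1) by (simp add: E_def)
    then obtain t where t: "t \<in> E" "\<And>s. s \<in> E \<Longrightarrow> s \<le> t"
      using compact_attains_sup[OF E] by blast
    have above: "k s > c" if "t < s" "s \<le> T" for s
      using t(2)[of s] t(1) that by (force simp: E_def not_le[symmetric])
    have tT: "0 \<le> t" "t < T" "k t \<le> c" using t(1) c(2) by (auto simp: E_def less_le)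
    have kt: "k t = c"
    proof (rule ccontr)
      assume "k t \<noteq> c"
      then have "k t < c" using tT by simp
      have "continuous_on {t..T} k" by (rule continuous_on_subset[OF kc]) (use tT in auto)
      then obtain s where "t \<le> s" "s \<le> T" "k s = c"
        using IVT'[of k t c T] \<open>k t < c\<close> c(2) tT by auto
      then show False using above[of s] \<open>k t < c\<close> by (cases "s = t") auto
    qed
    have t0: "t > 0" using tT kt c(1) by (cases "t = 0") auto
    have "t \<notin> N" using c(3) kt t0 tT by (auto simp: S_def)
    then obtain D where D: "D \<le> 1" "(g has_real_derivative D) (at t)" using der t0 tT by blast
    have "(k has_real_derivative D - (1 + \<epsilon>)) (at t)"
      unfolding k_def by (auto intro!: derivative_eq_intros D(2))
    from DERIV_neg_dec_right[OF this] D(1) \<epsilon> obtain d where d: "d > 0" "\<And>h. 0 < h \<Longrightarrow> h < d \<Longrightarrow> k (t + h) < k t"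
      by auto
    define h where "h = min (d / 2) (T - t)"
    have "0 < h" "h < d" "t + h \<le> T" using d(1) tT by (auto simp: h_def)
    then show False using d(2)[of h] above[of "t + h"] kt by simp
  qed
  show ?thesis
  proof (rule tendsto_lowerbound)
    show "((\<lambda>\<epsilon>. (1 + \<epsilon>) * T) \<longlongrightarrow> T) (at_right 0)" by (auto intro!: tendsto_eq_intros)
    show "\<forall>\<^sub>F \<epsilon> in at_right 0. g T - g 0 \<le> (1 + \<epsilon>) * T"
      using eventually_at_right_less[of 0] by eventually_elim (rule key)
  qed simp
qed

section \<open>Functions of unit gradient along subunit paths\<close>

context measured_diffusion
begin

text \<open>The weak identity is tested twice: L(f^2) against zeta, and L f against zeta f. In half
  the first minus the second the terms with derivatives of zeta cancel, leaving the integral of zeta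
  Gamma(f) on one side and of zeta times the sum of squares on the other.\<close>

lemma local_squares_carre:
  assumes c: "(U, \<phi>) \<in> A" and ls: "local_squares A \<mu> L (U, \<phi>) V m X"
    and f: "smooth_fun A f" and x: "x \<in> V"
  shows "carre L f f x = (\<Sum>i<m. (pd (X i (\<phi> x)) (f \<circ> inv_into U \<phi>) (\<phi> x))\<^sup>2)"
proof -
  note ls' = ls[unfolded local_squares_def prod.case]
  have V: "open V" "V \<subseteq> U" using ls' by blast+
  have lip: "\<exists>K. K-lipschitz_on (\<phi> ` V) (X i)" if "i < m" for i using ls' that by blast
  have weak: "(\<integral>x. g x * L f x \<partial>\<mu>) =
          - (\<Sum>i<m. LINT x:V|\<mu>. pd (X i (\<phi> x)) (f \<circ> inv_into U \<phi>) (\<phi> x) *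
                                pd (X i (\<phi> x)) (g \<circ> inv_into U \<phi>) (\<phi> x))"
    if "test_fun A f" "test_fun A g" "tsupp f \<subseteq> V" "tsupp g \<subseteq> V" for f g
    using ls' that by blast
  define Y where "Y = (\<lambda>i (f :: 'a \<Rightarrow> real) x. pd (X i (\<phi> x)) (f \<circ> inv_into U \<phi>) (\<phi> x))"
  have D: "((f \<circ> inv_into U \<phi>) has_derivative (\<lambda>v. pd v (f \<circ> inv_into U \<phi>) (\<phi> x))) (at (\<phi> x))"
    if "smooth_fun A f" "x \<in> V" for f x
    by (rule smooth_on_has_derivative[OF smooth_fun_chart[OF that(1) c] chart(2)[OF c]]) (use that V in auto)
  have Ycont: "continuous_on V (Y i f)" if "i < m" "smooth_fun A f" for i f
  proof -
    have \<phi>c: "continuous_on V \<phi>" by (rule continuous_on_subset[OF chart_continuous[OF c] V(2)])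
    obtain K where K: "K-lipschitz_on (\<phi> ` V) (X i)" using lip[OF \<open>i < m\<close>] by blast
    have Xc: "continuous_on V (\<lambda>x. X i (\<phi> x))"
      by (rule continuous_on_compose2[OF lipschitz_on_continuous_on[OF K] \<phi>c]) auto
    have pc: "continuous_on V (\<lambda>x. pd j (f \<circ> inv_into U \<phi>) (\<phi> x))" if "j \<in> Basis" for j
      by (rule continuous_on_compose2[OF smooth_on_continuous[OF smooth_on_pd[OF smooth_fun_chart[OF \<open>smooth_fun A f\<close> c] that]] \<phi>c])
        (use V in auto)
    have "continuous_on V (\<lambda>x. \<Sum>j\<in>Basis. (X i (\<phi> x) \<bullet> j) * pd j (f \<circ> inv_into U \<phi>) (\<phi> x))"
      by (intro continuous_intros Xc pc)
    then show ?thesis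
    proof (rule continuous_on_eq)
      fix x assume "x \<in> V"
      then show "(\<Sum>j\<in>Basis. (X i (\<phi> x) \<bullet> j) * pd j (f \<circ> inv_into U \<phi>) (\<phi> x)) = Y i f x"
        unfolding Y_def using pd_linear_sum[OF D[OF that(2)], of x "X i (\<phi> x)"] by simp
    qed
  qed
  have Ymult: "Y i (\<lambda>x. f x * g x) x = f x * Y i g x + g x * Y i f x"
    if "smooth_fun A f" "smooth_fun A g" "x \<in> V" for i f g x
  proof -
    have "pd v ((\<lambda>x. f x * g x) \<circ> inv_into U \<phi>) (\<phi> x) =
      f x * pd v (g \<circ> inv_into U \<phi>) (\<phi> x) + pd v (f \<circ> inv_into U \<phi>) (\<phi> x) * g x" for v
      using pd_mult[OF chart(2)[OF c] _ smooth_fun_chart[OF that(1) c] smooth_fun_chart[OF that(2) c], of "\<phi> x" v]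
        that(3) V(2) chart_inv[OF c, of x] by (auto simp: o_def)
    then show ?thesis by (simp add: Y_def mult.commute)
  qed
  have Yloc: "Y i f x = Y i g x" if "open W" "x \<in> W" "x \<in> V" "\<And>y. y \<in> W \<Longrightarrow> f y = g y" for i f g W x
    unfolding Y_def by (rule pd_chart_cong[OF c _ that(1,2,4)]) (use that V in auto)
  have Yout: "Y i f x = 0" if "x \<notin> tsupp f" "x \<in> V" for i f x
  proof -
    have "Y i f x = Y i (\<lambda>_. 0) x"
      by (rule Yloc[OF open_Compl[OF tsupp_closed[of f]]]) (use that tsupp_outside in auto)
    also have "\<dots> = 0" by (simp add: Y_def o_def)
    finally show ?thesis .
  qed
  \<comment> \<open>The vector fields are meaningful only on \<open>V\<close>, so integrands are
    multiplied by its indicator; compact support inside \<open>V\<close> makes them continuous on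
    the whole manifold.\<close>
  have int: "integrable \<mu> (\<lambda>x. indicator V x * k x)"
    if "continuous_on V k" "compact K" "K \<subseteq> V" "\<And>x. x \<in> V \<Longrightarrow> x \<notin> K \<Longrightarrow> k x = 0"
    for k :: "'a \<Rightarrow> real" and K
  proof (rule integrable_compact_support[OF that(2)])
    show z: "indicator V x * k x = 0" if "x \<notin> K" for x using \<open>\<And>x. x \<in> V \<Longrightarrow> x \<notin> K \<Longrightarrow> k x = 0\<close> that
      by (auto simp: indicator_def)
    have "continuous_on V (\<lambda>x. indicator V x * k x)"
      by (rule continuous_on_eq[OF that(1)]) simp
    then show "continuous_on UNIV (\<lambda>x. indicator V x * k x)"
      by (rule continuous_on_extend_zero[OF V(1) _ that(2,3)]) (rule z)
  qed
  have "carre L f f x - (\<Sum>i<m. (Y i f x)\<^sup>2) = 0"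
  proof (rule fundamental_lemma[OF V(1) _ x])
    show "continuous_on V (\<lambda>x. carre L f f x - (\<Sum>i<m. (Y i f x)\<^sup>2))"
      by (intro continuous_intros Ycont f smooth_fun_continuous carre.smooth_fun_form) auto
    fix \<zeta> assume z: "test_fun A \<zeta>" "tsupp \<zeta> \<subseteq> V"
    note zs = test_fun_smooth[OF z(1)]
    obtain \<theta> W where \<theta>: "test_fun A \<theta>" "tsupp \<theta> \<subseteq> V" "open W" "tsupp \<zeta> \<subseteq> W" "\<And>x. x \<in> W \<Longrightarrow> \<theta> x = 1"
      by (rule cutoff_exists[OF test_fun_compact[OF z(1)] V(1) z(2)]) blast
    \<comment> \<open>The identity is available only for test functions supported in
      \<open>V\<close>; near the support of \<open>\<zeta>\<close> the truncated function agrees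
      with \<open>f\<close>.\<close>
    define f0 where "f0 = (\<lambda>x. \<theta> x * f x)"
    have f0: "test_fun A f0" unfolding f0_def by (rule test_fun_mult(1)[OF \<theta>(1) f])
    have f0V: "tsupp f0 \<subseteq> V"
      using tsupp_subsetI[OF tsupp_closed[of \<theta>], of f0] tsupp_outside[of _ \<theta>] \<theta>(2) by (auto simp: f0_def)
    note f0s = test_fun_smooth[OF f0]
    have ff: "test_fun A (\<lambda>x. f0 x * f0 x)" "test_fun A (\<lambda>x. \<zeta> x * f0 x)"
      using test_fun_mult(1)[OF f0 f0s] test_fun_mult(1)[OF z(1) f0s] by auto
    have ffV: "tsupp (\<lambda>x. f0 x * f0 x) \<subseteq> V" "tsupp (\<lambda>x. \<zeta> x * f0 x) \<subseteq> V"
      using tsupp_subsetI[OF tsupp_closed[of f0], of "\<lambda>x. f0 x * f0 x"]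
        tsupp_subsetI[OF tsupp_closed[of \<zeta>], of "\<lambda>x. \<zeta> x * f0 x"]
        tsupp_outside[of _ f0] tsupp_outside[of _ \<zeta>] f0V z(2) by auto
    have e1: "\<zeta> x * (carre L f f x - (\<Sum>i<m. (Y i f x)\<^sup>2)) =
        1 / 2 * (\<zeta> x * L (\<lambda>x. f0 x * f0 x) x) - \<zeta> x * f0 x * L f0 x
        - (\<Sum>i<m. indicator V x * (\<zeta> x * (Y i f0 x)\<^sup>2))" for x
    proof (cases "x \<in> tsupp \<zeta>")
      case True
      have eq: "f0 y = f y" if "y \<in> W" for y using \<theta>(5)[OF that] by (simp add: f0_def)
      have xW: "x \<in> W" "x \<in> V" using True \<theta>(4) z(2) by auto
      have "carre L f f x = carre L f0 f0 x"
        by (rule carre_local[OF f f0s \<theta>(3) xW(1)]) (simp add: eq)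
      then have "carre L f f x = 1 / 2 * L (\<lambda>x. f0 x * f0 x) x - f0 x * L f0 x"
        by (simp add: carre_def field_simps)
      moreover have "Y i f x = Y i f0 x" for i by (rule Yloc[OF \<theta>(3) xW]) (simp add: eq)
      ultimately show ?thesis
        using xW(2) by (simp add: sum_distrib_left right_diff_distrib)
    qed (simp add: tsupp_outside)
    have i1: "integrable \<mu> (\<lambda>x. \<zeta> x * L (\<lambda>x. f0 x * f0 x) x)"
      by (intro integrable_test_mult[OF z(1)] smooth_fun_continuous smooth_fun_L test_fun_smooth ff)
    have i2: "integrable \<mu> (\<lambda>x. \<zeta> x * f0 x * L f0 x)"
      by (intro integrable_test_mult[OF ff(2)] smooth_fun_continuous smooth_fun_L f0s)
    have zc: "continuous_on V \<zeta>" "continuous_on V f0" by (rule smooth_fun_continuous[OF zs] smooth_fun_continuous[OF f0s])+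
    have i3: "integrable \<mu> (\<lambda>x. indicator V x * (\<zeta> x * (Y i f0 x)\<^sup>2))" if "i < m" for i
      by (rule int[OF _ test_fun_compact[OF z(1)] z(2)])
        (use tsupp_outside[of _ \<zeta>] in \<open>auto intro!: continuous_intros zc Ycont[OF that f0s]\<close>)
    have i4: "integrable \<mu> (\<lambda>x. indicator V x * (f0 x * Y i f0 x * Y i \<zeta> x))" if "i < m" for i
      by (rule int[OF _ test_fun_compact[OF f0] f0V])
        (use tsupp_outside[of _ f0] in \<open>auto intro!: continuous_intros zc Ycont[OF that f0s] Ycont[OF that zs]\<close>)
    have w1: "(\<integral>x. \<zeta> x * L (\<lambda>x. f0 x * f0 x) x \<partial>\<mu>) =
        - (\<Sum>i<m. 2 * (\<integral>x. indicator V x * (f0 x * Y i f0 x * Y i \<zeta> x) \<partial>\<mu>))"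
    proof -
      have "(LINT x:V|\<mu>. Y i (\<lambda>x. f0 x * f0 x) x * Y i \<zeta> x) = 2 * (\<integral>x. indicator V x * (f0 x * Y i f0 x * Y i \<zeta> x) \<partial>\<mu>)" for i
        unfolding set_lebesgue_integral_def integral_mult_right_zero[symmetric]
        by (rule Bochner_Integration.integral_cong) (auto simp: indicator_def Ymult[OF f0s f0s])
      then show ?thesis using weak[OF ff(1) z(1) ffV(1) z(2)] by (simp add: Y_def)
    qed
    have w2: "(\<integral>x. \<zeta> x * f0 x * L f0 x \<partial>\<mu>) =
        - (\<Sum>i<m. (\<integral>x. indicator V x * (\<zeta> x * (Y i f0 x)\<^sup>2) \<partial>\<mu>) + (\<integral>x. indicator V x * (f0 x * Y i f0 x * Y i \<zeta> x) \<partial>\<mu>))"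
    proof -
      have "(LINT x:V|\<mu>. Y i f0 x * Y i (\<lambda>x. \<zeta> x * f0 x) x) =
         (\<integral>x. indicator V x * (\<zeta> x * (Y i f0 x)\<^sup>2) \<partial>\<mu>) + (\<integral>x. indicator V x * (f0 x * Y i f0 x * Y i \<zeta> x) \<partial>\<mu>)"
        if "i < m" for i
        unfolding set_lebesgue_integral_def Bochner_Integration.integral_add[OF i3[OF that] i4[OF that], symmetric]
        by (rule Bochner_Integration.integral_cong)
          (auto simp: indicator_def Ymult[OF zs f0s] power2_eq_square algebra_simps)
      then show ?thesis using weak[OF f0 ff(2) f0V ffV(2)] by (simp add: Y_def)
    qed
    define R where "R = (\<lambda>i x. indicator V x * (\<zeta> x * (Y i f0 x)\<^sup>2))"
    have R: "integrable \<mu> (R i)" if "i \<in> {..<m}" for i using i3 that by (simp add: R_def)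
    have e1': "(\<lambda>x. \<zeta> x * (carre L f f x - (\<Sum>i<m. (Y i f x)\<^sup>2))) =
        (\<lambda>x. (1 / 2 * (\<zeta> x * L (\<lambda>x. f0 x * f0 x) x) - \<zeta> x * f0 x * L f0 x) - (\<Sum>i<m. R i x))"
      unfolding e1 R_def ..
    have "(\<integral>x. \<zeta> x * (carre L f f x - (\<Sum>i<m. (Y i f x)\<^sup>2)) \<partial>\<mu>) =
        1 / 2 * (\<integral>x. \<zeta> x * L (\<lambda>x. f0 x * f0 x) x \<partial>\<mu>) - (\<integral>x. \<zeta> x * f0 x * L f0 x \<partial>\<mu>)
        - (\<Sum>i<m. \<integral>x. R i x \<partial>\<mu>)"
    proof -
      have "integrable \<mu> (\<lambda>x. \<Sum>i<m. R i x)" by (rule Bochner_Integration.integrable_sum[OF R])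
      moreover have "(\<integral>x. (\<Sum>i<m. R i x) \<partial>\<mu>) = (\<Sum>i<m. \<integral>x. R i x \<partial>\<mu>)"
        by (rule Bochner_Integration.integral_sum[OF R])
      ultimately show ?thesis unfolding e1' using i1 i2 by simp
    qed
    also have "\<dots> = 0" unfolding w1 w2 R_def by (simp add: sum.distrib sum_distrib_left[symmetric])
    finally show "(\<integral>x. \<zeta> x * (carre L f f x - (\<Sum>i<m. (Y i f x)\<^sup>2)) \<partial>\<mu>) = 0" .
  qed
  then show ?thesis by (simp add: Y_def)
qed

text \<open>Cauchy-Schwarz for the coefficients of \<open>v\<close>: the derivatives along the
  fields have square sum Gamma(f), whichever local representation is used.\<close>

lemma subunit_vec_bound:
  assumes c: "(U, \<phi>) \<in> A" and v: "subunit_vec A \<mu> L (U, \<phi>) x v"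
    and f: "smooth_fun A f" "carre L f f x \<le> 1"
  shows "\<bar>pd v (f \<circ> inv_into U \<phi>) (\<phi> x)\<bar> \<le> 1"
proof -
  from v obtain V m X a where H: "x \<in> V" "local_squares A \<mu> L (U, \<phi>) V m X"
    "(\<Sum>i<m. (a i)\<^sup>2) \<le> 1" "v = (\<Sum>i<m. a i *\<^sub>R X i (\<phi> x))"
    unfolding subunit_vec_def snd_conv by blast
  have xU: "x \<in> U" using H(1,2) unfolding local_squares_def prod.case by blast
  let ?Y = "\<lambda>v. pd v (f \<circ> inv_into U \<phi>) (\<phi> x)"
  interpret linear ?Y
    by (rule has_derivative_linear[OF smooth_on_has_derivative[OF smooth_fun_chart[OF f(1) c] chart(2)[OF c]]])
      (use xU in auto)
  have "(?Y v)\<^sup>2 = (\<Sum>i<m. a i * ?Y (X i (\<phi> x)))\<^sup>2" by (simp add: H(4) sum scale)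
  also have "\<dots> \<le> (\<Sum>i<m. (a i)\<^sup>2) * (\<Sum>i<m. (?Y (X i (\<phi> x)))\<^sup>2)" by (rule Cauchy_Schwarz_ineq_sum)
  also have "\<dots> \<le> 1 * 1"
    using H(3) f(2) local_squares_carre[OF c H(2) f(1) H(1)] by (intro mult_mono) (auto intro: sum_nonneg)
  finally show ?thesis by (simp add: abs_square_le_1)
qed

text \<open>Along the path f is locally Lipschitz, since charts make the path Lipschitz and f is
  differentiable there, and its slope is at most 1 at almost every time. The one-dimensional
  estimate turns this into a bound on the increment.\<close>

lemma subunit_path_bound:
  assumes path: "subunit_path A \<mu> L T \<gamma>" and f: "unit_grad f"
  shows "f (\<gamma> T) - f (\<gamma> 0) \<le> T"
proof -
  have T: "T \<ge> 0" and \<gamma>c: "continuous_on {0..T} \<gamma>" using path by (auto simp: subunit_path_def lipschitz_path_def)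
  have lip: "\<exists>K. K-lipschitz_on {a..b} (\<phi> \<circ> \<gamma>)"
    if "(U, \<phi>) \<in> A" "0 \<le> a" "b \<le> T" "\<gamma> ` {a..b} \<subseteq> U" for U \<phi> a b
  proof -
    have "\<forall>(U, \<phi>)\<in>A. \<forall>a b. 0 \<le> a \<and> b \<le> T \<and> \<gamma> ` {a..b} \<subseteq> U \<longrightarrow> (\<exists>K. K-lipschitz_on {a..b} (\<phi> \<circ> \<gamma>))"
      using path unfolding subunit_path_def lipschitz_path_def by blast
    from bspec[OF this that(1), unfolded prod.case] show ?thesis using that(2-4) by blast
  qed
  have ae: "AE t in lborel. t \<in> {0<..<T} \<longrightarrow> (\<forall>(U, \<phi>)\<in>A. \<gamma> t \<in> U \<longrightarrow>
        (\<exists>v. ((\<phi> \<circ> \<gamma>) has_vector_derivative v) (at t) \<and> subunit_vec A \<mu> L (U, \<phi>) (\<gamma> t) v))"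
    using path unfolding subunit_path_def by blast
  then obtain N where N: "N \<in> null_sets lborel"
    "{t. \<not> (t \<in> {0<..<T} \<longrightarrow> (\<forall>(U, \<phi>)\<in>A. \<gamma> t \<in> U \<longrightarrow>
        (\<exists>v. ((\<phi> \<circ> \<gamma>) has_vector_derivative v) (at t) \<and> subunit_vec A \<mu> L (U, \<phi>) (\<gamma> t) v)))} \<subseteq> N"
    by (rule AE_E) (auto simp: null_sets_def)
  have near: "\<exists>U \<phi> e. (U, \<phi>) \<in> A \<and> e > 0 \<and> (\<forall>s. \<bar>s - t\<bar> < e \<longrightarrow> 0 < s \<and> s < T \<and> \<gamma> s \<in> U)"
    if t: "0 < t" "t < T" for t
  proof -
    obtain U \<phi> where c: "(U, \<phi>) \<in> A" "\<gamma> t \<in> U" by (rule chart_at)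
    have "continuous_on {0<..<T} \<gamma>" by (rule continuous_on_subset[OF \<gamma>c]) auto
    from continuous_open_preimage[OF this open_greaterThanLessThan chart(1)[OF c(1)]]
    have "open ({0<..<T} \<inter> \<gamma> -` U)" .
    moreover have "t \<in> {0<..<T} \<inter> \<gamma> -` U" using t c by simp
    ultimately obtain e where "e > 0" "ball t e \<subseteq> {0<..<T} \<inter> \<gamma> -` U" using open_contains_ball by blast
    then show ?thesis using c(1)
      by (intro exI[of _ U] exI[of _ \<phi>] exI[of _ e]) (auto simp: subset_iff dist_real_def abs_minus_commute)
  qed
  note fs = unit_grad_smooth[OF f]
  have "(\<lambda>t. f (\<gamma> t)) T - (\<lambda>t. f (\<gamma> t)) 0 \<le> T"
  proof (rule ae_derivative_bound[OF T])
    show "continuous_on {0..T} (\<lambda>t. f (\<gamma> t))"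
      by (rule continuous_on_compose2[OF smooth_fun_continuous[OF fs, of UNIV] \<gamma>c]) auto
    show "negligible N" using N(1) by (simp add: negligible_iff_null_sets null_sets_completionI)
  next
    fix t assume t: "0 < t" "t < T"
    from near[OF t] obtain U \<phi> e where e: "(U, \<phi>) \<in> A" "e > 0"
      "\<And>s. \<bar>s - t\<bar> < e \<Longrightarrow> 0 < s \<and> s < T \<and> \<gamma> s \<in> U" by blast
    define F where "F = f \<circ> inv_into U \<phi>"
    have F: "f (\<gamma> s) = F (\<phi> (\<gamma> s))" if "\<bar>s - t\<bar> < e" for s
      using e(3)[OF that] chart_inv[OF e(1)] by (simp add: F_def)
    have \<gamma>t: "\<gamma> t \<in> U" using e(3)[of t] e(2) by simp
    have d: "(F has_derivative (\<lambda>v. pd v F (\<phi> (\<gamma> t)))) (at (\<phi> (\<gamma> t)))"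
      unfolding F_def
      by (rule smooth_on_has_derivative[OF smooth_fun_chart[OF fs e(1)] chart(2)[OF e(1)]]) (use \<gamma>t in simp)
    show "\<exists>e>0. \<exists>B. \<forall>s. \<bar>s - t\<bar> < e \<longrightarrow> \<bar>f (\<gamma> s) - f (\<gamma> t)\<bar> \<le> B * \<bar>s - t\<bar>"
    proof -
      obtain K where K: "K-lipschitz_on {t - e / 2..t + e / 2} (\<phi> \<circ> \<gamma>)"
      proof -
        have "\<gamma> ` {t - e / 2..t + e / 2} \<subseteq> U"
        proof clarify
          fix s assume "s \<in> {t - e / 2..t + e / 2}"
          then have "\<bar>s - t\<bar> < e" using e(2) by (auto simp: abs_le_iff)
          then show "\<gamma> s \<in> U" using e(3) by blast
        qed
        moreover have "0 \<le> t - e / 2" "t + e / 2 \<le> T" using e(3)[of "t - e / 2"] e(3)[of "t + e / 2"] e(2) by auto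
        ultimately show thesis using lip[OF e(1)] that by blast
      qed
      \<comment> \<open>Differentiability with error constant 1 is enough: only a Lipschitz bound at
        t is wanted, not a limit.\<close>
      obtain d' where d': "d' > 0" "\<And>u. norm (u - \<phi> (\<gamma> t)) < d' \<Longrightarrow>
          norm (F u - F (\<phi> (\<gamma> t)) - pd (u - \<phi> (\<gamma> t)) F (\<phi> (\<gamma> t))) \<le> 1 * norm (u - \<phi> (\<gamma> t))"
        using d unfolding has_derivative_at_alt by (metis zero_less_one)
      define B where "B = onorm (\<lambda>v. pd v F (\<phi> (\<gamma> t)))"
      have B: "norm (pd v F (\<phi> (\<gamma> t))) \<le> B * norm v" for v
        unfolding B_def by (rule onorm[OF has_derivative_bounded_linear[OF d]])
      have B0: "B \<ge> 0" unfolding B_def by (rule onorm_pos_le[OF has_derivative_bounded_linear[OF d]])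
      \<comment> \<open>Short enough that the Lipschitz path stays within d' of its chart position
        at time t; the +1 guards against K = 0.\<close>
      define r where "r = min (e / 2) (d' / (\<bar>K\<bar> + 1))"
      have r: "r > 0" "r \<le> e / 2" "r * (\<bar>K\<bar> + 1) \<le> d'"
      proof -
        show "r > 0" using e(2) d'(1) by (auto simp: r_def)
        show "r \<le> e / 2" unfolding r_def by (rule min.cobounded1)
        have "r * (\<bar>K\<bar> + 1) \<le> d' / (\<bar>K\<bar> + 1) * (\<bar>K\<bar> + 1)" by (intro mult_right_mono) (auto simp: r_def)
        then show "r * (\<bar>K\<bar> + 1) \<le> d'" by (simp add: add_nonneg_eq_0_iff)
      qed
      have "\<bar>f (\<gamma> s) - f (\<gamma> t)\<bar> \<le> ((1 + B) * (\<bar>K\<bar> + 1)) * \<bar>s - t\<bar>" if s: "\<bar>s - t\<bar> < r" for s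
      proof -
        have "s \<in> {t - e / 2..t + e / 2}" "t \<in> {t - e / 2..t + e / 2}"
          using s r e(2) by (auto simp: abs_less_iff)
        from lipschitz_onD[OF K this] have "norm (\<phi> (\<gamma> s) - \<phi> (\<gamma> t)) \<le> K * \<bar>s - t\<bar>"
          by (simp add: dist_norm)
        also have "\<dots> \<le> (\<bar>K\<bar> + 1) * \<bar>s - t\<bar>" by (intro mult_right_mono) auto
        finally have 1: "norm (\<phi> (\<gamma> s) - \<phi> (\<gamma> t)) \<le> (\<bar>K\<bar> + 1) * \<bar>s - t\<bar>" .
        also have "\<dots> < (\<bar>K\<bar> + 1) * r" using s by (intro mult_strict_left_mono) auto
        also have "\<dots> \<le> d'" using r(3) by (simp add: mult.commute)
        finally have "norm (F (\<phi> (\<gamma> s)) - F (\<phi> (\<gamma> t)) - pd (\<phi> (\<gamma> s) - \<phi> (\<gamma> t)) F (\<phi> (\<gamma> t)))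
            \<le> 1 * norm (\<phi> (\<gamma> s) - \<phi> (\<gamma> t))" by (rule d'(2))
        then have "\<bar>F (\<phi> (\<gamma> s)) - F (\<phi> (\<gamma> t))\<bar> \<le> (1 + B) * norm (\<phi> (\<gamma> s) - \<phi> (\<gamma> t))"
          using B[of "\<phi> (\<gamma> s) - \<phi> (\<gamma> t)"] by (simp add: distrib_right)
        also have "\<dots> \<le> (1 + B) * ((\<bar>K\<bar> + 1) * \<bar>s - t\<bar>)" using 1 B0 by (intro mult_left_mono) auto
        finally show ?thesis using F[of s] F[of t] s r(2) e(2) by (simp add: mult.assoc)
      qed
      then show ?thesis using r(1) by blast
    qed
    show "\<exists>D\<le>1. ((\<lambda>t. f (\<gamma> t)) has_real_derivative D) (at t)" if "t \<notin> N"
    proof -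
      have "t \<in> {0<..<T} \<longrightarrow> (\<forall>(U, \<phi>)\<in>A. \<gamma> t \<in> U \<longrightarrow>
        (\<exists>v. ((\<phi> \<circ> \<gamma>) has_vector_derivative v) (at t) \<and> subunit_vec A \<mu> L (U, \<phi>) (\<gamma> t) v))"
        using N(2) that by blast
      then have "\<forall>(U, \<phi>)\<in>A. \<gamma> t \<in> U \<longrightarrow>
        (\<exists>v. ((\<phi> \<circ> \<gamma>) has_vector_derivative v) (at t) \<and> subunit_vec A \<mu> L (U, \<phi>) (\<gamma> t) v)" using t by simp
      from bspec[OF this e(1), unfolded prod.case] \<gamma>t
      obtain v where v: "((\<phi> \<circ> \<gamma>) has_vector_derivative v) (at t)" "subunit_vec A \<mu> L (U, \<phi>) (\<gamma> t) v" by blast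
      have "((\<lambda>s. F ((\<phi> \<circ> \<gamma>) s)) has_derivative (\<lambda>h. pd (h *\<^sub>R v) F (\<phi> (\<gamma> t)))) (at t)"
        using has_derivative_compose[OF v(1)[unfolded has_vector_derivative_def], of F] d by simp
      moreover have "(\<lambda>h. pd (h *\<^sub>R v) F (\<phi> (\<gamma> t))) = (*) (pd v F (\<phi> (\<gamma> t)))"
      proof -
        interpret linear "\<lambda>v. pd v F (\<phi> (\<gamma> t))" by (rule has_derivative_linear[OF d])
        show ?thesis by (rule ext) (simp add: scale)
      qed
      ultimately have "((\<lambda>s. F ((\<phi> \<circ> \<gamma>) s)) has_real_derivative pd v F (\<phi> (\<gamma> t))) (at t)"
        by (simp add: has_field_derivative_def)
      then have "((\<lambda>s. f (\<gamma> s)) has_real_derivative pd v F (\<phi> (\<gamma> t))) (at t)"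
        by (rule has_field_derivative_transform_within_open[of _ _ _ "ball t e"])
          (use F e(2) in \<open>auto simp: dist_real_def abs_minus_commute\<close>)
      moreover have "pd v F (\<phi> (\<gamma> t)) \<le> 1"
        using subunit_vec_bound[OF e(1) v(2) fs] f by (simp add: F_def unit_grad_def)
      ultimately show ?thesis by blast
    qed
  qed
  then show ?thesis by simp
qed

lemma subunit_path_finite:
  assumes "subunit_path A \<mu> L T \<gamma>" "\<gamma> 0 = x" "\<gamma> T = y" "unit_grad f"
  shows "\<bar>f x - f y\<bar> \<le> T"
  using subunit_path_bound[OF assms(1,4)] assms(2,3)
    subunit_path_bound[OF assms(1) unit_grad_affine[OF assms(4), of "-1" 0]] by simp

end

section \<open>The Harnack inequality\<close>

locale harnack_setting = curvature_dimension A L \<mu> h p GZ \<rho> \<kappa> d + finite_diffusion A L \<mu> h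
  for A :: "('a::{t2_space, second_countable_topology}, 'e::euclidean_space) atlas"
    and L and \<mu> and h and p and GZ and \<rho> \<kappa> d :: real
begin

text \<open>The shift by \<open>\<epsilon>\<close> supplies what \<open>hopf_lax\<close> demands on
  [s, t]: ln U is bounded below, and the gradient of ln U is bounded by that of \<open>P r f\<close>
  divided by epsilon. With c = d / D the differential inequality is the Li-Yau estimate.\<close>

lemma harnack_log:
  assumes f: "test_fun A f" "\<And>x. f x \<ge> 0" and \<epsilon>: "\<epsilon> > 0" and st: "0 < s" "s < t"
  shows "ln (P s f x + \<epsilon>) + D / 2 * ln s - (dst x y)\<^sup>2 / (4 * (d / D) * (t - s))
    \<le> ln (P t f y + \<epsilon>) + D / 2 * ln t"
proof -
  let ?U = "\<lambda>t x. P t f x + \<epsilon>"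
  let ?w = "\<lambda>t x. ln (?U t x) + D / 2 * ln t"
  let ?w' = "\<lambda>t x. P t (L f) x / ?U t x + D / (2 * t)"
  have U_def': "U f \<epsilon> = ?U" by (intro ext) (simp add: U_def[OF f \<epsilon>])
  note Upos = U_pos[OF f \<epsilon>, unfolded U_def'] and Uge = U_ge[OF f \<epsilon>, unfolded U_def']
    and Usm = U_smooth[OF f \<epsilon>, unfolded U_def']
  obtain F where F: "F > 0" "\<And>y. \<bar>f y\<bar> \<le> F" by (rule test_fun_bounded[OF f(1)]) blast
  obtain B where B: "\<And>r x. 0 < r \<Longrightarrow> r \<le> t \<Longrightarrow> carre L (P r f) (P r f) x \<le> B"
    using gradient_bound[OF f(1), of t] st by auto
  define M where "M = \<bar>ln \<epsilon>\<bar> + \<bar>ln (F + \<epsilon>)\<bar> + D / 2 * (\<bar>ln s\<bar> + \<bar>ln t\<bar>)"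
  \<comment> \<open>The summand 1 makes \<open>K\<close> positive and gives K <= K^2, so K^2
    dominates the bound for the squared gradient without a square root.\<close>
  define K where "K = \<bar>B\<bar> / \<epsilon>\<^sup>2 + 1"
  have Uw: "smooth_fun A (\<lambda>x. ln (?U r x))" if "r > 0" for r
    by (rule log_calculus(1)[OF carre.sym_form_axioms Usm[OF that] Upos[OF that]])
  have wc: "carre L (?w r) (?w r) x = carre L (P r f) (P r f) x / (?U r x)\<^sup>2" if r: "r > 0" for r x
  proof -
    note lc = log_calculus(2)[OF carre.sym_form_axioms Usm[OF r] Upos[OF r]]
    have "carre L (?w r) (?w r) x = carre L (\<lambda>x. ln (?U r x)) (\<lambda>x. ln (?U r x)) x"
      using carre_affine[OF Uw[OF r], of 1 "D / 2 * ln r"] by simp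
    moreover have "carre L (?U r) (?U r) x = ?U r x * (?U r x * carre L (\<lambda>x. ln (?U r x)) (\<lambda>x. ln (?U r x)) x)"
      using lc[OF Usm[OF r], of x] lc[OF Uw[OF r], of x] carre_commute[of "?U r" "\<lambda>x. ln (?U r x)" x] by simp
    moreover have "carre L (?U r) (?U r) x = carre L (P r f) (P r f) x"
      using form_U_U[OF f \<epsilon> carre.sym_form_axioms r, unfolded U_def'] .
    ultimately have "carre L (P r f) (P r f) x = (?U r x)\<^sup>2 * carre L (?w r) (?w r) x"
      by (simp add: power2_eq_square)
    then show ?thesis using Upos[OF r, of x] by simp
  qed
  have "?w s x - (dst x y)\<^sup>2 / (4 * (d / D) * (t - s)) \<le> ?w (s + (t - s)) y"
  proof (rule hopf_lax[where w = ?w and w' = ?w' and K = K and M = M])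
    show "d / D > 0" using d D_pos by simp
    show "K > 0" by (simp add: K_def add_nonneg_pos)
    show "smooth_fun A (?w r)" if "r > 0" for r
      by (intro smooth_fun_add smooth_fun_const Uw[OF that])
    show "((\<lambda>r. ?w r x) has_real_derivative ?w' r x) (at r)" if "r > 0" for r x
    proof -
      have "((\<lambda>r. ln (?U r x)) has_real_derivative 1 / ?U r x * (P r (L f) x + 0)) (at r)"
        by (intro DERIV_chain2[where f = ln] DERIV_ln_divide DERIV_add DERIV_const P_has_derivative[OF that f(1)] Upos[OF that])
      moreover have "((\<lambda>r. D / 2 * ln r) has_real_derivative D / 2 * (1 / r)) (at r)"
        by (intro DERIV_cmult DERIV_ln_divide that)
      ultimately have "((\<lambda>r. ?w r x) has_real_derivative 1 / ?U r x * (P r (L f) x + 0) + D / 2 * (1 / r)) (at r)"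
        by (rule DERIV_add)
      then show ?thesis by simp
    qed
    show "continuous_on ({0<..} \<times> UNIV) (\<lambda>(t, x). ?w t x)"
    proof -
      have "P (fst q) f (snd q) + \<epsilon> \<noteq> 0" "fst q \<noteq> 0" if "q \<in> {0<..} \<times> UNIV" for q :: "real \<times> 'a"
        using Upos[of "fst q" "snd q"] that by auto
      then show ?thesis
        unfolding case_prod_beta' using P_joint_continuous[OF f(1), unfolded case_prod_beta']
        by (intro continuous_intros) auto
    qed
    show "d / D * carre L (?w r) (?w r) x \<le> ?w' r x" if "r > 0" for r x
      unfolding wc[OF that] using li_yau[OF f \<epsilon> that, of x, unfolded U_def'] .
    show "\<bar>?w r x\<bar> \<le> M" if "s \<le> r" "r \<le> s + (t - s)" for r x
    proof -
      have r: "r > 0" "r \<le> t" using that st by auto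
      have "ln \<epsilon> \<le> ln (?U r x)" using Uge[OF r(1), of x] \<epsilon> Upos[OF r(1), of x] by simp
      moreover have "ln (?U r x) \<le> ln (F + \<epsilon>)"
        using P_abs_le[OF r(1) f(1) F(2), of x] Upos[OF r(1), of x] F(1) \<epsilon> by simp
      ultimately have 1: "\<bar>ln (?U r x)\<bar> \<le> \<bar>ln \<epsilon>\<bar> + \<bar>ln (F + \<epsilon>)\<bar>" by linarith
      have "ln s \<le> ln r" "ln r \<le> ln t" using that st r by auto
      then have "\<bar>ln r\<bar> \<le> \<bar>ln s\<bar> + \<bar>ln t\<bar>" by linarith
      then have "D / 2 * \<bar>ln r\<bar> \<le> D / 2 * (\<bar>ln s\<bar> + \<bar>ln t\<bar>)" using D_pos by (intro mult_left_mono) auto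
      then have "\<bar>D / 2 * ln r\<bar> \<le> D / 2 * (\<bar>ln s\<bar> + \<bar>ln t\<bar>)" using D_pos by (simp add: abs_mult)
      then show ?thesis using 1 unfolding M_def by linarith
    qed
    show "carre L (?w r) (?w r) x \<le> K\<^sup>2" if "s \<le> r" "r \<le> s + (t - s)" for r x
    proof -
      have r: "r > 0" "r \<le> t" using that st by auto
      have "carre L (?w r) (?w r) x \<le> \<bar>B\<bar> / \<epsilon>\<^sup>2"
        unfolding wc[OF r(1)] using B[OF r, of x] Uge[OF r(1), of x] \<epsilon>
        by (intro frac_le power_mono) auto
      also have "\<dots> \<le> K * 1" by (simp add: K_def)
      also have "\<dots> \<le> K * K" by (intro mult_left_mono) (auto simp: K_def)
      finally show ?thesis by (simp add: power2_eq_square)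
    qed
  qed (use st in auto)
  then show ?thesis by simp
qed

lemma harnack_exp:
  assumes "a > 0" "b > 0" "0 < s" "0 < t" "ln a + D / 2 * ln s - r \<le> ln b + D / 2 * ln t"
  shows "a \<le> b * (t / s) powr (D / 2) * exp r"
proof -
  have "ln a \<le> ln b + D / 2 * (ln t - ln s) + r" using assms(5) by (simp add: algebra_simps diff_divide_distrib)
  then have "exp (ln a) \<le> exp (ln b + D / 2 * (ln t - ln s) + r)" by simp
  also have "\<dots> = b * (t / s) powr (D / 2) * exp r"
    using assms by (simp add: exp_add powr_def ln_div)
  finally show ?thesis using assms(1) by simp
qed

lemma harnack_test:
  assumes f: "test_fun A f" "\<And>x. f x \<ge> 0" and st: "0 < s" "s < t"
  shows "P s f x \<le> P t f y * (t / s) powr (D / 2) * exp (D / d * ((dst x y)\<^sup>2 / (4 * (t - s))))"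
proof -
  have "X / (4 * (d / D) * r) = D / d * (X / (4 * r))" for X r :: real by (simp add: mult_ac)
  note e = this[of "(dst x y)\<^sup>2" "t - s"]
  let ?c = "(t / s) powr (D / 2) * exp (D / d * ((dst x y)\<^sup>2 / (4 * (t - s))))"
  have le: "P s f x + \<epsilon> \<le> (P t f y + \<epsilon>) * ?c" if "\<epsilon> > 0" for \<epsilon>
    using harnack_exp[OF _ _ _ _ harnack_log[OF f that st, of x y, unfolded e]]
      P_nonneg[of s f x] P_nonneg[of t f y] f(2) st that by (simp add: add_nonneg_pos mult.assoc)
  have lim: "((\<lambda>\<epsilon>. (P t f y + \<epsilon>) * ?c - \<epsilon>) \<longlongrightarrow> (P t f y + 0) * ?c - 0) (at_right 0)"
    by (intro tendsto_intros)
  have "P s f x \<le> (P t f y + 0) * ?c - 0"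
  proof (rule tendsto_lowerbound[OF lim])
    show "\<forall>\<^sub>F \<epsilon> in at_right 0. P s f x \<le> (P t f y + \<epsilon>) * ?c - \<epsilon>"
      using eventually_at_right_less[of 0] by eventually_elim (use le in fastforce)
  qed simp
  then show ?thesis by (simp add: mult.assoc)
qed

theorem harnack:
  assumes f: "smooth_fun A f" "\<And>x. f x \<ge> 0" "\<And>x. f x \<le> B" and st: "0 < s" "s < t"
  shows "P s f x \<le> P t f y * (t / s) powr (D / 2) * exp (D / d * ((dst x y)\<^sup>2 / (4 * (t - s))))"
proof -
  obtain C where C: "C > 0" "\<And>k y. \<bar>h k y\<bar> \<le> C" by (rule h_bounded) blast
  \<comment> \<open>The cutoffs are squared so that the approximating test functions stay
    nonnegative even where a cutoff is negative.\<close>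
  define g where "g = (\<lambda>k y. (h k y * h k y) * f y)"
  have gt: "test_fun A (g k)" for k
    unfolding g_def by (intro test_fun_mult(1) h_test h_smooth f(1))
  have gn: "g k y \<ge> 0" for k y unfolding g_def using f(2) by simp
  have gB: "\<bar>g k y\<bar> \<le> (C * C) * B" for k y
    unfolding g_def abs_mult using C(2)[of k y] f(2,3)[of y] by (intro mult_mono) auto
  have gl: "(\<lambda>k. g k y) \<longlonglongrightarrow> f y" for y
  proof -
    have "(\<lambda>k. g k y) \<longlonglongrightarrow> (1 * 1) * f y" unfolding g_def by (intro tendsto_intros h_lim)
    then show ?thesis by simp
  qed
  have fm: "f \<in> borel_measurable \<mu>" by (intro continuous_measurable smooth_fun_continuous f(1))
  have lim: "(\<lambda>k. P r (g k) z) \<longlonglongrightarrow> P r f z" if "r > 0" for r z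
    by (rule P_tendsto[OF that test_fun_measurable[OF gt] fm gB gl])
  have t: "t > 0" using st by simp
  show ?thesis
    by (rule LIMSEQ_le[OF lim[OF st(1)]
          tendsto_mult_right[OF tendsto_mult_right[OF lim[OF t]]]])
      (use harnack_test[OF gt gn st] in blast)
qed

end

section \<open>The Harnack inequality from the stated hypotheses\<close>

theorem theorem7p1:
  fixes A :: "('a::{t2_space, second_countable_topology}, 'e::euclidean_space) atlas"
    and \<mu> :: "'a measure"
    and L :: "('a \<Rightarrow> real) \<Rightarrow> 'a \<Rightarrow> real"
    and \<Gamma> \<Gamma>Z :: "('a \<Rightarrow> real) \<Rightarrow> ('a \<Rightarrow> real) \<Rightarrow> 'a \<Rightarrow> real"
    and \<Gamma>\<^sub>2 \<Gamma>\<^sub>2Z :: "('a \<Rightarrow> real) \<Rightarrow> 'a \<Rightarrow> real"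
    and p :: "'a \<Rightarrow> 'a \<Rightarrow> real \<Rightarrow> real"
    and P :: "real \<Rightarrow> ('a \<Rightarrow> real) \<Rightarrow> 'a \<Rightarrow> real"
    and h :: "nat \<Rightarrow> 'a \<Rightarrow> real"
    and \<rho>1 \<rho>2 \<kappa> d D :: real
  assumes manifold: "smooth_manifold A" "connected (UNIV :: 'a set)"
    and measure: "smooth_measure A \<mu>"
    and L: "smooth_diffusion_operator A L" "L (\<lambda>_. 1) = (\<lambda>_. 0)"
      "symmetric_on_tests A \<mu> L" "nonpositive_on_tests A \<mu> L"
    and subelliptic: "locally_subelliptic A \<mu> L"
    and squares: "locally_sum_of_squares A \<mu> L"
    and \<Gamma>_def: "\<Gamma> = carre L"
    and joined: "\<And>x y. \<exists>T \<gamma>. subunit_path A \<mu> L T \<gamma> \<and> \<gamma> 0 = x \<and> \<gamma> T = y"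
    and complete: "Metric_space.mcomplete UNIV (cc_dist A L)"
    and \<Gamma>Z: "smooth_symmetric_form A \<Gamma>Z"
      "\<And>f x. smooth_fun A f \<Longrightarrow> \<Gamma>Z f f x \<ge> 0"
    and \<Gamma>\<^sub>2_def: "\<Gamma>\<^sub>2 = iterated L \<Gamma>"
    and \<Gamma>\<^sub>2Z_def: "\<Gamma>\<^sub>2Z = iterated L \<Gamma>Z"
    and self_adjoint: "essentially_self_adjoint \<mu> (test_graph A L)"
    and kernel: "heat_kernel A \<mu> L p"
    and P_def: "P = heat \<mu> p"
    and a: "\<And>k. test_fun A (h k)" "\<And>x. incseq (\<lambda>k. h k x)" "\<And>x. (\<lambda>k. h k x) \<longlonglongrightarrow> 1"
      "(\<lambda>k. sup_norm (\<Gamma> (h k) (h k)) + sup_norm (\<Gamma>Z (h k) (h k))) \<longlonglongrightarrow> 0"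
    and b: "\<And>f. smooth_fun A f \<Longrightarrow> \<Gamma> f (\<Gamma>Z f f) = \<Gamma>Z f (\<Gamma> f f)"
    and c: "\<And>t. t \<ge> 0 \<Longrightarrow> P t (\<lambda>_. 1) = (\<lambda>_. 1)"
      "\<And>f T. test_fun A f \<Longrightarrow> T \<ge> 0 \<Longrightarrow>
         (SUP t\<in>{0..T}. sup_norm (\<Gamma> (P t f) (P t f)) + sup_norm (\<Gamma>Z (P t f) (P t f))) < \<infinity>"
    and d: "\<rho>1 \<ge> 0" "\<rho>2 > 0" "\<kappa> \<ge> 0" "d > 0"
      "\<And>f \<nu> x. smooth_fun A f \<Longrightarrow> \<nu> > 0 \<Longrightarrow>
         \<Gamma>\<^sub>2 f x + \<nu> * \<Gamma>\<^sub>2Z f x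
           \<ge> 1 / d * (L f x)\<^sup>2 + (\<rho>1 - \<kappa> / \<nu>) * \<Gamma> f f x + \<rho>2 * \<Gamma>Z f f x"
    and D_def: "D = d * (1 + 3 * \<kappa> / (2 * \<rho>2))"
  shows "\<forall>x y s t f. 0 < s \<and> s < t \<and> smooth_fun A f \<and> sup_norm f < \<infinity> \<and> (\<forall>z. f z \<ge> 0) \<longrightarrow>
    P s f x \<le> P t f y * (t / s) powr (D / 2) * exp (D / d * ((cc_dist A L x y)\<^sup>2 / (4 * (t - s))))"
proof -
  note D_eq = D_def
  have sup_norm_ge: "ennreal (g x) \<le> sup_norm g" for g :: "'a \<Rightarrow> real" and x
    unfolding sup_norm_def by (rule SUP_upper2[of x]) (auto intro: ennreal_leI)
  interpret diffusion A L
    by unfold_locales (rule manifold L)+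
  interpret measured_diffusion A L \<mu>
    by unfold_locales (rule measure L)+
  interpret exhausted_diffusion A L \<mu> h
  proof unfold_locales
    fix e :: real assume e: "e > 0"
    have "\<forall>\<^sub>F k in sequentially. sup_norm (\<Gamma> (h k) (h k)) + sup_norm (\<Gamma>Z (h k) (h k)) < ennreal e"
      by (rule order_tendstoD(2)[OF a(4)]) (use e in simp)
    then show "\<forall>\<^sub>F k in sequentially. \<forall>x. carre L (h k) (h k) x \<le> e"
    proof eventually_elim
      case (elim k)
      show ?case
      proof
        fix x
        have "ennreal (carre L (h k) (h k) x) \<le> sup_norm (\<Gamma> (h k) (h k))"
          unfolding \<Gamma>_def by (rule sup_norm_ge)
        also have "\<dots> \<le> sup_norm (\<Gamma> (h k) (h k)) + sup_norm (\<Gamma>Z (h k) (h k))" by simp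
        also have "\<dots> \<le> ennreal e" using elim by simp
        finally show "carre L (h k) (h k) x \<le> e" using e by simp
      qed
    qed
  qed (rule a)+
  interpret heat_diffusion A L \<mu> h p
  proof unfold_locales
    show "(\<integral>y. p x y t \<partial>\<mu>) = 1" if "t > 0" for t x
      using fun_cong[OF c(1)[of t], of x] that by (simp add: P_def heat_def)
  qed (rule kernel)
  interpret harnack_setting A L \<mu> h p \<Gamma>Z \<rho>2 \<kappa> d
  proof unfold_locales
    show "carre L f (\<Gamma>Z f f) x = \<Gamma>Z f (carre L f f) x" if "smooth_fun A f" for f x
      using b[OF that] by (simp add: \<Gamma>_def)
    show "\<exists>B. \<forall>t x. 0 < t \<and> t \<le> T \<longrightarrow> carre L (heat \<mu> p t f) (heat \<mu> p t f) x \<le> B \<and>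
        \<Gamma>Z (heat \<mu> p t f) (heat \<mu> p t f) x \<le> B" if f: "test_fun A f" and T: "T > 0" for f T
    proof -
      \<comment> \<open>A finite extended supremum becomes one real bound, valid for both forms at
        all points and all times up to T.\<close>
      define S where "S = (SUP t\<in>{0..T}. sup_norm (\<Gamma> (P t f) (P t f)) + sup_norm (\<Gamma>Z (P t f) (P t f)))"
      have S: "S < \<infinity>" unfolding S_def by (rule c(2)[OF f]) (use T in simp)
      have "carre L (P t f) (P t f) x \<le> enn2real S \<and> \<Gamma>Z (P t f) (P t f) x \<le> enn2real S"
        if t: "0 < t" "t \<le> T" for t x
      proof -
        have S': "sup_norm (\<Gamma> (P t f) (P t f)) + sup_norm (\<Gamma>Z (P t f) (P t f)) \<le> S"
          unfolding S_def by (rule SUP_upper) (use t in simp)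
        have le: "g x \<le> enn2real S" if "sup_norm g \<le> S" for g
        proof -
          have "ennreal (g x) \<le> S" using sup_norm_ge[of g x] that by (rule order_trans)
          also have "S = ennreal (enn2real S)" using S by simp
          finally show ?thesis by simp
        qed
        have "sup_norm (carre L (P t f) (P t f)) \<le> S"
          using order_trans[OF _ S', of "sup_norm (\<Gamma> (P t f) (P t f))"] by (simp add: \<Gamma>_def)
        moreover have "sup_norm (\<Gamma>Z (P t f) (P t f)) \<le> S"
          using order_trans[OF _ S', of "sup_norm (\<Gamma>Z (P t f) (P t f))"] by simp
        ultimately show ?thesis using le by blast
      qed
      then show ?thesis unfolding P_def by blast
    qed
    show "iterated L (carre L) f x + \<nu> * iterated L \<Gamma>Z f x
        \<ge> 1 / d * (L f x)\<^sup>2 - \<kappa> / \<nu> * carre L f f x + \<rho>2 * \<Gamma>Z f f x"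
      if "smooth_fun A f" "\<nu> > 0" for f \<nu> x
    proof -
      \<comment> \<open>The curvature term has a favourable sign, so the inequality holds a fortiori
        in the form used above.\<close>
      have "\<rho>1 * carre L f f x \<ge> 0" using d(1) carre_nonneg[OF that(1)] by simp
      then show ?thesis using d(5)[OF that, of x]
        by (simp add: \<Gamma>_def \<Gamma>\<^sub>2_def \<Gamma>\<^sub>2Z_def left_diff_distrib)
    qed
    \<comment> \<open>The duration of one subunit path joining the two points bounds the increment
      of every competitor.\<close>
    show "\<exists>T. \<forall>f. unit_grad f \<longrightarrow> \<bar>f x - f y\<bar> \<le> T" for x y
      using joined[of x y] subunit_path_finite by blast
  qed (use \<Gamma>Z d in auto)
  have D: "D = curvature_dimension.D \<rho>2 \<kappa> d"
    unfolding D_eq curvature_dimension.D_def[OF curvature_dimension_axioms] ..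
  show ?thesis
  proof (intro allI impI, elim conjE)
    fix x y f and s t :: real
    assume H: "0 < s" "s < t" "smooth_fun A f" "sup_norm f < \<infinity>" "\<forall>z. 0 \<le> f z"
    have "f z \<le> enn2real (sup_norm f)" for z
    proof -
      have "ennreal (f z) \<le> ennreal (enn2real (sup_norm f))" using sup_norm_ge[of f z] H(4) by simp
      then show ?thesis by simp
    qed
    then show "P s f x \<le> P t f y * (t / s) powr (D / 2) * exp (D / d * ((cc_dist A L x y)\<^sup>2 / (4 * (t - s))))"
      unfolding P_def D using H by (intro harnack) auto
  qed
qed

end
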